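(* The irreducible affine Coxeter groups of types $\widetilde A$, $\widetilde C$, and $\widetilde G_2$ are futuristic; all other irreducible affine Coxeter groups (those of types $\widetilde B$, $\widetilde D$, $\widetilde E_6$, $\widetilde E_7$, $\widetilde E_8$, and $\widetilde F_4$) are ancient.
   Context: Let $(W,S)$ be a Coxeter system with $S=\{s_i:i\in I\}$, $I$ a finite index set; $m(i,i')$ is the order of $s_is_{i'}$. The Coxeter graph has vertex set $I$, with distinct $i,i'$ joined by an edge labeled $m(i,i')$ whenever $m(i,i')\ge 3$; $W$ is irreducible if this graph is connected. The types of irreducible affine Coxeter groups are those of the standard classification. The root space is $V=\mathbb R^I$ with standard basis the simple roots $\{\alpha_i:i\in I\}$ and symmetric bilinear form $B(\alpha_i,\alpha_{i'})=-\cos(\pi/m(i,i'))$ (and $-1$ if $m(i,i')=\infty$); $W$ is affine if $B$ is positive semidefinite but not positive definite. $W$ acts on $V$ by $s_i\beta=\beta-2B(\beta,\alpha_i)\alpha_i$. The root system is $\Phi=\{w\alpha_i:w\in W,i\in I\}=\Phi^+\sqcup\Phi^-$, where $\Phi^+$ are the roots that are nonnegative combinations of simple roots and $\Phi^-=-\Phi^+$. For $\beta\in\Phi$ the half-space $H_\beta^+$ is $\{w\in W:w\beta\in\Phi^+\}$. A subset of $W$ is convex if it is an intersection of half-spaces (the empty intersection being $W$). For a nonempty convex set $\mathscr L\subseteq W$ let $\mathrm R(\mathscr L)=\{\beta\in\Phi:\mathscr L\subseteq H_\beta^+\}$. For $i\in I$, the toggle $\tau_i\colon W\to W$ is defined by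 $\tau_i(u)=u$ if $u^{-1}\alpha_i\in\mathrm R(\mathscr L)$ and $\tau_i(u)=s_iu$ otherwise. A Coxeter element is a product $c=s_{i_n}\cdots s_{i_1}$ where $i_1,\ldots,i_n$ is an ordering of $I$ (each element once); $\mathrm{Pro}_c=\tau_{i_n}\cdots\tau_{i_1}$ (composition), which depends only on $c$ and $\mathscr L$. The set $\mathscr L$ is heavy with respect to $c$ if every periodic point of $\mathrm{Pro}_c$ (i.e. every $u\in W$ with $\mathrm{Pro}_c^K(u)=u$ for some $K\ge 1$) lies in $\mathscr L$. A Coxeter element $c$ is futuristic if every nonempty convex $\mathscr L\subseteq W$ is heavy with respect to $c$. The Coxeter group $W$ is futuristic if all its Coxeter elements are futuristic, and ancient if none of them is. *)

theory Defs
  imports "HOL-Analysis.Analysis" "HOL-Algebra.Multiplicative_Group"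
begin

definition word_prod :: "('g, 'b) monoid_scheme \<Rightarrow> ('i \<Rightarrow> 'g) \<Rightarrow> 'i list \<Rightarrow> 'g" where
  "word_prod W s xs = foldr (\<lambda>i g. s i \<otimes>\<^bsub>W\<^esub> g) xs \<one>\<^bsub>W\<^esub>"

text \<open>The congruence on words generated by \<open>(i j)\<^bsup>m i j\<^esup> = 1\<close>; the value \<open>m i j = 0\<close> encodes
  \<open>m i j = \<infinity>\<close> (no relation), in accordance with \<^const>\<open>group.ord\<close>.\<close>

inductive coxeter_equiv :: "('i \<Rightarrow> 'i \<Rightarrow> nat) \<Rightarrow> 'i list \<Rightarrow> 'i list \<Rightarrow> bool"
  for m :: "'i \<Rightarrow> 'i \<Rightarrow> nat" where
  equiv_refl: "coxeter_equiv m xs xs"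
| equiv_sym: "coxeter_equiv m xs ys \<Longrightarrow> coxeter_equiv m ys xs"
| equiv_trans: "coxeter_equiv m xs ys \<Longrightarrow> coxeter_equiv m ys zs \<Longrightarrow> coxeter_equiv m xs zs"
| equiv_rel: "m i j \<noteq> 0 \<Longrightarrow>
    coxeter_equiv m (xs @ concat (replicate (m i j) [i, j]) @ ys) (xs @ ys)"

text \<open>The last assumption says that \<open>W\<close> is presented by the generators \<open>s i\<close> and the relations
  \<open>(s i s j)\<^bsup>m(i, j)\<^esup> = 1\<close>, where \<open>m(i, j)\<close> is the order of \<open>s i s j\<close>. Since the generators are
  involutions, presentations as a monoid and as a group agree.\<close>

locale coxeter_system = group W
  for W :: "('g, 'b) monoid_scheme" (structure) +
  fixes s :: "'i :: finite \<Rightarrow> 'g"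
  assumes generator_closed: "s i \<in> carrier W"
    and generator_inj: "inj s"
    and generator_order: "ord (s i) = 2"
    and generated: "generate W (range s) = carrier W"
    and presentation: "word_prod W s xs = word_prod W s ys \<longleftrightarrow>
      coxeter_equiv (\<lambda>i j. ord (s i \<otimes> s j)) xs ys"
begin

definition m :: "'i \<Rightarrow> 'i \<Rightarrow> nat" where
  "m i j = ord (s i \<otimes> s j)"

definition coxeter_graph :: "('i \<times> 'i) set" where
  "coxeter_graph = {(i, j). i \<noteq> j \<and> (m i j \<ge> 3 \<or> m i j = 0)}"

definition is_irreducible :: bool where
  "is_irreducible \<longleftrightarrow> (\<forall>i j. (i, j) \<in> coxeter_graph\<^sup>*)"

definition simple_root :: "'i \<Rightarrow> real ^ 'i" where
  "simple_root i = axis i 1"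

definition form_entry :: "'i \<Rightarrow> 'i \<Rightarrow> real" where
  "form_entry i j = (if m i j = 0 then - 1 else - cos (pi / real (m i j)))"

definition form :: "real ^ 'i \<Rightarrow> real ^ 'i \<Rightarrow> real" where
  "form x y = (\<Sum>i\<in>UNIV. \<Sum>j\<in>UNIV. x $ i * y $ j * form_entry i j)"

definition is_affine :: bool where
  "is_affine \<longleftrightarrow> (\<forall>x. form x x \<ge> 0) \<and> \<not> (\<forall>x. x \<noteq> 0 \<longrightarrow> form x x > 0)"

definition reflection :: "'i \<Rightarrow> real ^ 'i \<Rightarrow> real ^ 'i" where
  "reflection i \<beta> = \<beta> - (2 * form \<beta> (simple_root i)) *\<^sub>R simple_root i"

text \<open>The action of \<open>W\<close> on the root space determined by letting \<open>s i\<close> act as \<open>reflection i\<close>; the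
  resulting map does not depend on the word chosen to represent \<open>w\<close>.\<close>

definition action :: "'g \<Rightarrow> real ^ 'i \<Rightarrow> real ^ 'i" where
  "action w = (THE f. \<exists>xs. word_prod W s xs = w \<and> f = foldr reflection xs)"

definition roots :: "(real ^ 'i) set" where
  "roots = {action w (simple_root i) | w i. w \<in> carrier W}"

definition positive_roots :: "(real ^ 'i) set" where
  "positive_roots = {\<beta> \<in> roots. \<forall>i. \<beta> $ i \<ge> 0}"

definition half_space :: "real ^ 'i \<Rightarrow> 'g set" where
  "half_space \<beta> = {w \<in> carrier W. action w \<beta> \<in> positive_roots}"

definition is_convex :: "'g set \<Rightarrow> bool" where
  "is_convex L \<longleftrightarrow> (\<exists>T \<subseteq> roots. L = carrier W \<inter> (\<Inter>\<beta>\<in>T. half_space \<beta>))"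

definition root_set :: "'g set \<Rightarrow> (real ^ 'i) set" where
  "root_set L = {\<beta> \<in> roots. L \<subseteq> half_space \<beta>}"

definition toggle :: "'g set \<Rightarrow> 'i \<Rightarrow> 'g \<Rightarrow> 'g" where
  "toggle L i u = (if action (inv u) (simple_root i) \<in> root_set L then u else s i \<otimes> u)"

text \<open>A list \<open>[i\<^sub>1, \<dots>, i\<^sub>n]\<close> enumerating the index set represents the Coxeter element
  \<open>s i\<^sub>n \<cdots> s i\<^sub>1\<close>, so the list is reversed in the product, and the toggle of \<open>i\<^sub>1\<close> is applied
  first.\<close>

definition represents_coxeter_element :: "'i list \<Rightarrow> 'g \<Rightarrow> bool" where
  "represents_coxeter_element xs c \<longleftrightarrow>
    distinct xs \<and> set xs = UNIV \<and> c = word_prod W s (rev xs)"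

definition coxeter_element :: "'g \<Rightarrow> bool" where
  "coxeter_element c \<longleftrightarrow> (\<exists>xs. represents_coxeter_element xs c)"

text \<open>Orderings with the same product differ by exchanging adjacent commuting generators, and the
  toggles of commuting generators commute. So the choice of the ordering is immaterial.\<close>

definition promotion :: "'g set \<Rightarrow> 'g \<Rightarrow> 'g \<Rightarrow> 'g" where
  "promotion L c = fold (toggle L) (SOME xs. represents_coxeter_element xs c)"

definition heavy :: "'g set \<Rightarrow> 'g \<Rightarrow> bool" where
  "heavy L c \<longleftrightarrow> (\<forall>u \<in> carrier W. (\<exists>K \<ge> 1. (promotion L c ^^ K) u = u) \<longrightarrow> u \<in> L)"

definition futuristic_element :: "'g \<Rightarrow> bool" where
  "futuristic_element c \<longleftrightarrow> (\<forall>L. is_convex L \<and> L \<noteq> {} \<longrightarrow> heavy L c)"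

definition futuristic :: bool where
  "futuristic \<longleftrightarrow> (\<forall>c. coxeter_element c \<longrightarrow> futuristic_element c)"

definition ancient :: bool where
  "ancient \<longleftrightarrow> (\<forall>c. coxeter_element c \<longrightarrow> \<not> futuristic_element c)"

text \<open>The index set can be numbered by \<open>0, \<dots>, n\<close> in such a way that \<open>M a b\<close> is the value of \<open>m\<close>
  at the vertices numbered \<open>a < b\<close>. Only these arguments of \<open>M\<close> matter.\<close>

definition has_coxeter_matrix :: "nat \<Rightarrow> (nat \<Rightarrow> nat \<Rightarrow> nat) \<Rightarrow> bool" where
  "has_coxeter_matrix n M \<longleftrightarrow> (\<exists>f. bij_betw f {0..n} (UNIV :: 'i set) \<and>
    (\<forall>a b. a < b \<and> b \<le> n \<longrightarrow> m (f a) (f b) = M a b))"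

text \<open>A cycle on \<open>n + 1\<close> vertices for \<open>n \<ge> 2\<close>; a single edge labelled \<open>\<infinity>\<close> for \<open>n = 1\<close>.\<close>

definition type_A :: bool where
  "type_A \<longleftrightarrow> has_coxeter_matrix 1 (\<lambda>a b. 0) \<or>
    (\<exists>n \<ge> 2. has_coxeter_matrix n (\<lambda>a b. if b = a + 1 \<or> a = 0 \<and> b = n then 3 else 2))"

text \<open>The path \<open>1, \<dots>, n\<close>, whose last edge is labelled 4, together with the edge \<open>{0, 2}\<close>.\<close>

definition type_B :: bool where
  "type_B \<longleftrightarrow> (\<exists>n \<ge> 3. has_coxeter_matrix n (\<lambda>a b.
     if b = a + 1 \<and> b = n then 4
     else if a \<ge> 1 \<and> b = a + 1 \<or> a = 0 \<and> b = 2 then 3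
     else 2))"

text \<open>The path \<open>0, \<dots>, n\<close>, whose first and last edges are labelled 4.\<close>

definition type_C :: bool where
  "type_C \<longleftrightarrow> (\<exists>n \<ge> 2. has_coxeter_matrix n (\<lambda>a b.
     if b = a + 1 then (if a = 0 \<or> b = n then 4 else 3) else 2))"

text \<open>The path \<open>1, \<dots>, n - 1\<close> together with the edges \<open>{0, 2}\<close> and \<open>{n - 2, n}\<close>.\<close>

definition type_D :: bool where
  "type_D \<longleftrightarrow> (\<exists>n \<ge> 4. has_coxeter_matrix n (\<lambda>a b.
     if a \<ge> 1 \<and> b = a + 1 \<and> b < n \<or> a = 0 \<and> b = 2 \<or> a = n - 2 \<and> b = n then 3 else 2))"

definition type_E6 :: bool where
  "type_E6 \<longleftrightarrow> has_coxeter_matrix 6 (\<lambda>a b.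
     if (a, b) \<in> {(0, 1), (1, 2), (0, 3), (3, 4), (0, 5), (5, 6)} then 3 else 2)"

definition type_E7 :: bool where
  "type_E7 \<longleftrightarrow> has_coxeter_matrix 7 (\<lambda>a b.
     if (a, b) \<in> {(0, 1), (1, 2), (2, 3), (3, 4), (4, 5), (5, 6), (3, 7)} then 3 else 2)"

definition type_E8 :: bool where
  "type_E8 \<longleftrightarrow> has_coxeter_matrix 8 (\<lambda>a b.
     if (a, b) \<in> {(0, 1), (1, 2), (2, 3), (3, 4), (4, 5), (5, 6), (6, 7), (2, 8)} then 3 else 2)"

definition type_F4 :: bool where
  "type_F4 \<longleftrightarrow> has_coxeter_matrix 4 (\<lambda>a b.
     if (a, b) \<in> {(0, 1), (1, 2), (3, 4)} then 3 else if (a, b) = (2, 3) then 4 else 2)"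

definition type_G2 :: bool where
  "type_G2 \<longleftrightarrow> has_coxeter_matrix 2 (\<lambda>a b.
     if (a, b) = (0, 1) then 3 else if (a, b) = (1, 2) then 6 else 2)"

end

end

theory Submission
  imports Defs
begin

text \<open>Iterating the promotion on \<open>u\<close> amounts to following a root \<open>\<rho>\<close> of \<open>R(L)\<close>: toggling only stops at
  \<open>u\<close> when \<open>u \<rho>\<close> is a simple root. For types A and C the simple roots are the gaps between consecutive slots
  of a line, and a root of \<open>R(L)\<close> says that one label stays to the left of another. A blocked label sends out
  a beam, whose steps force infinitely many other blockings and rule out periodicity outside \<open>L\<close>. For type
  G2 a linear functional, corrected by the defect of the Coxeter element, decreases along every periodic
  orbit that leaves \<open>L\<close>.

  For the other types the Coxeter element permutes finitely many positive roots \<open>\<gamma>\<close> of a tube. The convex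
  hull of suitable translations does not contain the identity, while the starting element is only ever
  blocked in roots orthogonal to these \<open>\<gamma>\<close>; this confines its orbit to a finite set. The graphs
  are trees, so that all Coxeter elements are conjugate and one ordering of the vertices suffices.

  The classification looks at the positive null vector, which is harmonic on the Coxeter graph: the
  coordinates fall off linearly along the arms that leave the vertex where it is maximal.\<close>

section \<open>Reflections and roots\<close>

text \<open>Promotion is defined through an arbitrary listing. On a cycle the Coxeter elements form
  several conjugacy classes, so that the slot argument has to work for every listing: its measures
  contain the time that a label still waits for its toggle. A set that is not heavy requires a
  periodic point in an infinite group. Positive roots orthogonal to the \<open>\<gamma>\<close> stay
  positive along the orbit; if they add up, with multiplicities, to an invariant null vector, then
  their images are bounded, and integrality leaves finitely many. For a hull of translations,
  \<open>R(L)\<close> is found by applying long translations: no multiple of \<open>\<delta>\<close>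
  may tend to minus infinity. This forces the products with \<open>\<gamma>\<close> to be 0, or -1
  for the roots \<open>c \<delta> - \<gamma>\<close>, which never become simple. In type B this is
  not enough: roots such as \<open>\<delta> - e 2\<close>, whose product with
  \<open>\<gamma>\<close> is \<open>- 1 / sqrt 2\<close>, lie in \<open>R(L)\<close>, and a
  positivity argument has to keep them from becoming simple.\<close>

context coxeter_system
begin

lemma word_prod_Nil [simp]: "word_prod W s [] = \<one>"
  by (simp add: word_prod_def)

lemma word_prod_Cons [simp]: "word_prod W s (i # xs) = s i \<otimes> word_prod W s xs"
  by (simp add: word_prod_def)

lemma generator_carrier [simp]: "s i \<in> carrier W"
  by (rule generator_closed)

lemma word_prod_closed [simp]: "word_prod W s xs \<in> carrier W"
  by (induction xs) auto

lemma word_prod_append: "word_prod W s (xs @ ys) = word_prod W s xs \<otimes> word_prod W s ys"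
  by (induction xs) (auto simp: m_assoc)

lemma generator_sq [simp]: "s i \<otimes> s i = \<one>"
proof -
  have "s i [^] (2::nat) = \<one>"
    using pow_ord_eq_1[OF generator_carrier, of i] generator_order by simp
  then show ?thesis by (simp add: numeral_2_eq_2)
qed

lemma generator_cancel [simp]: "w \<in> carrier W ==> s i \<otimes> (s i \<otimes> w) = w"
  by (simp flip: m_assoc)

lemma generator_cancel_right [simp]: "w \<in> carrier W ==> w \<otimes> s i \<otimes> s i = w"
  by (simp add: m_assoc)

lemma inv_generator [simp]: "inv (s i) = s i"
  by (rule inv_equality) auto

lemma word_prod_surj: "w \<in> carrier W ==> \<exists>xs. w = word_prod W s xs"
proof -
  assume "w \<in> carrier W"
  then have "w \<in> generate W (range s)" by (simp add: generated)
  then show ?thesis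
  proof induction
    case one
    then show ?case by (metis word_prod_Nil)
  next
    case (incl h)
    then obtain i where "h = s i" by blast
    then show ?case by (intro exI[of _ "[i]"]) simp
  next
    case (inv h)
    then obtain i where "h = s i" by blast
    then show ?case by (intro exI[of _ "[i]"]) simp
  next
    case (eng h1 h2)
    then show ?case by (metis word_prod_append)
  qed
qed

lemma word_prod_surjE:
  assumes "w \<in> carrier W" obtains xs where "w = word_prod W s xs"
  using word_prod_surj[OF assms] by blast

lemma m_self [simp]: "m i i = 1"
  by (simp add: m_def)

lemma m_sym: "m i j = m j i"
proof -
  have *: "ord (s i \<otimes> s j) dvd ord (s j \<otimes> s i)" for i j
  proof -
    have "(s i \<otimes> s j) [^] k = s i \<otimes> (s j \<otimes> s i) [^] k \<otimes> s i" for k :: nat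
      by (induction k) (auto simp: m_assoc)
    then show ?thesis
      by (subst pow_eq_id[symmetric]) (auto simp: pow_ord_eq_1)
  qed
  show ?thesis
    unfolding m_def by (intro dvd_antisym *)
qed

lemma m_eq_1_iff: "m i j = 1 \<longleftrightarrow> i = j"
proof
  assume "m i j = 1"
  then have "s i \<otimes> s j = \<one>"
    using ord_eq_1[of "s i \<otimes> s j"] by (simp add: m_def)
  then have "s i = s j"
    by (metis inv_equality inv_generator generator_carrier)
  then show "i = j"
    using generator_inj by (simp add: inj_def)
qed simp

lemma m_ge_2: "i ~= j ==> m i j ~= 0 ==> m i j >= 2"
  using m_eq_1_iff[of i j] by linarith

lemma form_entry_sym: "form_entry i j = form_entry j i"
  by (simp add: form_entry_def m_sym[of i j])

lemma form_entry_self [simp]: "form_entry i i = 1"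
  by (simp add: form_entry_def)

lemma form_entry_nonpos: "i ~= j ==> form_entry i j <= 0"
proof (cases "m i j = 0")
  case False
  assume "i ~= j"
  with False have "m i j >= 2" by (rule m_ge_2[rotated])
  then have "cos (pi / m i j) >= 0"
    by (intro cos_ge_zero) (auto simp: field_simps intro: order_trans[of _ 0])
  with False show ?thesis by (simp add: form_entry_def)
qed (simp add: form_entry_def)

lemma form_sym: "form x y = form y x"
proof -
  have "(\<Sum>i\<in>UNIV. x $ i * y $ j * form_entry i j) = (\<Sum>i\<in>UNIV. y $ j * x $ i * form_entry j i)" for j
    by (rule sum.cong) (simp_all add: form_entry_sym[of j] mult_ac)
  then show ?thesis
    unfolding form_def by (subst sum.swap) simp
qed

lemma form_add_left: "form (x + y) z = form x z + form y z"
  by (simp add: form_def algebra_simps sum.distrib)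

lemma form_add_right: "form z (x + y) = form z x + form z y"
  by (simp add: form_def algebra_simps sum.distrib)

lemma form_scaleR_left: "form (a *\<^sub>R x) z = a * form x z"
  by (simp add: form_def algebra_simps sum_distrib_left)

lemma form_scaleR_right: "form z (a *\<^sub>R x) = a * form z x"
  by (simp add: form_def algebra_simps sum_distrib_left)

lemma form_zero_left [simp]: "form 0 z = 0"
  by (simp add: form_def)

lemma form_zero_right [simp]: "form z 0 = 0"
  by (simp add: form_def)

lemma form_minus_left: "form (- x) z = - form x z"
  using form_scaleR_left[of "-1" x z] by simp

lemma form_minus_right: "form z (- x) = - form z x"
  using form_scaleR_right[of z "-1" x] by simp

lemma form_diff_left: "form (x - y) z = form x z - form y z"
  using form_add_left[of x "- y" z] by (simp add: form_minus_left)

lemma form_diff_right: "form z (x - y) = form z x - form z y"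
  using form_add_right[of z x "- y"] by (simp add: form_minus_right)

lemma form_sum_left: "form (sum f A) z = (\<Sum>a\<in>A. form (f a) z)"
  by (induction A rule: infinite_finite_induct) (auto simp: form_add_left)

lemma form_sum_right: "form z (sum f A) = (\<Sum>a\<in>A. form z (f a))"
  by (induction A rule: infinite_finite_induct) (auto simp: form_add_right)

lemmas form_linear = form_add_left form_add_right form_diff_left form_diff_right
  form_minus_left form_minus_right form_scaleR_left form_scaleR_right

lemma form_simple_right: "form x (simple_root j) = (\<Sum>i\<in>UNIV. x $ i * form_entry i j)"
proof -
  have "x $ i * axis j 1 $ k * form_entry i k = (if k = j then x $ i * form_entry i j else 0)" for i k
    by (simp add: axis_def)
  then show ?thesis
    by (simp add: form_def simple_root_def)
qed

lemma form_simple [simp]: "form (simple_root i) (simple_root j) = form_entry i j"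
proof -
  have "axis i 1 $ k * form_entry k j = (if k = i then form_entry i j else 0)" for k
    by (simp add: axis_def)
  then show ?thesis
    unfolding form_simple_right by (simp add: simple_root_def)
qed

lemma simple_root_nth: "simple_root i $ j = (if j = i then 1 else 0)"
  by (simp add: simple_root_def axis_def)

lemma reflection_nth: "reflection i v $ j = (if j = i then v $ i - 2 * form v (simple_root i) else v $ j)"
  by (simp add: reflection_def simple_root_nth)

lemma reflection_linear: "linear (reflection i)"
  by (rule linearI) (auto simp: reflection_def form_linear algebra_simps)

lemma reflection_involution [simp]: "reflection i (reflection i v) = v"
  by (simp add: reflection_def form_linear algebra_simps)

lemma form_reflection [simp]: "form (reflection i x) (reflection i y) = form x y"
  by (simp add: reflection_def form_linear algebra_simps form_sym[of "simple_root i"])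

lemma foldr_reflection_linear: "linear (foldr reflection xs)"
proof (induction xs)
  case Nil
  then show ?case by (simp add: linear_id[unfolded id_def] id_def)
next
  case (Cons a xs)
  then show ?case
    using linear_compose[OF Cons reflection_linear] by (simp add: o_def)
qed

lemma linear_foldr_reflection [simp]:
  "foldr reflection xs (x + y) = foldr reflection xs x + foldr reflection xs y"
  "foldr reflection xs (x - y) = foldr reflection xs x - foldr reflection xs y"
  "foldr reflection xs (- x) = - foldr reflection xs x"
  "foldr reflection xs (a *\<^sub>R x) = a *\<^sub>R foldr reflection xs x"
  using foldr_reflection_linear[of xs]
  by (simp_all add: linear_add linear_diff linear_neg linear_scale)

lemma form_foldr_reflection [simp]:
  "form (foldr reflection xs x) (foldr reflection xs y) = form x y"
  by (induction xs) auto

lemma foldr_reflection_rev [simp]: "foldr reflection (rev xs) (foldr reflection xs v) = v"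
  by (induction xs arbitrary: v rule: rev_induct) auto

lemma foldr_reflection_rev' [simp]: "foldr reflection xs (foldr reflection (rev xs) v) = v"
  using foldr_reflection_rev[of "rev xs" v] by simp

end

text \<open>For \<open>x = 2 cos \<theta>\<close> these are the values \<open>sin (k \<theta>) / sin \<theta>\<close>.\<close>

fun chebyshev_U :: "real => nat => real" where
  "chebyshev_U x 0 = 0"
| "chebyshev_U x (Suc 0) = 1"
| "chebyshev_U x (Suc (Suc k)) = x * chebyshev_U x (Suc k) - chebyshev_U x k"

lemma chebyshev_U_sin: "chebyshev_U (2 * cos \<theta>) k * sin \<theta> = sin (real k * \<theta>)"
proof (induction "2 * cos \<theta>" k rule: chebyshev_U.induct)
  case (3 k)
  have "sin (real (Suc (Suc k)) * \<theta>) + sin (real k * \<theta>) = 2 * cos \<theta> * sin (real (Suc k) * \<theta>)"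
  proof -
    define y where "y = real (Suc k) * \<theta>"
    have "real (Suc (Suc k)) * \<theta> = y + \<theta>" "real k * \<theta> = y - \<theta>"
      by (simp_all add: y_def algebra_simps)
    then show ?thesis
      unfolding y_def[symmetric] by (simp add: sin_add sin_diff)
  qed
  with 3 show ?case by (simp add: algebra_simps)
qed simp_all

lemma chebyshev_U_2: "chebyshev_U 2 k = real k"
  by (induction "2 :: real" k rule: chebyshev_U.induct) auto

fun alternating :: "'a => 'a => nat => 'a list" where
  "alternating i j 0 = []"
| "alternating i j (Suc k) = (if even k then j else i) # alternating i j k"

lemma length_alternating [simp]: "length (alternating i j k) = k"
  by (induction k) auto

lemma alternating_double: "alternating i j (2 * k) = concat (replicate k [i, j])"
  by (induction k) auto

lemma alternating_add: "\<exists>xs. length xs = d \<and> alternating i j (d + k) = xs @ alternating i j k"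
  by (induction d) (auto intro: exI[of _ "_ # _"])

context coxeter_system
begin

lemma reflection_plane:
  "reflection j (a *\<^sub>R simple_root i + b *\<^sub>R simple_root j) =
    a *\<^sub>R simple_root i + (- 2 * form_entry i j * a - b) *\<^sub>R simple_root j"
  by (simp add: vec_eq_iff reflection_nth simple_root_nth form_linear algebra_simps)

text \<open>Both reflections preserve the plane of the two simple roots, and the coefficients obey
  the recursion of \<open>chebyshev_U\<close>. For finite \<open>m i j\<close> the value
  \<open>U k\<close> is proportional to \<open>sin (k * pi / m)\<close>, which stays nonnegative up
  to \<open>k = m i j\<close>.\<close>

lemma foldr_alternating:
  "foldr reflection (alternating i j k) (simple_root i) =
    (let U = chebyshev_U (- 2 * form_entry i j) in
      if even k then U (Suc k) *\<^sub>R simple_root i + U k *\<^sub>R simple_root j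
      else U k *\<^sub>R simple_root i + U (Suc k) *\<^sub>R simple_root j)"
proof (induction k)
  case (Suc k)
  show ?case
    using Suc form_entry_sym[of j i]
      reflection_plane[of j "chebyshev_U (- 2 * form_entry i j) (Suc k)" i "chebyshev_U (- 2 * form_entry i j) k"]
      reflection_plane[of i "chebyshev_U (- 2 * form_entry i j) (Suc k)" j "chebyshev_U (- 2 * form_entry i j) k"]
    by (auto simp: Let_def add.commute)
qed simp

lemma neg_twice_form_entry: "m i j ~= 0 ==> - 2 * form_entry i j = 2 * cos (pi / m i j)"
  by (simp add: form_entry_def)

lemma sin_pi_div_m_pos:
  assumes "i ~= j" "m i j ~= 0"
  shows "sin (pi / m i j) > 0"
proof -
  have "m i j >= 2" using assms by (rule m_ge_2)
  then have "pi / m i j <= pi / 2" by (intro divide_left_mono) auto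
  also have "... < pi" by simp
  finally show ?thesis using assms by (intro sin_gt_zero) auto
qed

lemma chebyshev_U_nonneg:
  assumes "i ~= j" "m i j = 0 \<or> k <= m i j"
  shows "chebyshev_U (- 2 * form_entry i j) k >= 0"
proof (cases "m i j = 0")
  case True
  then show ?thesis by (simp add: form_entry_def chebyshev_U_2)
next
  case False
  have "real k * (pi / m i j) <= real (m i j) * (pi / m i j)"
    using assms False by (intro mult_right_mono) auto
  with False have "sin (real k * (pi / m i j)) >= 0"
    by (intro sin_ge_zero) auto
  then show ?thesis
    using chebyshev_U_sin[of "pi / m i j" k] sin_pi_div_m_pos[OF assms(1) False]
    unfolding neg_twice_form_entry[OF False]
    by (smt (verit) zero_less_mult_iff mult_less_0_iff)
qed

lemma dihedral_fixes_simple: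
  assumes "i ~= j" "m i j ~= 0"
  shows "foldr reflection (alternating i j (2 * m i j)) (simple_root i) = simple_root i"
proof -
  let ?t = "pi / m i j" and ?U = "chebyshev_U (- 2 * form_entry i j)"
  have s: "sin ?t ~= 0" using sin_pi_div_m_pos[OF assms] by simp
  have e: "real (2 * m i j) * ?t = 2 * pi" "real (Suc (2 * m i j)) * ?t = ?t + 2 * pi"
    using assms by (simp_all add: field_simps)
  have "?U (2 * m i j) * sin ?t = 0"
    unfolding neg_twice_form_entry[OF assms(2)] chebyshev_U_sin e by simp
  moreover have "?U (Suc (2 * m i j)) * sin ?t = sin ?t"
    unfolding neg_twice_form_entry[OF assms(2)] chebyshev_U_sin e by simp
  ultimately have "?U (2 * m i j) = 0" "?U (Suc (2 * m i j)) = 1"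
    using s by auto
  then show ?thesis
    unfolding foldr_alternating Let_def by simp
qed

lemma rev_alternating_even: "rev (alternating i j (2 * k)) = alternating j i (2 * k)"
proof -
  have *: "concat (replicate k [j, i]) @ [j, i] = j # i # concat (replicate k [j, i])" for k
    by (induction k) auto
  have "rev (concat (replicate k [i, j])) = concat (replicate k [j, i])"
    by (induction k) (auto simp: *)
  then show ?thesis by (simp add: alternating_double)
qed

lemma foldr_reflection_fixes_orthogonal:
  assumes "!!i. i \<in> set xs ==> form v (simple_root i) = 0"
  shows "foldr reflection xs v = v"
  using assms by (induction xs) (auto simp: reflection_def)

text \<open>The rotation fixes both simple roots and everything orthogonal to them. For finite
  \<open>m i j\<close> the Gram determinant of the plane is the square of a nonzero sine, so that
  these vectors span the whole space even if the form is degenerate on it.\<close>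

lemma reflection_braid:
  assumes "m i j ~= 0"
  shows "foldr reflection (concat (replicate (m i j) [i, j])) v = v"
proof (cases "i = j")
  case True
  then show ?thesis by simp
next
  case False
  define D where "D = foldr reflection (alternating i j (2 * m i j))"
  have Di: "D (simple_root i) = simple_root i"
    unfolding D_def using False assms by (rule dihedral_fixes_simple)
  have "foldr reflection (rev (alternating i j (2 * m i j))) (simple_root j) = simple_root j"
    unfolding rev_alternating_even using dihedral_fixes_simple[of j i] False assms
    by (simp add: m_sym[of j i])
  then have Dj: "D (simple_root j) = simple_root j"
    unfolding D_def by (metis foldr_reflection_rev')
  let ?c = "form_entry i j" and ?p = "form v (simple_root i)" and ?q = "form v (simple_root j)"
  have "?c\<^sup>2 ~= 1"
    using zero_less_power[OF sin_pi_div_m_pos[OF False assms], of 2]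
      sin_cos_squared_add[of "pi / m i j"] assms
    unfolding form_entry_def by (simp only: if_False power2_minus)
  then have d: "1 - ?c\<^sup>2 ~= 0" by simp
  \<comment> \<open>Cramer's rule for the orthogonal projection of \<open>v\<close> to the plane of
    the two simple roots.\<close>
  define a b where "a = (?p - ?c * ?q) / (1 - ?c\<^sup>2)" and "b = (?q - ?c * ?p) / (1 - ?c\<^sup>2)"
  define r where "r = v - a *\<^sub>R simple_root i - b *\<^sub>R simple_root j"
  have "form r (simple_root i) = 0" "form r (simple_root j) = 0"
    using d unfolding r_def a_def b_def
    by (auto simp: form_linear form_entry_sym[of j i] divide_simps) (auto simp: algebra_simps power2_eq_square)
  moreover have "set (alternating i j k) \<subseteq> {i, j}" for k
    by (induction k) auto
  ultimately have "D r = r"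
    unfolding D_def by (intro foldr_reflection_fixes_orthogonal) blast
  moreover have "v = r + a *\<^sub>R simple_root i + b *\<^sub>R simple_root j"
    by (simp add: r_def)
  ultimately have "D v = v"
    using Di Dj by (simp add: D_def)
  then show ?thesis by (simp add: D_def alternating_double)
qed

text \<open>The defining relations hold for the reflections. This is what makes the description
  operator in \<open>action\<close> definite.\<close>

lemma coxeter_equiv_reflection:
  assumes "coxeter_equiv (%i j. ord (s i \<otimes> s j)) xs ys"
  shows "foldr reflection xs = foldr reflection ys"
  using assms
proof induction
  case (equiv_rel i j xs ys)
  then show ?case
    using reflection_braid[of i j] by (auto simp: m_def fun_eq_iff)
qed auto

lemma action_word_prod: "action (word_prod W s xs) = foldr reflection xs"
  unfolding action_def
proof (rule the_equality)
  fix f assume "\<exists>ys. word_prod W s ys = word_prod W s xs \<and> f = foldr reflection ys"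
  then show "f = foldr reflection xs"
    using presentation coxeter_equiv_reflection by metis
qed auto

lemma action_one [simp]: "action \<one> v = v"
  using action_word_prod[of "[]"] by simp

lemma action_generator [simp]: "action (s i) = reflection i"
  using action_word_prod[of "[i]"] by (simp add: fun_eq_iff)

lemma action_mult [simp]:
  assumes "u \<in> carrier W" "w \<in> carrier W"
  shows "action (u \<otimes> w) v = action u (action w v)"
  using assms by (auto elim!: word_prod_surjE simp: action_word_prod simp flip: word_prod_append)

lemma action_inv [simp]:
  assumes "u \<in> carrier W"
  shows "action (inv u) (action u v) = v" "action u (action (inv u) v) = v"
  using assms by (auto simp flip: action_mult)

lemma action_linear: "u \<in> carrier W ==> linear (action u)"
  using foldr_reflection_linear by (auto elim!: word_prod_surjE simp: action_word_prod)

lemma action_simps [simp]: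
  assumes "u \<in> carrier W"
  shows "action u (x + y) = action u x + action u y"
    and "action u (x - y) = action u x - action u y"
    and "action u (- x) = - action u x"
    and "action u (a *\<^sub>R x) = a *\<^sub>R action u x"
    and "action u 0 = 0"
  using action_linear[OF assms]
  by (simp_all add: linear_add linear_diff linear_neg linear_scale linear_0)

lemma form_action [simp]: "u \<in> carrier W ==> form (action u x) (action u y) = form x y"
  by (auto elim!: word_prod_surjE simp: action_word_prod)

section \<open>Length function and signs of roots\<close>

definition len :: "'g => nat" where
  "len w = (LEAST k. \<exists>xs. length xs = k \<and> word_prod W s xs = w)"

lemma len_le: "len (word_prod W s xs) <= length xs"
  unfolding len_def by (rule Least_le) auto

lemma reduced_word:
  assumes "w \<in> carrier W"
  obtains xs where "word_prod W s xs = w" "length xs = len w"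
proof -
  have "\<exists>k xs. length xs = k \<and> word_prod W s xs = w"
    using word_prod_surj[OF assms] by auto
  then have "\<exists>xs. length xs = len w \<and> word_prod W s xs = w"
    unfolding len_def by (rule LeastI_ex)
  then show ?thesis using that by blast
qed

lemma len_one [simp]: "len \<one> = 0"
  using len_le[of "[]"] by simp

lemma len_eq_0: "w \<in> carrier W ==> len w = 0 ==> w = \<one>"
  by (elim reduced_word) auto

lemma len_mult_word:
  assumes "w \<in> carrier W"
  shows "len (w \<otimes> word_prod W s ys) <= len w + length ys"
proof -
  obtain xs where "word_prod W s xs = w" "length xs = len w"
    using reduced_word[OF assms] .
  then show ?thesis
    using len_le[of "xs @ ys"] by (simp add: word_prod_append)
qed

text \<open>All relators have even length. The resulting sign character prevents a generator from
  leaving the length unchanged.\<close>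

lemma coxeter_equiv_parity:
  "coxeter_equiv M xs ys ==> even (length xs) = even (length ys)"
proof (induction rule: coxeter_equiv.induct)
  case (equiv_rel i j xs ys)
  have "length (concat (replicate k [i, j])) = 2 * k" for k
    by (induction k) auto
  then show ?case by simp
qed auto

lemma len_parity: "even (len (word_prod W s xs)) = even (length xs)"
proof -
  obtain ys where "word_prod W s ys = word_prod W s xs" "length ys = len (word_prod W s xs)"
    by (rule reduced_word[OF word_prod_closed])
  then show ?thesis
    using presentation coxeter_equiv_parity by metis
qed

lemma len_generator_neq:
  assumes "w \<in> carrier W"
  shows "len (w \<otimes> s i) ~= len w"
proof -
  obtain xs where "w = word_prod W s xs" using word_prod_surjE[OF assms] .
  then show ?thesis
    using len_parity[of xs] len_parity[of "xs @ [i]"] by (auto simp: word_prod_append)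
qed

lemma len_generator:
  assumes "w \<in> carrier W"
  shows "len (w \<otimes> s i) = len w + 1 \<or> len w = len (w \<otimes> s i) + 1"
proof -
  have "len (w \<otimes> s i) <= len w + 1" "len (w \<otimes> s i \<otimes> s i) <= len (w \<otimes> s i) + 1"
    using len_mult_word[of w "[i]"] len_mult_word[of "w \<otimes> s i" "[i]"] assms by simp_all
  then show ?thesis
    using len_generator_neq[OF assms, of i] assms by simp linarith
qed

lemma right_descent:
  assumes "w \<in> carrier W" "w ~= \<one>"
  obtains i where "len w = len (w \<otimes> s i) + 1"
proof -
  obtain xs where xs: "word_prod W s xs = w" "length xs = len w"
    using reduced_word[OF assms(1)] .
  with assms have "xs ~= []" by auto
  then obtain ys i where ys: "xs = ys @ [i]" by (metis rev_exhaust)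
  then have "w \<otimes> s i = word_prod W s ys"
    using xs by (auto simp: word_prod_append m_assoc)
  then have "len (w \<otimes> s i) < len w"
    using xs ys len_le[of ys] by simp
  then show ?thesis using that len_generator[OF assms(1), of i] by fastforce
qed

lemma alternating_swap:
  assumes "m i j ~= 0"
  shows "word_prod W s (alternating i j (m i j)) = word_prod W s (alternating j i (m i j))"
proof -
  have "word_prod W s (alternating i j (2 * k)) = (s i \<otimes> s j) [^] k" for k
  proof (induction k)
    case (Suc k)
    have "(s i \<otimes> s j) [^] Suc k = s i \<otimes> s j \<otimes> (s i \<otimes> s j) [^] k"
      by (rule nat_pow_Suc2) simp
    with Suc show ?case by (simp add: m_assoc)
  qed simp
  then have 1: "word_prod W s (alternating i j (2 * m i j)) = \<one>"
    by (simp add: m_def)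
  \<comment> \<open>Letters are carried one by one from the front of the relator to the other side;
    \<open>d = m i j\<close> cuts it in half.\<close>
  have "word_prod W s (alternating i j (2 * m i j)) =
      inv (word_prod W s (alternating j i d)) \<otimes> word_prod W s (alternating i j (2 * m i j - d))"
    if "d <= 2 * m i j" for d
    using that
  proof (induction d)
    case (Suc d)
    then obtain e where e: "2 * m i j = d + Suc e"
      by (metis add_Suc_right less_iff_Suc_add Suc_le_eq)
    then have "even d \<longleftrightarrow> odd e" by presburger
    with Suc e show ?case
      by (auto simp: inv_mult_group m_assoc)
  qed simp
  from this[of "m i j"] 1 show ?thesis
    by (simp add: mult_2) (metis inv_equality inv_inv inv_closed word_prod_closed)
qed

text \<open>The classical splitting along a dihedral subgroup. If \<open>j\<close> is a descent of
  \<open>w\<close>, then \<open>w\<close> is a product of some \<open>v\<close> that ascends at both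
  \<open>i\<close> and \<open>j\<close> and an alternating word shorter than \<open>m i j\<close>.
  The word sends the simple root into the cone of the two simple roots, and by induction
  \<open>v\<close> keeps this cone positive.\<close>

lemma action_simple_nonneg:
  assumes "w \<in> carrier W" "len (w \<otimes> s i) = len w + 1"
  shows "action w (simple_root i) $ r >= 0"
  using assms
proof (induction "len w" arbitrary: w i rule: less_induct)
  case less
  show ?case
  proof (cases "w = \<one>")
    case True
    then show ?thesis by (simp add: simple_root_nth)
  next
    case False
    then obtain j where j: "len w = len (w \<otimes> s j) + 1"
      using right_descent less.prems by blast
    with less.prems have "i ~= j" by auto
    \<comment> \<open>Alternating words end in \<open>j\<close>, the descent just found. The longest
      one that can be split off with additive lengths is wanted.\<close>
    define P where "P = (%k. \<exists>v\<in>carrier W. w = v \<otimes> word_prod W s (alternating i j k) \<and> len w = len v + k)"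
    have "P 1"
      unfolding P_def using j less.prems by (intro bexI[of _ "w \<otimes> s j"]) auto
    moreover have "\<forall>k. P k --> k <= len w"
      by (auto simp: P_def)
    ultimately obtain k where k: "P k" "\<forall>l. P l --> l <= k"
      using Greatest_le_nat[of P _ "len w"] GreatestI_nat[of P 1 "len w"] by blast
    with \<open>P 1\<close> have "k >= 1" by blast
    from k(1) obtain v where v: "v \<in> carrier W" "w = v \<otimes> word_prod W s (alternating i j k)"
        "len w = len v + k"
      by (auto simp: P_def)
    have up: "len (v \<otimes> s l) = len v + 1" if l: "l \<in> {i, j}" for l
    proof (rule ccontr)
      assume "len (v \<otimes> s l) ~= len v + 1"
      then have down: "len v = len (v \<otimes> s l) + 1"
        using len_generator[OF v(1), of l] by blast
      show False
      proof (cases "l = (if even k then j else i)")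
        case True
        have "P (Suc k)"
          unfolding P_def using True down v by (intro bexI[of _ "v \<otimes> s l"]) (auto simp: m_assoc)
        with k(2) show False by fastforce
      next
        case False
        obtain k' where k': "k = Suc k'" using \<open>k >= 1\<close> by (cases k) auto
        with False l have "alternating i j k = l # alternating i j k'" by auto
        then have "w = v \<otimes> s l \<otimes> word_prod W s (alternating i j k')"
          using v by (simp add: m_assoc)
        then have "len w <= len (v \<otimes> s l) + k'"
          using len_mult_word[of "v \<otimes> s l" "alternating i j k'"] v by simp
        with down v k' show False by simp
      qed
    qed
    \<comment> \<open>By the braid relation, a longer word could be rewritten to end in
      \<open>i\<close>, and then \<open>s i\<close> would shorten \<open>w\<close>.\<close>
    have less_m: "m i j = 0 \<or> k < m i j"
    proof (rule ccontr)
      assume "~ (m i j = 0 \<or> k < m i j)"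
      then have nz: "m i j ~= 0" and "m i j <= k" by auto
      then obtain xs where xs: "length xs = k - m i j" "alternating i j k = xs @ alternating i j (m i j)"
        using alternating_add[of "k - m i j" i j "m i j"] by auto
      obtain n where n: "m i j = Suc n" using nz by (cases "m i j") auto
      have last: "\<exists>ys. length ys = n \<and> alternating j i (Suc n) = ys @ [i]" for n
        using alternating_add[of n j i 1] by simp
      then obtain ys where ys: "length ys = n" "alternating j i (m i j) = ys @ [i]"
        unfolding n by blast
      have "w \<otimes> s i = v \<otimes> (word_prod W s (xs @ ys))"
        using v xs ys alternating_swap[OF nz] by (simp add: word_prod_append m_assoc)
      then have "len (w \<otimes> s i) <= len v + length (xs @ ys)"
        using len_mult_word v by metis
      with xs ys n v less.prems \<open>m i j <= k\<close> show False by simp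
    qed
    have "len v < len w" using v \<open>k >= 1\<close> by simp
    then have nn: "action v (simple_root i) $ r >= 0" "action v (simple_root j) $ r >= 0"
      using less.hyps[of v] v up by auto
    obtain a b where ab: "a >= 0" "b >= 0"
        "foldr reflection (alternating i j k) (simple_root i) = a *\<^sub>R simple_root i + b *\<^sub>R simple_root j"
      using chebyshev_U_nonneg[OF \<open>i ~= j\<close>, of k] chebyshev_U_nonneg[OF \<open>i ~= j\<close>, of "Suc k"] less_m
      unfolding foldr_alternating Let_def by (metis less_imp_le Suc_leI)
    have "action w (simple_root i) = a *\<^sub>R action v (simple_root i) + b *\<^sub>R action v (simple_root j)"
      using v ab by (simp add: action_word_prod)
    then show ?thesis using ab nn by simp
  qed
qed

lemma action_simple_nonpos:
  assumes "w \<in> carrier W" "len w = len (w \<otimes> s i) + 1"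
  shows "action w (simple_root i) $ k <= 0"
proof -
  have "action (w \<otimes> s i) (simple_root i) $ k >= 0"
    using assms by (intro action_simple_nonneg) auto
  then show ?thesis
    using assms by (simp add: reflection_def)
qed

text \<open>A nontrivial element has a right descent and turns the corresponding simple root
  negative.\<close>

lemma action_faithful:
  assumes "u \<in> carrier W" "w \<in> carrier W" "!!i. action u (simple_root i) = action w (simple_root i)"
  shows "u = w"
proof -
  define v where "v = inv w \<otimes> u"
  have v: "v \<in> carrier W" using assms by (simp add: v_def)
  have "v = \<one>"
  proof (rule ccontr)
    assume "v ~= \<one>"
    then obtain i where "len v = len (v \<otimes> s i) + 1" using right_descent v by blast
    then have "action v (simple_root i) $ i <= 0" by (rule action_simple_nonpos[OF v])
    then show False using assms by (simp add: v_def simple_root_nth)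
  qed
  then show ?thesis
    using assms by (metis v_def inv_equality inv_inv inv_closed)
qed

definition nonneg :: "real ^ 'i => bool" where
  "nonneg v \<longleftrightarrow> (\<forall>i. v $ i >= 0)"

lemma rootsI: "w \<in> carrier W ==> action w (simple_root i) \<in> roots"
  by (auto simp: roots_def)

lemma rootsE:
  assumes "\<beta> \<in> roots"
  obtains w i where "w \<in> carrier W" "\<beta> = action w (simple_root i)"
  using assms by (auto simp: roots_def)

lemma simple_root_in_roots [simp]: "simple_root i \<in> roots"
  using rootsI[of \<one> i] by simp

lemma action_roots [simp]: "u \<in> carrier W ==> \<beta> \<in> roots ==> action u \<beta> \<in> roots"
  by (elim rootsE) (use rootsI in \<open>auto simp flip: action_mult\<close>)

lemma reflection_roots [simp]: "\<beta> \<in> roots ==> reflection i \<beta> \<in> roots"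
  using action_roots[of "s i" \<beta>] by simp

lemma foldr_reflection_roots: "\<beta> \<in> roots ==> foldr reflection xs \<beta> \<in> roots"
  by (induction xs) auto

lemma root_norm [simp]: "\<beta> \<in> roots ==> form \<beta> \<beta> = 1"
  by (elim rootsE) auto

lemma minus_roots [simp]: "\<beta> \<in> roots ==> - \<beta> \<in> roots"
proof (elim rootsE)
  fix w i assume w: "w \<in> carrier W" "\<beta> = action w (simple_root i)"
  then have "- \<beta> = action (w \<otimes> s i) (simple_root i)"
    by (simp add: reflection_def scaleR_2)
  with w show "- \<beta> \<in> roots" using rootsI[of "w \<otimes> s i" i] by simp
qed

lemma minus_roots_iff [simp]: "- \<beta> \<in> roots \<longleftrightarrow> \<beta> \<in> roots"
  using minus_roots[of \<beta>] minus_roots[of "- \<beta>"] by auto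

lemma root_dichotomy:
  assumes "\<beta> \<in> roots"
  shows "nonneg \<beta> \<or> nonneg (- \<beta>)"
proof -
  obtain w i where "w \<in> carrier W" "\<beta> = action w (simple_root i)" using assms by (rule rootsE)
  then show ?thesis
    using len_generator[of w i] action_simple_nonneg[of w i] action_simple_nonpos[of w i]
    by (auto simp: nonneg_def)
qed

lemma root_nonzero: "\<beta> \<in> roots ==> \<beta> ~= 0"
  using root_norm by fastforce

lemma nonneg_antisym: "nonneg v ==> nonneg (- v) ==> v = 0"
  by (auto simp: nonneg_def vec_eq_iff intro: antisym)

lemma root_not_both: "\<beta> \<in> roots ==> nonneg \<beta> ==> ~ nonneg (- \<beta>)"
  using nonneg_antisym root_nonzero by blast

lemma not_nonneg_root: "\<beta> \<in> roots ==> ~ nonneg \<beta> \<longleftrightarrow> nonneg (- \<beta>)"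
  using root_dichotomy root_not_both by blast

lemma nonneg_simple [simp]: "nonneg (simple_root i)"
  by (simp add: nonneg_def simple_root_nth)

lemma nonneg_add: "nonneg u ==> nonneg v ==> nonneg (u + v)"
  by (simp add: nonneg_def)

lemma nonneg_scaleR: "a >= 0 ==> nonneg v ==> nonneg (a *\<^sub>R v)"
  by (simp add: nonneg_def)

lemma root_multiple_of_simple:
  assumes "\<beta> \<in> roots" "nonneg \<beta>" "!!k. k ~= i ==> \<beta> $ k = 0"
  shows "\<beta> = simple_root i"
proof -
  have *: "\<beta> = (\<beta> $ i) *\<^sub>R simple_root i"
    using assms(3) by (auto simp: vec_eq_iff simple_root_nth)
  have "form \<beta> \<beta> = (\<beta> $ i)\<^sup>2"
    by (subst *, subst (2) *) (simp add: form_linear power2_eq_square)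
  then have "(\<beta> $ i)\<^sup>2 = 1" using assms(1) by simp
  then have "\<beta> $ i = 1"
    using assms(2) by (auto simp: nonneg_def power2_eq_1_iff) (metis not_one_le_zero neg_0_le_iff_le)
  with * show ?thesis by simp
qed

text \<open>Some coordinate other than \<open>i\<close> is positive and survives the reflection; a
  root with one positive coordinate is positive.\<close>

lemma reflection_nonneg:
  assumes "\<beta> \<in> roots" "nonneg \<beta>" "\<beta> ~= simple_root i"
  shows "nonneg (reflection i \<beta>)"
proof -
  obtain k where k: "k ~= i" "\<beta> $ k ~= 0"
    using root_multiple_of_simple assms by blast
  then have "reflection i \<beta> $ k > 0"
    using assms(2) by (simp add: reflection_nth nonneg_def order_less_le)
  then have "~ nonneg (- reflection i \<beta>)"
    by (auto simp: nonneg_def not_le intro!: exI[of _ k])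
  then show ?thesis
    using root_dichotomy[of "reflection i \<beta>"] assms by auto
qed

lemma positive_roots_iff: "\<beta> \<in> positive_roots \<longleftrightarrow> \<beta> \<in> roots \<and> nonneg \<beta>"
  by (simp add: positive_roots_def nonneg_def)

lemma half_space_iff: "\<beta> \<in> roots ==> w \<in> half_space \<beta> \<longleftrightarrow> w \<in> carrier W \<and> nonneg (action w \<beta>)"
  by (auto simp: half_space_def positive_roots_iff)

lemma root_set_iff:
  "\<beta> \<in> root_set L \<longleftrightarrow> \<beta> \<in> roots \<and> (\<forall>w\<in>L. w \<in> carrier W \<and> nonneg (action w \<beta>))"
  by (auto simp: root_set_def half_space_iff)

section \<open>Toggles, convex sets and independence of the listing\<close>

lemma toggle_carrier [simp]: "u \<in> carrier W ==> toggle L i u \<in> carrier W"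
  by (simp add: toggle_def)

lemma fold_toggle_carrier [simp]: "u \<in> carrier W ==> fold (toggle L) xs u \<in> carrier W"
  by (induction xs arbitrary: u) auto

text \<open>Only the simple root of \<open>i\<close> is turned negative by \<open>s i\<close>, and
  exactly when the image of a root of \<open>R(L)\<close> is this simple root, the toggle is
  blocked.\<close>

lemma toggle_stays_right:
  assumes "u \<in> carrier W" "\<beta> \<in> root_set L" "nonneg (action u \<beta>)"
  shows "nonneg (action (toggle L i u) \<beta>)"
proof (cases "action u \<beta> = simple_root i")
  case True
  then have "action (inv u) (simple_root i) = \<beta>"
    using assms by (metis action_inv(1))
  then show ?thesis using assms by (simp add: toggle_def)
next
  case False
  then show ?thesis
    using assms reflection_nonneg[of "action u \<beta>" i]
    by (auto simp: toggle_def root_set_iff)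
qed

lemma convex_iff:
  "is_convex L ==> u \<in> L \<longleftrightarrow> u \<in> carrier W \<and> (\<forall>\<beta>\<in>root_set L. nonneg (action u \<beta>))"
proof -
  assume "is_convex L"
  then obtain T where T: "T \<subseteq> roots" "L = carrier W \<inter> (\<Inter>\<beta>\<in>T. half_space \<beta>)"
    by (auto simp: is_convex_def)
  then have "T \<subseteq> root_set L" by (auto simp: root_set_def)
  then have "u \<in> half_space \<beta>"
    if "u \<in> carrier W" "\<forall>\<beta>\<in>root_set L. nonneg (action u \<beta>)" "\<beta> \<in> T" for \<beta>
    using that T(1) half_space_iff by blast
  then have "u \<in> L" if "u \<in> carrier W" "\<forall>\<beta>\<in>root_set L. nonneg (action u \<beta>)"
    using that unfolding T(2) by blast
  then show ?thesis by (auto simp: root_set_iff T(2))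
qed

lemma toggle_convex: "is_convex L ==> u \<in> L ==> toggle L i u \<in> L"
  using toggle_stays_right by (simp add: convex_iff)

lemma fold_toggle_convex: "is_convex L ==> u \<in> L ==> fold (toggle L) xs u \<in> L"
  by (induction xs arbitrary: u) (auto intro: toggle_convex)

lemma m_eq_2_commute:
  assumes "m i j = 2"
  shows "s i \<otimes> s j = s j \<otimes> s i"
proof -
  have "(s i \<otimes> s j) [^] (2::nat) = \<one>"
    using pow_ord_eq_1[of "s i \<otimes> s j"] assms unfolding m_def by (metis generator_carrier m_closed)
  then have "(s i \<otimes> s j) \<otimes> (s i \<otimes> s j) = \<one>" by (simp add: numeral_2_eq_2)
  then have "inv (s i \<otimes> s j) = s i \<otimes> s j" by (intro inv_equality) auto
  then show ?thesis by (simp add: inv_mult_group)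
qed

lemma form_entry_m_2 [simp]: "m i j = 2 ==> form_entry i j = 0"
  by (simp add: form_entry_def)

lemma toggle_commute:
  assumes "u \<in> carrier W" "m i j = 2"
  shows "toggle L i (toggle L j u) = toggle L j (toggle L i u)"
proof -
  have f: "form_entry i j = 0" "form_entry j i = 0"
    using assms form_entry_sym[of i j] by simp_all
  then have "reflection j (simple_root i) = simple_root i" "reflection i (simple_root j) = simple_root j"
    by (simp_all add: reflection_def)
  then have "action (inv (s j \<otimes> u)) (simple_root i) = action (inv u) (simple_root i)"
    "action (inv (s i \<otimes> u)) (simple_root j) = action (inv u) (simple_root j)"
    using assms by (simp_all add: inv_mult_group)
  then show ?thesis
    using assms m_eq_2_commute[OF assms(2)] by (simp add: toggle_def flip: m_assoc)
qed

definition heavy_listing :: "'g set => 'i list => bool" where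
  "heavy_listing L xs \<longleftrightarrow>
    (\<forall>u\<in>carrier W. (\<exists>K\<ge>1. (fold (toggle L) xs ^^ K) u = u) --> u \<in> L)"

text \<open>The moves realise conjugation: a commutation leaves the Coxeter element unchanged, and a
  rotation conjugates it by its first generator.\<close>

inductive listing_equiv :: "'i list => 'i list => bool" where
  le_refl: "listing_equiv xs xs"
| le_sym: "listing_equiv xs ys ==> listing_equiv ys xs"
| le_trans: "listing_equiv xs ys ==> listing_equiv ys zs ==> listing_equiv xs zs"
| le_swap: "m i j = 2 ==> listing_equiv (xs @ i # j # ys) (xs @ j # i # ys)"
| le_rotate: "listing_equiv (i # xs) (xs @ [i])"

text \<open>The toggles of \<open>ys\<close> carry periodic points of one listing to periodic points
  of the other. They land in \<open>L\<close> there; since toggles never leave \<open>L\<close>,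
  running through the rest of the period brings the original point into \<open>L\<close>.\<close>

lemma heavy_listing_rotate:
  assumes "is_convex L"
  shows "heavy_listing L (xs @ ys) ==> heavy_listing L (ys @ xs)"
  unfolding heavy_listing_def
proof (intro ballI impI)
  fix u assume heavy: "\<forall>u\<in>carrier W. (\<exists>K\<ge>1. (fold (toggle L) (xs @ ys) ^^ K) u = u) --> u \<in> L"
    and u: "u \<in> carrier W" and "\<exists>K\<ge>1. (fold (toggle L) (ys @ xs) ^^ K) u = u"
  then obtain K where K: "K >= 1" "(fold (toggle L) (ys @ xs) ^^ K) u = u" by blast
  let ?A = "fold (toggle L) xs" and ?B = "fold (toggle L) ys"
  have *: "(fold (toggle L) (xs @ ys) ^^ k) (?B v) = ?B ((fold (toggle L) (ys @ xs) ^^ k) v)" for k v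
    by (induction k) auto
  have "?B u \<in> L"
    using heavy *[of K u] K u by (metis fold_toggle_carrier)
  then have "fold (toggle L) (ys @ xs) u \<in> L"
    using assms fold_toggle_convex by simp
  moreover have "(fold (toggle L) (ys @ xs) ^^ k) v \<in> L" if "v \<in> L" for k v
    using that assms by (induction k) (simp_all add: fold_toggle_convex del: fold_append)
  moreover obtain k where "K = Suc k" using K(1) by (cases K) auto
  ultimately show "u \<in> L"
    using K(2) by (metis funpow_Suc_right comp_apply)
qed

lemma heavy_listing_equiv:
  assumes "listing_equiv xs ys" "is_convex L"
  shows "heavy_listing L xs \<longleftrightarrow> heavy_listing L ys"
  using assms(1)
proof induction
  case (le_swap i j xs ys)
  have "(fold (toggle L) (xs @ i # j # ys) ^^ k) u = (fold (toggle L) (xs @ j # i # ys) ^^ k) u \<and>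
      (fold (toggle L) (xs @ i # j # ys) ^^ k) u \<in> carrier W"
    if "u \<in> carrier W" for k u
  proof -
    have *: "fold (toggle L) (xs @ i # j # ys) v = fold (toggle L) (xs @ j # i # ys) v"
      if "v \<in> carrier W" for v
      using toggle_commute[of "fold (toggle L) xs v" i j L] le_swap that by simp
    show ?thesis
    proof (induction k)
      case (Suc k)
      then show ?case
        using * by (auto simp del: fold_append fold_simps)
    qed (use that in simp)
  qed
  then show ?case by (auto simp: heavy_listing_def)
next
  case (le_rotate i xs)
  show ?case
    using heavy_listing_rotate[OF assms(2), of "[i]" xs] heavy_listing_rotate[OF assms(2), of xs "[i]"]
    by auto
qed auto

lemma listing_equiv_set: "listing_equiv xs ys ==> set xs = set ys"
  by (induction rule: listing_equiv.induct) auto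

lemma listing_equiv_rotate: "listing_equiv (xs @ ys) (ys @ xs)"
proof (induction xs arbitrary: ys)
  case (Cons x xs)
  have "listing_equiv (x # xs @ ys) (xs @ ys @ [x])"
    using le_rotate[of x "xs @ ys"] by simp
  then show ?case using Cons[of "ys @ [x]"] le_trans by fastforce
qed (simp add: le_refl)

lemma listing_equiv_pass:
  assumes "!!w. w \<in> set bs ==> m l w = 2"
  shows "listing_equiv (as @ l # bs @ cs) (as @ bs @ l # cs)"
  using assms
proof (induction bs arbitrary: as)
  case (Cons b bs)
  have "listing_equiv (as @ l # b # bs @ cs) (as @ b # l # bs @ cs)"
    using Cons.prems by (intro le_swap) auto
  moreover have "listing_equiv ((as @ [b]) @ l # bs @ cs) ((as @ [b]) @ bs @ l # cs)"
    using Cons.prems by (intro Cons.IH) auto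
  ultimately show ?case using le_trans by simp
qed (simp add: le_refl)

text \<open>Each vertex has at most one neighbour among the later ones; such an order exists exactly for
  forests.\<close>

fun elimination_order :: "'i list => bool" where
  "elimination_order [] \<longleftrightarrow> True"
| "elimination_order (v # vs) \<longleftrightarrow> elimination_order vs \<and> (\<exists>p. \<forall>w\<in>set vs. w ~= p --> m v w = 2)"

text \<open>Meant for a vertex \<open>l\<close> whose only neighbour in the listing is
  \<open>p\<close>: up to the moves, \<open>l\<close> can always be kept directly behind
  \<open>p\<close>.\<close>

definition insert_after :: "'i => 'i => 'i list => 'i list" where
  "insert_after p l xs = concat (map (%w. if w = p then [w, l] else [w]) xs)"

lemma insert_after_simps [simp]:
  "insert_after p l [] = []"
  "insert_after p l (x # xs) = (if x = p then x # l # insert_after p l xs else x # insert_after p l xs)"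
  "insert_after p l (xs @ ys) = insert_after p l xs @ insert_after p l ys"
  by (auto simp: insert_after_def)

lemma insert_after_notin: "p ~: set xs ==> insert_after p l xs = xs"
  by (induction xs) auto

text \<open>A move that does not touch \<open>p\<close> lifts as it stands. If \<open>p\<close> is
  exchanged with another letter, then \<open>l\<close>, which commutes with that letter, follows
  \<open>p\<close>; if \<open>p\<close> is rotated, \<open>l\<close> is rotated along with
  it.\<close>

lemma insert_after_equiv:
  assumes "listing_equiv xs ys" "!!w. w \<in> set xs ==> w ~= p ==> m l w = 2"
  shows "listing_equiv (insert_after p l xs) (insert_after p l ys)"
  using assms
proof induction
  case (le_sym xs ys)
  have "listing_equiv (insert_after p l xs) (insert_after p l ys)"
    using le_sym.prems listing_equiv_set[OF le_sym.hyps] by (intro le_sym.IH) auto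
  then show ?case by (rule listing_equiv.le_sym)
next
  case (le_trans xs ys zs)
  have "listing_equiv (insert_after p l xs) (insert_after p l ys)"
    using le_trans.prems by (intro le_trans.IH) auto
  moreover have "listing_equiv (insert_after p l ys) (insert_after p l zs)"
    using le_trans.prems listing_equiv_set[OF le_trans.hyps(1)] by (intro le_trans.IH) auto
  ultimately show ?case by (rule listing_equiv.le_trans)
next
  case (le_swap i j xs ys)
  let ?g = "insert_after p l"
  have ij: "i ~= j" using le_swap.hyps by (intro notI) simp
  consider "i = p" | "j = p" | "i ~= p" "j ~= p" by blast
  then show ?case
  proof cases
    case 1
    have "listing_equiv (?g xs @ p # l # [j] @ ?g ys) (?g xs @ p # j # l # ?g ys)"
      using listing_equiv_pass[of "[j]" l "?g xs @ [p]" "?g ys"] le_swap 1 ij by auto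
    moreover have "listing_equiv (?g xs @ p # j # l # ?g ys) (?g xs @ j # p # l # ?g ys)"
      using listing_equiv.le_swap[of p j "?g xs" "l # ?g ys"] le_swap.hyps 1 by simp
    ultimately have "listing_equiv (?g xs @ p # l # [j] @ ?g ys) (?g xs @ j # p # l # ?g ys)"
      by (rule listing_equiv.le_trans)
    then show ?thesis using 1 ij by simp
  next
    case 2
    have "listing_equiv (?g xs @ p # l # [i] @ ?g ys) (?g xs @ p # i # l # ?g ys)"
      using listing_equiv_pass[of "[i]" l "?g xs @ [p]" "?g ys"] le_swap 2 ij by auto
    moreover have "listing_equiv (?g xs @ p # i # l # ?g ys) (?g xs @ i # p # l # ?g ys)"
      using listing_equiv.le_swap[of p i "?g xs" "l # ?g ys"] le_swap.hyps 2 m_sym[of i p] by simp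
    ultimately have "listing_equiv (?g xs @ i # p # l # ?g ys) (?g xs @ p # l # [i] @ ?g ys)"
      by (rule listing_equiv.le_sym[OF listing_equiv.le_trans])
    then show ?thesis using 2 ij by simp
  next
    case 3
    then show ?thesis using listing_equiv.le_swap[OF le_swap.hyps] by simp
  qed
next
  case (le_rotate i xs)
  then show ?case
    using listing_equiv_rotate[of "insert_after p l [i]" "insert_after p l xs"] by (auto split: if_splits)
qed (simp add: le_refl)

text \<open>Rotate until \<open>p\<close> comes first; nothing then stops \<open>l\<close> from
  moving to the left until it meets \<open>p\<close>.\<close>

lemma listing_equiv_insert_after:
  assumes "distinct xs" "p \<in> set xs" "l \<in> set xs" "p ~= l"
    and "!!w. w \<in> set xs ==> w ~= p ==> w ~= l ==> m l w = 2"
  shows "listing_equiv xs (insert_after p l (filter (%w. w ~= l) xs))"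
proof -
  obtain us ws where xs: "xs = us @ p # ws" using assms(2) by (meson split_list)
  have "l \<in> set (ws @ us)" using assms xs by auto
  then obtain as bs where ab: "ws @ us = as @ l # bs" by (meson split_list)
  have d: "distinct (p # ws @ us)" using assms(1) xs by auto
  then have nl: "l ~: set as" "l ~: set bs" "p ~: set as" "p ~: set bs" unfolding ab by auto
  have fil: "filter (%w. w ~= l) (p # ws @ us) = p # as @ bs"
  proof -
    have "filter (%w. w ~= l) as = as" "filter (%w. w ~= l) bs = bs"
      using nl by (auto intro!: filter_True)
    then show ?thesis unfolding ab using assms(4) by simp
  qed
  have "listing_equiv xs (p # as @ l # bs)"
    unfolding xs using listing_equiv_rotate[of us "p # ws"] ab by simp
  moreover have "listing_equiv ([p] @ l # as @ bs) ([p] @ as @ l # bs)"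
  proof (rule listing_equiv_pass)
    fix w assume w: "w \<in> set as"
    then have "w \<in> set (ws @ us)" unfolding ab by simp
    then show "m l w = 2" using w nl d xs by (intro assms(5)) auto
  qed
  moreover have "insert_after p l (p # as @ bs) = p # l # as @ bs"
    using nl by (simp add: insert_after_notin)
  moreover have "listing_equiv (insert_after p l (filter (%w. w ~= l) (p # ws @ us)))
      (insert_after p l (filter (%w. w ~= l) xs))"
    unfolding append_Cons[symmetric]
  proof (rule insert_after_equiv)
    show "listing_equiv (filter (%w. w ~= l) ((p # ws) @ us)) (filter (%w. w ~= l) xs)"
      unfolding xs using listing_equiv_rotate[of "filter (%w. w ~= l) (p # ws)"
          "filter (%w. w ~= l) us"] by (simp only: filter_append)
  qed (use assms(5) xs in \<open>auto split: if_splits\<close>)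
  ultimately show ?thesis
    unfolding fil using le_trans le_sym by (metis append_Cons append_Nil)
qed

lemma distinct_singleton_iff: "distinct xs \<and> set xs = {l} \<longleftrightarrow> xs = [l]"
  by (cases xs; cases "tl xs") auto

text \<open>The known fact that all Coxeter elements of a forest are conjugate, by induction on the
  removal of a leaf: the moves between the shortened listings lift to the full ones with the leaf
  glued behind its neighbour.\<close>

lemma elimination_order_equiv:
  assumes "elimination_order vs" "distinct vs" "distinct xs" "set xs = set vs"
    "distinct ys" "set ys = set vs"
  shows "listing_equiv xs ys"
  using assms
proof (induction vs arbitrary: xs ys)
  case (Cons l vs)
  show ?case
  proof (cases "vs = []")
    case True
    then have "xs = [l]" "ys = [l]"
      using Cons.prems by (auto simp flip: distinct_singleton_iff)
    then show ?thesis by (simp add: le_refl)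
  next
    case False
    from Cons.prems(1) obtain p0 where p0: "\<forall>w\<in>set vs. w ~= p0 --> m l w = 2" by auto
    \<comment> \<open>The given neighbour may lie outside \<open>vs\<close>, in which case the leaf
      is isolated and any member of \<open>vs\<close> can take its place.\<close>
    define p where "p = (if p0 \<in> set vs then p0 else hd vs)"
    have p: "p \<in> set vs" "\<forall>w\<in>set vs. w ~= p --> m l w = 2"
      using p0 False unfolding p_def by auto
    let ?f = "filter (%w. w ~= l)"
    have sets: "set (?f xs) = set vs" "set (?f ys) = set vs"
      using Cons.prems by auto
    have "listing_equiv (?f xs) (?f ys)"
      using Cons.prems sets by (intro Cons.IH) auto
    then have "listing_equiv (insert_after p l (?f xs)) (insert_after p l (?f ys))"
      using p sets by (intro insert_after_equiv) auto
    moreover have ins: "listing_equiv zs (insert_after p l (?f zs))" if "distinct zs" "set zs = set (l # vs)" for zs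
      using that p Cons.prems(2) by (intro listing_equiv_insert_after) auto
    have "listing_equiv xs (insert_after p l (?f xs))" "listing_equiv ys (insert_after p l (?f ys))"
      using ins Cons.prems by blast+
    ultimately show ?thesis using le_trans[OF le_trans] le_sym by fast
  qed
qed (simp add: le_refl)

lemma heavy_iff_listing:
  assumes "coxeter_element c"
  shows "\<exists>xs. distinct xs \<and> set xs = UNIV \<and> (\<forall>L. heavy L c \<longleftrightarrow> heavy_listing L xs)"
proof -
  let ?xs = "SOME xs. represents_coxeter_element xs c"
  have "represents_coxeter_element ?xs c"
    using assms unfolding coxeter_element_def by (rule someI_ex)
  then show ?thesis
    by (intro exI[of _ ?xs])
       (auto simp: represents_coxeter_element_def heavy_def heavy_listing_def promotion_def)
qed

lemma futuristicI:
  assumes "!!L xs. is_convex L ==> L ~= {} ==> distinct xs ==> set xs = UNIV ==> heavy_listing L xs"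
  shows futuristic
  unfolding futuristic_def futuristic_element_def using heavy_iff_listing assms by metis

lemma listing_independence:
  assumes "elimination_order vs" "distinct vs" "set vs = UNIV" "distinct xs" "set xs = UNIV"
    and "distinct ys" "set ys = UNIV" "is_convex L"
  shows "heavy_listing L xs \<longleftrightarrow> heavy_listing L ys"
  using assms elimination_order_equiv[of vs xs ys] heavy_listing_equiv by auto

text \<open>Conjugacy transports heaviness of a fixed \<open>L\<close>, so on a forest one and the
  same \<open>L\<close> defeats every Coxeter element.\<close>

lemma ancientI:
  assumes "elimination_order vs" "distinct vs" "set vs = UNIV" "distinct xs" "set xs = UNIV"
    and "is_convex L" "L ~= {}" "~ heavy_listing L xs"
  shows ancient
  unfolding ancient_def futuristic_element_def
  using heavy_iff_listing listing_independence[OF assms(1-5) _ _ assms(6)] assms(6-8) by metis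

section \<open>Integrality of roots\<close>

lemma form_action_inv: "u \<in> carrier W ==> form (action (inv u) v) x = form v (action u x)"
  by (metis form_action action_inv(2))

text \<open>\<open>d i\<close> is the length to which the unit vector of the simple root
  \<open>i\<close> is rescaled; the quotients are then the Cartan integers.\<close>

definition crystallographic :: "('i => real) => bool" where
  "crystallographic d \<longleftrightarrow> (\<forall>i. d i > 0) \<and> (\<forall>i j. 2 * form_entry i j * d j / d i \<in> \<int>)"

lemma crystallographic_root:
  assumes "crystallographic d" "w \<in> carrier W"
  shows "action w (simple_root j) $ i * d j / d i \<in> \<int>"
proof -
  have pos: "d i > 0" for i using assms by (auto simp: crystallographic_def)
  obtain xs where xs: "w = word_prod W s xs" using assms(2) by (rule word_prod_surjE)
  have "foldr reflection xs (simple_root j) $ i * d j / d i \<in> \<int>"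
  proof (induction xs arbitrary: i)
    case Nil
    then show ?case using pos[of j] by (simp add: simple_root_nth)
  next
    case (Cons k xs)
    let ?v = "foldr reflection xs (simple_root j)"
    have "2 * form ?v (simple_root k) * d j / d k =
        (\<Sum>l\<in>UNIV. (?v $ l * d j / d l) * (2 * form_entry k l * d l / d k))"
      unfolding form_simple_right sum_distrib_left sum_distrib_right sum_divide_distrib
    proof (rule sum.cong[OF refl])
      fix l
      show "2 * (?v $ l * form_entry l k) * d j / d k = ?v $ l * d j / d l * (2 * form_entry k l * d l / d k)"
        using pos[of l] form_entry_sym[of k l] by (simp add: field_simps)
    qed
    also have "... \<in> \<int>"
      using Cons.IH assms(1) by (intro Ints_sum Ints_mult) (auto simp: crystallographic_def)
    finally have *: "2 * form ?v (simple_root k) * d j / d k \<in> \<int>" .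
    show ?case
    proof (cases "i = k")
      case True
      have "(?v $ k - 2 * form ?v (simple_root k)) * d j / d k =
          ?v $ k * d j / d k - 2 * form ?v (simple_root k) * d j / d k"
        by (simp add: algebra_simps diff_divide_distrib)
      then show ?thesis using True Cons.IH[of k] * by (simp add: reflection_nth)
    qed (use Cons.IH in \<open>simp add: reflection_nth\<close>)
  qed
  then show ?thesis by (simp add: xs action_word_prod)
qed

text \<open>This is the product of the two Cartan integers of the pair, in which the lengths
  \<open>d\<close> cancel.\<close>

lemma crystallographic_form:
  assumes "crystallographic d" "\<beta> \<in> roots" "\<gamma> \<in> roots"
  shows "4 * (form \<beta> \<gamma>)\<^sup>2 \<in> \<int>"
proof -
  have pos: "d i > 0" for i using assms by (auto simp: crystallographic_def)
  have *: "2 * form (action w (simple_root j)) (action u (simple_root l)) * d j / d l \<in> \<int>"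
    if wu: "w \<in> carrier W" "u \<in> carrier W" for w u j l
  proof -
    let ?v = "action (inv u \<otimes> w) (simple_root j)"
    have "form ?v (simple_root l) = form (action w (simple_root j)) (action u (simple_root l))"
      using wu by (simp add: form_action_inv)
    then have "2 * form (action w (simple_root j)) (action u (simple_root l)) * d j / d l =
        2 * form ?v (simple_root l) * d j / d l" by simp
    also have "... = (\<Sum>k\<in>UNIV. (?v $ k * d j / d k) * (2 * form_entry l k * d k / d l))"
      unfolding form_simple_right sum_distrib_left sum_distrib_right sum_divide_distrib
    proof (rule sum.cong[OF refl])
      fix k
      show "2 * (?v $ k * form_entry k l) * d j / d l = ?v $ k * d j / d k * (2 * form_entry l k * d k / d l)"
        using pos[of k] form_entry_sym[of k l] by (simp add: field_simps)
    qed
    also have "... \<in> \<int>"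
      using crystallographic_root[OF assms(1), of "inv u \<otimes> w" j] wu assms(1)
      by (intro Ints_sum Ints_mult) (auto simp: crystallographic_def)
    finally show ?thesis .
  qed
  obtain w j where w: "w \<in> carrier W" "\<beta> = action w (simple_root j)" using assms(2) by (rule rootsE)
  obtain u l where u: "u \<in> carrier W" "\<gamma> = action u (simple_root l)" using assms(3) by (rule rootsE)
  have "4 * (form \<beta> \<gamma>)\<^sup>2 = (2 * form \<beta> \<gamma> * d j / d l) * (2 * form \<gamma> \<beta> * d l / d j)"
    using pos[of j] pos[of l] form_sym[of \<beta> \<gamma>] by (simp add: field_simps power2_eq_square)
  also have "... \<in> \<int>"
    using *[of w u j l] *[of u w l j] w u by (intro Ints_mult) auto
  finally show ?thesis .
qed

text \<open>After rescaling, roots are integer vectors; the scale depends only on the index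
  \<open>j\<close> of the simple root that is moved, and there are finitely many of these.\<close>

lemma finite_bounded_roots:
  assumes "crystallographic d"
  shows "finite {\<beta> \<in> roots. \<forall>i. \<bar>\<beta> $ i\<bar> <= C i}"
proof -
  have pos: "d i > 0" for i using assms by (auto simp: crystallographic_def)
  define B where "B = (%j i. {- \<lceil>C i * d j / d i\<rceil>..\<lceil>C i * d j / d i\<rceil>})"
  define F where "F = (%j (n :: 'i => int). (\<chi> i. of_int (n i) * d i / d j) :: real ^ 'i)"
  have "{\<beta> \<in> roots. \<forall>i. \<bar>\<beta> $ i\<bar> <= C i} \<subseteq> (\<Union>j. F j ` (PiE UNIV (B j)))"
  proof
    fix \<beta> assume "\<beta> \<in> {\<beta> \<in> roots. \<forall>i. \<bar>\<beta> $ i\<bar> <= C i}"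
    then have \<beta>: "\<beta> \<in> roots" and bound: "\<bar>\<beta> $ i\<bar> <= C i" for i by auto
    obtain w j where w: "w \<in> carrier W" "\<beta> = action w (simple_root j)" using \<beta> by (rule rootsE)
    define n where "n = (%i. \<lfloor>\<beta> $ i * d j / d i\<rfloor>)"
    have n: "of_int (n i) = \<beta> $ i * d j / d i" for i
      using crystallographic_root[OF assms w(1), of j i] w(2) by (simp add: n_def)
    have "\<beta> = F j n"
      using pos[THEN less_imp_neq] by (simp add: F_def n vec_eq_iff field_simps)
    moreover have "n i \<in> B j i" for i
    proof -
      have "\<bar>of_int (n i)\<bar> = \<bar>\<beta> $ i\<bar> * (d j / d i)"
        using pos[of i] pos[of j] by (simp add: n abs_mult abs_divide)
      also have "... <= C i * (d j / d i)"
        using bound[of i] pos[of i] pos[of j] by (intro mult_right_mono) auto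
      also have "... = C i * d j / d i" by simp
      finally have "\<bar>real_of_int (n i)\<bar> <= C i * d j / d i" .
      then show ?thesis unfolding B_def by auto linarith+
    qed
    ultimately show "\<beta> \<in> (\<Union>j. F j ` (PiE UNIV (B j)))" by auto
  qed
  moreover have "finite (\<Union>j. F j ` (PiE UNIV (B j)))"
    by (intro finite_UN_I finite_imageI finite_PiE) (auto simp: B_def)
  ultimately show ?thesis by (rule finite_subset)
qed

section \<open>The null vector of an irreducible affine form\<close>

lemma coxeter_graph_sym: "(i, j) \<in> coxeter_graph ==> (j, i) \<in> coxeter_graph"
  by (auto simp: coxeter_graph_def m_sym)

lemma form_entry_edge:
  assumes "(i, j) \<in> coxeter_graph"
  shows "form_entry i j < 0"
proof (cases "m i j = 0")
  case False
  then have "m i j >= 3" using assms by (auto simp: coxeter_graph_def)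
  then have "pi / m i j <= pi / 3" by (intro divide_left_mono) auto
  also have "... < pi / 2" by simp
  finally have "cos (pi / m i j) > 0"
    using pi_gt_zero by (intro cos_gt_zero_pi) (auto intro: less_le_trans[of _ 0])
  then show ?thesis using False by (simp add: form_entry_def)
qed (simp add: form_entry_def)

lemma not_edge_m_2: "i ~= j ==> (i, j) ~: coxeter_graph ==> m i j = 2"
  using m_ge_2[of i j] by (auto simp: coxeter_graph_def)

lemma psd_isotropic:
  assumes "!!x. form x x >= 0" "form x x = 0"
  shows "form x y = 0"
proof (rule ccontr)
  assume ne: "form x y ~= 0"
  \<comment> \<open>Almost the minimum of the quadratic polynomial in \<open>t\<close>; the added 1
    keeps the denominator positive when \<open>y\<close> is isotropic.\<close>
  define t where "t = - form x y / (form y y + 1)"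
  have q: "form y y + 1 > 0" using assms(1)[of y] by simp
  have "form (x + t *\<^sub>R y) (x + t *\<^sub>R y) = 2 * t * form x y + t\<^sup>2 * form y y"
    using assms(2) form_sym[of y x] by (simp add: form_linear power2_eq_square algebra_simps)
  also have "... < 2 * t * form x y + t\<^sup>2 * (form y y + 1)"
    using ne q by (simp add: t_def)
  also have "... = - (form x y)\<^sup>2 / (form y y + 1)"
    using q by (simp add: t_def divide_simps power2_eq_square)
  also have "... <= 0" using q by simp
  finally show False using assms(1)[of "x + t *\<^sub>R y"] by simp
qed

lemma psd_root_bound:
  assumes "!!x. form x x >= 0" "\<beta> \<in> roots" "\<gamma> \<in> roots"
  shows "\<bar>form \<beta> \<gamma>\<bar> <= 1"
  using assms(1)[of "\<beta> + \<gamma>"] assms(1)[of "\<beta> - \<gamma>"] assms(2,3) form_sym[of \<gamma> \<beta>]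
  by (simp add: form_linear abs_le_iff)

text \<open>A Perron-Frobenius argument: off-diagonal entries are nonpositive, so absolute values
  again give an isotropic vector, which is orthogonal to everything. At a vertex with coordinate 0
  this makes a sum of nonnegative terms vanish, so that zeros spread along the edges.\<close>

lemma abs_isotropic:
  assumes psd: "!!x. form x x >= 0" and irr: is_irreducible and x: "form x x = 0" "x $ i = 0"
  shows "x = 0"
proof -
  define y :: "real ^ 'i" where "y = (\<chi> i. \<bar>x $ i\<bar>)"
  have "form y y <= form x x"
    unfolding form_def
  proof (intro sum_mono)
    fix i j
    show "y $ i * y $ j * form_entry i j <= x $ i * x $ j * form_entry i j"
    proof (cases "i = j")
      case True
      then show ?thesis by (simp add: y_def flip: abs_mult)
    next
      case False
      have "x $ i * x $ j <= \<bar>x $ i\<bar> * \<bar>x $ j\<bar>" by (simp flip: abs_mult)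
      then show ?thesis
        using form_entry_nonpos[OF False] by (auto simp: y_def intro: mult_right_mono_neg)
    qed
  qed
  then have y0: "form y y = 0" using psd[of y] x by simp
  have step: "y $ k = 0" if "y $ j = 0" "(j, k) \<in> coxeter_graph" for j k
  proof -
    have "(\<Sum>i\<in>UNIV. - (y $ i * form_entry i j)) = 0"
      using psd_isotropic[OF psd y0, of "simple_root j"] by (simp add: form_simple_right sum_negf)
    moreover have "0 <= - (y $ i * form_entry i j)" for i
      using that(1) form_entry_nonpos[of i j]
      by (cases "i = j") (auto simp: y_def mult_le_0_iff)
    ultimately have "y $ k * form_entry k j = 0"
      by (simp add: sum_nonneg_eq_0_iff)
    then show ?thesis using form_entry_edge[OF coxeter_graph_sym[OF that(2)]] by simp
  qed
  have "y $ k = 0" for k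
  proof -
    have "(i, k) \<in> coxeter_graph\<^sup>*" using irr by (auto simp: is_irreducible_def)
    then show ?thesis
      using step by (induction rule: rtrancl_induct) (auto simp: y_def x)
  qed
  then show ?thesis by (simp add: y_def vec_eq_iff)
qed

lemma null_vectorE:
  assumes irr: is_irreducible and aff: is_affine
  obtains \<delta> where "!!i. \<delta> $ i > 0" "!!v. form \<delta> v = 0"
    "!!v. form v v = 0 ==> \<exists>c. v = c *\<^sub>R \<delta>"
proof -
  have psd: "form x x >= 0" for x using aff by (simp add: is_affine_def)
  obtain x where x: "x ~= 0" "form x x = 0"
    using aff psd unfolding is_affine_def by (metis order_le_less)
  define y :: "real ^ 'i" where "y = (\<chi> i. \<bar>x $ i\<bar>)"
  have nz: "x $ i ~= 0" for i using abs_isotropic[OF psd irr x(2)] x(1) by blast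
  have "form y y <= form x x"
    unfolding form_def
  proof (intro sum_mono)
    fix i j
    have "x $ i * x $ j <= \<bar>x $ i\<bar> * \<bar>x $ j\<bar>" by (simp flip: abs_mult)
    then show "y $ i * y $ j * form_entry i j <= x $ i * x $ j * form_entry i j"
      using form_entry_nonpos[of i j]
      by (cases "i = j") (auto simp: y_def intro: mult_right_mono_neg simp flip: abs_mult)
  qed
  then have y0: "form y y = 0" using psd[of y] x by simp
  show ?thesis
  proof (rule that[of y])
    show "y $ i > 0" for i using nz[of i] by (simp add: y_def)
    show null: "form y v = 0" for v using psd_isotropic[OF psd y0] .
    fix v assume v: "form v v = 0"
    obtain i :: 'i where True by simp
    define c where "c = v $ i / y $ i"
    have "form (v - c *\<^sub>R y) (v - c *\<^sub>R y) = 0"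
      using v null form_sym[of v y] by (simp add: form_linear)
    moreover have "(v - c *\<^sub>R y) $ i = 0" using nz[of i] by (simp add: c_def y_def)
    ultimately have "v - c *\<^sub>R y = 0" by (rule abs_isotropic[OF psd irr])
    then show "\<exists>c. v = c *\<^sub>R y" by auto
  qed
qed

section \<open>Reflections and translations in the group\<close>

lemma reflection_element:
  assumes "\<gamma> \<in> roots"
  obtains t where "t \<in> carrier W" "!!v. action t v = v - (2 * form v \<gamma>) *\<^sub>R \<gamma>"
proof -
  obtain w i where w: "w \<in> carrier W" "\<gamma> = action w (simple_root i)" using assms by (rule rootsE)
  show ?thesis
    using w form_action_inv[OF w(1)] by (intro that[of "w \<otimes> s i \<otimes> inv w"]) (auto simp: reflection_def)
qed

text \<open>The mirrors of \<open>\<gamma>\<close> and \<open>\<delta> - \<gamma>\<close> are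
  parallel, so the product of the two reflections is a translation; \<open>k\<close> is its
  power.\<close>

lemma translation_element:
  assumes "\<gamma> \<in> roots" "\<delta> - \<gamma> \<in> roots" "!!v. form \<delta> v = 0"
  obtains t where "t \<in> carrier W" "!!v. action t v = v + (2 * real k * form v \<gamma>) *\<^sub>R \<delta>"
proof -
  obtain a where a: "a \<in> carrier W" "!!v. action a v = v - (2 * form v \<gamma>) *\<^sub>R \<gamma>"
    by (rule reflection_element[OF assms(1)]) blast
  obtain b where b: "b \<in> carrier W" "!!v. action b v = v - (2 * form v (\<delta> - \<gamma>)) *\<^sub>R (\<delta> - \<gamma>)"
    by (rule reflection_element[OF assms(2)]) blast
  have d: "form v \<delta> = 0" for v using assms(3) form_sym by metis
  have ab: "action (a \<otimes> b) v = v + (2 * form v \<gamma>) *\<^sub>R \<delta>" for v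
  proof -
    have bv: "action b v = v + (2 * form v \<gamma>) *\<^sub>R (\<delta> - \<gamma>)"
      using b(2)[of v] d by (simp add: form_linear)
    have "form (action b v) \<gamma> = - form v \<gamma>"
      unfolding bv using assms(1,3) by (simp add: form_linear)
    then have "action a (action b v) = v + (2 * form v \<gamma>) *\<^sub>R \<delta>"
      unfolding a(2) using bv by (simp add: scaleR_diff_right)
    then show ?thesis using a b by simp
  qed
  have "\<exists>t\<in>carrier W. \<forall>v. action t v = v + (2 * real k * form v \<gamma>) *\<^sub>R \<delta>"
  proof (induction k)
    case 0
    then show ?case by (intro bexI[of _ \<one>]) auto
  next
    case (Suc k)
    then obtain t where t: "t \<in> carrier W" "\<forall>v. action t v = v + (2 * real k * form v \<gamma>) *\<^sub>R \<delta>" by blast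
    then show ?case
      using a b ab assms(3)
      by (intro bexI[of _ "t \<otimes> (a \<otimes> b)"]) (auto simp: form_linear algebra_simps simp del: action_mult(1)[of a b])
  qed
  then show ?thesis using that by blast
qed

text \<open>Time counts single toggles, reading the listing cyclically. Rounds of promotion end at
  the multiples of its length, but blocking has to be followed within a round.\<close>

primrec orbit :: "'g set => 'i list => 'g => nat => 'g" where
  "orbit L xs u 0 = u"
| "orbit L xs u (Suc t) = toggle L (xs ! (t mod length xs)) (orbit L xs u t)"

primrec free_orbit :: "'i list => real ^ 'i => nat => real ^ 'i" where
  "free_orbit xs v 0 = v"
| "free_orbit xs v (Suc t) = reflection (xs ! (t mod length xs)) (free_orbit xs v t)"

lemma orbit_carrier [simp]: "u \<in> carrier W ==> orbit L xs u t \<in> carrier W"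
  by (induction t) auto

lemma orbit_take:
  assumes "j <= length xs"
  shows "orbit L xs u (k * length xs + j) = fold (toggle L) (take j xs) (orbit L xs u (k * length xs))"
  using assms by (induction j) (auto simp: take_Suc_conv_app_nth)

lemma orbit_rounds: "orbit L xs u (k * length xs) = (fold (toggle L) xs ^^ k) u"
proof (induction k)
  case (Suc k)
  then show ?case using orbit_take[of "length xs" xs L u k] by (simp add: add.commute)
qed simp

lemma orbit_periodic:
  assumes "(fold (toggle L) xs ^^ K) u = u"
  shows "orbit L xs u (t + n * (K * length xs)) = orbit L xs u t"
proof (induction n)
  case (Suc n)
  have *: "orbit L xs u (t + K * length xs) = orbit L xs u t" for t
  proof (induction t)
    case 0
    then show ?case using assms by (simp add: orbit_rounds)
  next
    case (Suc t)
    then show ?case by simp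
  qed
  from *[of "t + n * (K * length xs)"] Suc show ?case
    by (simp add: algebra_simps)
qed simp

lemma free_orbit_take:
  assumes "j <= length xs"
  shows "free_orbit xs v (k * length xs + j) = fold reflection (take j xs) (free_orbit xs v (k * length xs))"
  using assms by (induction j) (auto simp: take_Suc_conv_app_nth)

lemma free_orbit_rounds: "free_orbit xs v (k * length xs) = (fold reflection xs ^^ k) v"
proof (induction k)
  case (Suc k)
  then show ?case using free_orbit_take[of "length xs" xs v k] by (simp add: add.commute)
qed simp

lemma free_orbit_periodic:
  assumes "(fold reflection xs ^^ P) v = v" "P > 0" "xs ~= []"
  obtains k j where "k < P" "j < length xs"
    "free_orbit xs v t = fold reflection (take j xs) ((fold reflection xs ^^ k) v)"
proof -
  have *: "free_orbit xs v (t + n * (P * length xs)) = free_orbit xs v t" for n t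
  proof (induction n)
    case (Suc n)
    have *: "free_orbit xs v (t + P * length xs) = free_orbit xs v t" for t
    proof (induction t)
      case 0
      then show ?case using assms by (simp add: free_orbit_rounds)
    next
      case (Suc t)
      then show ?case by simp
    qed
    from *[of "t + n * (P * length xs)"] Suc show ?case
      by (simp add: algebra_simps)
  qed simp
  define r where "r = t mod (P * length xs)"
  have "free_orbit xs v t = free_orbit xs v r"
    using *[of r "t div (P * length xs)"] by (simp add: r_def mult.commute)
  also have "r = r div length xs * length xs + r mod length xs" by simp
  also have "free_orbit xs v ... = fold reflection (take (r mod length xs) xs) ((fold reflection xs ^^ (r div length xs)) v)"
    using assms(3) by (subst free_orbit_take) (auto simp: free_orbit_rounds less_imp_le)
  finally have "free_orbit xs v t = ..." .
  moreover have "r < P * length xs" using assms by (simp add: r_def)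
  then have "r div length xs < P"
    using assms by (simp add: div_less_iff_less_mult)
  ultimately show ?thesis using that[of "r div length xs" "r mod length xs"] assms(3) by simp
qed

lemma finite_range_free_orbit:
  assumes "(fold reflection xs ^^ P) v = v" "P > 0" "xs ~= []"
  shows "finite (range (free_orbit xs v))"
proof (rule finite_subset)
  show "range (free_orbit xs v) \<subseteq>
      (%(k, j). fold reflection (take j xs) ((fold reflection xs ^^ k) v)) ` ({..<P} \<times> {..<length xs})"
  proof
    fix y assume "y \<in> range (free_orbit xs v)"
    then obtain t where "y = free_orbit xs v t" by blast
    moreover obtain k j where "k < P" "j < length xs"
        "free_orbit xs v t = fold reflection (take j xs) ((fold reflection xs ^^ k) v)"
      using free_orbit_periodic[OF assms] .
    ultimately show "y \<in> (%(k, j). fold reflection (take j xs) ((fold reflection xs ^^ k) v)) `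
        ({..<P} \<times> {..<length xs})" by force
  qed
qed auto

lemma action_eq_on_span:
  assumes "u \<in> carrier W" "w \<in> carrier W" "!!i. simple_root i \<in> span S"
    "!!v. v \<in> S ==> action u v = action w v"
  shows "u = w"
proof (rule action_faithful)
  fix i
  show "action u (simple_root i) = action w (simple_root i)"
    using linear_eq_on_span[OF action_linear[OF assms(1)] action_linear[OF assms(2)] assms(4,3)] .
qed fact+

text \<open>The trap. Let \<open>L\<close> be the convex hull of \<open>X\<close>. Starting from \<open>1\<close>, mirrors are only hit in roots
  orthogonal to \<open>N\<close>, so that \<open>N\<close> moves as in the absence of \<open>L\<close>. The roots in \<open>M\<close> stay positive and add
  up to a null vector, so the orbit is finite. But the root \<open>\<gamma> \<in> N\<close> never becomes negative, while it
  is negative on \<open>L\<close>.\<close>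

lemma trap:
  assumes xs: "xs ~= []"
    and cryst: "crystallographic d"
    and X: "X \<subseteq> carrier W" "X ~= {}"
    and \<gamma>: "\<gamma> \<in> N" "\<gamma> \<in> roots" "!!x. x \<in> X ==> nonneg (- action x \<gamma>)"
      "!!t. nonneg (free_orbit xs \<gamma> t)"
    and N: "finite N" "!!v. v \<in> N ==> finite (range (free_orbit xs v))"
    and M: "finite M" "M \<subseteq> roots" "!!b. b \<in> M ==> nonneg b"
      "!!b x. b \<in> M ==> x \<in> X ==> nonneg (action x b)"
    and n: "!!b. b \<in> M ==> n b > 0" "!!v. form (\<Sum>b\<in>M. n b *\<^sub>R b) v = 0"
    and span: "!!i. simple_root i \<in> span (N \<union> M)"
    and hits: "!!\<rho> u t i v. \<rho> \<in> roots ==> (!!x. x \<in> X ==> nonneg (action x \<rho>)) ==>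
      u \<in> carrier W ==> (!!v. v \<in> N ==> action u v = free_orbit xs v t) ==>
      (!!b. b \<in> M ==> nonneg (action u b)) ==> action u \<rho> = simple_root i ==> v \<in> N ==>
      i = xs ! (t mod length xs) ==> form \<rho> v = 0"
  shows "\<exists>L. is_convex L \<and> L ~= {} \<and> ~ heavy_listing L xs"
proof -
  define T where "T = {\<rho> \<in> roots. \<forall>x\<in>X. nonneg (action x \<rho>)}"
  define L where "L = carrier W \<inter> (\<Inter>\<beta>\<in>T. half_space \<beta>)"
  have "X \<subseteq> L"
    using X(1) by (auto simp: L_def T_def half_space_iff)
  have convex: "is_convex L"
    unfolding is_convex_def L_def by (intro exI[of _ T]) (auto simp: T_def)
  have T: "root_set L = T"
  proof
    show "root_set L \<subseteq> T"
      using \<open>X \<subseteq> L\<close> by (auto simp: root_set_iff T_def)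
    show "T \<subseteq> root_set L"
      by (auto simp: root_set_iff L_def T_def half_space_iff)
  qed
  define u where "u = orbit L xs \<one>"
  have u: "u t \<in> carrier W" for t by (simp add: u_def)
  define good where "good = (%t. (\<forall>v\<in>N. action (u t) v = free_orbit xs v t) \<and> (\<forall>b\<in>M. nonneg (action (u t) b)))"
  have good: "good t" for t
  proof (induction t)
    case 0
    then show ?case using M(3) by (simp add: good_def u_def)
  next
    case (Suc t)
    let ?i = "xs ! (t mod length xs)"
    have step: "u (Suc t) = toggle L ?i (u t)" by (simp add: u_def)
    have "nonneg (action (u (Suc t)) b)" if "b \<in> M" for b
      unfolding step using that Suc M u by (intro toggle_stays_right) (auto simp: T T_def good_def)
    moreover have "action (u (Suc t)) v = free_orbit xs v (Suc t)" if v: "v \<in> N" for v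
    proof (cases "action (inv (u t)) (simple_root ?i) \<in> root_set L")
      case True
      define \<rho> where "\<rho> = action (inv (u t)) (simple_root ?i)"
      have "form \<rho> v = 0"
        using True Suc u v unfolding T T_def \<rho>_def[symmetric] good_def
        by (intro hits[of \<rho> "u t" t ?i v]) (auto simp: \<rho>_def)
      \<comment> \<open>The blocked toggle leaves the image of \<open>v\<close> in place, and by
        orthogonality the free reflection would do the same: the free orbit keeps describing
        \<open>N\<close>.\<close>
      then have "form (simple_root ?i) (action (u t) v) = 0"
        using form_action_inv[OF u, of t "simple_root ?i" v] by (simp add: \<rho>_def)
      then have "form (free_orbit xs v t) (simple_root ?i) = 0"
        using Suc v by (simp add: good_def form_sym[of "simple_root ?i"])
      moreover have "u (Suc t) = u t" using True by (simp add: step toggle_def)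
      ultimately show ?thesis using Suc v by (simp add: good_def reflection_def)
    next
      case False
      then show ?thesis using Suc u v by (simp add: step toggle_def good_def)
    qed
    ultimately show ?case by (simp add: good_def)
  qed
  \<comment> \<open>A null vector is fixed by the group. As all images of \<open>M\<close> stay
    positive, none of them can exceed its share of \<open>D\<close> in any coordinate.\<close>
  define D where "D = (\<Sum>b\<in>M. n b *\<^sub>R b)"
  have D: "action (u t) D = D" for t
  proof -
    obtain ys where "u t = word_prod W s ys" using u by (rule word_prod_surjE)
    then show ?thesis
      using n(2) by (auto simp: action_word_prod D_def intro!: foldr_reflection_fixes_orthogonal)
  qed
  have bound: "action (u t) b \<in> {\<beta> \<in> roots. \<forall>i. \<bar>\<beta> $ i\<bar> <= D $ i / n b}" if b: "b \<in> M" for t b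
  proof -
    have "action (u t) D = (\<Sum>b\<in>M. n b *\<^sub>R action (u t) b)"
      unfolding D_def using action_linear[OF u] by (simp add: linear_sum linear_scale)
    then have "D $ i = (\<Sum>b\<in>M. n b * action (u t) b $ i)" for i
      by (simp add: D)
    moreover have "n b * action (u t) b $ i <= (\<Sum>b\<in>M. n b * action (u t) b $ i)" for i
      using good[of t] M(1) b n(1) by (intro member_le_sum) (auto simp: good_def nonneg_def less_imp_le)
    ultimately have "n b * action (u t) b $ i <= D $ i" for i by simp
    then have "action (u t) b $ i <= D $ i / n b" for i
      using n(1)[OF b] by (simp add: field_simps)
    then show ?thesis
      using good[of t] b M(2) u by (auto simp: good_def nonneg_def)
  qed
  define S where "S = N \<union> M"
  define F where "F = (%v. if v \<in> N then range (free_orbit xs v) else {\<beta> \<in> roots. \<forall>i. \<bar>\<beta> $ i\<bar> <= D $ i / n v})"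
  have "finite (range u)"
  proof (rule finite_imageD)
    show "inj_on (%w. restrict (action w) S) (range u)"
    proof (rule inj_onI)
      fix a b assume ab: "a \<in> range u" "b \<in> range u" "restrict (action a) S = restrict (action b) S"
      have eq: "action a v = action b v" if "v \<in> S" for v
        using fun_cong[OF ab(3), of v] that by simp
      then show "a = b"
        using ab(1,2) u span eq by (intro action_eq_on_span[of a b S]) (auto simp: S_def)
    qed
    have "(%w. restrict (action w) S) ` range u \<subseteq> PiE S F"
    proof
      fix f assume "f \<in> (%w. restrict (action w) S) ` range u"
      then obtain t where f: "f = restrict (action (u t)) S" by blast
      have "action (u t) v \<in> F v" if "v \<in> S" for v
      proof (cases "v \<in> N")
        case True
        then show ?thesis using good[of t] by (simp add: F_def good_def)
      next
        case False
        then show ?thesis using bound[of v t] that by (simp add: F_def S_def)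
      qed
      then show "f \<in> PiE S F" unfolding f by simp
    qed
    moreover have "finite (PiE S F)"
      using N M(1) finite_bounded_roots[OF cryst] by (intro finite_PiE) (auto simp: S_def F_def)
    ultimately show "finite ((%w. restrict (action w) S) ` range u)" by (rule finite_subset)
  qed
  \<comment> \<open>Pigeonhole over complete rounds. The repeated point is periodic, although the
    starting point \<open>1\<close> itself may not be.\<close>
  then have "finite (range (%k. u (k * length xs)))"
    by (rule finite_subset[rotated]) auto
  then have "~ inj (%k. u (k * length xs))"
    using finite_imageD by blast
  then obtain k' l' where "k' ~= l'" "u (k' * length xs) = u (l' * length xs)"
    by (auto simp: inj_def)
  then obtain k l where kl: "k < l" "u (k * length xs) = u (l * length xs)"
    by (cases "k' < l'") (simp, metis linorder_neqE_nat)
  define w where "w = u (k * length xs)"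
  have "(fold (toggle L) xs ^^ (l - k)) w = w"
    using kl funpow_add[of "l - k" k "fold (toggle L) xs"] unfolding w_def u_def orbit_rounds by simp
  moreover have "w ~: L"
  proof
    assume "w \<in> L"
    moreover have "- \<gamma> \<in> T" using \<gamma> X by (auto simp: T_def)
    ultimately have "nonneg (action w (- \<gamma>))"
      unfolding T[symmetric] root_set_iff by blast
    moreover have "nonneg (action w \<gamma>)"
      using good[of "k * length xs"] \<gamma> by (simp add: w_def good_def)
    ultimately have "action w \<gamma> = 0" using u nonneg_antisym by (simp add: w_def)
    moreover have "action w \<gamma> \<in> roots" using \<gamma> u by (simp add: w_def)
    ultimately show False using root_nonzero by blast
  qed
  moreover have "w \<in> carrier W" by (simp add: w_def u)
  ultimately have "~ heavy_listing L xs"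
    unfolding heavy_listing_def using kl(1)
    by (metis Suc_leI One_nat_def zero_less_diff)
  moreover have "L ~= {}" using \<open>X \<subseteq> L\<close> X(2) by auto
  ultimately show ?thesis using convex by (intro exI[of _ L]) simp
qed

text \<open>Negative powers are translations along \<open>\<delta> - \<gamma>\<close>.\<close>

lemma int_translation_element:
  fixes k :: int
  assumes "\<gamma> \<in> roots" "\<delta> - \<gamma> \<in> roots" "!!v. form \<delta> v = 0"
  obtains t where "t \<in> carrier W" "!!v. action t v = v + (2 * real_of_int k * form v \<gamma>) *\<^sub>R \<delta>"
proof (cases "k >= 0")
  case True
  obtain t where "t \<in> carrier W" "!!v. action t v = v + (2 * real (nat k) * form v \<gamma>) *\<^sub>R \<delta>"
    by (rule translation_element[OF assms]) blast
  with True that show ?thesis by simp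
next
  case False
  have d: "form v \<delta> = 0" for v using assms(3) form_sym by metis
  obtain t where t: "t \<in> carrier W"
      "!!v. action t v = v + (2 * real (nat (- k)) * form v (\<delta> - \<gamma>)) *\<^sub>R \<delta>"
    by (rule translation_element[of "\<delta> - \<gamma>" \<delta> "nat (- k)"]) (use assms in auto)
  have "action t v = v + (2 * real_of_int k * form v \<gamma>) *\<^sub>R \<delta>" for v
    unfolding t(2) using False d by (simp add: form_linear)
  with that t(1) show ?thesis by blast
qed

section \<open>Hulls of translations\<close>

lemma nonneg_ray:
  assumes "\<delta> $ i > 0" "!!k :: nat. nonneg (\<rho> + (a + real k * b) *\<^sub>R \<delta>)"
  shows "b >= 0"
proof (rule ccontr)
  assume "~ b >= 0"
  obtain k :: nat where k: "real k > (\<rho> $ i + a * \<delta> $ i) / (- b * \<delta> $ i)"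
    using reals_Archimedean2 by blast
  have "- b * \<delta> $ i > 0" using \<open>~ b >= 0\<close> assms(1) by (simp add: mult_neg_pos)
  with k have "\<rho> $ i + a * \<delta> $ i < real k * (- b * \<delta> $ i)"
    by (simp only: pos_divide_less_eq)
  moreover have "0 <= \<rho> $ i + (a + real k * b) * \<delta> $ i"
    using assms(2)[of k] by (auto simp: nonneg_def)
  ultimately show False by (simp add: algebra_simps)
qed

text \<open>For unit vectors with product -1 the sum is isotropic, hence a multiple of the null
  vector.\<close>

lemma form_minus_1:
  assumes irr: is_irreducible and aff: is_affine and "\<rho> \<in> roots" "\<gamma> \<in> roots" "form \<rho> \<gamma> = -1"
    and "!!v. form \<delta> v = 0" "\<delta> ~= 0"
  obtains c where "\<rho> = c *\<^sub>R \<delta> - \<gamma>"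
proof -
  obtain \<delta>0 where \<delta>0: "!!v. form v v = 0 ==> \<exists>c. v = c *\<^sub>R \<delta>0"
    using null_vectorE[OF irr aff] by metis
  have "form (\<rho> + \<gamma>) (\<rho> + \<gamma>) = 0"
    using assms form_sym[of \<gamma> \<rho>] by (simp add: form_linear)
  then obtain a b where "\<rho> + \<gamma> = a *\<^sub>R \<delta>0" "\<delta> = b *\<^sub>R \<delta>0" using \<delta>0 assms(6) by metis
  then have "\<rho> = (a / b) *\<^sub>R \<delta> - \<gamma>" using assms(7) by (auto simp: eq_diff_eq)
  then show ?thesis by (rule that)
qed

text \<open>The assumption on products that is later called \<open>key\<close> is the outcome of a
  limit argument that depends on the pair of roots. Product -1 forces
  \<open>\<rho> = c \<delta> - \<gamma>1\<close>; if it became a simple root, that root and the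
  image of \<open>\<gamma>1\<close> would add up to a multiple of \<open>\<delta>\<close>, against
  \<open>nohit\<close>.\<close>

lemma trap_translations:
  assumes irr: is_irreducible and aff: is_affine and cryst: "crystallographic d" and xs: "xs ~= []"
    and \<gamma>: "\<gamma>1 \<in> roots" "\<gamma>2 \<in> roots" and cod: "\<delta> - \<gamma>1 \<in> roots" "\<delta> - \<gamma>2 \<in> roots"
    and key: "!!\<rho>. \<rho> \<in> roots ==> (!!(p :: int) (q :: int). 2 * real_of_int q - 2 * real_of_int p * form \<gamma>1 \<gamma>2 >= 1 ==>
        nonneg (\<rho> + (2 * real_of_int p * form \<rho> \<gamma>2 - 2 * real_of_int q * form \<rho> \<gamma>1) *\<^sub>R \<delta>)) ==>
      form \<rho> \<gamma>1 = 0 \<and> form \<rho> \<gamma>2 = 0 \<or> form \<rho> \<gamma>1 = - 1"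
    and \<delta>: "!!v. form \<delta> v = 0" "!!i. \<delta> $ i > 0" "nonneg (\<delta> - \<gamma>1)"
    and V: "\<gamma>1 \<in> V" "V \<subseteq> {\<gamma>1, \<gamma>2, \<delta> - \<gamma>1 - \<gamma>2}" "!!v. v \<in> V ==> finite (range (free_orbit xs v))"
    and pos: "!!t. nonneg (free_orbit xs \<gamma>1 t)"
    and nohit: "!!t i c. c *\<^sub>R \<delta> ~= simple_root i + free_orbit xs \<gamma>1 t"
    and M: "finite M" "M \<subseteq> roots" "!!b. b \<in> M ==> nonneg b"
      "!!b. b \<in> M ==> form b \<gamma>1 = 0 \<and> form b \<gamma>2 = 0"
    and n: "!!b. b \<in> M ==> n b > 0" "!!v. form (\<Sum>b\<in>M. n b *\<^sub>R b) v = 0"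
    and span: "!!i. simple_root i \<in> span (V \<union> M)"
  shows "\<exists>L. is_convex L \<and> L ~= {} \<and> ~ heavy_listing L xs"
proof -
  have d: "form v \<delta> = 0" for v using \<delta>(1) form_sym by metis
  have \<delta>0: "\<delta> ~= 0" using \<delta>(2) by (metis zero_index less_irrefl)
  \<comment> \<open>Products of translations along \<open>\<gamma>2\<close> and
    \<open>\<gamma>1\<close>. They move \<open>\<gamma>1\<close> by at least one
    \<open>\<delta>\<close> downwards, which makes it negative because
    \<open>\<delta> - \<gamma>1\<close> is positive.\<close>
  define X where "X = {x \<in> carrier W. \<exists>(p :: int) (q :: int). 2 * real_of_int q - 2 * real_of_int p * form \<gamma>1 \<gamma>2 >= 1 \<and>
    (\<forall>v. action x v = v + (2 * real_of_int p * form v \<gamma>2 - 2 * real_of_int q * form v \<gamma>1) *\<^sub>R \<delta>)}"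
  have XI: "\<exists>x\<in>X. \<forall>v. action x v = v + (2 * real_of_int p * form v \<gamma>2 - 2 * real_of_int q * form v \<gamma>1) *\<^sub>R \<delta>"
    if "2 * real_of_int q - 2 * real_of_int p * form \<gamma>1 \<gamma>2 >= 1" for p q :: int
  proof -
    obtain a where a: "a \<in> carrier W" "!!v. action a v = v + (2 * real_of_int p * form v \<gamma>2) *\<^sub>R \<delta>"
      using int_translation_element[OF \<gamma>(2) cod(2) \<delta>(1)] by blast
    obtain b where b: "b \<in> carrier W" "!!v. action b v = v + (2 * real_of_int (- q) * form v \<gamma>1) *\<^sub>R \<delta>"
      using int_translation_element[OF \<gamma>(1) cod(1) \<delta>(1)] by blast
    have "action (a \<otimes> b) v = v + (2 * real_of_int p * form v \<gamma>2 - 2 * real_of_int q * form v \<gamma>1) *\<^sub>R \<delta>" for v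
      using a b by (simp add: form_linear \<delta>(1) scaleR_left_diff_distrib)
    moreover from this have "a \<otimes> b \<in> X"
      unfolding X_def using that a(1) b(1) by (intro CollectI conjI exI[of _ p] exI[of _ q]) auto
    ultimately show ?thesis by blast
  qed
  show ?thesis
  proof (rule trap[of xs d X \<gamma>1 V M n])
    show "finite V" using V(2) by (rule finite_subset) simp
    show "X ~= {}" using XI[where p = 0 and q = 1] by auto
    show "nonneg (- action x \<gamma>1)" if "x \<in> X" for x
    proof -
      obtain p q :: int where pq: "2 * real_of_int q - 2 * real_of_int p * form \<gamma>1 \<gamma>2 >= 1"
          "\<forall>v. action x v = v + (2 * real_of_int p * form v \<gamma>2 - 2 * real_of_int q * form v \<gamma>1) *\<^sub>R \<delta>"
        using \<open>x \<in> X\<close> by (auto simp: X_def)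
      have "action x \<gamma>1 = \<gamma>1 + (2 * real_of_int p * form \<gamma>1 \<gamma>2 - 2 * real_of_int q * form \<gamma>1 \<gamma>1) *\<^sub>R \<delta>"
        using pq(2) by blast
      then have "- action x \<gamma>1 = (\<delta> - \<gamma>1) + (2 * real_of_int q - 2 * real_of_int p * form \<gamma>1 \<gamma>2 - 1) *\<^sub>R \<delta>"
        using \<gamma> by (simp add: algebra_simps)
      moreover have "nonneg \<delta>" using \<delta>(2) by (simp add: nonneg_def less_imp_le)
      then have "nonneg ((\<delta> - \<gamma>1) + (2 * real_of_int q - 2 * real_of_int p * form \<gamma>1 \<gamma>2 - 1) *\<^sub>R \<delta>)"
        using pq(1) \<delta>(3) by (intro nonneg_add nonneg_scaleR) auto
      ultimately show ?thesis by (simp only:)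
    qed
    show "nonneg (action x b)" if "b \<in> M" "x \<in> X" for b x
    proof -
      have "action x b = b" using that M(4) by (auto simp: X_def)
      then show ?thesis using that M(3) by simp
    qed
    fix \<rho> u t i v
    assume \<rho>: "\<rho> \<in> roots" "!!x. x \<in> X ==> nonneg (action x \<rho>)" and u: "u \<in> carrier W"
      "!!v. v \<in> V ==> action u v = free_orbit xs v t" "action u \<rho> = simple_root i" and v: "v \<in> V"
    have "form \<rho> \<gamma>1 = 0 \<and> form \<rho> \<gamma>2 = 0 \<or> form \<rho> \<gamma>1 = - 1"
    proof (rule key[OF \<rho>(1)])
      show "nonneg (\<rho> + (2 * real_of_int p * form \<rho> \<gamma>2 - 2 * real_of_int q * form \<rho> \<gamma>1) *\<^sub>R \<delta>)"
        if "2 * real_of_int q - 2 * real_of_int p * form \<gamma>1 \<gamma>2 >= 1" for p q :: int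
        using XI[OF that] \<rho>(2) by metis
    qed
    then show "form \<rho> v = 0"
    proof
      assume "form \<rho> \<gamma>1 = 0 \<and> form \<rho> \<gamma>2 = 0"
      then show ?thesis using v V(2) d[of \<rho>] by (auto simp: form_linear)
    next
      assume "form \<rho> \<gamma>1 = - 1"
      then obtain c where c: "\<rho> = c *\<^sub>R \<delta> - \<gamma>1"
        using form_minus_1[OF irr aff \<rho>(1) \<gamma>(1) _ \<delta>(1) \<delta>0] by blast
      obtain ys where ys: "u = word_prod W s ys" using u(1) by (rule word_prod_surjE)
      have "action u \<delta> = \<delta>"
        unfolding ys action_word_prod using \<delta>(1) by (intro foldr_reflection_fixes_orthogonal)
      then have "simple_root i = c *\<^sub>R \<delta> - free_orbit xs \<gamma>1 t"
        using u(1) u(2)[OF V(1)] u(3) c by simp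
      then show ?thesis using nohit[of c i t] by (simp add: eq_diff_eq)
    qed
  qed (use assms in \<open>auto simp: X_def\<close>)
qed

text \<open>The case of three roots permuted cyclically by a round, whose sum is null. Their finite
  parts behave like the simple roots and the negative highest root of A2.\<close>

lemma trap_A2:
  assumes irr: is_irreducible and aff: is_affine and cryst: "crystallographic d" and xs: "xs ~= []"
    and \<gamma>: "\<gamma>1 \<in> roots" "\<gamma>2 \<in> roots" "\<gamma>3 \<in> roots" "form \<gamma>1 \<gamma>2 = - 1 / 2"
    and \<delta>: "\<delta> = \<gamma>1 + \<gamma>2 + \<gamma>3" "!!v. form \<delta> v = 0" "!!i. \<delta> $ i > 0" "nonneg (\<delta> - \<gamma>1)"
    and cyc: "fold reflection xs \<gamma>1 = \<gamma>2" "fold reflection xs \<gamma>2 = \<gamma>3" "fold reflection xs \<gamma>3 = \<gamma>1"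
    and pos: "!!t. nonneg (free_orbit xs \<gamma>1 t)"
    and nohit: "!!t i c. c *\<^sub>R \<delta> ~= simple_root i + free_orbit xs \<gamma>1 t"
    and M: "finite M" "M \<subseteq> roots" "!!b. b \<in> M ==> nonneg b"
      "!!b. b \<in> M ==> form b \<gamma>1 = 0 \<and> form b \<gamma>2 = 0"
    and n: "!!b. b \<in> M ==> n b > 0" "!!v. form (\<Sum>b\<in>M. n b *\<^sub>R b) v = 0"
    and span: "!!i. simple_root i \<in> span ({\<gamma>1, \<gamma>2, \<gamma>3} \<union> M)"
  shows "\<exists>L. is_convex L \<and> L ~= {} \<and> ~ heavy_listing L xs"
proof -
  have psd: "form x x >= 0" for x using aff by (simp add: is_affine_def)
  have d: "form v \<delta> = 0" for v using \<delta>(2) form_sym by metis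
  have g13: "form \<gamma>1 \<gamma>3 = - 1 / 2" and g23: "form \<gamma>2 \<gamma>3 = - 1 / 2"
    using d[of \<gamma>1] d[of \<gamma>2] \<gamma> form_sym[of \<gamma>2 \<gamma>1] by (simp_all add: \<delta>(1) form_linear)
  have sum_root: "\<beta> + \<gamma> \<in> roots" if "\<beta> \<in> roots" "\<gamma> \<in> roots" "form \<beta> \<gamma> = - 1 / 2" for \<beta> \<gamma>
  proof -
    obtain t where "t \<in> carrier W" "!!v. action t v = v - (2 * form v \<gamma>) *\<^sub>R \<gamma>"
      using reflection_element[OF \<open>\<gamma> \<in> roots\<close>] by blast
    then show ?thesis using action_roots[of t \<beta>] that by simp
  qed
  have cod: "\<delta> - \<gamma>1 \<in> roots" "\<delta> - \<gamma>2 \<in> roots"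
    using sum_root[OF \<gamma>(2,3) g23] sum_root[OF \<gamma>(1,3) g13] by (simp_all add: \<delta>(1) algebra_simps)
  have key: "form \<rho> \<gamma>1 = 0 \<and> form \<rho> \<gamma>2 = 0 \<or> form \<rho> \<gamma>1 = - 1"
    if \<rho>: "\<rho> \<in> roots" "!!(p :: int) (q :: int). 2 * real_of_int q - 2 * real_of_int p * form \<gamma>1 \<gamma>2 >= 1 ==>
        nonneg (\<rho> + (2 * real_of_int p * form \<rho> \<gamma>2 - 2 * real_of_int q * form \<rho> \<gamma>1) *\<^sub>R \<delta>)" for \<rho>
  proof -
    define y z where "y = form \<rho> \<gamma>1" and "z = form \<rho> \<gamma>2"
    have nn: "nonneg (\<rho> + (2 * p * z - 2 * q * y) *\<^sub>R \<delta>)" if "p + 2 * q >= 1" for p q :: int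
      using \<rho>(2)[of q p] that \<gamma>(4) by (simp add: y_def z_def)
    \<comment> \<open>The pairs \<open>(p, q)\<close> run along the line \<open>p + 2 q = 1\<close>
      in both directions. On it the translations act equally on \<open>\<gamma>1\<close>, and the
      growth rate of \<open>\<rho>\<close> must vanish.\<close>
    have "0 <= 4 * z + 2 * y"
    by (rule nonneg_ray[of \<delta> undefined \<rho> "2 * z"])
        (use nn[of "1 + 2 * int k" "- int k" for k :: nat] in \<open>simp_all add: algebra_simps \<delta>(3)\<close>)
    moreover have "0 <= - (4 * z + 2 * y)"
    by (rule nonneg_ray[of \<delta> undefined \<rho> "2 * z"])
        (use nn[of "1 - 2 * int k" "int k" for k :: nat] in \<open>simp_all add: algebra_simps \<delta>(3)\<close>)
    ultimately have yz: "y = - 2 * z" by simp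
    \<comment> \<open>Now a ray that leads into the half plane of admissible pairs.\<close>
    have "0 <= 2 * z"
    by (rule nonneg_ray[of \<delta> undefined \<rho> "2 * z"])
        (use nn[of "1 + int k" 0 for k :: nat] in \<open>simp_all add: algebra_simps \<delta>(3)\<close>)
    \<comment> \<open>Integrality leaves \<open>z = 0\<close> and \<open>z = 1/2\<close>, that is,
      \<open>y = 0\<close> and \<open>y = -1\<close>.\<close>
    have "4 * z\<^sup>2 \<in> \<int>"
      unfolding z_def using crystallographic_form[OF cryst] \<rho> \<gamma> by simp
    then obtain k where k: "4 * z\<^sup>2 = real_of_int k" by (auto elim: Ints_cases)
    have "\<bar>y\<bar> <= 1" unfolding y_def by (intro psd_root_bound psd \<rho> \<gamma>)
    then have "(2 * z)\<^sup>2 <= 1" using yz unfolding abs_square_le_1 by simp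
    then have "k <= 1" "k >= 0" using k by (simp_all add: power2_eq_square) (smt (verit) zero_le_square of_int_0_le_iff)
    then consider "k = 0" | "k = 1" by linarith
    then show ?thesis
    proof cases
      case 1
      then show ?thesis using k yz by (simp add: y_def z_def)
    next
      case 2
      then have "(2 * z)\<^sup>2 = 1" using k by (simp add: power2_eq_square)
      then have "2 * z = 1" using \<open>0 <= 2 * z\<close> power2_eq_imp_eq[of "2 * z" 1] by simp
      then show ?thesis using yz by (simp add: y_def)
    qed
  qed
  show ?thesis
  proof (rule trap_translations[OF irr aff cryst xs \<gamma>(1,2) cod key, where V = "{\<gamma>1, \<gamma>2, \<gamma>3}" and M = M and n = n])
    show "finite (range (free_orbit xs v))" if "v \<in> {\<gamma>1, \<gamma>2, \<gamma>3}" for v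
      by (rule finite_range_free_orbit[where P = 3]) (use that cyc xs in \<open>auto simp: numeral_3_eq_3\<close>)
  qed (use assms in \<open>auto simp: \<delta>(1)\<close>)
qed

text \<open>Two orthogonal roots, each exchanged with its complement in \<open>\<delta>\<close> by a
  round. Translations along \<open>\<gamma>2\<close> do not affect \<open>\<gamma>1\<close> and are
  unrestricted, which makes the product with \<open>\<gamma>2\<close> zero; \<open>parity\<close>
  then excludes the product -1/2 with \<open>\<gamma>1\<close>.\<close>

lemma trap_A1A1:
  assumes irr: is_irreducible and aff: is_affine and cryst: "crystallographic d" and xs: "xs ~= []"
    and \<gamma>: "\<gamma>1 \<in> roots" "\<gamma>2 \<in> roots" "\<delta> - \<gamma>1 \<in> roots" "\<delta> - \<gamma>2 \<in> roots" "form \<gamma>1 \<gamma>2 = 0"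
    and parity: "!!\<rho>. \<rho> \<in> roots ==> form \<rho> \<gamma>1 + form \<rho> \<gamma>2 \<in> \<int>"
    and \<delta>: "!!v. form \<delta> v = 0" "!!i. \<delta> $ i > 0" "nonneg (\<delta> - \<gamma>1)"
    and cyc: "fold reflection xs \<gamma>1 = \<delta> - \<gamma>1" "fold reflection xs \<gamma>2 = \<delta> - \<gamma>2"
    and pos: "!!t. nonneg (free_orbit xs \<gamma>1 t)"
    and nohit: "!!t i c. c *\<^sub>R \<delta> ~= simple_root i + free_orbit xs \<gamma>1 t"
    and M: "finite M" "M \<subseteq> roots" "!!b. b \<in> M ==> nonneg b"
      "!!b. b \<in> M ==> form b \<gamma>1 = 0 \<and> form b \<gamma>2 = 0"
    and n: "!!b. b \<in> M ==> n b > 0" "!!v. form (\<Sum>b\<in>M. n b *\<^sub>R b) v = 0"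
    and span: "!!i. simple_root i \<in> span ({\<gamma>1, \<gamma>2} \<union> M)"
  shows "\<exists>L. is_convex L \<and> L ~= {} \<and> ~ heavy_listing L xs"
proof -
  have psd: "form x x >= 0" for x using aff by (simp add: is_affine_def)
  have key: "form \<rho> \<gamma>1 = 0 \<and> form \<rho> \<gamma>2 = 0 \<or> form \<rho> \<gamma>1 = - 1"
    if \<rho>: "\<rho> \<in> roots" "!!(p :: int) (q :: int). 2 * real_of_int q - 2 * real_of_int p * form \<gamma>1 \<gamma>2 >= 1 ==>
        nonneg (\<rho> + (2 * real_of_int p * form \<rho> \<gamma>2 - 2 * real_of_int q * form \<rho> \<gamma>1) *\<^sub>R \<delta>)" for \<rho>
  proof -
    define y z where "y = form \<rho> \<gamma>1" and "z = form \<rho> \<gamma>2"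
    have nn: "nonneg (\<rho> + (2 * p * z - 2 * q * y) *\<^sub>R \<delta>)" if "q >= 1" for p q :: int
      using \<rho>(2)[of q p] that \<gamma>(5) by (simp add: y_def z_def)
    have "0 <= 2 * z"
    by (rule nonneg_ray[of \<delta> undefined \<rho> "- 2 * y"])
        (use nn[of 1 "int k" for k :: nat] in \<open>simp_all add: algebra_simps \<delta>(2)\<close>)
    moreover have "0 <= - 2 * z"
    by (rule nonneg_ray[of \<delta> undefined \<rho> "- 2 * y"])
        (use nn[of 1 "- int k" for k :: nat] in \<open>simp_all add: algebra_simps \<delta>(2)\<close>)
    ultimately have z: "z = 0" by simp
    have "0 <= - 2 * y"
    by (rule nonneg_ray[of \<delta> undefined \<rho> "- 2 * y"])
        (use nn[of "1 + int k" 0 for k :: nat] z in \<open>simp_all add: algebra_simps \<delta>(2)\<close>)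
    moreover have "\<bar>y\<bar> <= 1" unfolding y_def by (intro psd_root_bound psd \<rho> \<gamma>)
    moreover obtain k where "y = real_of_int k"
      using parity[OF \<rho>(1)] z by (auto simp: y_def z_def elim: Ints_cases)
    ultimately have "k = 0 \<or> k = -1" by auto
    then show ?thesis using z \<open>y = real_of_int k\<close> by (auto simp: y_def z_def)
  qed
  have twice: "fold reflection xs (\<delta> - \<gamma>) = \<delta> - fold reflection xs \<gamma>" for \<gamma>
  proof -
    have "foldr reflection (rev xs) \<delta> = \<delta>" using \<delta>(1) by (intro foldr_reflection_fixes_orthogonal)
    then have "action (word_prod W s (rev xs)) (\<delta> - \<gamma>) = \<delta> - action (word_prod W s (rev xs)) \<gamma>"
      by (simp flip: action_word_prod)
    then show ?thesis by (simp add: action_word_prod foldr_conv_fold)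
  qed
  show ?thesis
  proof (rule trap_translations[OF irr aff cryst xs \<gamma>(1-4) key, where V = "{\<gamma>1, \<gamma>2}" and M = M and n = n])
    show "finite (range (free_orbit xs v))" if "v \<in> {\<gamma>1, \<gamma>2}" for v
      by (rule finite_range_free_orbit[where P = 2]) (use that cyc xs twice in \<open>auto simp: numeral_2_eq_2\<close>)
  qed (use assms in auto)
qed

end

section \<open>Certified traps for the exceptional types\<close>

definition dot_list :: "int list => int list => int" where
  "dot_list v w = sum_list (map2 (*) v w)"

text \<open>In rescaled simple roots the reflection is integral: it subtracts the row
  \<open>b\<close> of the Cartan matrix, applied to the vector, from one coordinate.\<close>

definition reflect_list :: "int list list => nat => int list => int list" where
  "reflect_list A b v = v[b := v ! b - dot_list (A ! b) v]"

definition unit_list :: "nat => nat => int list" where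
  "unit_list n b = (replicate n 0)[b := 1]"

definition form_list :: "int list list => int list => int list => int list => int" where
  "form_list A D v w = dot_list (map2 (*) w D) (map (%r. dot_list r v) A)"

definition combine_list :: "nat => int list => int list list => int list" where
  "combine_list n cs vs = foldr (%(c, v) w. map2 (+) (map ((*) c) v) w) (zip cs vs) (replicate n 0)"

fun elimination_list :: "int list list => nat list => bool" where
  "elimination_list A [] \<longleftrightarrow> True"
| "elimination_list A (v # vs) \<longleftrightarrow> elimination_list A vs \<and> length (filter (%w. A ! v ! w ~= 0) vs) <= 1"

text \<open>\<open>x\<close> and \<open>y\<close> are the two Cartan integers of simple roots of squared lengths \<open>p\<close> and \<open>q\<close> with
  \<open>m = k\<close>.\<close>

definition cartan_entry :: "nat => int => int => int => int => bool" where
  "cartan_entry k x y p q \<longleftrightarrow>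
    k = 2 \<and> x = 0 \<and> y = 0 \<or> k = 3 \<and> x = -1 \<and> y = -1 \<and> p = q \<or>
    k = 4 \<and> (x = -1 \<and> y = -2 \<and> p = 2 * q \<or> x = -2 \<and> y = -1 \<and> q = 2 * p) \<or>
    k = 6 \<and> (x = -1 \<and> y = -3 \<and> p = 3 * q \<or> x = -3 \<and> y = -1 \<and> q = 3 * p)"

definition cartan_check :: "(nat => nat => nat) => int list list => int list => bool" where
  "cartan_check M A D \<longleftrightarrow>
    length D = length A \<and> list_all (%r. length r = length A) A \<and> list_all (%x. x > 0) D \<and>
    list_all (%b. A ! b ! b = 2 \<and>
      list_all (%a. cartan_entry (M a b) (A ! a ! b) (A ! b ! a) (D ! a) (D ! b)) [0..<b]) [0..<length A]"

lemma dot_list_nth: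
  assumes "length v = n" "length w = n"
  shows "dot_list v w = (\<Sum>a<n. v ! a * w ! a)"
  using assms by (simp add: dot_list_def sum_list_sum_nth atLeast0LessThan)

lemma length_reflect_list [simp]: "length (reflect_list A b v) = length v"
  by (simp add: reflect_list_def)

lemma length_fold_reflect_list [simp]: "length (fold (reflect_list A) bs v) = length v"
  by (induction bs arbitrary: v) auto

lemma length_foldr_reflect_list [simp]: "length (foldr (reflect_list A) bs v) = length v"
  by (induction bs) auto

lemma length_unit_list [simp]: "length (unit_list n b) = n"
  by (simp add: unit_list_def)

context coxeter_system
begin

text \<open>Integer lists are coordinates with respect to simple roots rescaled to squared length
  \<open>D\<close>; \<open>form_list\<close> is then twice the form.\<close>

definition list_vector :: "('i => nat) => int list => int list => real ^ 'i" where
  "list_vector idx D v = (\<chi> i. of_int (v ! idx i) * sqrt (of_int (D ! idx i)))"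

definition cartan_matrix :: "('i => nat) => int list list => int list => bool" where
  "cartan_matrix idx A D \<longleftrightarrow> bij_betw idx UNIV {..<length A} \<and> length D = length A \<and>
    (\<forall>r\<in>set A. length r = length A) \<and> (\<forall>x\<in>set D. x > 0) \<and>
    (\<forall>i j. 2 * form_entry i j * sqrt (of_int (D ! idx j)) = of_int (A ! idx i ! idx j) * sqrt (of_int (D ! idx i)))"

lemma has_coxeter_matrixE:
  assumes "has_coxeter_matrix n M"
  obtains f where "bij_betw f {..n} UNIV" "!!a b. a < b ==> b <= n ==> m (f a) (f b) = M a b"
  using assms unfolding has_coxeter_matrix_def by (auto simp: atLeast0AtMost)

lemma form_entry_values:
  "m i j = 3 ==> 2 * form_entry i j = - 1"
  "m i j = 4 ==> 2 * form_entry i j = - sqrt 2"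
  "m i j = 6 ==> 2 * form_entry i j = - sqrt 3"
  by (simp_all add: form_entry_def cos_60 cos_45 cos_30)

lemma cartan_matrixI:
  assumes M: "has_coxeter_matrix n M" and check: "cartan_check M A D" and n: "length A = Suc n"
  obtains idx where "cartan_matrix idx A D"
proof -
  obtain f where f: "bij_betw f {..n} UNIV" "!!a b. a < b ==> b <= n ==> m (f a) (f b) = M a b"
    using has_coxeter_matrixE[OF M] by blast
  define idx where "idx = inv_into {..n} f"
  have bij: "bij_betw idx UNIV {..n}" unfolding idx_def by (rule bij_betw_inv_into[OF f(1)])
  have f_idx: "f (idx i) = i" and idx_le: "idx i <= n" for i
    using f(1) bij unfolding idx_def by (auto simp: bij_betw_def f_inv_into_f inv_into_into)
  have len: "length D = length A" "\<forall>r\<in>set A. length r = length A" "\<forall>x\<in>set D. x > 0"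
    using check by (auto simp: cartan_check_def list_all_iff)
  have D: "D ! a > 0" if "a <= n" for a using len n that by simp
  have chk: "cartan_entry (M a b) (A ! a ! b) (A ! b ! a) (D ! a) (D ! b)" if "a < b" "b < length A" for a b
    using check that by (auto simp: cartan_check_def list_all_iff)
  have diag: "A ! b ! b = 2" if "b < length A" for b
    using check that by (auto simp: cartan_check_def list_all_iff)
  have entry: "2 * form_entry i j * sqrt (of_int (D ! idx j)) = of_int (A ! idx i ! idx j) * sqrt (of_int (D ! idx i)) \<and>
      2 * form_entry i j * sqrt (of_int (D ! idx i)) = of_int (A ! idx j ! idx i) * sqrt (of_int (D ! idx j))"
    if "idx i < idx j" for i j
  proof -
    have "cartan_entry (m i j) (A ! idx i ! idx j) (A ! idx j ! idx i) (D ! idx i) (D ! idx j)"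
      using chk[OF that] idx_le[of j] f(2)[OF that] n by (simp add: f_idx)
    then show ?thesis
      using D[OF idx_le[of i]] D[OF idx_le[of j]] form_entry_values[of i j]
      by (auto simp: cartan_entry_def real_sqrt_mult)
  qed
  have "2 * form_entry i j * sqrt (of_int (D ! idx j)) = of_int (A ! idx i ! idx j) * sqrt (of_int (D ! idx i))" for i j
  proof -
    consider "idx i < idx j" | "idx j < idx i" | "idx i = idx j" by linarith
    then show ?thesis
    proof cases
      case 3
      then have "i = j" using bij by (auto simp: bij_betw_def inj_on_def)
      moreover have "A ! idx i ! idx i = 2"
        using diag idx_le[of i] n by simp
      ultimately show ?thesis by simp
    qed (use entry form_entry_sym in \<open>metis+\<close>)
  qed
  then have "cartan_matrix idx A D"
    using bij len n by (simp add: cartan_matrix_def lessThan_Suc_atMost)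
  then show ?thesis by (rule that)
qed

context
  fixes idx A D
  assumes cm: "cartan_matrix idx A D"
begin

lemma cm_bij: "bij_betw idx UNIV {..<length A}"
  and cm_lengths: "length D = length A" "!!r. r \<in> set A ==> length r = length A"
  and cm_D_pos: "!!x. x \<in> set D ==> x > 0"
  and cm_entry: "2 * form_entry i j * sqrt (of_int (D ! idx j)) = of_int (A ! idx i ! idx j) * sqrt (of_int (D ! idx i))"
  using cm by (auto simp: cartan_matrix_def)

lemma cm_idx_less [simp]: "idx i < length A"
  using cm_bij by (auto simp: bij_betw_def)

lemma cm_idx_eq [simp]: "idx i = idx j \<longleftrightarrow> i = j"
  using cm_bij by (auto simp: bij_betw_def inj_on_def)

lemma cm_row [simp]: "b < length A ==> length (A ! b) = length A"
  using cm_lengths by simp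

lemma cm_D [simp]: "b < length A ==> D ! b > 0"
  using cm_D_pos cm_lengths by simp

lemma cm_D_nonzero [simp]: "b < length A ==> D ! b ~= 0"
  by (metis cm_D less_irrefl)

lemma cm_sum: "(\<Sum>i\<in>UNIV. g (idx i)) = (\<Sum>a<length A. g a)"
  by (rule sum.reindex_bij_betw[OF cm_bij])

lemma cm_unidx:
  assumes "b < length A" obtains i where "idx i = b"
  using assms cm_bij by (auto simp: bij_betw_def image_iff dest!: equalityD2 subsetD[of _ _ b])

lemma cm_crystallographic: "crystallographic (%i. sqrt (of_int (D ! idx i)))"
proof -
  have "2 * form_entry i j * sqrt (of_int (D ! idx j)) / sqrt (of_int (D ! idx i)) = of_int (A ! idx i ! idx j)" for i j
    unfolding cm_entry using cm_D[OF cm_idx_less[of i]] by simp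
  then show ?thesis by (auto simp: crystallographic_def)
qed

lemma form_list_vector_simple:
  assumes "length v = length A"
  shows "2 * form (list_vector idx D v) (simple_root i) = of_int (dot_list (A ! idx i) v) * sqrt (of_int (D ! idx i))"
proof -
  have "2 * form (list_vector idx D v) (simple_root i) =
      (\<Sum>j\<in>UNIV. of_int (v ! idx j) * (2 * form_entry i j * sqrt (of_int (D ! idx j))))"
    unfolding form_simple_right sum_distrib_left
    by (rule sum.cong) (auto simp: list_vector_def form_entry_sym[of _ i])
  also have "... = (\<Sum>j\<in>UNIV. of_int (A ! idx i ! idx j * v ! idx j) * sqrt (of_int (D ! idx i)))"
    unfolding cm_entry by (simp add: mult_ac)
  also have "... = (\<Sum>a<length A. of_int (A ! idx i ! a * v ! a) * sqrt (of_int (D ! idx i)))"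
    by (rule cm_sum)
  also have "... = of_int (dot_list (A ! idx i) v) * sqrt (of_int (D ! idx i))"
    using assms by (simp add: dot_list_nth[where n = "length A"] sum_distrib_right)
  finally show ?thesis .
qed

lemma reflection_list_vector:
  assumes "length v = length A"
  shows "reflection i (list_vector idx D v) = list_vector idx D (reflect_list A (idx i) v)"
proof -
  have "reflection i (list_vector idx D v) $ j = list_vector idx D (reflect_list A (idx i) v) $ j" for j
    using assms unfolding reflection_nth form_list_vector_simple[OF assms]
    by (auto simp: list_vector_def reflect_list_def algebra_simps)
  then show ?thesis by (simp add: vec_eq_iff)
qed

lemma form_list_vector:
  assumes "length v = length A" "length w = length A"
  shows "2 * form (list_vector idx D v) (list_vector idx D w) = of_int (form_list A D v w)"
proof -
  have w: "list_vector idx D w = (\<Sum>i\<in>UNIV. (of_int (w ! idx i) * sqrt (of_int (D ! idx i))) *\<^sub>R simple_root i)"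
    by (simp add: list_vector_def vec_eq_iff simple_root_nth if_distrib cong: if_cong)
  have "2 * form (list_vector idx D v) (list_vector idx D w) =
      (\<Sum>i\<in>UNIV. of_int (w ! idx i) * sqrt (of_int (D ! idx i)) * (2 * form (list_vector idx D v) (simple_root i)))"
    unfolding w form_sum_right form_scaleR_right sum_distrib_left by (simp add: mult_ac)
  also have "... = (\<Sum>i\<in>UNIV. of_int (w ! idx i * D ! idx i * dot_list (A ! idx i) v))"
    unfolding form_list_vector_simple[OF assms(1)]
    using cm_D[OF cm_idx_less] by (intro sum.cong) (auto simp: less_imp_le)
  also have "... = (\<Sum>a<length A. of_int (w ! a * D ! a * dot_list (A ! a) v))"
    by (rule cm_sum)
  also have "... = of_int (form_list A D v w)"
    unfolding form_list_def using assms cm_lengths by (subst dot_list_nth[where n = "length A"]) auto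
  finally show ?thesis .
qed

lemma list_vector_unit: "list_vector idx D (unit_list (length A) (idx i)) = sqrt (of_int (D ! idx i)) *\<^sub>R simple_root i"
  by (auto simp: list_vector_def vec_eq_iff simple_root_nth unit_list_def nth_list_update)

lemma list_vector_add:
  assumes "length v = length A" "length w = length A"
  shows "list_vector idx D (map2 (+) v w) = list_vector idx D v + list_vector idx D w"
  using assms by (simp add: list_vector_def vec_eq_iff algebra_simps)

lemma list_vector_scale:
  assumes "length v = length A"
  shows "list_vector idx D (map ((*) c) v) = of_int c *\<^sub>R list_vector idx D v"
  using assms by (simp add: list_vector_def vec_eq_iff algebra_simps)

lemma list_vector_zero: "list_vector idx D (replicate (length A) 0) = 0"
  by (simp add: list_vector_def vec_eq_iff)

lemma length_combine_list:
  "\<forall>v\<in>set vs. length v = length A ==> length (combine_list (length A) cs vs) = length A"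
proof (induction vs arbitrary: cs)
  case (Cons v vs)
  then show ?case by (cases cs) (auto simp: combine_list_def)
qed (simp add: combine_list_def)

lemma list_vector_combine:
  assumes "\<forall>v\<in>set vs. length v = length A" "length cs = length vs"
  shows "list_vector idx D (combine_list (length A) cs vs) =
    (\<Sum>k<length vs. of_int (cs ! k) *\<^sub>R list_vector idx D (vs ! k))"
  using assms
proof (induction vs arbitrary: cs)
  case Nil
  then show ?case by (simp add: combine_list_def list_vector_zero)
next
  case (Cons v vs)
  then obtain c cs' where cs: "cs = c # cs'" by (cases cs) auto
  have "combine_list (length A) cs (v # vs) = map2 (+) (map ((*) c) v) (combine_list (length A) cs' vs)"
    by (simp add: cs combine_list_def)
  then show ?case
    using Cons length_combine_list[of vs cs']
    by (simp add: cs list_vector_add list_vector_scale lessThan_Suc_eq_insert_0 sum.reindex)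
qed

lemma list_vector_nonneg:
  assumes "length v = length A" "list_all (%x. x >= 0) v"
  shows "nonneg (list_vector idx D v)"
proof -
  have "v ! idx i >= 0" for i using assms by (simp add: list_all_length)
  then show ?thesis using cm_D[OF cm_idx_less] by (simp add: nonneg_def list_vector_def less_imp_le)
qed

lemma list_vector_null:
  assumes "length v = length A" "list_all (%r. dot_list r v = 0) A"
  shows "form (list_vector idx D v) w = 0"
proof -
  have "form (list_vector idx D v) (simple_root i) = 0" for i
    using form_list_vector_simple[OF assms(1), of i] assms(2) by (simp add: list_all_length)
  then have "form (list_vector idx D v) (\<Sum>i\<in>UNIV. w $ i *\<^sub>R simple_root i) = 0"
    unfolding form_sum_right by (simp add: form_linear)
  moreover have "(\<Sum>i\<in>UNIV. w $ i *\<^sub>R simple_root i) = w"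
    by (simp add: vec_eq_iff simple_root_nth if_distrib cong: if_cong)
  ultimately show ?thesis by simp
qed

text \<open>Roots are unit vectors here, while the list describes a vector of squared length
  \<open>D ! b\<close>; hence the factor.\<close>

lemma foldr_reflect_list_root:
  assumes "b < length A" "list_all (%b. b < length A) bs"
  shows "(1 / sqrt (of_int (D ! b))) *\<^sub>R list_vector idx D (foldr (reflect_list A) bs (unit_list (length A) b)) \<in> roots"
  using assms(2)
proof (induction bs)
  case Nil
  obtain i where i: "idx i = b" using cm_unidx[OF assms(1)] .
  then show ?case using list_vector_unit[of i] cm_D[OF assms(1)] by simp
next
  case (Cons c bs)
  obtain i where i: "idx i = c" using cm_unidx[of c] Cons.prems by auto
  let ?v = "foldr (reflect_list A) bs (unit_list (length A) b)"
  have "reflection i ((1 / sqrt (of_int (D ! b))) *\<^sub>R list_vector idx D ?v) \<in> roots"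
    using Cons by (intro reflection_roots) auto
  moreover have "reflection i (list_vector idx D ?v) = list_vector idx D (reflect_list A c ?v)"
    using reflection_list_vector[of ?v i] i by simp
  ultimately show ?case
    using linear_scale[OF reflection_linear] by simp
qed

definition listing_of :: "nat list => 'i list" where
  "listing_of bs = map (inv_into UNIV idx) bs"

lemma idx_inv: "b < length A ==> idx (inv_into UNIV idx b) = b"
  using cm_unidx f_inv_into_f by (metis UNIV_I image_eqI)

lemma inv_idx: "inv_into UNIV idx (idx i) = i"
  using cm_bij by (simp add: bij_betw_def)

lemma fold_reflect_list:
  assumes "length v = length A" "\<forall>b\<in>set bs. b < length A"
  shows "fold reflection (listing_of bs) (list_vector idx D v) = list_vector idx D (fold (reflect_list A) bs v)"
  using assms
proof (induction bs arbitrary: v)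
  case (Cons b bs)
  then show ?case
    using reflection_list_vector[of v "inv_into UNIV idx b"] Cons.IH[of "reflect_list A b v"]
    by (simp add: listing_of_def idx_inv)
qed (simp add: listing_of_def)

lemma listing_of_distinct: "distinct bs ==> \<forall>b\<in>set bs. b < length A ==> distinct (listing_of bs)"
  unfolding listing_of_def distinct_map by (auto intro!: inj_onI) (metis idx_inv)

lemma listing_of_set: "set bs = {..<length A} ==> set (listing_of bs) = UNIV"
proof -
  assume bs: "set bs = {..<length A}"
  have "i \<in> set (listing_of bs)" for i
    using bs image_eqI[of i "inv_into UNIV idx" "idx i" "set bs"] by (simp add: listing_of_def inv_idx)
  then show ?thesis by auto
qed

lemma elimination_list_order:
  assumes "elimination_list A bs" "\<forall>b\<in>set bs. b < length A" "distinct bs"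
  shows "elimination_order (listing_of bs)"
  using assms
proof (induction bs)
  case (Cons v vs)
  let ?g = "inv_into UNIV idx" and ?F = "filter (%w. A ! v ! w ~= 0) vs"
  have "length ?F <= 1" using Cons.prems by simp
  then obtain p where p: "set ?F \<subseteq> {p}"
    by (cases ?F; cases "tl ?F") auto
  have "m (?g v) (?g w) = 2" if "w \<in> set vs" "?g w ~= ?g p" for w
  proof (rule not_edge_m_2)
    have vw: "v < length A" "w < length A" "v ~= w" using Cons.prems that by auto
    then show "?g v ~= ?g w" using idx_inv by metis
    have "A ! v ! w = 0" using p that by auto
    then have "form_entry (?g v) (?g w) = 0"
      using cm_entry[of "?g v" "?g w"] vw cm_D[of w] by (simp add: idx_inv)
    then show "(?g v, ?g w) ~: coxeter_graph" using form_entry_edge by fastforce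
  qed
  then show ?case
    using Cons by (auto simp: listing_of_def intro!: exI[of _ "?g p"])
qed (simp add: listing_of_def)

end

end

text \<open>A root is certified by a simple root and a word that is applied to it.\<close>

definition root_list :: "int list list => nat list \<times> nat => int list" where
  "root_list A = (%(w, b). foldr (reflect_list A) w (unit_list (length A) b))"

definition valid_root_list :: "int list list => int list => int => nat list \<times> nat => bool" where
  "valid_root_list A D e = (%(w, b). b < length A \<and> D ! b = e \<and> list_all (%c. c < length A) w)"

text \<open>Adding any multiple of a simple root to \<open>q\<close> alters only one coordinate
  \<open>i\<close>. Two other coordinates with different ratios of \<open>q\<close> and
  \<open>\<delta>\<close> therefore show that the result is no multiple of
  \<open>\<delta>\<close>.\<close>

definition not_near_null :: "nat => int list => int list => bool" where
  "not_near_null N \<delta> q \<longleftrightarrow> list_all (%i. list_ex (%a. list_ex (%b. a ~= i \<and> b ~= i \<and>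
    q ! a * \<delta> ! b ~= q ! b * \<delta> ! a) [0..<N]) [0..<N]) [0..<N]"

definition orbit_check :: "int list list => int list => int list => bool" where
  "orbit_check A \<delta> g \<longleftrightarrow> list_all (%j. let q = fold (reflect_list A) [0..<j] g in
    list_all (%x. x >= 0) q \<and> not_near_null (length A) \<delta> q) [0..<length A]"

text \<open>\<open>gs\<close> consists of the periodic roots and \<open>bs\<close> of roots orthogonal to them; \<open>ns\<close> are the
  multiplicities in a null combination of \<open>bs\<close>, and the rows of \<open>P\<close> express \<open>K\<close> times the simple roots
  in terms of \<open>gs\<close> and \<open>bs\<close>.\<close>

definition trap_check :: "int list list => int list => int list list => int =>
    (nat list \<times> nat) list => int list => int => int list list => int list => bool" where
  "trap_check A D gs e bws ns K P \<delta> \<longleftrightarrow>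
    (let N = length A; bs = map (root_list A) bws in
      e > 0 \<and> list_all (%g. length g = N) gs \<and> list_all (valid_root_list A D e) bws \<and>
      list_all (%b. list_all (%x. x >= 0) b \<and> list_all (%g. form_list A D b g = 0) gs) bs \<and>
      distinct bs \<and> length ns = length bs \<and> list_all (%x. x > 0) ns \<and>
      list_all (%r. dot_list r (combine_list N ns bs) = 0) A \<and>
      K > 0 \<and> length P = N \<and> list_all (%cs. length cs = length gs + length bs) P \<and>
      map (%cs. combine_list N cs (gs @ bs)) P = map (%a. map ((*) K) (unit_list N a)) [0..<N] \<and>
      length \<delta> = N \<and> list_all (%r. dot_list r \<delta> = 0) A \<and> list_all (%x. x > 0) \<delta> \<and>
      list_all (%x. x >= 0) (map2 (-) \<delta> (gs ! 0)))"

lemma length_root_list [simp]: "length (root_list A r) = length A"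
  by (cases r) (simp add: root_list_def)

context coxeter_system
begin

context
  fixes idx A D
  assumes cm: "cartan_matrix idx A D"
begin

lemma root_list_root:
  assumes "valid_root_list A D e r"
  shows "(1 / sqrt (of_int e)) *\<^sub>R list_vector idx D (root_list A r) \<in> roots"
  using assms foldr_reflect_list_root[OF cm] by (cases r) (auto simp: valid_root_list_def root_list_def)

lemma not_near_null_vector:
  assumes "not_near_null (length A) \<delta> q" "length q = length A" "length \<delta> = length A"
  shows "c *\<^sub>R list_vector idx D \<delta> ~= simple_root i + list_vector idx D q"
proof
  assume eq: "c *\<^sub>R list_vector idx D \<delta> = simple_root i + list_vector idx D q"
  obtain a b where ab: "a < length A" "b < length A" "a ~= idx i" "b ~= idx i" "q ! a * \<delta> ! b ~= q ! b * \<delta> ! a"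
  proof -
    have "list_ex (%a. list_ex (%b. a ~= idx i \<and> b ~= idx i \<and> q ! a * \<delta> ! b ~= q ! b * \<delta> ! a)
        [0..<length A]) [0..<length A]"
      using assms(1) cm_idx_less[OF cm, of i] by (simp add: not_near_null_def list_all_iff)
    then show ?thesis using that by (auto simp: list_ex_iff)
  qed
  have *: "c * of_int (\<delta> ! k) = of_int (q ! k)" if k: "k < length A" "k ~= idx i" for k
  proof -
    obtain j where j: "idx j = k" using cm_unidx[OF cm k(1)] .
    then have "j ~= i" using k by auto
    have "(c *\<^sub>R list_vector idx D \<delta>) $ j = (simple_root i + list_vector idx D q) $ j" using eq by simp
    then show ?thesis
      using \<open>j ~= i\<close> j cm_D[OF cm k(1)] by (simp add: list_vector_def simple_root_nth)
  qed
  have "real_of_int (q ! a * \<delta> ! b) = real_of_int (q ! b * \<delta> ! a)"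
    unfolding of_int_mult *[OF ab(1,3), symmetric] *[OF ab(2,4), symmetric] by simp
  then show False using ab(5) by (simp only: of_int_eq_iff)
qed

text \<open>Every time is some whole rounds and a remainder. The set \<open>gs\<close> is closed
  under a round, so that checking each remainder for each member covers all times.\<close>

lemma orbit_check_free_orbit:
  assumes "!!g. g \<in> set gs ==> length g = length A \<and> orbit_check A \<delta> g"
    and "!!g. g \<in> set gs ==> fold (reflect_list A) [0..<length A] g \<in> set gs"
    and "g \<in> set gs" "length \<delta> = length A" "A ~= []"
  defines "xs \<equiv> listing_of idx [0..<length A]"
  shows "nonneg (free_orbit xs (list_vector idx D g) t) \<and>
    c *\<^sub>R list_vector idx D \<delta> ~= simple_root i + free_orbit xs (list_vector idx D g) t"
proof -
  let ?N = "length A"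
  have N: "length xs = ?N" by (simp add: xs_def listing_of_def[OF cm])
  have rounds: "\<exists>h\<in>set gs. free_orbit xs (list_vector idx D g) (k * length xs) = list_vector idx D h" for k
  proof (induction k)
    case 0
    then show ?case using assms(3) by auto
  next
    case (Suc k)
    then obtain h where h: "h \<in> set gs" "free_orbit xs (list_vector idx D g) (k * length xs) = list_vector idx D h"
      by blast
    have "free_orbit xs (list_vector idx D g) (Suc k * length xs) = fold reflection xs (list_vector idx D h)"
      using free_orbit_take[of "length xs" xs "list_vector idx D g" k] h by (simp add: add.commute)
    also have "... = list_vector idx D (fold (reflect_list A) [0..<?N] h)"
      unfolding xs_def using assms(1)[OF h(1)] by (intro fold_reflect_list[OF cm]) auto
    finally show ?case using assms(2)[OF h(1)] by blast
  qed
  define k j where "k = t div ?N" and "j = t mod ?N"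
  have j: "j < ?N" using assms(5) by (simp add: j_def)
  have t: "t = k * length xs + j" by (simp add: k_def j_def N)
  obtain h where h: "h \<in> set gs" "free_orbit xs (list_vector idx D g) (k * length xs) = list_vector idx D h"
    using rounds by blast
  have "take j xs = listing_of idx [0..<j]"
    using j by (simp add: xs_def listing_of_def[OF cm] take_map)
  then have "free_orbit xs (list_vector idx D g) t = fold reflection (listing_of idx [0..<j]) (list_vector idx D h)"
    unfolding t using j N h free_orbit_take[of j xs "list_vector idx D g" k] by simp
  also have "... = list_vector idx D (fold (reflect_list A) [0..<j] h)"
    using assms(1)[OF h(1)] j by (intro fold_reflect_list[OF cm]) auto
  finally have eq: "free_orbit xs (list_vector idx D g) t = list_vector idx D (fold (reflect_list A) [0..<j] h)" .
  have "list_all (%x. x >= 0) (fold (reflect_list A) [0..<j] h)"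
      "not_near_null ?N \<delta> (fold (reflect_list A) [0..<j] h)"
    using assms(1)[OF h(1)] j by (auto simp: orbit_check_def list_all_iff Let_def)
  then show ?thesis
    unfolding eq using assms(1)[OF h(1)] assms(4)
    by (auto intro!: list_vector_nonneg[OF cm] dest: not_near_null_vector)
qed

context
  fixes gs e bws ns K P \<delta>
  assumes check: "trap_check A D gs e bws ns K P \<delta>"
begin

definition "trap_M = (%r. (1 / sqrt (of_int e)) *\<^sub>R list_vector idx D (root_list A r)) ` set bws"

lemma trap_N_length: "g \<in> set gs ==> length g = length A"
  using check by (auto simp: trap_check_def Let_def list_all_iff)

lemma trap_e_pos: "e > 0"
  using check by (simp add: trap_check_def Let_def)

lemma trap_M_props:
  shows "finite trap_M" "trap_M \<subseteq> roots" "!!b. b \<in> trap_M ==> nonneg b"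
    "!!b g. b \<in> trap_M ==> g \<in> set gs ==> form b (list_vector idx D g) = 0"
proof -
  show "finite trap_M" by (simp add: trap_M_def)
  show "trap_M \<subseteq> roots"
    using check root_list_root by (auto simp: trap_M_def trap_check_def Let_def list_all_iff)
  show "nonneg b" if "b \<in> trap_M" for b
    using that check trap_e_pos unfolding trap_M_def trap_check_def Let_def list_all_iff
    by (auto intro!: nonneg_scaleR list_vector_nonneg[OF cm] simp: list_all_iff)
  fix b g assume b: "b \<in> trap_M" and g: "g \<in> set gs"
  obtain r where r: "r \<in> set bws" "b = (1 / sqrt (of_int e)) *\<^sub>R list_vector idx D (root_list A r)"
    using b by (auto simp: trap_M_def)
  have "form_list A D (root_list A r) g = 0"
    using check r(1) g by (auto simp: trap_check_def Let_def list_all_iff)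
  then have "form (list_vector idx D (root_list A r)) (list_vector idx D g) = 0"
    using form_list_vector[OF cm, of "root_list A r" g] trap_N_length[OF g] by simp
  then show "form b (list_vector idx D g) = 0"
    using r by (simp add: form_linear)
qed

text \<open>The certificate lists multiplicities by position, whereas \<open>trap\<close> expects a
  function on vectors. The listed roots are distinct, which allows the position of a vector to be
  recovered.\<close>

lemma trap_M_null:
  obtains n where "!!b. b \<in> trap_M ==> n b > 0" "!!v. form (\<Sum>b\<in>trap_M. n b *\<^sub>R b) v = 0"
proof -
  let ?bs = "map (root_list A) bws" and ?h = "%r. (1 / sqrt (of_int e)) *\<^sub>R list_vector idx D (root_list A r)"
  have c: "distinct ?bs" "length ns = length bws" "\<forall>x\<in>set ns. x > 0"
      "list_all (%r. dot_list r (combine_list (length A) ns ?bs) = 0) A"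
    using check by (auto simp: trap_check_def Let_def list_all_iff)
  have len: "\<forall>v\<in>set ?bs. length v = length A" by auto
  have inj: "inj_on ?h (set bws)"
  proof (rule inj_onI)
    fix x y assume xy: "x \<in> set bws" "y \<in> set bws" "?h x = ?h y"
    then have "list_vector idx D (root_list A x) = list_vector idx D (root_list A y)"
      using trap_e_pos by simp
    then have "root_list A x ! idx i = root_list A y ! idx i" for i
      using cm_D[OF cm cm_idx_less[OF cm, of i]] by (auto simp: list_vector_def vec_eq_iff) (metis less_irrefl)
    then have "root_list A x ! a = root_list A y ! a" if "a < length A" for a
      using cm_unidx[OF cm that] by metis
    then have "root_list A x = root_list A y" by (intro nth_equalityI) auto
    then show "x = y" using c(1) xy by (auto simp: distinct_map inj_on_def)
  qed
  \<comment> \<open>The position of a certificate in the list, turned into a position of its vector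
    through the injectivity of \<open>?h\<close>.\<close>
  define pos where "pos = (%r. THE k. k < length bws \<and> bws ! k = r)"
  have dist: "distinct bws" using c(1) by (simp add: distinct_map)
  have pos: "pos (bws ! k) = k" if "k < length bws" for k
    unfolding pos_def using that dist by (intro the_equality) (auto simp: nth_eq_iff_index_eq)
  define n where "n = (%b. real_of_int (ns ! pos (the_inv_into (set bws) ?h b)))"
  have n: "n (?h (bws ! k)) = of_int (ns ! k)" if "k < length bws" for k
    unfolding n_def using that pos the_inv_into_f_f[OF inj, of "bws ! k"] by simp
  have "n b > 0" if bM: "b \<in> trap_M" for b
  proof -
    obtain k where "k < length bws" "b = ?h (bws ! k)"
      using bM by (auto simp: trap_M_def in_set_conv_nth)
    then show ?thesis using n c by simp
  qed
  moreover have "form (\<Sum>b\<in>trap_M. n b *\<^sub>R b) v = 0" for v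
  proof -
    have "(\<Sum>b\<in>trap_M. n b *\<^sub>R b) = (\<Sum>r\<in>set bws. n (?h r) *\<^sub>R ?h r)"
      unfolding trap_M_def by (subst sum.reindex[OF inj]) simp
    also have "... = (\<Sum>k<length bws. n (?h (bws ! k)) *\<^sub>R ?h (bws ! k))"
      by (rule sum.reindex_bij_betw[symmetric, OF bij_betw_nth[OF dist]]) auto
    also have "... = (\<Sum>k<length bws. (1 / sqrt (of_int e)) *\<^sub>R (of_int (ns ! k) *\<^sub>R list_vector idx D (?bs ! k)))"
      using n by (intro sum.cong) auto
    also have "... = (1 / sqrt (of_int e)) *\<^sub>R list_vector idx D (combine_list (length A) ns ?bs)"
      using list_vector_combine[OF cm len] c(2) by (simp add: scaleR_sum_right)
    finally show ?thesis
      using list_vector_null[OF cm length_combine_list[OF cm len] c(4)] by (simp add: form_linear)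
  qed
  ultimately show ?thesis by (rule that)
qed

lemma trap_span: "simple_root i \<in> span (list_vector idx D ` set gs \<union> trap_M)"
proof -
  let ?S = "list_vector idx D ` set gs \<union> trap_M"
  let ?vs = "gs @ map (root_list A) bws"
  have c: "K > 0" "length P = length A" "\<forall>cs\<in>set P. length cs = length ?vs"
    "map (%cs. combine_list (length A) cs ?vs) P = map (%a. map ((*) K) (unit_list (length A) a)) [0..<length A]"
    using check by (auto simp: trap_check_def Let_def list_all_iff)
  have len: "\<forall>v\<in>set ?vs. length v = length A" using trap_N_length by auto
  let ?a = "idx i"
  have a: "?a < length A" using cm_idx_less[OF cm] .
  have "combine_list (length A) (P ! ?a) ?vs = map ((*) K) (unit_list (length A) ?a)"
    using arg_cong[OF c(4), of "%l. l ! ?a"] a c(2) by simp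
  then have "(of_int K * sqrt (of_int (D ! ?a))) *\<^sub>R simple_root i =
      list_vector idx D (combine_list (length A) (P ! ?a) ?vs)"
    using list_vector_unit[OF cm, of i] list_vector_scale[OF cm, of "unit_list (length A) ?a" K] by simp
  also have "... = (\<Sum>k<length ?vs. of_int (P ! ?a ! k) *\<^sub>R list_vector idx D (?vs ! k))"
    using c a by (intro list_vector_combine[OF cm len]) auto
  also have "... \<in> span ?S"
  proof (intro span_sum span_scale)
    fix k assume "k \<in> {..<length ?vs}"
    then have "?vs ! k \<in> set ?vs" using nth_mem by blast
    then consider "?vs ! k \<in> set gs" | b where "b \<in> set bws" "?vs ! k = root_list A b"
      by auto
    then show "list_vector idx D (?vs ! k) \<in> span ?S"
    proof cases
      case 1
      then show ?thesis by (intro span_base) auto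
    next
      case 2
      then have "list_vector idx D (?vs ! k) = sqrt (of_int e) *\<^sub>R ((1 / sqrt (of_int e)) *\<^sub>R list_vector idx D (root_list A b))"
        using trap_e_pos by simp
      moreover have "(1 / sqrt (of_int e)) *\<^sub>R list_vector idx D (root_list A b) \<in> span ?S"
        using 2 by (intro span_base) (auto simp: trap_M_def)
      ultimately show ?thesis using span_scale by metis
    qed
  qed
  finally have "(1 / (of_int K * sqrt (of_int (D ! ?a)))) *\<^sub>R (of_int K * sqrt (of_int (D ! ?a))) *\<^sub>R simple_root i \<in> span ?S"
    by (rule span_scale)
  then show ?thesis using c(1) cm_D[OF cm a] by simp
qed

end

end

lemma listing_props:
  assumes "cartan_matrix idx A D"
  shows "distinct (listing_of idx [0..<length A])" "set (listing_of idx [0..<length A]) = UNIV"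
    "A ~= []" "listing_of idx [0..<length A] ~= []"
proof -
  show d: "distinct (listing_of idx [0..<length A])"
    by (rule listing_of_distinct[OF assms]) auto
  show "set (listing_of idx [0..<length A]) = UNIV"
    by (rule listing_of_set[OF assms]) (auto simp: atLeast0LessThan)
  show "A ~= []" using cm_idx_less[OF assms, of undefined] by auto
  then show "listing_of idx [0..<length A] ~= []" by (simp add: listing_of_def[OF assms])
qed

lemma ancient_elimination_list:
  assumes cm: "cartan_matrix idx A D" and "elimination_list A (rev [0..<length A])"
    and "\<exists>L. is_convex L \<and> L ~= {} \<and> ~ heavy_listing L (listing_of idx [0..<length A])"
  shows ancient
proof -
  let ?vs = "listing_of idx (rev [0..<length A])"
  have "elimination_order ?vs"
    using assms(2) by (intro elimination_list_order[OF cm]) auto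
  moreover have "distinct ?vs" by (rule listing_of_distinct[OF cm]) auto
  moreover have "set ?vs = UNIV" by (rule listing_of_set[OF cm]) (auto simp: atLeast0LessThan)
  ultimately show ?thesis using assms(3) listing_props[OF cm] ancientI by metis
qed

lemma ancient_trap_A2:
  assumes irr: is_irreducible and aff: is_affine and cm: "cartan_matrix idx A D"
    and check: "trap_check A D [g1, g2, g3] e bws ns K P (map2 (+) g1 (map2 (+) g2 g3))"
    and r1: "valid_root_list A D 1 r1" "root_list A r1 = g1"
    and cyc: "form_list A D g1 g2 = -1"
      "map (fold (reflect_list A) [0..<length A]) [g1, g2, g3] =
       [g2, g3, g1]"
    and orbit: "list_all (orbit_check A (map2 (+) g1 (map2 (+) g2 g3)))
      [g1, g2, g3]"
    and elim: "elimination_list A (rev [0..<length A])"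
  shows ancient
proof (rule ancient_elimination_list[OF cm elim])
  let ?g = "list_vector idx D" and ?xs = "listing_of idx [0..<length A]"
  let ?\<delta> = "map2 (+) g1 (map2 (+) g2 g3)"
  note len = trap_N_length[OF cm check, simplified]
  note check' = check[unfolded trap_check_def Let_def]
  obtain n where n: "!!b. b \<in> trap_M idx A D e bws ==> n b > 0"
      "!!v. form (\<Sum>b\<in>trap_M idx A D e bws. n b *\<^sub>R b) v = 0"
    using trap_M_null[OF cm check] by blast
  note M = trap_M_props[OF cm check]
  have \<delta>: "list_vector idx D ?\<delta> = ?g g1 + ?g g2 + ?g g3"
    using len by (simp add: list_vector_add[OF cm])
  have fold: "fold reflection ?xs (?g r) = list_vector idx D (fold (reflect_list A) [0..<length A] r)" if "length r = length A" for r
    using that by (intro fold_reflect_list[OF cm]) auto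
  have orb: "nonneg (free_orbit ?xs (?g g1) t) \<and> c *\<^sub>R list_vector idx D ?\<delta> ~= simple_root i + free_orbit ?xs (?g g1) t" for t c i
    using orbit cyc(2) listing_props(3)[OF cm] len
    by (intro orbit_check_free_orbit[OF cm, of "[g1, g2, g3]"]) auto
  show "\<exists>L. is_convex L \<and> L ~= {} \<and> ~ heavy_listing L ?xs"
  proof (rule trap_A2[OF irr aff cm_crystallographic[OF cm] listing_props(4)[OF cm],
        of "?g g1" "?g g2" "?g g3" "list_vector idx D ?\<delta>" "trap_M idx A D e bws" n])
    have fold_roots: "fold reflection ys v \<in> roots" if "v \<in> roots" for ys v
      using foldr_reflection_roots[OF that, of "rev ys"] by (simp add: foldr_conv_fold)
    show g1: "?g g1 \<in> roots"
      using root_list_root[OF cm r1(1)] r1(2) by simp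
    \<comment> \<open>Only \<open>g1\<close> carries a certificate of being a root; the other two
      are its images under a round.\<close>
    then have "fold reflection ?xs (?g g1) \<in> roots" by (rule fold_roots)
    then show g2: "?g g2 \<in> roots" using cyc(2) len by (simp add: fold)
    then have "fold reflection ?xs (?g g2) \<in> roots" by (rule fold_roots)
    then show "?g g3 \<in> roots" using cyc(2) len by (simp add: fold)
    show "form (?g g1) (?g g2) = - 1 / 2"
      using form_list_vector[OF cm, of g1 g2] cyc(1) len by simp
    show "form (list_vector idx D ?\<delta>) v = 0" for v
      using check' len by (intro list_vector_null[OF cm]) auto
    show "list_vector idx D ?\<delta> $ i > 0" for i
    proof -
      have "?\<delta> ! idx i \<in> set ?\<delta>"
        by (rule nth_mem) (simp add: len cm_idx_less[OF cm])
      moreover have "\<forall>x\<in>set ?\<delta>. x > 0"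
        using check' unfolding list_all_iff by blast
      ultimately have "?\<delta> ! idx i > 0" by blast
      then show ?thesis
        unfolding list_vector_def using cm_D[OF cm cm_idx_less[OF cm, of i]] by simp
    qed
    show "nonneg (list_vector idx D ?\<delta> - ?g g1)"
    proof -
      have "list_vector idx D (map2 (-) ?\<delta> g1) = list_vector idx D ?\<delta> - ?g g1"
        using len by (simp add: list_vector_def vec_eq_iff algebra_simps cm_idx_less[OF cm])
      moreover have "nonneg (list_vector idx D (map2 (-) ?\<delta> g1))"
        using check' len by (intro list_vector_nonneg[OF cm]) auto
      ultimately show ?thesis by simp
    qed
    show "form b (?g g1) = 0 \<and> form b (?g g2) = 0" if "b \<in> trap_M idx A D e bws" for b
      using M(4)[OF that] by simp
    show "simple_root i \<in> span ({?g g1, ?g g2, ?g g3} \<union> trap_M idx A D e bws)" for i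
      using trap_span[OF cm check, of i] by simp
  qed (use cyc(2) orb M n len in \<open>simp_all add: fold \<delta>\<close>)
qed

lemma root_form_Ints:
  assumes "crystallographic (%_. 1)" "!!i. form (simple_root i) v \<in> \<int>" "\<rho> \<in> roots"
  shows "form \<rho> v \<in> \<int>"
proof -
  obtain w j where w: "w \<in> carrier W" "\<rho> = action w (simple_root j)" using assms(3) by (rule rootsE)
  have "\<rho> = (\<Sum>i\<in>UNIV. \<rho> $ i *\<^sub>R simple_root i)"
    by (simp add: vec_eq_iff simple_root_nth if_distrib cong: if_cong)
  then have "form \<rho> v = (\<Sum>i\<in>UNIV. \<rho> $ i * form (simple_root i) v)"
    by (metis (no_types, lifting) form_sum_left form_scaleR_left sum.cong)
  moreover have "\<rho> $ i \<in> \<int>" for i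
    using crystallographic_root[OF assms(1) w(1), of j i] w(2) by simp
  ultimately show ?thesis using assms(2) by (auto intro!: Ints_sum Ints_mult)
qed

text \<open>The roots orthogonal to the three periodic ones form a system A2 x A2. The six certified
  roots are its affine simple roots: two triangles, each with sum \<open>\<delta>\<close>.\<close>

lemma ancient_E6:
  assumes is_irreducible is_affine type_E6
  shows ancient
proof -
  define A :: "int list list" where "A = [[2, -1, 0, -1, 0, -1, 0], [-1, 2, -1, 0, 0, 0, 0], [0, -1, 2, 0, 0, 0, 0], [-1, 0, 0, 2, -1, 0, 0], [0, 0, 0, -1, 2, 0, 0], [-1, 0, 0, 0, 0, 2, -1], [0, 0, 0, 0, 0, -1, 2]]"
  define D :: "int list" where "D = [1, 1, 1, 1, 1, 1, 1]"
  define g1 g2 g3 :: "int list" where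
    g: "g1 = [1, 0, 0, 1, 0, 1, 1]" "g2 = [1, 1, 1, 0, 0, 1, 0]" "g3 = [1, 1, 0, 1, 1, 0, 0]"
  have check: "cartan_check (%a b. if (a, b) \<in> {(0, 1), (1, 2), (0, 3), (3, 4), (0, 5), (5, 6)} then 3 else 2) A D"
    unfolding A_def D_def by code_simp
  obtain idx where cm: "cartan_matrix idx A D"
    by (rule cartan_matrixI[OF assms(3)[unfolded type_E6_def] check]) (simp add: A_def, blast)
  show ?thesis
  proof (rule ancient_trap_A2[OF assms(1,2) cm])
    show "trap_check A D [g1, g2, g3] 1
        [([], 0), ([1, 0, 5], 6), ([4, 3, 0], 5), ([1, 3, 0], 5), ([2, 1, 0], 3), ([2, 1, 4, 3, 0, 5], 6)] [1, 1, 1, 1, 1, 1] 3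
        [[0, 0, 0, 3, 0, 0, 0, 0, 0], [-1, 0, 1, -1, 1, -1, 1, 0, 0], [2, 3, 1, -1, -2, -1, -2, 0, 0], [2, 0, 1, -1, -2, -1, 1, 0, 0], [-1, 0, 1, -1, 1, 2, -2, 0, 0], [-1, 0, -2, -1, 1, 2, 1, 0, 0], [2, 0, 1, -1, 1, -1, -2, 0, 0]]
        (map2 (+) g1 (map2 (+) g2 g3))"
      unfolding A_def D_def g by code_simp
    show "valid_root_list A D 1 ([3, 0, 5], 6)" "root_list A ([3, 0, 5], 6) = g1"
      unfolding A_def D_def g by code_simp+
    show "form_list A D g1 g2 = -1"
      unfolding A_def D_def g by code_simp
    show "map (fold (reflect_list A) [0..<length A]) [g1, g2, g3] = [g2, g3, g1]"
      unfolding A_def g by code_simp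
    show "list_all (orbit_check A (map2 (+) g1 (map2 (+) g2 g3))) [g1, g2, g3]"
      unfolding A_def g by code_simp
    show "elimination_list A (rev [0..<length A])"
      unfolding A_def by code_simp
  qed
qed

text \<open>The orthogonal system is A5; its six affine simple roots form a cycle with sum
  \<open>\<delta>\<close>.\<close>

lemma ancient_E7:
  assumes is_irreducible is_affine type_E7
  shows ancient
proof -
  define A :: "int list list" where "A = [[2, -1, 0, 0, 0, 0, 0, 0], [-1, 2, -1, 0, 0, 0, 0, 0], [0, -1, 2, -1, 0, 0, 0, 0], [0, 0, -1, 2, -1, 0, 0, -1], [0, 0, 0, -1, 2, -1, 0, 0], [0, 0, 0, 0, -1, 2, -1, 0], [0, 0, 0, 0, 0, -1, 2, 0], [0, 0, 0, -1, 0, 0, 0, 2]]"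
  define D :: "int list" where "D = [1, 1, 1, 1, 1, 1, 1, 1]"
  define g1 g2 g3 :: "int list" where
    g: "g1 = [0, 0, 1, 1, 1, 1, 0, 0]" "g2 = [0, 1, 1, 1, 1, 0, 0, 1]" "g3 = [1, 1, 1, 2, 1, 1, 1, 1]"
  have check: "cartan_check (%a b. if (a, b) \<in> {(0, 1), (1, 2), (2, 3), (3, 4), (4, 5), (5, 6), (3, 7)} then 3 else 2) A D"
    unfolding A_def D_def by code_simp
  obtain idx where cm: "cartan_matrix idx A D"
    by (rule cartan_matrixI[OF assms(3)[unfolded type_E7_def] check]) (simp add: A_def, blast)
  show ?thesis
  proof (rule ancient_trap_A2[OF assms(1,2) cm])
    show "trap_check A D [g1, g2, g3] 1
        [([3], 4), ([2, 3], 7), ([4, 5], 6), ([1, 2], 3), ([0, 1], 2), ([5, 4, 3], 7)] [1, 1, 1, 1, 1, 1] 3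
        [[0, -1, 1, 1, 0, -1, -2, 2, 0], [0, 2, 1, -2, -3, -1, 1, -1, 0], [0, -1, -2, 1, 3, 2, 1, 2, 0], [0, -1, 1, 1, 0, -1, 1, -1, 0], [0, 1, -1, 2, 0, 1, -1, 1, 0], [3, 1, 2, -4, -3, -2, -1, -2, 0], [-3, -2, -1, 2, 3, 4, 2, 1, 0], [0, 2, 1, -2, 0, -1, -2, -1, 0]]
        (map2 (+) g1 (map2 (+) g2 g3))"
      unfolding A_def D_def g by code_simp
    show "valid_root_list A D 1 ([2, 3, 4], 5)" "root_list A ([2, 3, 4], 5) = g1"
      unfolding A_def D_def g by code_simp+
    show "form_list A D g1 g2 = -1"
      unfolding A_def D_def g by code_simp
    show "map (fold (reflect_list A) [0..<length A]) [g1, g2, g3] = [g2, g3, g1]"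
      unfolding A_def g by code_simp
    show "list_all (orbit_check A (map2 (+) g1 (map2 (+) g2 g3))) [g1, g2, g3]"
      unfolding A_def g by code_simp
    show "elimination_list A (rev [0..<length A])"
      unfolding A_def by code_simp
  qed
qed

text \<open>The orthogonal system is E6; the multiplicities 3, 2, 2, 1, 2, 1, 1 are the marks of its
  affine diagram.\<close>

lemma ancient_E8:
  assumes is_irreducible is_affine type_E8
  shows ancient
proof -
  define A :: "int list list" where "A = [[2, -1, 0, 0, 0, 0, 0, 0, 0], [-1, 2, -1, 0, 0, 0, 0, 0, 0], [0, -1, 2, -1, 0, 0, 0, 0, -1], [0, 0, -1, 2, -1, 0, 0, 0, 0], [0, 0, 0, -1, 2, -1, 0, 0, 0], [0, 0, 0, 0, -1, 2, -1, 0, 0], [0, 0, 0, 0, 0, -1, 2, -1, 0], [0, 0, 0, 0, 0, 0, -1, 2, 0], [0, 0, -1, 0, 0, 0, 0, 0, 2]]"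
  define D :: "int list" where "D = [1, 1, 1, 1, 1, 1, 1, 1, 1]"
  define g1 g2 g3 :: "int list" where
    g: "g1 = [0, 1, 2, 1, 1, 1, 0, 0, 1]" "g2 = [1, 2, 2, 2, 2, 1, 1, 1, 1]" "g3 = [1, 1, 2, 2, 1, 1, 1, 0, 1]"
  have check: "cartan_check (%a b. if (a, b) \<in> {(0, 1), (1, 2), (2, 3), (3, 4), (4, 5), (5, 6), (6, 7), (2, 8)} then 3 else 2) A D"
    unfolding A_def D_def by code_simp
  obtain idx where cm: "cartan_matrix idx A D"
    by (rule cartan_matrixI[OF assms(3)[unfolded type_E8_def] check]) (simp add: A_def, blast)
  show ?thesis
  proof (rule ancient_trap_A2[OF assms(1,2) cm])
    show "trap_check A D [g1, g2, g3] 1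
        [([], 8), ([0, 1], 2), ([1, 2], 3), ([3, 4], 5), ([2, 3], 4), ([4, 5], 6), ([5, 6], 7)] [3, 2, 2, 1, 2, 1, 1] 3
        [[-1, 0, 1, 0, 2, -2, 1, 0, -1, 0], [-1, 0, -2, 3, 2, 4, 1, 0, 2, 0], [2, 0, 1, -3, -1, -2, -2, 0, -1, 0], [-1, 0, 1, 0, -1, 1, 1, 0, -1, 0], [-1, 0, -2, 3, 2, 1, 1, 3, 2, 0], [2, 0, 1, -3, -1, -2, 1, -3, -1, 0], [-1, 0, 1, 0, -1, 1, -2, 0, 2, 0], [2, 3, 1, -6, -4, -5, -2, -3, -4, 0], [0, 0, 0, 3, 0, 0, 0, 0, 0, 0]]
        (map2 (+) g1 (map2 (+) g2 g3))"
      unfolding A_def D_def g by code_simp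
    show "valid_root_list A D 1 ([2, 1, 5, 4, 3, 2], 8)" "root_list A ([2, 1, 5, 4, 3, 2], 8) = g1"
      unfolding A_def D_def g by code_simp+
    show "form_list A D g1 g2 = -1"
      unfolding A_def D_def g by code_simp
    show "map (fold (reflect_list A) [0..<length A]) [g1, g2, g3] = [g2, g3, g1]"
      unfolding A_def g by code_simp
    show "list_all (orbit_check A (map2 (+) g1 (map2 (+) g2 g3))) [g1, g2, g3]"
      unfolding A_def g by code_simp
    show "elimination_list A (rev [0..<length A])"
      unfolding A_def by code_simp
  qed
qed

text \<open>The periodic roots are short, and the orthogonal system is an A2 of long roots. Hence
  the length 1 in the certificate of \<open>g1\<close> and 2 in those of the other roots.\<close>

lemma ancient_F4:
  assumes is_irreducible is_affine type_F4
  shows ancient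
proof -
  define A :: "int list list" where "A = [[2, -1, 0, 0, 0], [-1, 2, -1, 0, 0], [0, -1, 2, -1, 0], [0, 0, -2, 2, -1], [0, 0, 0, -1, 2]]"
  define D :: "int list" where "D = [2, 2, 2, 1, 1]"
  define g1 g2 g3 :: "int list" where
    g: "g1 = [0, 0, 1, 1, 0]" "g2 = [0, 1, 1, 1, 1]" "g3 = [1, 1, 1, 2, 1]"
  have check: "cartan_check (%a b. if (a, b) \<in> {(0, 1), (1, 2), (3, 4)} then 3 else if (a, b) = (2, 3) then 4 else 2) A D"
    unfolding A_def D_def by code_simp
  obtain idx where cm: "cartan_matrix idx A D"
    by (rule cartan_matrixI[OF assms(3)[unfolded type_F4_def] check]) (simp add: A_def, blast)
  show ?thesis
  proof (rule ancient_trap_A2[OF assms(1,2) cm])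
    show "trap_check A D [g1, g2, g3] 2
        [([0, 1], 2), ([1, 3], 2), ([4, 3], 2)] [1, 1, 1] 3
        [[0, -2, 2, 1, -1, 0], [-3, 1, -1, 1, 2, 0], [3, 1, -1, 1, -1, 0], [0, -1, 1, -1, 1, 0], [0, 2, 1, -1, -2, 0]]
        (map2 (+) g1 (map2 (+) g2 g3))"
      unfolding A_def D_def g by code_simp
    show "valid_root_list A D 1 ([2], 3)" "root_list A ([2], 3) = g1"
      unfolding A_def D_def g by code_simp+
    show "form_list A D g1 g2 = -1"
      unfolding A_def D_def g by code_simp
    show "map (fold (reflect_list A) [0..<length A]) [g1, g2, g3] = [g2, g3, g1]"
      unfolding A_def g by code_simp
    show "list_all (orbit_check A (map2 (+) g1 (map2 (+) g2 g3))) [g1, g2, g3]"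
      unfolding A_def g by code_simp
    show "elimination_list A (rev [0..<length A])"
      unfolding A_def by code_simp
  qed
qed

section \<open>Type D\<close>

definition fvector :: "('i => nat) => (nat => real) => (nat => real) => real ^ 'i" where
  "fvector idx d g = (\<chi> i. g (idx i) * d (idx i))"

text \<open>In the coordinates given by \<^const>\<open>fvector\<close>, the reflection in the simple root numbered \<open>b\<close> replaces
  \<open>g b\<close> by \<open>N b g - g b\<close>, where \<open>N b g\<close> is a weighted sum over the neighbours of \<open>b\<close>.\<close>

definition neighbour_sum :: "('i => nat) => nat => (nat => real) => (nat => (nat => real) => real) => bool" where
  "neighbour_sum idx n d N \<longleftrightarrow> bij_betw idx UNIV {..n} \<and> (\<forall>b\<le>n. d b > 0) \<and>
    (\<forall>i g. 2 * form (fvector idx d g) (simple_root i) = (2 * g (idx i) - N (idx i) g) * d (idx i))"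

context
  fixes idx n d N
  assumes ns: "neighbour_sum idx n d N"
begin

lemma ns_bij: "bij_betw idx UNIV {..n}"
  and ns_d: "b <= n ==> d b > 0"
  and ns_form: "2 * form (fvector idx d g) (simple_root i) = (2 * g (idx i) - N (idx i) g) * d (idx i)"
  using ns by (auto simp: neighbour_sum_def)

lemma ns_idx_le [simp]: "idx i <= n"
  using ns_bij by (auto simp: bij_betw_def)

lemma ns_idx_eq [simp]: "idx i = idx j \<longleftrightarrow> i = j"
  using ns_bij by (auto simp: bij_betw_def inj_on_def)

lemma ns_inv [simp]: "b <= n ==> idx (inv_into UNIV idx b) = b"
  using ns_bij by (auto simp: bij_betw_def intro!: f_inv_into_f)

lemma ns_inv' [simp]: "inv_into UNIV idx (idx i) = i"
  using ns_bij by (simp add: bij_betw_def)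

lemma ns_d_idx [simp]: "d (idx i) > 0"
  by (simp add: ns_d)

lemma ns_d_idx_nonzero [simp]: "d (idx i) ~= 0"
  by (metis ns_d_idx less_irrefl)

lemma fvector_eq_iff: "fvector idx d g = fvector idx d h \<longleftrightarrow> (\<forall>b\<le>n. g b = h b)"
proof
  assume eq: "fvector idx d g = fvector idx d h"
  show "\<forall>b\<le>n. g b = h b"
  proof (intro allI impI)
    fix b assume "b <= n"
    moreover have "fvector idx d g $ inv_into UNIV idx b = fvector idx d h $ inv_into UNIV idx b" using eq by simp
    ultimately show "g b = h b" using ns_d[of b] by (simp add: fvector_def)
  qed
qed (simp add: fvector_def)

lemma fvector_simps:
  "fvector idx d g + fvector idx d h = fvector idx d (%b. g b + h b)"
  "fvector idx d g - fvector idx d h = fvector idx d (%b. g b - h b)"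
  "- fvector idx d g = fvector idx d (%b. - g b)"
  "c *\<^sub>R fvector idx d g = fvector idx d (%b. c * g b)"
  by (simp_all add: fvector_def vec_eq_iff algebra_simps)

lemma fvector_unit: "b <= n ==> fvector idx d (%a. if a = b then 1 else 0) = d b *\<^sub>R simple_root (inv_into UNIV idx b)"
  by (auto simp: fvector_def vec_eq_iff simple_root_nth)

lemma reflection_fvector:
  "reflection i (fvector idx d g) = fvector idx d (g(idx i := N (idx i) g - g (idx i)))"
proof -
  have "reflection i (fvector idx d g) $ j = fvector idx d (g(idx i := N (idx i) g - g (idx i))) $ j" for j
    unfolding reflection_nth ns_form by (auto simp: fvector_def algebra_simps)
  then show ?thesis by (simp add: vec_eq_iff)
qed

lemma fvector_nonneg: "(!!b. b <= n ==> g b >= 0) ==> nonneg (fvector idx d g)"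
  by (simp add: nonneg_def fvector_def less_imp_le)

lemma fvector_null:
  assumes "!!b. b <= n ==> N b g = 2 * g b"
  shows "form (fvector idx d g) w = 0"
proof -
  have "form (fvector idx d g) (simple_root i) = 0" for i
    using ns_form[of g i] assms[of "idx i"] by simp
  then have "form (fvector idx d g) (\<Sum>i\<in>UNIV. w $ i *\<^sub>R simple_root i) = 0"
    unfolding form_sum_right by (simp add: form_linear)
  moreover have "(\<Sum>i\<in>UNIV. w $ i *\<^sub>R simple_root i) = w"
    by (simp add: vec_eq_iff simple_root_nth if_distrib cong: if_cong)
  ultimately show ?thesis by simp
qed

lemma form_fvector:
  "2 * form (fvector idx d g) (fvector idx d h) = (\<Sum>b\<le>n. h b * (2 * g b - N b g) * (d b)\<^sup>2)"
proof -
  have w: "fvector idx d h = (\<Sum>i\<in>UNIV. (h (idx i) * d (idx i)) *\<^sub>R simple_root i)"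
    by (simp add: fvector_def vec_eq_iff simple_root_nth if_distrib cong: if_cong)
  have "2 * form (fvector idx d g) (fvector idx d h) =
      (\<Sum>i\<in>UNIV. h (idx i) * d (idx i) * (2 * form (fvector idx d g) (simple_root i)))"
    unfolding w form_sum_right form_scaleR_right sum_distrib_left by (simp add: mult_ac)
  also have "... = (\<Sum>i\<in>UNIV. h (idx i) * (2 * g (idx i) - N (idx i) g) * (d (idx i))\<^sup>2)"
    unfolding ns_form by (simp add: power2_eq_square mult_ac)
  also have "... = (\<Sum>b\<le>n. h b * (2 * g b - N b g) * (d b)\<^sup>2)"
    by (rule sum.reindex_bij_betw[OF ns_bij])
  finally show ?thesis .
qed

lemma root_fvector_reflect:
  assumes "c *\<^sub>R fvector idx d g \<in> roots" "b <= n"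
    and "!!a. a <= n ==> h a = (if a = b then N b g - g b else g a)"
  shows "c *\<^sub>R fvector idx d h \<in> roots"
proof -
  let ?i = "inv_into UNIV idx b"
  have "reflection ?i (fvector idx d g) = fvector idx d h"
    unfolding reflection_fvector fvector_eq_iff using assms(2,3) by simp
  then have "reflection ?i (c *\<^sub>R fvector idx d g) = c *\<^sub>R fvector idx d h"
    using linear_scale[OF reflection_linear, of ?i c "fvector idx d g"] by simp
  then show ?thesis using reflection_roots[OF assms(1), of ?i] by simp
qed

lemma root_fvector_unit:
  assumes "b <= n" "!!a. a <= n ==> g a = (if a = b then 1 else 0)"
  shows "(1 / d b) *\<^sub>R fvector idx d g \<in> roots"
proof -
  have "fvector idx d g = fvector idx d (%a. if a = b then 1 else 0)"
    unfolding fvector_eq_iff using assms(2) by simp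
  then have "fvector idx d g = d b *\<^sub>R simple_root (inv_into UNIV idx b)"
    using fvector_unit[OF assms(1)] by simp
  then show ?thesis using ns_d[OF assms(1)] by simp
qed

definition "natural_listing = map (inv_into UNIV idx) [0..<Suc n]"

lemma length_natural_listing [simp]: "length natural_listing = Suc n"
  by (simp add: natural_listing_def)

lemma natural_listing_nonempty [simp]: "natural_listing ~= []"
  by (simp add: natural_listing_def)

lemma natural_listing_props: "distinct natural_listing" "set natural_listing = UNIV"
proof -
  show "distinct natural_listing"
  proof -
    have "inj_on (inv_into UNIV idx) {0..<Suc n}"
      by (rule inj_on_inverseI[of _ idx]) simp
    then show ?thesis by (simp add: natural_listing_def distinct_map del: upt_Suc)
  qed
  have "i \<in> set natural_listing" for i
    using image_eqI[of i "inv_into UNIV idx" "idx i" "{0..<Suc n}"] by (simp add: natural_listing_def less_Suc_eq_le del: upt_Suc)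
  then show "set natural_listing = UNIV" by auto
qed

text \<open>A round is a Gauss-Seidel sweep: when vertex \<open>b\<close> is reflected, the lower
  vertices already carry their new values \<open>h\<close> and the higher ones still the old values
  \<open>g\<close>.\<close>

lemma fold_natural_listing:
  assumes "!!b. b <= n ==> h b = N b (%a. if a < b then h a else g a) - g b" "j <= Suc n"
  shows "fold reflection (take j natural_listing) (fvector idx d g) = fvector idx d (%a. if a < j then h a else g a)"
  using assms(2)
proof (induction j)
  case (Suc j)
  let ?i = "inv_into UNIV idx j"
  have "take (Suc j) natural_listing = take j natural_listing @ [?i]"
    using Suc.prems by (simp add: take_Suc_conv_app_nth natural_listing_def del: upt_Suc)
  then have "fold reflection (take (Suc j) natural_listing) (fvector idx d g) =
      reflection ?i (fvector idx d (%a. if a < j then h a else g a))"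
    using Suc by simp
  also have "... = fvector idx d (%a. if a < Suc j then h a else g a)"
    unfolding reflection_fvector fvector_eq_iff using Suc.prems assms(1)[of j] by (auto simp: less_Suc_eq)
  finally show ?case .
qed simp

lemma fold_natural_listing_full:
  assumes "!!b. b <= n ==> h b = N b (%a. if a < b then h a else g a) - g b"
  shows "fold reflection natural_listing (fvector idx d g) = fvector idx d h"
  using fold_natural_listing[of h g "Suc n", OF assms] by (simp add: fvector_eq_iff)

lemma free_orbit_natural_listing:
  assumes "!!k b. b <= n ==> g (Suc k) b = N b (%a. if a < b then g (Suc k) a else g k a) - g k b"
  shows "free_orbit natural_listing (fvector idx d (g 0)) t =
    fvector idx d (%a. if a < t mod Suc n then g (Suc (t div Suc n)) a else g (t div Suc n) a)"
proof -
  have r: "free_orbit natural_listing v (k * Suc n) = (fold reflection natural_listing ^^ k) v" for v k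
    using free_orbit_rounds[of natural_listing v k] by (simp only: length_natural_listing)
  have rounds: "free_orbit natural_listing (fvector idx d (g 0)) (k * Suc n) = fvector idx d (g k)" for k
  proof (induction k)
    case (Suc k)
    then have "(fold reflection natural_listing ^^ Suc k) (fvector idx d (g 0)) =
        fold reflection natural_listing (fvector idx d (g k))"
      unfolding r by simp
    then show ?case unfolding r using fold_natural_listing_full[OF assms] by simp
  qed simp
  define k j where "k = t div Suc n" and "j = t mod Suc n"
  have j: "j <= n" using mod_less_divisor[of "Suc n" t] by (simp add: j_def)
  have "t = k * Suc n + j" unfolding k_def j_def by (rule div_mult_mod_eq[symmetric])
  then have "free_orbit natural_listing (fvector idx d (g 0)) t =
      fold reflection (take j natural_listing) (fvector idx d (g k))"
    using free_orbit_take[of j natural_listing "fvector idx d (g 0)" k] j rounds[of k] by simp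
  also have "... = fvector idx d (%a. if a < j then g (Suc k) a else g k a)"
    using j by (intro fold_natural_listing assms) auto
  finally show ?thesis by (simp only: j_def k_def)
qed

end

lemma neighbour_sumI:
  assumes f: "bij_betw f {..n} UNIV" and d: "!!b. b <= n ==> d b > 0"
    and nb: "!!b. b <= n ==> distinct (nb b) \<and> set (nb b) \<subseteq> {..n} - {b}"
    and entry: "!!a b. a <= n ==> b <= n ==> a ~= b ==>
      2 * form_entry (f a) (f b) * d a = - (if a \<in> set (nb b) then w b a else 0) * d b"
  shows "neighbour_sum (inv_into {..n} f) n d (%b g. \<Sum>a\<leftarrow>nb b. w b a * g a)"
    "!!b. b <= n ==> inv_into UNIV (inv_into {..n} f) b = f b"
proof -
  let ?idx = "inv_into {..n} f"
  have bij: "bij_betw ?idx UNIV {..n}" by (rule bij_betw_inv_into[OF f])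
  have f_idx: "f (?idx i) = i" for i using f by (simp add: bij_betw_def f_inv_into_f)
  have idx_f: "?idx (f b) = b" if "b <= n" for b using f that by (simp add: bij_betw_def)
  show "inv_into UNIV ?idx b = f b" if "b <= n" for b
    using bij idx_f[OF that] by (metis bij_betw_def inv_into_f_f UNIV_I)
  have le: "?idx i <= n" for i using bij by (auto simp: bij_betw_def)
  have "2 * form (fvector ?idx d g) (simple_root i) =
      (2 * g (?idx i) - (\<Sum>a\<leftarrow>nb (?idx i). w (?idx i) a * g a)) * d (?idx i)" for g i
  proof -
    let ?b = "?idx i"
    let ?c = "%a. (if a = ?b then 2 * g a else - (if a \<in> set (nb ?b) then w ?b a * g a else 0)) * d ?b"
    have "2 * form (fvector ?idx d g) (simple_root i) = (\<Sum>j\<in>UNIV. ?c (?idx j))"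
      unfolding form_simple_right sum_distrib_left
    proof (rule sum.cong[OF refl])
      fix j
      show "2 * (fvector ?idx d g $ j * form_entry j i) = ?c (?idx j)"
      proof (cases "?idx j = ?b")
        case True
        then have "j = i" using f_idx by metis
        then show ?thesis by (simp add: fvector_def)
      next
        case False
        have "2 * (fvector ?idx d g $ j * form_entry j i) = g (?idx j) * (2 * form_entry (f (?idx j)) (f ?b) * d (?idx j))"
          by (simp add: fvector_def f_idx)
        also have "... = ?c (?idx j)"
          unfolding entry[OF le le False] using False by simp
        finally show ?thesis .
      qed
    qed
    also have "... = (\<Sum>a\<le>n. ?c a)" by (rule sum.reindex_bij_betw[OF bij])
    also have "... = (\<Sum>a\<le>n. if a = ?b then 2 * g a * d ?b else 0) -
        (\<Sum>a\<le>n. if a \<in> set (nb ?b) then w ?b a * g a * d ?b else 0)"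
      unfolding sum_subtractf[symmetric] using nb[OF le[of i]] by (intro sum.cong) auto
    also have "(\<Sum>a\<le>n. if a = ?b then 2 * g a * d ?b else 0) = 2 * g ?b * d ?b"
      using le[of i] by simp
    also have "(\<Sum>a\<le>n. if a \<in> set (nb ?b) then w ?b a * g a * d ?b else 0) =
        (\<Sum>a\<in>set (nb ?b). w ?b a * g a * d ?b)"
      using nb[OF le[of i]] by (subst sum.inter_restrict[symmetric]) (auto intro!: sum.cong)
    also have "... = (\<Sum>a\<leftarrow>nb ?b. w ?b a * g a) * d ?b"
      using nb[OF le[of i]] by (simp add: sum_list_distinct_conv_sum_set sum_distrib_right)
    finally show ?thesis by (simp add: algebra_simps)
  qed
  then show "neighbour_sum ?idx n d (%b g. \<Sum>a\<leftarrow>nb b. w b a * g a)"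
    using bij d by (simp add: neighbour_sum_def)
qed

text \<open>From the far end every vertex has one neighbour of smaller number. The vertices 0 and 1
  are not joined, so they come before their common candidate 2.\<close>

lemma elimination_order_fork:
  assumes f: "bij_betw f {..n} UNIV" and "n >= 2" and "m (f 0) (f 1) = 2"
    and parent: "!!k. 3 <= k ==> k <= n ==> \<exists>p. \<forall>a<k. a ~= p --> m (f a) (f k) = 2"
  defines "vs \<equiv> map f (rev [3..<Suc n] @ [1, 0, 2])"
  shows "elimination_order vs" "distinct vs" "set vs = UNIV"
proof -
  have "elimination_order (map f (rev [3..<k] @ [1, 0, 2]))" if "3 <= k" "k <= Suc n" for k
    using that
  proof (induction k rule: dec_induct)
    case base
    have "m (f 1) (f 0) = 2" using assms(3) m_sym by metis
    then show ?case by (auto intro!: exI[of _ "f 2"])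
  next
    case (step k)
    obtain p where p: "\<forall>a<k. a ~= p --> m (f a) (f k) = 2" using parent[of k] step by auto
    have sub: "set (rev [3..<k] @ [1, 0, 2]) \<subseteq> {..<k}" using step by auto
    have "\<forall>w\<in>set (map f (rev [3..<k] @ [1, 0, 2])). w ~= f p --> m (f k) w = 2"
    proof (intro ballI impI)
      fix w assume "w \<in> set (map f (rev [3..<k] @ [1, 0, 2]))" "w ~= f p"
      then obtain a where "w = f a" "a < k" "a ~= p" using sub unfolding set_map by blast
      then show "m (f k) w = 2" using p m_sym[of "f k" "f a"] by simp
    qed
    then show ?case using step by auto
  qed
  then show "elimination_order vs" using assms(2) by (simp add: vs_def del: upt_Suc)
  have set: "set (rev [3..<Suc n] @ [1, 0, 2]) = {..n}" using assms(2) by auto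
  show "set vs = UNIV"
    unfolding vs_def set_map set using f by (simp add: bij_betw_def)
  show "distinct vs"
    unfolding vs_def distinct_map set using f by (auto simp: bij_betw_def)
qed

text \<open>The members of the family need not be distinct; the weight of a vector is collected over
  all of its indices.\<close>

lemma family_weights:
  assumes "finite J" "!!j. j \<in> J ==> w j > 0"
  obtains n :: "real ^ 'i => real" where "!!b. b \<in> v ` J ==> n b > 0"
    "(\<Sum>b\<in>v ` J. n b *\<^sub>R b) = (\<Sum>j\<in>J. w j *\<^sub>R v j)"
proof (rule that)
  let ?n = "%b. \<Sum>j\<in>{j \<in> J. v j = b}. w j"
  show "?n b > 0" if "b \<in> v ` J" for b
    using that assms by (intro sum_pos) auto
  have "(\<Sum>j\<in>J. w j *\<^sub>R v j) = (\<Sum>b\<in>v ` J. \<Sum>j\<in>{j \<in> J. v j = b}. w j *\<^sub>R v j)"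
    using assms(1) by (rule sum.image_gen)
  also have "... = (\<Sum>b\<in>v ` J. ?n b *\<^sub>R b)"
    by (intro sum.cong) (auto simp: scaleR_sum_left)
  finally show "(\<Sum>b\<in>v ` J. ?n b *\<^sub>R b) = (\<Sum>j\<in>J. w j *\<^sub>R v j)" by simp
qed

end

definition D_neighbours :: "nat => nat => nat list" where
  "D_neighbours n b = (if b = 0 \<or> b = 1 then [2] else if b = n - 1 \<or> b = n then [n - 2]
    else (if b = 2 then [0, 1] else [b - 1]) @ (if b = n - 2 then [n - 1, n] else [b + 1]))"

definition D_delta :: "nat => nat => real" where
  "D_delta n a = (if a = 0 \<or> a = 1 \<or> a = n - 1 \<or> a = n then 1 else 2)"

text \<open>With simple roots \<open>e k - e (k + 1)\<close> for \<open>k\<close> from 1 to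
  \<open>n - 1\<close>, and \<open>e (n - 1) + e n\<close> at the end, this is
  \<open>e 1 - e n\<close>, and \<open>D_gamma'\<close> is \<open>e 1 + e n\<close>.\<close>

definition D_gamma :: "nat => nat => real" where
  "D_gamma n a = (if 1 <= a \<and> a <= n - 1 then 1 else 0)"

definition D_gamma' :: "nat => nat => real" where
  "D_gamma' n a = (if 1 <= a \<and> a <= n - 2 \<or> a = n then 1 else 0)"

definition D_sum :: "nat => nat => (nat => real) => real" where
  "D_sum n b g = (\<Sum>a\<leftarrow>D_neighbours n b. g a)"

text \<open>Roots orthogonal to \<open>D_gamma\<close> and \<open>D_gamma'\<close>: the simple roots \<open>2, ..., n - 2\<close> for \<open>j <= n\<close>, and three more.\<close>

definition D_M :: "nat => nat => nat => real" where
  "D_M n j a = (if j <= n then (if a = j then 1 else 0)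
    else if j = n + 1 then (if a >= n - 2 then 1 else 0)
    else if j = n + 2 then (if a <= 2 then 1 else 0) else 1)"

text \<open>Sums with free parts avoid truncated subtraction, so that the simplifier can decide
  which positions coincide.\<close>

lemma D_cases:
  fixes n b :: nat
  assumes "n >= 4" "b <= n"
  obtains (1) k where "n = k + 4" "b = 0" | (2) k where "n = k + 4" "b = 1"
    | (3) k where "n = k + 4" "b = k + 3" | (4) k where "n = k + 4" "b = k + 4"
    | (5) "n = 4" "b = 2" | (6) k where "n = k + 5" "b = 2" | (7) k where "n = k + 5" "b = k + 3"
    | (8) k l where "n = k + l + 6" "b = k + 3"
proof -
  obtain k where k: "n = k + 4" using assms(1) by (metis add.commute le_Suc_ex)
  consider "b = 0" | "b = 1" | "b = k + 3" | "b = k + 4" | "b = 2" | "b >= 3" "b <= k + 2"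
    using assms(2) k by linarith
  then show ?thesis
  proof cases
    case 5
    then show ?thesis using that(5,6) k by (cases k) auto
  next
    case 6
    obtain c where c: "b = c + 3" using 6(1) by (metis add.commute le_Suc_ex)
    obtain l where "k = c + 1 + l" using 6(2) c by (intro that[of "k - c - 1"]) simp
    then show ?thesis using that(7,8) k c by (cases l) auto
  qed (use that(1-4) k in blast)+
qed

lemma D_sum_simps:
  fixes n :: nat
  assumes "n >= 4"
  shows "D_sum n 0 g = g 2" "D_sum n 1 g = g 2" "D_sum n (Suc 0) g = g 2"
    "D_sum n (n - 1) g = g (n - 2)" "D_sum n (n - Suc 0) g = g (n - 2)" "D_sum n n g = g (n - 2)"
proof -
  obtain k where "n = k + 4" using assms by (metis add.commute le_Suc_ex)
  then show "D_sum n 0 g = g 2" "D_sum n 1 g = g 2" "D_sum n (Suc 0) g = g 2"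
    "D_sum n (n - 1) g = g (n - 2)" "D_sum n (n - Suc 0) g = g (n - 2)" "D_sum n n g = g (n - 2)"
    by (simp_all add: D_sum_def D_neighbours_def)
qed

lemma D_neighbours_less:
  fixes n a b :: nat
  assumes "n >= 4" "a < b" "b <= n"
  shows "a \<in> set (D_neighbours n b) \<longleftrightarrow> a >= 1 \<and> b = a + 1 \<and> b < n \<or> a = 0 \<and> b = 2 \<or> a = n - 2 \<and> b = n"
    and "b \<in> set (D_neighbours n a) \<longleftrightarrow> a >= 1 \<and> b = a + 1 \<and> b < n \<or> a = 0 \<and> b = 2 \<or> a = n - 2 \<and> b = n"
proof -
  obtain k where k: "n = k + 4" using assms(1) by (metis add.commute le_Suc_ex)
  have s: "n - 1 = k + 3" "n - 2 = k + 2" using k by auto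
  consider "b = 1" | "b = n" | "b = n - 1" | "2 <= b" "b <= n - 2" using assms s by linarith
  then show "a \<in> set (D_neighbours n b) \<longleftrightarrow> a >= 1 \<and> b = a + 1 \<and> b < n \<or> a = 0 \<and> b = 2 \<or> a = n - 2 \<and> b = n"
    using assms unfolding D_neighbours_def s by cases (auto simp: k)
  consider "a = 0" | "a = 1" | "a = n - 1" | "2 <= a" "a <= n - 2" using assms s by linarith
  then show "b \<in> set (D_neighbours n a) \<longleftrightarrow> a >= 1 \<and> b = a + 1 \<and> b < n \<or> a = 0 \<and> b = 2 \<or> a = n - 2 \<and> b = n"
    using assms unfolding D_neighbours_def s by cases (auto simp: k)
qed

context coxeter_system
begin

context
  fixes n :: nat and f
  assumes n: "n >= 4" and f: "bij_betw f {..n} (UNIV :: 'i set)"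
    and M: "!!a b. a < b ==> b <= n ==> m (f a) (f b) =
      (if a >= 1 \<and> b = a + 1 \<and> b < n \<or> a = 0 \<and> b = 2 \<or> a = n - 2 \<and> b = n then 3 else 2)"
begin

lemma D_entry:
  assumes "a <= n" "b <= n" "a ~= b"
  shows "2 * form_entry (f a) (f b) = - (if a \<in> set (D_neighbours n b) then 1 else 0)"
proof -
  consider "a < b" | "b < a" using assms by linarith
  then show ?thesis
  proof cases
    case 1
    show ?thesis
      using M[OF 1 assms(2)] D_neighbours_less(1)[OF n 1 assms(2)] form_entry_values(1)[of "f a" "f b"] by auto
  next
    case 2
    show ?thesis
      using M[OF 2 assms(1)] D_neighbours_less(2)[OF n 2 assms(1)] form_entry_values(1)[of "f b" "f a"]
        form_entry_sym[of "f a" "f b"] by auto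
  qed
qed

abbreviation "D_idx \<equiv> inv_into {..n} f"

lemma D_neighbour_sum: "neighbour_sum D_idx n (%_. 1) (D_sum n)"
proof -
  have nb: "distinct (D_neighbours n b) \<and> set (D_neighbours n b) \<subseteq> {..n} - {b}" if "b <= n" for b
    by (rule D_cases[OF n that]; simp add: D_neighbours_def)
  have "neighbour_sum D_idx n (%_. 1) (%b g. \<Sum>a\<leftarrow>D_neighbours n b. 1 * g a)"
    by (rule neighbour_sumI(1)[OF f _ nb, where w = "%_ _. 1"]) (use D_entry in auto)
  then show ?thesis unfolding D_sum_def[abs_def] by simp
qed

lemma D_null: "b <= n ==> D_sum n b (D_delta n) = 2 * D_delta n b"
  by (elim D_cases[OF n]; simp add: D_sum_def D_neighbours_def D_delta_def D_gamma_def D_gamma'_def)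

lemma D_gamma_step:
  assumes "b <= n"
  shows "D_delta n b - D_gamma n b =
      D_sum n b (%a. if a < b then D_delta n a - D_gamma n a else D_gamma n a) - D_gamma n b"
    and "D_gamma n b = D_sum n b (%a. if a < b then D_gamma n a else D_delta n a - D_gamma n a)
      - (D_delta n b - D_gamma n b)"
    and "D_delta n b - D_gamma' n b =
      D_sum n b (%a. if a < b then D_delta n a - D_gamma' n a else D_gamma' n a) - D_gamma' n b"
proof -
  show "D_delta n b - D_gamma n b =
      D_sum n b (%a. if a < b then D_delta n a - D_gamma n a else D_gamma n a) - D_gamma n b"
    by (rule D_cases[OF n assms]; simp add: D_sum_def D_neighbours_def D_delta_def D_gamma_def D_gamma'_def)
  show "D_gamma n b = D_sum n b (%a. if a < b then D_gamma n a else D_delta n a - D_gamma n a)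
      - (D_delta n b - D_gamma n b)"
    by (rule D_cases[OF n assms]; simp add: D_sum_def D_neighbours_def D_delta_def D_gamma_def D_gamma'_def)
  show "D_delta n b - D_gamma' n b =
      D_sum n b (%a. if a < b then D_delta n a - D_gamma' n a else D_gamma' n a) - D_gamma' n b"
    by (rule D_cases[OF n assms]; simp add: D_sum_def D_neighbours_def D_delta_def D_gamma_def D_gamma'_def)
qed

lemma D_crystallographic: "crystallographic (%_. 1)"
proof -
  have "2 * form_entry i j \<in> \<int>" for i j
  proof (cases "i = j")
    case False
    have "f (D_idx i) = i" "f (D_idx j) = j" "D_idx i <= n" "D_idx j <= n"
      using f bij_betw_inv_into[OF f] by (auto simp: bij_betw_def f_inv_into_f)
    moreover from this have "D_idx i ~= D_idx j" using False by metis
    ultimately show ?thesis using D_entry[of "D_idx i" "D_idx j"] by simp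
  qed simp
  then show ?thesis by (simp add: crystallographic_def)
qed

text \<open>Along the path the coefficients of the root are constant; its defect from harmonicity is
  therefore concentrated at the four leaves.\<close>

lemma D_form_gamma: "2 * form (fvector D_idx (%_. 1) (D_gamma n)) (fvector D_idx (%_. 1) h) =
    h 1 + h (n - 1) - h 0 - h n"
  and D_form_gamma': "2 * form (fvector D_idx (%_. 1) (D_gamma' n)) (fvector D_idx (%_. 1) h) =
    h 1 + h n - h 0 - h (n - 1)"
proof -
  have s: "(\<Sum>b\<le>n. h b * c b) = (\<Sum>b\<in>{0, 1, n - 1, n}. h b * c b)"
    if "!!b. b <= n ==> b ~: {0, 1, n - 1, n} ==> c b = (0::real)" for c
    using that n by (intro sum.mono_neutral_right) auto
  have c1: "2 * D_gamma n b - D_sum n b (D_gamma n) = (if b = 0 \<or> b = n then -1 else if b = 1 \<or> b = n - 1 then 1 else 0)"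
    if "b <= n" for b
    by (rule D_cases[OF n that]; simp add: D_sum_def D_neighbours_def D_delta_def D_gamma_def D_gamma'_def)
  have c2: "2 * D_gamma' n b - D_sum n b (D_gamma' n) = (if b = 0 \<or> b = n - 1 then -1 else if b = 1 \<or> b = n then 1 else 0)"
    if "b <= n" for b
    by (rule D_cases[OF n that]; simp add: D_sum_def D_neighbours_def D_delta_def D_gamma_def D_gamma'_def)
  have "(\<Sum>b\<le>n. h b * (2 * D_gamma n b - D_sum n b (D_gamma n)) * 1\<^sup>2) =
      (\<Sum>b\<le>n. h b * (if b = 0 \<or> b = n then -1 else if b = 1 \<or> b = n - 1 then 1 else 0))"
    by (rule sum.cong) (simp_all add: c1)
  also have "... = h 1 + h (n - 1) - h 0 - h n"
    using n by (subst s) auto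
  finally show "2 * form (fvector D_idx (%_. 1) (D_gamma n)) (fvector D_idx (%_. 1) h) =
      h 1 + h (n - 1) - h 0 - h n"
    using form_fvector[OF D_neighbour_sum] by simp
  have "(\<Sum>b\<le>n. h b * (2 * D_gamma' n b - D_sum n b (D_gamma' n)) * 1\<^sup>2) =
      (\<Sum>b\<le>n. h b * (if b = 0 \<or> b = n - 1 then -1 else if b = 1 \<or> b = n then 1 else 0))"
    by (rule sum.cong) (simp_all add: c2)
  also have "... = h 1 + h n - h 0 - h (n - 1)"
    using n by (subst s) auto
  finally show "2 * form (fvector D_idx (%_. 1) (D_gamma' n)) (fvector D_idx (%_. 1) h) =
      h 1 + h n - h 0 - h (n - 1)"
    using form_fvector[OF D_neighbour_sum] by simp
qed

lemma D_unit_root: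
  assumes "b <= n" "!!a. a <= n ==> g a = (if a = b then 1 else 0)"
  shows "fvector D_idx (%_. 1) g \<in> roots"
  using root_fvector_unit[OF D_neighbour_sum assms] by simp

lemma D_reflect_root:
  assumes "fvector D_idx (%_. 1) g \<in> roots" "b <= n"
    and "!!a. a <= n ==> h a = (if a = b then D_sum n b g - g b else g a)"
  shows "fvector D_idx (%_. 1) h \<in> roots"
  using root_fvector_reflect[OF D_neighbour_sum, of 1 g b h] assms by simp

lemma D_chain_root:
  assumes "e = n - 1 \<or> e = n" "1 <= k" "k <= n - 1"
  shows "fvector D_idx (%_. 1) (%a. if k <= a \<and> a <= n - 2 \<or> a = e then 1 else 0) \<in> roots"
  using assms(3,2)
proof (induction k rule: inc_induct)
  case base
  then show ?case using n assms(1) by (intro D_unit_root[of e]) auto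
next
  case (step k)
  have "D_sum n k (%a. if Suc k <= a \<and> a <= n - 2 \<or> a = e then 1 else 0) = 1"
    using assms(1) step by (cases rule: D_cases[OF n, of k]) (auto simp: D_sum_def D_neighbours_def)
  then show ?case
    using n step assms(1) by (intro D_reflect_root[where b = k, OF step.IH]) auto
qed

lemma D_ancient:
  assumes irr: is_irreducible and aff: is_affine
  shows ancient
proof -
  let ?v = "fvector D_idx (%_. 1)" and ?xs = "natural_listing D_idx n"
  note ns = D_neighbour_sum
  note simps = fvector_simps[OF ns]
  define J where "J = {2..n - 2} \<union> {n + 1, n + 2, n + 3}"
  \<comment> \<open>The roots orthogonal to both \<open>\<gamma>\<close> form D(n - 2) on the
    coordinates from 2 to \<open>n - 1\<close>. The weights add two null combinations: the one of
    its affine diagram, and the one of the cycle that the all-ones root closes. The latter root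
    makes the family suffice for \<open>n = 4\<close> as well.\<close>
  define w where "w = (%j. if j <= n then 1 + (if j <= n - 3 then 1 else 0) + (if j >= 3 then 1 else 0) else 1 :: real)"
  have w: "w j > 0" for j by (simp add: w_def)
  obtain k :: "real ^ 'i => real" where k: "!!b. b \<in> (%j. ?v (D_M n j)) ` J ==> k b > 0"
    "(\<Sum>b\<in>(%j. ?v (D_M n j)) ` J. k b *\<^sub>R b) = (\<Sum>j\<in>J. w j *\<^sub>R ?v (D_M n j))"
    by (rule family_weights[of J w "%j. ?v (D_M n j)"]) (simp add: J_def, rule w, blast)
  have sum: "(\<Sum>j\<in>J. w j *\<^sub>R ?v (D_M n j)) = ?v (%a. 2 * D_delta n a)"
  proof -
    have "(\<Sum>j\<in>J. w j * D_M n j a) = 2 * D_delta n a" if "a <= n" for a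
    proof -
      have "(\<Sum>j\<in>J. w j * D_M n j a) = (\<Sum>j\<in>{2..n - 2}. w j * D_M n j a) + (\<Sum>j\<in>{n + 1, n + 2, n + 3}. w j * D_M n j a)"
        unfolding J_def by (rule sum.union_disjoint) auto
      also have "(\<Sum>j\<in>{2..n - 2}. w j * D_M n j a) = (\<Sum>j\<in>{2..n - 2}. if j = a then w a else 0)"
        using n by (intro sum.cong) (auto simp: D_M_def)
      also have "... = (if 2 <= a \<and> a <= n - 2 then w a else 0)" by simp
      finally show ?thesis
        by (cases rule: D_cases[OF n that]) (simp_all add: D_M_def w_def D_delta_def)
    qed
    moreover have "(\<Sum>j\<in>J. w j *\<^sub>R ?v (D_M n j)) = ?v (%a. \<Sum>j\<in>J. w j * D_M n j a)"
      by (simp add: fvector_def vec_eq_iff)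
    ultimately show ?thesis using fvector_eq_iff[OF ns] by simp
  qed
  have cyc: "fold reflection ?xs (?v (D_gamma n)) = ?v (D_delta n) - ?v (D_gamma n)"
    "fold reflection ?xs (?v (D_gamma' n)) = ?v (D_delta n) - ?v (D_gamma' n)"
    unfolding simps by (intro fold_natural_listing_full[OF ns] D_gamma_step; assumption)+
  have fold_roots: "fold reflection ys v \<in> roots" if "v \<in> roots" for ys v
    using foldr_reflection_roots[OF that, of "rev ys"] by (simp add: foldr_conv_fold)
  have g: "?v (D_gamma n) \<in> roots"
  proof -
    have "?v (D_gamma n) = ?v (%a. if 1 <= a \<and> a <= n - 2 \<or> a = n - 1 then 1 else 0)"
      unfolding fvector_eq_iff[OF ns] using n by (auto simp: D_gamma_def)
    then show ?thesis using D_chain_root[of "n - 1" 1] n by simp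
  qed
  have g': "?v (D_gamma' n) \<in> roots"
    using D_chain_root[of n 1] n unfolding D_gamma'_def[abs_def] by simp
  have dg: "?v (D_delta n) - ?v (D_gamma n) \<in> roots" "?v (D_delta n) - ?v (D_gamma' n) \<in> roots"
    unfolding cyc[symmetric] by (intro fold_roots g g')+
  have J: "finite J" by (simp add: J_def)
  have M_root: "?v (D_M n j) \<in> roots" if jJ: "j \<in> J" for j
  proof -
    consider "2 <= j" "j <= n - 2" | "j = n + 1" | "j = n + 2" | "j = n + 3"
      using jJ by (auto simp: J_def)
    then show ?thesis
    proof cases
      case 1
      then show ?thesis using n by (intro D_unit_root[of j]) (auto simp: D_M_def)
    next
      case 2
      have "?v (%a. if a = n - 2 then 1 else 0) \<in> roots"
        using n by (intro D_unit_root) auto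
      then have "?v (%a. if a = n - 2 \<or> a = n - 1 then 1 else 0) \<in> roots"
        using n by (elim D_reflect_root[where b = "n - 1"]) (auto simp: D_sum_simps)
      then show ?thesis
        using n 2 by (elim D_reflect_root[where b = n]) (auto simp: D_sum_simps D_M_def)
    next
      case 3
      have "?v (%a. if a = 2 then 1 else 0) \<in> roots"
        using n by (intro D_unit_root) auto
      then have "?v (%a. if a = 0 \<or> a = 2 then 1 else 0) \<in> roots"
        using n by (elim D_reflect_root[where b = 0]) (auto simp: D_sum_simps)
      then show ?thesis
        using n 3 by (elim D_reflect_root[where b = 1]) (auto simp: D_sum_simps D_M_def)
    next
      case 4
      have "?v (%a. if a = 1 \<or> a = n - 1 then 0 else 1) \<in> roots"
        using dg(1) n unfolding simps
        by (subst fvector_eq_iff[OF ns, THEN iffD2, of _ "%b. D_delta n b - D_gamma n b"])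
          (auto simp: D_delta_def D_gamma_def)
      then have "?v (%a. if a = n - 1 then 0 else 1) \<in> roots"
        using n by (elim D_reflect_root[where b = 1]) (auto simp: D_sum_simps)
      then show ?thesis
        using n 4 by (elim D_reflect_root[where b = "n - 1"]) (auto simp: D_sum_simps D_M_def)
    qed
  qed
  define S where "S = {?v (D_gamma n), ?v (D_gamma' n)} \<union> (%j. ?v (D_M n j)) ` J"
  let ?u = "%b a. if a = b then 1 else (0 :: real)"
  have S: "?v (D_gamma n) \<in> span S" "?v (D_gamma' n) \<in> span S" "!!j. j \<in> J ==> ?v (D_M n j) \<in> span S"
    by (auto simp: S_def intro: span_base)
  have mid: "?v (?u b) \<in> span S" if "2 <= b" "b <= n - 2" for b
  proof -
    have "D_M n b = ?u b" using that by (auto simp: D_M_def)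
    then show ?thesis using S(3)[of b] that by (simp add: J_def)
  qed
  \<comment> \<open>\<open>M\<close> supplies the sum of the two last unit vectors, and
    \<open>D_gamma\<close> minus \<open>D_gamma'\<close> is their difference.\<close>
  have e1: "?v (?u (n - 1)) = (1 / 2) *\<^sub>R (?v (D_M n (n + 1)) - ?v (?u (n - 2)) + (?v (D_gamma n) - ?v (D_gamma' n)))"
    unfolding simps fvector_eq_iff[OF ns]
    by (intro allI impI, erule D_cases[OF n]; simp add: D_M_def D_gamma_def D_gamma'_def)
  have un1: "?v (?u (n - 1)) \<in> span S"
    unfolding e1 using n by (intro span_scale span_add span_diff S mid) (auto simp: J_def)
  have e2: "?v (?u n) = ?v (D_M n (n + 1)) - ?v (?u (n - 2)) - ?v (?u (n - 1))"
    unfolding simps fvector_eq_iff[OF ns]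
    by (intro allI impI, erule D_cases[OF n]; simp add: D_M_def)
  have un: "?v (?u n) \<in> span S"
    unfolding e2 using n by (intro span_diff S mid un1) (auto simp: J_def)
  have e3: "?v (?u 1) = ?v (D_gamma n) - ?v (?u (n - 1)) - (\<Sum>b\<in>{2..n - 2}. ?v (?u b))"
  proof -
    have s: "(\<Sum>b\<in>{2..n - 2}. ?v (?u b)) = ?v (%a. \<Sum>b\<in>{2..n - 2}. ?u b a)"
      by (simp add: fvector_def vec_eq_iff)
    show ?thesis
      unfolding s simps fvector_eq_iff[OF ns]
      by (intro allI impI, erule D_cases[OF n]; simp add: D_gamma_def)
  qed
  have u1: "?v (?u 1) \<in> span S"
    unfolding e3 by (intro span_diff span_sum S mid un1) auto
  have e4: "?v (?u 0) = ?v (D_M n (n + 2)) - ?v (?u 1) - ?v (?u 2)"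
    unfolding simps fvector_eq_iff[OF ns]
    by (intro allI impI, erule D_cases[OF n]; simp add: D_M_def)
  have u0: "?v (?u 0) \<in> span S"
    unfolding e4 using n by (intro span_diff S mid u1) (auto simp: J_def)
  have unit: "simple_root i = ?v (?u (D_idx i))" for i
    using fvector_unit[OF ns ns_idx_le[OF ns, of i]] ns_inv'[OF ns, of i] by simp
  have span: "simple_root i \<in> span S" for i
  proof -
    have "D_idx i <= n" by (rule ns_idx_le[OF ns])
    then consider "D_idx i = 0" | "D_idx i = 1" | "D_idx i = n - 1" | "D_idx i = n" | "2 <= D_idx i" "D_idx i <= n - 2"
      using n by linarith
    then show ?thesis unfolding unit using u0 u1 un1 un mid by cases simp_all
  qed
  \<comment> \<open>Whole rounds alternate between the root and its complement in
    \<open>\<delta>\<close>.\<close>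
  define G where "G = (%k :: nat. if even k then D_gamma n else (%a. D_delta n a - D_gamma n a))"
  have G: "G (Suc k) b = D_sum n b (%a. if a < b then G (Suc k) a else G k a) - G k b" if "b <= n" for k b
  proof (cases "even k")
    case True
    then have eqs: "G k = D_gamma n" "G (Suc k) = (%a. D_delta n a - D_gamma n a)"
      by (simp_all add: G_def)
    show ?thesis unfolding eqs by (rule D_gamma_step(1)[OF that])
  next
    case False
    then have eqs: "G k = (%a. D_delta n a - D_gamma n a)" "G (Suc k) = D_gamma n"
      by (simp_all add: G_def)
    show ?thesis unfolding eqs by (rule D_gamma_step(2)[OF that])
  qed
  have G0: "D_gamma n = G 0" by (simp add: G_def)
  have orbit: "\<exists>j k. j <= n \<and> free_orbit ?xs (?v (D_gamma n)) t = ?v (%a. if a < j then G (Suc k) a else G k a)" for t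
  proof (intro exI conjI)
    show "t mod Suc n <= n" using mod_less_divisor[of "Suc n" t] by simp
    show "free_orbit ?xs (?v (D_gamma n)) t =
        ?v (%a. if a < t mod Suc n then G (Suc (t div Suc n)) a else G (t div Suc n) a)"
      unfolding G0 by (rule free_orbit_natural_listing[where g = G, OF ns]) (rule G)
  qed
  have "\<exists>L. is_convex L \<and> L ~= {} \<and> ~ heavy_listing L ?xs"
  proof (rule trap_A1A1[OF irr aff D_crystallographic natural_listing_nonempty[OF ns],
        of "?v (D_gamma n)" "?v (D_gamma' n)" "?v (D_delta n)" "(%j. ?v (D_M n j)) ` J" k])
    show "form (?v (D_gamma n)) (?v (D_gamma' n)) = 0"
    proof -
      have "D_gamma' n 1 = 1" "D_gamma' n (n - 1) = 0" "D_gamma' n 0 = 0" "D_gamma' n n = 1"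
        using n by (auto simp: D_gamma'_def)
      then show ?thesis using D_form_gamma[of "D_gamma' n"] by simp
    qed
    show "form \<rho> (?v (D_gamma n)) + form \<rho> (?v (D_gamma' n)) \<in> \<int>" if "\<rho> \<in> roots" for \<rho>
    proof -
      \<comment> \<open>Each product alone may be a half integer, for instance at
        \<open>n - 1\<close>; in the sum these halves cancel or complete each other.\<close>
      have "form (simple_root i) (?v (D_gamma n) + ?v (D_gamma' n)) \<in> \<int>" for i
      proof -
        have "2 * form (simple_root i) (?v (D_gamma n) + ?v (D_gamma' n)) =
            2 * (?u (D_idx i) 1 - ?u (D_idx i) 0)"
          unfolding unit form_add_right distrib_left
          using D_form_gamma[of "?u (D_idx i)"] D_form_gamma'[of "?u (D_idx i)"]
            form_sym[of "?v (?u (D_idx i))"] by simp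
        then have "form (simple_root i) (?v (D_gamma n) + ?v (D_gamma' n)) = ?u (D_idx i) 1 - ?u (D_idx i) 0"
          by (metis mult_left_cancel zero_neq_numeral)
        then show ?thesis by simp
      qed
      from root_form_Ints[OF D_crystallographic this that] show ?thesis by (simp add: form_add_right)
    qed
    show "form (?v (D_delta n)) v = 0" for v
      by (rule fvector_null[OF ns]) (rule D_null)
    show "?v (D_delta n) $ i > 0" for i by (simp add: fvector_def D_delta_def)
    show "nonneg (?v (D_delta n) - ?v (D_gamma n))"
      unfolding simps by (rule fvector_nonneg[OF ns]) (simp add: D_delta_def D_gamma_def)
    show "nonneg (free_orbit ?xs (?v (D_gamma n)) t)" for t
    proof -
      obtain j k where "free_orbit ?xs (?v (D_gamma n)) t = ?v (%a. if a < j then G (Suc k) a else G k a)"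
        using orbit by blast
      then show ?thesis
        by (auto intro!: fvector_nonneg[OF ns] simp: G_def D_gamma_def D_delta_def)
    qed
    show "c *\<^sub>R ?v (D_delta n) ~= simple_root i + free_orbit ?xs (?v (D_gamma n)) t" for t i c
    proof
      assume eq: "c *\<^sub>R ?v (D_delta n) = simple_root i + free_orbit ?xs (?v (D_gamma n)) t"
      obtain j k where j: "j <= n" and
        fo: "free_orbit ?xs (?v (D_gamma n)) t = ?v (%a. if a < j then G (Suc k) a else G k a)"
        using orbit by blast
      have "c *\<^sub>R ?v (D_delta n) = ?v (?u (D_idx i)) + ?v (%a. if a < j then G (Suc k) a else G k a)"
        using eq unfolding fo unit .
      then have e: "c * D_delta n a = ?u (D_idx i) a + (if a < j then G (Suc k) a else G k a)" if "a <= n" for a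
        unfolding simps fvector_eq_iff[OF ns] using that by blast
      have n': "0 < n" "1 <= n" "2 <= n" "n - 1 <= n" "2 ~= n - 1" "2 ~= n" using n by auto
      \<comment> \<open>Proportionality to \<open>\<delta>\<close> is tested at the four leaves and
        at 2; the simple root changes at most one of these coordinates.\<close>
      show False
        using e[of 0] e[of 1] e[of 2] e[of "n - 1"] e[of n] n j
        by (cases "even k"; cases "D_idx i = 2"; cases "D_idx i = 0")
          (auto simp: G_def D_gamma_def D_delta_def split: if_splits)
    qed
    show "nonneg b" if "b \<in> (%j. ?v (D_M n j)) ` J" for b
      using that by (auto intro!: fvector_nonneg[OF ns] simp: D_M_def)
    show "form b (?v (D_gamma n)) = 0 \<and> form b (?v (D_gamma' n)) = 0" if bM: "b \<in> (%j. ?v (D_M n j)) ` J" for b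
    proof -
      obtain j where j: "j \<in> J" "b = ?v (D_M n j)" using bM by blast
      then have "D_M n j 1 + D_M n j (n - 1) - D_M n j 0 - D_M n j n = 0" "D_M n j 1 + D_M n j n - D_M n j 0 - D_M n j (n - 1) = 0"
      proof -
        obtain k where k: "n = k + 4" using n by (metis add.commute le_Suc_ex)
        consider "2 <= j" "j <= n - 2" | "j = n + 1" | "j = n + 2" | "j = n + 3"
          using j(1) by (auto simp: J_def)
        then show "D_M n j 1 + D_M n j (n - 1) - D_M n j 0 - D_M n j n = 0"
          "D_M n j 1 + D_M n j n - D_M n j 0 - D_M n j (n - 1) = 0"
          unfolding k by (cases; simp add: D_M_def)+
      qed
      then show ?thesis
        using D_form_gamma[of "D_M n j"] D_form_gamma'[of "D_M n j"] j form_sym[of b] by simp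
    qed
    show "form (\<Sum>b\<in>(%j. ?v (D_M n j)) ` J. k b *\<^sub>R b) v = 0" for v
      unfolding k(2) sum by (rule fvector_null[OF ns])
        (use D_null in \<open>simp add: D_sum_def sum_list_const_mult\<close>)
    show "simple_root i \<in> span ({?v (D_gamma n), ?v (D_gamma' n)} \<union> (%j. ?v (D_M n j)) ` J)" for i
      using span unfolding S_def .
  qed (use g g' dg cyc k(1) M_root J in auto)
  then obtain L where L: "is_convex L" "L ~= {}" "~ heavy_listing L ?xs" by blast
  have "m (f 0) (f 1) = 2" using M[of 0 1] n by simp
  note m01 = this
  have parent: "\<exists>p. \<forall>a<l. a ~= p --> m (f a) (f l) = 2" if l: "3 <= l" "l <= n" for l
    using M[of _ l] l n by (intro exI[of _ "if l = n then n - 2 else l - 1"]) auto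
  have n2: "n >= 2" using n by simp
  show ?thesis
    by (rule ancientI[OF elimination_order_fork[OF f n2 m01 parent] natural_listing_props[OF ns] L])
qed

end

lemma ancient_D:
  assumes is_irreducible is_affine type_D
  shows ancient
proof -
  obtain n where n: "n >= 4" "has_coxeter_matrix n (%a b.
     if a >= 1 \<and> b = a + 1 \<and> b < n \<or> a = 0 \<and> b = 2 \<or> a = n - 2 \<and> b = n then 3 else 2)"
    using assms(3) by (auto simp: type_D_def)
  obtain f where "bij_betw f {..n} UNIV" "!!a b. a < b ==> b <= n ==> m (f a) (f b) =
      (if a >= 1 \<and> b = a + 1 \<and> b < n \<or> a = 0 \<and> b = 2 \<or> a = n - 2 \<and> b = n then 3 else 2)"
    using has_coxeter_matrixE[OF n(2)] by blast
  from D_ancient[OF n(1) this assms(1,2)] show ?thesis .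
qed

section \<open>Type B\<close>

lemma root_induct [consumes 1, case_names simple reflection]:
  assumes "\<beta> \<in> roots" "!!i. P (simple_root i)" "!!i v. P v ==> P (reflection i v)"
  shows "P \<beta>"
proof -
  obtain w i where w: "w \<in> carrier W" "\<beta> = action w (simple_root i)" using assms(1) by (rule rootsE)
  obtain xs where "w = word_prod W s xs" using w(1) by (rule word_prod_surjE)
  moreover have "P (foldr reflection xs (simple_root i))" by (induction xs) (use assms(2,3) in auto)
  ultimately show ?thesis by (simp add: w(2) action_word_prod)
qed

lemma root_reflection_root:
  assumes "\<gamma> \<in> roots" "\<beta> \<in> roots"
  shows "\<beta> - (2 * form \<beta> \<gamma>) *\<^sub>R \<gamma> \<in> roots"
proof -
  obtain t where "t \<in> carrier W" "!!v. action t v = v - (2 * form v \<gamma>) *\<^sub>R \<gamma>"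
    by (rule reflection_element[OF assms(1)]) blast
  then show ?thesis using action_roots[of t \<beta>] assms(2) by simp
qed

lemma free_orbit_scaleR: "free_orbit xs (c *\<^sub>R v) t = c *\<^sub>R free_orbit xs v t"
  by (induction t) (simp_all add: linear_scale[OF reflection_linear])

lemma nonneg_scaleR_iff: "c > 0 ==> nonneg (c *\<^sub>R v) \<longleftrightarrow> nonneg v"
  by (auto simp: nonneg_def zero_le_mult_iff)

text \<open>The usual coordinates: the roots are \<open>\<plusminus>e a + k \<delta>\<close> and \<open>(\<plusminus>e a \<plusminus> e b + k \<delta>) / sqrt 2\<close>.\<close>

definition B_coordinates :: "nat => (nat => 'i) => (nat => real ^ 'i) => real ^ 'i => bool" where
  "B_coordinates n f e \<delta> \<longleftrightarrow> n >= 3 \<and> bij_betw f {..n} UNIV \<and>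
    (\<forall>k\<in>{1..n}. \<forall>l\<in>{1..n}. form (e k) (e l) = (if k = l then 1 else 0)) \<and> (\<forall>v. form \<delta> v = 0) \<and>
    sqrt 2 *\<^sub>R simple_root (f 0) = \<delta> - e 1 - e 2 \<and>
    (\<forall>k\<in>{1..<n}. sqrt 2 *\<^sub>R simple_root (f k) = e k - e (Suc k)) \<and> simple_root (f n) = e n"

context
  fixes n f e \<delta>
  assumes B: "B_coordinates n f e \<delta>"
begin

lemma B_n: "n >= 3" and B_bij: "bij_betw f {..n} UNIV"
  and B_orth: "!!k l. 1 <= k ==> k <= n ==> 1 <= l ==> l <= n ==> form (e k) (e l) = (if k = l then 1 else 0)"
  and B_null: "!!v. form \<delta> v = 0"
  and B_simple: "sqrt 2 *\<^sub>R simple_root (f 0) = \<delta> - e 1 - e 2"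
    "!!k. 1 <= k ==> k < n ==> sqrt 2 *\<^sub>R simple_root (f k) = e k - e (Suc k)"
    "simple_root (f n) = e n"
  using B by (auto simp: B_coordinates_def)

lemma B_null': "form v \<delta> = 0"
  using B_null form_sym by metis

lemma B_simple':
  "simple_root (f 0) = (1 / sqrt 2) *\<^sub>R (\<delta> - e 1 - e 2)"
  "1 <= k ==> k < n ==> simple_root (f k) = (1 / sqrt 2) *\<^sub>R (e k - e (Suc k))"
proof -
  have *: "v = (1 / sqrt 2) *\<^sub>R (sqrt 2 *\<^sub>R v)" for v :: "real ^ 'i" by simp
  show "simple_root (f 0) = (1 / sqrt 2) *\<^sub>R (\<delta> - e 1 - e 2)"
    unfolding B_simple(1)[symmetric] by (rule *)
  show "simple_root (f k) = (1 / sqrt 2) *\<^sub>R (e k - e (Suc k))" if "1 <= k" "k < n"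
    unfolding B_simple(2)[OF that, symmetric] by (rule *)
qed

lemma B_index: obtains b where "b <= n" "i = f b"
  using B_bij by (metis UNIV_I atMost_iff bij_betw_def imageE)

lemma B_reflection_simple: "reflection (f 0) v = v - form v (\<delta> - e 1 - e 2) *\<^sub>R (\<delta> - e 1 - e 2)"
  "1 <= k ==> k < n ==> reflection (f k) v = v - form v (e k - e (Suc k)) *\<^sub>R (e k - e (Suc k))"
  "reflection (f n) v = v - (2 * form v (e n)) *\<^sub>R e n"
  by (simp_all add: reflection_def B_simple' B_simple(3) form_scaleR_right)

lemma B_reflection:
  assumes "1 <= a" "a <= n"
  shows "reflection (f 0) (e a) = (if a = 1 then \<delta> - e 2 else if a = 2 then \<delta> - e 1 else e a)"
    "1 <= k ==> k < n ==> reflection (f k) (e a) = (if a = k then e (Suc k) else if a = Suc k then e k else e a)"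
    "reflection (f n) (e a) = (if a = n then - e n else e a)"
    "reflection i \<delta> = \<delta>"
proof -
  show "reflection (f 0) (e a) = (if a = 1 then \<delta> - e 2 else if a = 2 then \<delta> - e 1 else e a)"
    using B_n assms by (simp add: B_reflection_simple form_linear B_orth B_null')
  show "reflection (f k) (e a) = (if a = k then e (Suc k) else if a = Suc k then e k else e a)" if "1 <= k" "k < n"
    using assms that by (simp add: B_reflection_simple form_linear B_orth B_null')
  show "reflection (f n) (e a) = (if a = n then - e n else e a)"
    using B_n assms by (simp add: B_reflection_simple form_linear B_orth B_null' scaleR_2)
  show "reflection i \<delta> = \<delta>" by (simp add: reflection_def B_null)
qed

definition "B_signed = {\<sigma> *\<^sub>R e a + of_int k *\<^sub>R \<delta> | \<sigma> a k. (\<sigma> = 1 \<or> \<sigma> = -1) \<and> 1 <= a \<and> a <= n}"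

lemma B_signedI: "\<sigma> = 1 \<or> \<sigma> = -1 ==> 1 <= a ==> a <= n ==> v = \<sigma> *\<^sub>R e a + of_int k *\<^sub>R \<delta> ==> v \<in> B_signed"
  unfolding B_signed_def by blast

lemma B_signed_reflection:
  assumes "v \<in> B_signed"
  shows "reflection i v \<in> B_signed"
proof -
  obtain b where b: "b <= n" "i = f b" by (rule B_index)
  obtain \<sigma> a k where v: "\<sigma> = 1 \<or> \<sigma> = -1" "1 <= a" "a <= n" "v = \<sigma> *\<^sub>R e a + of_int k *\<^sub>R \<delta>"
    using assms unfolding B_signed_def by blast
  have lin: "reflection i v = \<sigma> *\<^sub>R reflection i (e a) + of_int k *\<^sub>R \<delta>"
    using B_reflection(4)[OF v(2,3)] by (simp add: v(4) linear_add[OF reflection_linear] linear_scale[OF reflection_linear])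
  have "\<exists>\<tau> c l. (\<tau> = 1 \<or> \<tau> = -1) \<and> 1 <= c \<and> c <= n \<and> reflection i (e a) = \<tau> *\<^sub>R e c + of_int l *\<^sub>R \<delta>"
  proof -
    consider "b = 0" | "1 <= b" "b < n" | "b = n" using b by linarith
    then show ?thesis
    proof cases
      case 1
      consider "a = 1" | "a = 2" | "a ~= 1" "a ~= 2" by blast
      then show ?thesis
      proof cases
        case 1
        with \<open>b = 0\<close> show ?thesis using B_n v b(2) B_reflection(1)[of a]
          by (intro exI[of _ "-1"] exI[of _ 2] exI[of _ 1]) simp
      next
        case 2
        with \<open>b = 0\<close> show ?thesis using B_n v b(2) B_reflection(1)[of a]
          by (intro exI[of _ "-1"] exI[of _ 1] exI[of _ 1]) simp
      next
        case 3
        with \<open>b = 0\<close> show ?thesis using B_n v b(2) B_reflection(1)[of a]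
          by (intro exI[of _ 1] exI[of _ a] exI[of _ 0]) simp
      qed
    next
      case 2
      then show ?thesis using v b(2) B_reflection(2)[of a b]
        by (intro exI[of _ 1] exI[of _ "if a = b then Suc b else if a = Suc b then b else a"] exI[of _ 0]) simp
    next
      case 3
      then show ?thesis using v b(2) B_reflection(3)[of a]
        by (intro exI[of _ "if a = n then - 1 else 1"] exI[of _ a] exI[of _ 0]) simp
    qed
  qed
  then obtain \<tau> c l where c: "\<tau> = 1 \<or> \<tau> = -1" "1 <= c" "c <= n" "reflection i (e a) = \<tau> *\<^sub>R e c + of_int l *\<^sub>R \<delta>"
    by blast
  have "reflection i v = (\<sigma> * \<tau>) *\<^sub>R e c + of_int ((if \<sigma> = 1 then l else - l) + k) *\<^sub>R \<delta>"
    unfolding lin c(4) using v(1) by (auto simp: algebra_simps)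
  then show ?thesis using v(1) c by (intro B_signedI[of "\<sigma> * \<tau>" c _ "(if \<sigma> = 1 then l else - l) + k"]) auto
qed

text \<open>The second alternative describes the long roots as normalised sums of two orthogonal
  short ones. Reflections preserve \<open>B_signed\<close> and orthogonality, so only the simple
  roots have to be inspected.\<close>

lemma B_roots:
  assumes "\<beta> \<in> roots"
  shows "\<beta> \<in> B_signed \<or> (\<exists>x\<in>B_signed. \<exists>y\<in>B_signed. form x y = 0 \<and> \<beta> = (1 / sqrt 2) *\<^sub>R (x + y))"
  using assms
proof (induction rule: root_induct)
  case (simple i)
  obtain b where b: "b <= n" "i = f b" by (rule B_index)
  then consider "b = 0" | "1 <= b" "b < n" | "b = n" by linarith
  then show ?case
  proof cases
    case 1
    have "- e 1 + \<delta> \<in> B_signed"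
      using B_n by (intro B_signedI[of "-1" 1 _ 1]) auto
    moreover have "- e 2 \<in> B_signed"
      using B_n by (intro B_signedI[of "-1" 2 _ 0]) auto
    moreover have "form (- e 1 + \<delta>) (- e 2) = 0"
      using B_n by (simp add: form_linear B_orth B_null)
    moreover have "simple_root i = (1 / sqrt 2) *\<^sub>R ((- e 1 + \<delta>) + (- e 2))"
      using 1 b(2) B_simple'(1) by (simp add: algebra_simps)
    ultimately show ?thesis by blast
  next
    case 2
    have "e b \<in> B_signed"
      using 2 by (intro B_signedI[of 1 b _ 0]) auto
    moreover have "- e (Suc b) \<in> B_signed"
      using 2 by (intro B_signedI[of "-1" "Suc b" _ 0]) auto
    moreover have "form (e b) (- e (Suc b)) = 0"
      using 2 by (simp add: form_linear B_orth B_null)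
    moreover have "simple_root i = (1 / sqrt 2) *\<^sub>R (e b + - e (Suc b))"
      using 2 b(2) B_simple'(2)[of b] by (simp add: algebra_simps)
    ultimately show ?thesis by blast
  next
    case 3
    then have "simple_root i \<in> B_signed"
      using B_n b(2) B_simple(3) by (intro B_signedI[of 1 n _ 0]) auto
    then show ?thesis by blast
  qed
next
  case (reflection i v)
  then show ?case
  proof
    assume "\<exists>x\<in>B_signed. \<exists>y\<in>B_signed. form x y = 0 \<and> v = (1 / sqrt 2) *\<^sub>R (x + y)"
    then obtain x y where xy: "x \<in> B_signed" "y \<in> B_signed" "form x y = 0" "v = (1 / sqrt 2) *\<^sub>R (x + y)" by blast
    have "reflection i v = (1 / sqrt 2) *\<^sub>R (reflection i x + reflection i y)"
      by (simp only: xy(4) linear_add[OF reflection_linear] linear_scale[OF reflection_linear])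
    moreover have "form (reflection i x) (reflection i y) = 0" using xy(3) by simp
    ultimately show ?thesis using B_signed_reflection[OF xy(1), of i] B_signed_reflection[OF xy(2), of i] by blast
  qed (use B_signed_reflection in blast)
qed

lemma B_e_root: "1 <= a ==> a <= n ==> e a \<in> roots"
proof -
  assume a: "1 <= a" "a <= n"
  show ?thesis
    using a(2,1)
  proof (induction a rule: inc_induct)
    case base
    show ?case using B_simple(3) by (metis simple_root_in_roots)
  next
    case (step k)
    then show ?case using reflection_roots[OF step.IH, of "f k"] B_reflection(2)[of "Suc k" k] by simp
  qed
qed

lemma B_delta_e_root: "1 <= a ==> a <= n ==> \<delta> - e a \<in> roots"
proof (induction a rule: dec_induct)
  case base
  have "reflection (f 0) (e 2) = \<delta> - e 1" using B_reflection(1)[of 2] B_n by simp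
  then show ?case using reflection_roots[OF B_e_root[of 2], of "f 0"] B_n by simp
next
  case (step k)
  have "reflection (f k) (\<delta> - e k) = \<delta> - e (Suc k)"
    using step B_reflection(2)[of k k] B_reflection(4)[of k] by (simp add: linear_diff[OF reflection_linear])
  then show ?case using reflection_roots[OF step.IH, of "f k"] step by simp
qed

lemma B_diff_root:
  assumes "1 <= a" "a < b" "b <= n"
  shows "(1 / sqrt 2) *\<^sub>R (e a - e b) \<in> roots"
proof -
  have "Suc a <= b" using assms by simp
  then show ?thesis using assms(3)
  proof (induction b rule: dec_induct)
    case base
    then show ?case using assms(1) B_simple'(2)[of a] simple_root_in_roots[of "f a"] by simp
  next
    case (step k)
    have "reflection (f k) ((1 / sqrt 2) *\<^sub>R (e a - e k)) = (1 / sqrt 2) *\<^sub>R (e a - e (Suc k))"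
      using step assms(1) B_reflection(2)[of k k] B_reflection(2)[of a k]
      by (simp add: linear_diff[OF reflection_linear] linear_scale[OF reflection_linear])
    then show ?case using reflection_roots[OF step.IH, of "f k"] step by simp
  qed
qed

text \<open>The reflection in the short root \<open>e b\<close> changes the sign of
  \<open>e b\<close> alone.\<close>

lemma B_flip:
  assumes "1 <= b" "b <= n" "c *\<^sub>R (v - e b) \<in> roots" "form v (e b) = 0"
  shows "c *\<^sub>R (v + e b) \<in> roots"
proof -
  have "c *\<^sub>R (v - e b) - (2 * form (c *\<^sub>R (v - e b)) (e b)) *\<^sub>R e b = c *\<^sub>R (v + e b)"
    using assms by (simp add: form_linear B_orth algebra_simps scaleR_2 flip: scaleR_add_left)
  then show ?thesis using root_reflection_root[OF B_e_root[OF assms(1,2)] assms(3)] by simp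
qed

lemma B_special_roots:
  shows "(1 / sqrt 2) *\<^sub>R (\<delta> - e 2 - e 3) \<in> roots" "(1 / sqrt 2) *\<^sub>R (\<delta> + e 2 + e 3) \<in> roots"
    "(1 / sqrt 2) *\<^sub>R (\<delta> - e 2 + e 3) \<in> roots" "(1 / sqrt 2) *\<^sub>R (e 2 + e 3) \<in> roots"
    "4 <= d ==> d <= n ==> (1 / sqrt 2) *\<^sub>R (\<delta> - e 1 - e d) \<in> roots"
proof -
  have a0: "(1 / sqrt 2) *\<^sub>R (\<delta> - e 1 - e 2) \<in> roots"
    using B_simple'(1) by (metis simple_root_in_roots)
  note form = form_linear B_orth B_null B_null'
  show 1: "(1 / sqrt 2) *\<^sub>R (\<delta> - e 2 - e 3) \<in> roots"
    using root_reflection_root[OF B_diff_root[of 1 3] a0] B_n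
    by (simp add: form algebra_simps flip: scaleR_add_left)
  show 3: "(1 / sqrt 2) *\<^sub>R (\<delta> - e 2 + e 3) \<in> roots"
    using B_flip[OF _ _ 1] B_n by (simp add: form)
  have "(1 / sqrt 2) *\<^sub>R (\<delta> + e 3 - e 2) \<in> roots" using 3 by (simp add: algebra_simps)
  from B_flip[OF _ _ this] show "(1 / sqrt 2) *\<^sub>R (\<delta> + e 2 + e 3) \<in> roots"
    using B_n by (simp add: form algebra_simps)
  show "(1 / sqrt 2) *\<^sub>R (e 2 + e 3) \<in> roots"
    using B_flip[OF _ _ B_diff_root[of 2 3]] B_n by (simp add: form)
  show "(1 / sqrt 2) *\<^sub>R (\<delta> - e 1 - e d) \<in> roots" if "4 <= d" "d <= n"
    using root_reflection_root[OF B_diff_root[of 2 d] a0] B_n that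
    by (simp add: form algebra_simps flip: scaleR_add_left)
qed

end

section \<open>The mirrors and the trap of type B\<close>

context
  fixes n f e \<delta> c
  assumes B: "B_coordinates n f e \<delta>"
    and c_pos: "!!a. c a > 0"
    and e_nth: "!!k a. 1 <= k ==> k <= n ==> a <= n ==> e k $ f a = (if k <= a then c a else 0)"
    and \<delta>_nth: "!!a. a <= n ==> \<delta> $ f a = (if a <= 1 then c a else 2 * c a)"
begin

lemma B_nonnegI:
  assumes "!!a. a <= n ==> v $ f a >= 0"
  shows "nonneg v"
proof -
  have "v $ i >= 0" for i by (rule B_index[OF B, of i]) (use assms in blast)
  then show ?thesis by (simp add: nonneg_def)
qed

lemma B_delta_pos: "\<delta> $ i > 0"
  by (rule B_index[OF B, of i]) (simp add: \<delta>_nth c_pos)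

definition "B_gamma = (1 / sqrt 2) *\<^sub>R (e 2 - e 3)"

text \<open>The flag distinguishes two roots whose sum is a multiple of \<open>\<delta>\<close>.
  This pairing gives the null combination that \<open>trap\<close> asks for.\<close>

definition B_mirror :: "bool \<times> nat => real ^ 'i" where
  "B_mirror = (%(p, d). if d = 3 then (1 / sqrt 2) *\<^sub>R (if p then \<delta> + (e 2 + e 3) else \<delta> - (e 2 + e 3))
    else if p then e d else \<delta> - e d)"

definition "B_mirrors = B_mirror ` (UNIV \<times> {3..n})"

text \<open>All group elements that satisfy the two requirements of \<open>trap\<close>, not only
  translations. Symmetries that fix \<open>B_gamma\<close> and permute the mirrors act on this set
  from the right, and they are used to move roots of \<open>R(L)\<close> around.\<close>

definition "B_traps = {x \<in> carrier W. nonneg (- action x B_gamma) \<and> (\<forall>b\<in>B_mirrors. nonneg (action x b))}"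

lemma B_mirrors_iff: "b \<in> B_mirrors \<longleftrightarrow> b = (1 / sqrt 2) *\<^sub>R (\<delta> + (e 2 + e 3)) \<or>
    b = (1 / sqrt 2) *\<^sub>R (\<delta> - (e 2 + e 3)) \<or> (\<exists>d. 4 <= d \<and> d <= n \<and> (b = e d \<or> b = \<delta> - e d))"
  (is "_ \<longleftrightarrow> ?rhs")
proof
  assume "b \<in> B_mirrors"
  then obtain p d where pd: "3 <= d" "d <= n" "b = B_mirror (p, d)" by (auto simp: B_mirrors_def)
  show ?rhs
  proof (cases "d = 3")
    case True
    then show ?thesis using pd(3) by (cases p) (simp_all add: B_mirror_def)
  next
    case False
    then show ?thesis using pd by (cases p) (auto simp: B_mirror_def intro!: exI[of _ d])
  qed
next
  assume ?rhs
  then consider "b = B_mirror (True, 3)" | "b = B_mirror (False, 3)"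
    | d where "4 <= d" "d <= n" "b = B_mirror (True, d)" | d where "4 <= d" "d <= n" "b = B_mirror (False, d)"
    by (auto simp: B_mirror_def)
  then show "b \<in> B_mirrors"
    using B_n[OF B] by cases (simp_all add: B_mirrors_def)
qed

lemma B_mirrors_elims:
  assumes "b \<in> B_mirrors"
  obtains (1) "b = (1 / sqrt 2) *\<^sub>R (\<delta> + (e 2 + e 3))" | (2) "b = (1 / sqrt 2) *\<^sub>R (\<delta> - (e 2 + e 3))"
    | (3) d where "4 <= d" "d <= n" "b = e d" | (4) d where "4 <= d" "d <= n" "b = \<delta> - e d"
  using assms unfolding B_mirrors_iff by blast

lemmas B_form = form_linear B_orth[OF B] B_null[OF B] B_null'[OF B]

lemma B_gamma_simple: "simple_root (f 2) = B_gamma"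
  using B_simple'(2)[OF B, of 2] B_n[OF B] by (simp add: B_gamma_def)

lemma B_mirror_orth: "b \<in> B_mirrors ==> form b B_gamma = 0"
  using B_n[OF B] by (elim B_mirrors_elims) (simp_all add: B_gamma_def B_form)

lemma B_mirror_roots: "b \<in> B_mirrors ==> b \<in> roots"
  using B_n[OF B] B_special_roots(1,2)[OF B] B_e_root[OF B] B_delta_e_root[OF B]
  by (elim B_mirrors_elims) (simp_all add: add.assoc diff_diff_eq)

lemma B_mirror_nonneg: "b \<in> B_mirrors ==> nonneg b"
  using B_n[OF B] c_pos by (elim B_mirrors_elims; intro B_nonnegI) (simp_all add: e_nth \<delta>_nth less_imp_le)

lemma B_trapsI:
  assumes "x \<in> carrier W" "nonneg (- action x B_gamma)" "!!b. b \<in> B_mirrors ==> action x b = b"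
  shows "x \<in> B_traps"
  using assms B_mirror_nonneg by (simp add: B_traps_def)

lemma B_traps_mult:
  assumes "x \<in> B_traps" "h \<in> carrier W" "action h B_gamma = B_gamma"
    "!!b. b \<in> B_mirrors ==> action h b \<in> B_mirrors"
  shows "x \<otimes> h \<in> B_traps"
  using assms by (auto simp: B_traps_def)

lemma B_reflection_mirror: "b \<in> B_mirrors ==> reflection (f 2) b = b"
  using B_mirror_orth[of b] by (simp add: reflection_def B_gamma_simple)

lemma B_gamma_norm: "form B_gamma B_gamma = 1"
  using B_n[OF B] by (simp add: B_gamma_def B_form)

lemma B_reflection_gamma: "reflection (f 2) B_gamma = - B_gamma"
  by (simp add: reflection_def B_gamma_simple B_gamma_norm scaleR_2)

lemma B_gamma_nonneg: "nonneg B_gamma"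
  by (metis B_gamma_simple nonneg_simple)

lemma B_generator_traps: "s (f 2) \<in> B_traps"
  using B_gamma_nonneg B_reflection_mirror by (intro B_trapsI) (simp_all add: B_reflection_gamma)

text \<open>The generator \<open>s (f 2)\<close> negates \<open>B_gamma\<close> and fixes the
  mirrors. Translations along \<open>e 1\<close> in both directions may follow it, and translations
  along \<open>B_gamma\<close> in one direction; long ones bound the products of
  \<open>\<rho>\<close>.\<close>

lemma B_traps_form:
  assumes R: "!!x. x \<in> B_traps ==> nonneg (action x \<rho>)"
  shows "form \<rho> (e 1) = 0" "form \<rho> B_gamma <= 0"
proof -
  let ?\<rho> = "reflection (f 2) \<rho>"
  have 1: "form ?\<rho> (e 1) = form \<rho> (e 1)"
    using B_n[OF B] by (simp add: reflection_def B_gamma_simple form_linear B_gamma_def B_orth[OF B])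
  have "nonneg (?\<rho> + (2 * of_int k * form \<rho> (e 1)) *\<^sub>R \<delta>)" for k :: int
  proof -
    obtain t where t: "t \<in> carrier W" "!!v. action t v = v + (2 * real_of_int k * form v (e 1)) *\<^sub>R \<delta>"
      by (rule int_translation_element[of "e 1" \<delta> k])
        (use B_e_root[OF B, of 1] B_delta_e_root[OF B, of 1] B_n[OF B] B_null[OF B] in auto)
    have "t \<otimes> s (f 2) \<in> B_traps"
    proof (rule B_trapsI)
      have "form B_gamma (e 1) = 0" using B_n[OF B] by (simp add: B_gamma_def B_form)
      then show "nonneg (- action (t \<otimes> s (f 2)) B_gamma)"
        using t(1) B_gamma_nonneg by (simp add: B_reflection_gamma t(2) form_minus_left)
      fix b assume b: "b \<in> B_mirrors"
      then have "form b (e 1) = 0" using B_n[OF B] by (elim B_mirrors_elims) (simp_all add: B_form)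
      then show "action (t \<otimes> s (f 2)) b = b"
        using t(1) b by (simp add: B_reflection_mirror t(2))
    qed (use t(1) in simp)
    from R[OF this] show ?thesis using t(1) 1 by (simp add: t(2))
  qed
  note * = this
  have "nonneg (?\<rho> + (0 + real k * (2 * form \<rho> (e 1))) *\<^sub>R \<delta>)" for k
    using *[of "int k"] by (simp add: mult_ac)
  then have "2 * form \<rho> (e 1) >= 0" by (rule nonneg_ray[OF B_delta_pos])
  moreover have "nonneg (?\<rho> + (0 + real k * (- 2 * form \<rho> (e 1))) *\<^sub>R \<delta>)" for k
    using *[of "- int k"] by (simp add: mult_ac)
  then have "- 2 * form \<rho> (e 1) >= 0" by (rule nonneg_ray[OF B_delta_pos])
  ultimately show "form \<rho> (e 1) = 0" by simp
  have 2: "form ?\<rho> B_gamma = - form \<rho> B_gamma"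
    by (simp add: reflection_def B_gamma_simple form_linear B_gamma_norm)
  have "nonneg (?\<rho> + (0 + real k * (- (2 / sqrt 2) * form \<rho> B_gamma)) *\<^sub>R \<delta>)" for k
  proof -
    have root: "B_gamma \<in> roots" by (metis B_gamma_simple simple_root_in_roots)
    have root': "(1 / sqrt 2) *\<^sub>R \<delta> - B_gamma \<in> roots"
      using B_special_roots(3)[OF B] by (simp add: B_gamma_def algebra_simps)
    obtain t where t: "t \<in> carrier W"
      "!!v. action t v = v + (2 * real k * form v B_gamma) *\<^sub>R ((1 / sqrt 2) *\<^sub>R \<delta>)"
      by (rule translation_element[OF root root', of k]) (use B_null[OF B] in \<open>auto simp: form_scaleR_left\<close>)
    have "t \<otimes> s (f 2) \<in> B_traps"
    proof (rule B_trapsI)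
      have "nonneg (B_gamma + (2 * real k / sqrt 2) *\<^sub>R \<delta>)"
        using B_delta_pos B_gamma_nonneg
        by (intro nonneg_add nonneg_scaleR) (auto simp: nonneg_def less_imp_le)
      then show "nonneg (- action (t \<otimes> s (f 2)) B_gamma)"
        using t(1) by (simp add: B_reflection_gamma t(2) form_minus_left B_gamma_norm add.commute)
      fix b assume "b \<in> B_mirrors"
      then show "action (t \<otimes> s (f 2)) b = b"
        using t(1) by (simp add: B_reflection_mirror t(2) B_mirror_orth)
    qed (use t in simp)
    from R[OF this] show ?thesis using t(1) 2 by (simp add: t(2) mult_ac)
  qed
  then have "- (2 / sqrt 2) * form \<rho> B_gamma >= 0" by (rule nonneg_ray[OF B_delta_pos])
  then show "form \<rho> B_gamma <= 0" by (simp add: divide_le_0_iff mult_le_0_iff)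
qed

text \<open>The reflection in \<open>e 2 + e 3\<close>, a root orthogonal to \<open>B_gamma\<close>;
  it exchanges the two special mirrors.\<close>

lemma B_swap:
  obtains h where "h \<in> carrier W" "action h B_gamma = B_gamma" "action h (e 3) = - e 2"
    "!!b. b \<in> B_mirrors ==> action h b \<in> B_mirrors"
    "!!d. 4 <= d ==> d <= n ==> action h (e d) = e d" "action h \<delta> = \<delta>"
proof -
  obtain h where h: "h \<in> carrier W"
    "!!v. action h v = v - (2 * form v ((1 / sqrt 2) *\<^sub>R (e 2 + e 3))) *\<^sub>R ((1 / sqrt 2) *\<^sub>R (e 2 + e 3))"
    by (rule reflection_element[OF B_special_roots(4)[OF B]]) blast
  have h2: "action h v = v - form v (e 2 + e 3) *\<^sub>R (e 2 + e 3)" for v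
    unfolding h(2) by (simp add: form_scaleR_right)
  show ?thesis
  proof (rule that[OF h(1)])
    show "action h B_gamma = B_gamma" using B_n[OF B] by (simp add: h2 B_gamma_def B_form)
    show "action h (e 3) = - e 2" using B_n[OF B] by (simp add: h2 B_form)
    show "action h (e d) = e d" if "4 <= d" "d <= n" for d using that by (simp add: h2 B_form)
    show "action h \<delta> = \<delta>" by (simp add: h2 B_form)
    show "action h b \<in> B_mirrors" if "b \<in> B_mirrors" for b
      using that
    proof (cases rule: B_mirrors_elims)
      case 1
      have "action h b = (1 / sqrt 2) *\<^sub>R (\<delta> - (e 2 + e 3))"
        using B_n[OF B] by (simp add: 1 h2 B_form algebra_simps flip: scaleR_2 scaleR_add_left)
      then show ?thesis by (simp add: B_mirrors_iff)
    next
      case 2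
      have "action h b = (1 / sqrt 2) *\<^sub>R (\<delta> + (e 2 + e 3))"
        using B_n[OF B] by (simp add: 2 h2 B_form algebra_simps flip: scaleR_2 scaleR_add_left)
      then show ?thesis by (simp add: B_mirrors_iff)
    next
      case (3 d)
      have "action h b = b" using 3 by (simp add: h2 B_form)
      then show ?thesis using that by simp
    next
      case (4 d)
      have "action h b = b" using 4 by (simp add: h2 B_form)
      then show ?thesis using that by simp
    qed
  qed
qed

text \<open>The reflection that exchanges \<open>e 1\<close> and \<open>e d\<close>, followed by the
  one that takes \<open>e 1\<close> to \<open>\<delta> - e d\<close>. Among the mirrors it exchanges
  \<open>e d\<close> and its complement only; \<open>e 1\<close> serves as an auxiliary
  direction.\<close>

lemma B_turn:
  assumes d: "4 <= d" "d <= n"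
  obtains h where "h \<in> carrier W" "action h B_gamma = B_gamma" "action h (e 2) = e 2" "action h (e 3) = e 3"
    "!!b. b \<in> B_mirrors ==> action h b \<in> B_mirrors" "action h (\<delta> - e d) = e d" "action h \<delta> = \<delta>"
proof -
  obtain h where h: "h \<in> carrier W"
    "!!v. action h v = v - (2 * form v ((1 / sqrt 2) *\<^sub>R (\<delta> - e 1 - e d))) *\<^sub>R ((1 / sqrt 2) *\<^sub>R (\<delta> - e 1 - e d))"
    by (rule reflection_element[OF B_special_roots(5)[OF B d]]) blast
  have h2: "action h v = v - form v (\<delta> - e 1 - e d) *\<^sub>R (\<delta> - e 1 - e d)" for v
    unfolding h(2) by (simp add: form_scaleR_right)
  have "1 <= (1 :: nat)" "1 < d" using d by auto
  obtain k where k: "k \<in> carrier W"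
    "!!v. action k v = v - (2 * form v ((1 / sqrt 2) *\<^sub>R (e 1 - e d))) *\<^sub>R ((1 / sqrt 2) *\<^sub>R (e 1 - e d))"
    by (rule reflection_element[OF B_diff_root[OF B \<open>1 <= 1\<close> \<open>1 < d\<close> d(2)]]) blast
  have k2: "action k v = v - form v (e 1 - e d) *\<^sub>R (e 1 - e d)" for v
    unfolding k(2) by (simp add: form_scaleR_right)
  have fix_e: "action (h \<otimes> k) (e a) = e a" if "a ~= 1" "a ~= d" "1 <= a" "a <= n" for a
    using that h(1) k(1) d by (simp add: h2 k2 B_form)
  have ed: "action (h \<otimes> k) (e d) = \<delta> - e d"
    using h(1) k(1) d by (simp add: h2 k2 B_form)
  have delta: "action (h \<otimes> k) \<delta> = \<delta>"
    using h(1) k(1) by (simp add: h2 k2 B_form)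
  have hk: "h \<otimes> k \<in> carrier W" using h(1) k(1) by simp
  note lin = linear_add[OF action_linear[OF hk]] linear_diff[OF action_linear[OF hk]] linear_scale[OF action_linear[OF hk]]
  show ?thesis
  proof (rule that[OF hk])
    show "action (h \<otimes> k) B_gamma = B_gamma"
      using B_n[OF B] d fix_e[of 2] fix_e[of 3] by (simp add: B_gamma_def lin del: action_mult)
    show "action (h \<otimes> k) (e 2) = e 2" "action (h \<otimes> k) (e 3) = e 3" using fix_e[of 2] fix_e[of 3] d by auto
    show "action (h \<otimes> k) (\<delta> - e d) = e d" by (simp add: lin ed delta del: action_mult)
    show "action (h \<otimes> k) \<delta> = \<delta>" by (rule delta)
    show "action (h \<otimes> k) b \<in> B_mirrors" if "b \<in> B_mirrors" for b
      using that
    proof (cases rule: B_mirrors_elims)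
      case 1
      then have "action (h \<otimes> k) b = b" using fix_e[of 2] fix_e[of 3] d by (simp add: lin delta del: action_mult)
      then show ?thesis using that by simp
    next
      case 2
      then have "action (h \<otimes> k) b = b" using fix_e[of 2] fix_e[of 3] d by (simp add: lin delta del: action_mult)
      then show ?thesis using that by simp
    next
      case (3 a)
      then have "action (h \<otimes> k) b = (if a = d then \<delta> - e d else e a)" using ed fix_e[of a] by simp
      then show ?thesis using 3 d by (auto simp: B_mirrors_iff)
    next
      case (4 a)
      then have "action (h \<otimes> k) b = (if a = d then e d else \<delta> - e a)"
        using ed fix_e[of a] by (simp add: lin delta del: action_mult)
      then show ?thesis using 4 d by (auto simp: B_mirrors_iff)
    qed
  qed
qed

text \<open>By the symmetries of the trap it is enough to treat \<open>z = - e 2\<close> and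
  \<open>Y = 0\<close> or \<open>Y = e d\<close>. There the generator \<open>s (f 2)\<close> alone
  belongs to the trap and forces a bound at one coordinate.\<close>

lemma B_level:
  assumes R: "!!x. x \<in> B_traps ==> nonneg (action x \<rho>)"
    and \<rho>: "\<rho> = r *\<^sub>R (z + Y + of_int \<kappa> *\<^sub>R \<delta>)" "r > 0" "z = e 3 \<or> z = - e 2"
    and Y: "Y = 0 \<or> (\<exists>d. 4 <= d \<and> d <= n \<and> (Y = e d \<or> Y = \<delta> - e d))"
  shows "\<kappa> >= 1"
proof -
  have base: "\<kappa> >= 1" if R: "nonneg (action (s (f 2)) (r *\<^sub>R (- e 2 + Y + of_int \<kappa> *\<^sub>R \<delta>)))"
    and Y: "Y = 0 \<or> (\<exists>d. 4 <= d \<and> d <= n \<and> Y = e d)" for Y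
  proof -
    have "reflection (f 2) (e 2) = e 3"
      using B_reflection(2)[OF B, of 2 2] B_n[OF B] by simp
    moreover have "reflection (f 2) Y = Y"
      using Y B_n[OF B] B_reflection(2)[OF B, of _ 2] by (auto simp: linear_0[OF reflection_linear])
    moreover have "reflection (f 2) \<delta> = \<delta>" by (simp add: reflection_def B_null[OF B])
    ultimately have "reflection (f 2) (- e 2 + Y + of_int \<kappa> *\<^sub>R \<delta>) = - e 3 + Y + of_int \<kappa> *\<^sub>R \<delta>"
      using reflection_linear by (simp add: linear_add linear_neg linear_diff linear_scale)
    then have "action (s (f 2)) (r *\<^sub>R (- e 2 + Y + of_int \<kappa> *\<^sub>R \<delta>)) = r *\<^sub>R (- e 3 + Y + of_int \<kappa> *\<^sub>R \<delta>)"
      by (subst action_simps(4)) simp_all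
    then have "nonneg (r *\<^sub>R (- e 3 + Y + of_int \<kappa> *\<^sub>R \<delta>))"
      using R by (rule subst)
    then have "(- e 3 + Y + of_int \<kappa> *\<^sub>R \<delta>) $ f 3 >= 0"
      unfolding nonneg_scaleR_iff[OF \<rho>(2)] unfolding nonneg_def by blast
    moreover have "Y $ f 3 = 0" using Y
    proof
      assume "\<exists>d. 4 <= d \<and> d <= n \<and> Y = e d"
      then obtain d where "4 <= d" "d <= n" "Y = e d" by blast
      then show ?thesis using e_nth[of d 3] by simp
    qed simp
    \<comment> \<open>At the vertex \<open>f 3\<close> the vector \<open>\<delta>\<close> counts
      twice, \<open>e 3\<close> once and \<open>e d\<close> with \<open>d >= 4\<close> not at all;
      an odd number \<open>2 \<kappa> - 1\<close> is nonnegative only for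
      \<open>\<kappa> >= 1\<close>.\<close>
    then have "(- e 3 + Y + of_int \<kappa> *\<^sub>R \<delta>) $ f 3 = c 3 * (2 * of_int \<kappa> - 1)"
      using B_n[OF B] by (simp add: e_nth \<delta>_nth algebra_simps)
    ultimately have "c 3 * (2 * of_int \<kappa> - 1) >= 0" by simp
    then have "2 * of_int \<kappa> - 1 >= (0 :: real)" using c_pos[of 3] by (simp add: zero_le_mult_iff)
    then show ?thesis by linarith
  qed
  obtain h where h: "h \<in> carrier W" "action h B_gamma = B_gamma" "action h (e 3) = - e 2"
      "!!b. b \<in> B_mirrors ==> action h b \<in> B_mirrors"
      "!!d. 4 <= d ==> d <= n ==> action h (e d) = e d" "action h \<delta> = \<delta>"
    using B_swap by blast
  have step: "\<kappa> >= 1" if R: "!!x. x \<in> B_traps ==> nonneg (action x (r *\<^sub>R (z + Y + of_int \<kappa> *\<^sub>R \<delta>)))"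
    and Y: "Y = 0 \<or> (\<exists>d. 4 <= d \<and> d <= n \<and> Y = e d)" for Y
  proof (cases "z = e 3")
    case True
    have "s (f 2) \<otimes> h \<in> B_traps" by (rule B_traps_mult[OF B_generator_traps h(1,2,4)])
    moreover have "action h Y = Y" using Y h(5) linear_0[OF action_linear[OF h(1)]] by auto
    then have "action h (r *\<^sub>R (z + Y + of_int \<kappa> *\<^sub>R \<delta>)) = r *\<^sub>R (- e 2 + Y + of_int \<kappa> *\<^sub>R \<delta>)"
      using True h(3,6) action_linear[OF h(1)] by (simp only: linear_add linear_scale)
    ultimately have "nonneg (action (s (f 2)) (r *\<^sub>R (- e 2 + Y + of_int \<kappa> *\<^sub>R \<delta>)))"
      using R[of "s (f 2) \<otimes> h"] action_mult[OF generator_carrier h(1)] by simp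
    then show ?thesis using Y by (rule base)
  next
    case False
    then show ?thesis using R[OF B_generator_traps] \<rho>(3) Y base by blast
  qed
  show ?thesis
  proof (cases "\<exists>d. 4 <= d \<and> d <= n \<and> Y = \<delta> - e d")
    case False
    then show ?thesis using Y R \<rho> step by blast
  next
    case True
    then obtain d where d: "4 <= d" "d <= n" "Y = \<delta> - e d" by blast
    obtain k where k: "k \<in> carrier W" "action k B_gamma = B_gamma" "action k (e 2) = e 2" "action k (e 3) = e 3"
      "!!b. b \<in> B_mirrors ==> action k b \<in> B_mirrors" "action k (\<delta> - e d) = e d" "action k \<delta> = \<delta>"
      using B_turn[OF d(1,2)] by blast
    have "action k z = z" using \<rho>(3) k(3,4) linear_neg[OF action_linear[OF k(1)]] by auto
    then have "action k \<rho> = r *\<^sub>R (z + e d + of_int \<kappa> *\<^sub>R \<delta>)"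
      using k(6,7) action_linear[OF k(1)] unfolding \<rho>(1) d(3) by (simp only: linear_add linear_scale)
    moreover have "nonneg (action x (action k \<rho>))" if "x \<in> B_traps" for x
    proof -
      have "x \<in> carrier W" using that by (simp add: B_traps_def)
      then show ?thesis using R[OF B_traps_mult[OF that k(1,2,5)]] k(1) by simp
    qed
    ultimately show ?thesis using d step[of "e d"] by auto
  qed
qed

text \<open>If \<open>\<rho>\<close> becomes the simple root \<open>\<alpha>\<close>, then a positive combination of the positive roots \<open>b\<close> and
  \<open>\<delta> - u (e 2 - e 3)\<close> (up to scaling) is a multiple of \<open>\<alpha>\<close>; but these are orthogonal.\<close>

lemma B_core:
  assumes R: "!!x. x \<in> B_traps ==> nonneg (action x \<rho>)"
    and \<rho>: "\<rho> = r *\<^sub>R (z + Y + of_int \<kappa> *\<^sub>R \<delta>)" "r > 0" "z = e 3 \<or> z = - e 2"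
    and Y: "Y = 0 \<or> (\<exists>d. 4 <= d \<and> d <= n \<and> (Y = e d \<or> Y = \<delta> - e d))"
    and u: "u \<in> carrier W" "!!b. b \<in> B_mirrors ==> nonneg (action u b)"
      "nonneg (\<delta> - action u (e 2 - e 3))" "action u \<rho> = simple_root i"
  shows False
proof -
  have \<kappa>: "\<kappa> >= 1" using B_level[OF R \<rho> Y] .
  note lin = linear_add[OF action_linear[OF u(1)]] linear_diff[OF action_linear[OF u(1)]]
    linear_scale[OF action_linear[OF u(1)]] linear_neg[OF action_linear[OF u(1)]]
  define b where "b = (if z = e 3 then \<delta> + (e 2 + e 3) else \<delta> - (e 2 + e 3))"
  define p where "p = \<delta> - (e 2 - e 3)"
  \<comment> \<open>Here the level enters: the two copies of \<open>\<delta>\<close> that are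
    missing on the right are supplied by \<open>\<kappa> >= 1\<close>.\<close>
  have z: "2 *\<^sub>R z = b + p - 2 *\<^sub>R \<delta>"
    using \<rho>(3) unfolding b_def p_def by (auto simp: scaleR_2)
  have "(1 / sqrt 2) *\<^sub>R b \<in> B_mirrors" by (simp add: b_def B_mirrors_iff)
  from u(2)[OF this] have b: "nonneg (action u b)" by (simp add: lin nonneg_scaleR_iff)
  have \<delta>: "action u \<delta> = \<delta>"
  proof -
    obtain xs where "u = word_prod W s xs" using u(1) by (rule word_prod_surjE)
    then show ?thesis
      using B_null[OF B] by (simp add: action_word_prod foldr_reflection_fixes_orthogonal)
  qed
  then have p: "nonneg (action u p)" using u(3) by (simp add: p_def lin)
  have Y': "nonneg (action u Y)"
    using Y u(2) linear_0[OF action_linear[OF u(1)]] by (auto simp: B_mirrors_iff nonneg_def)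
  have "(2 * r) *\<^sub>R \<rho> = (2 * r * r) *\<^sub>R (z + Y + of_int \<kappa> *\<^sub>R \<delta>)" by (simp add: \<rho>(1))
  have "(2 / r) *\<^sub>R \<rho> = 2 *\<^sub>R z + 2 *\<^sub>R Y + (2 * of_int \<kappa>) *\<^sub>R \<delta>"
    using \<rho>(2) by (simp add: \<rho>(1) scaleR_add_right)
  also have "... = b + p + 2 *\<^sub>R Y + (2 * of_int (\<kappa> - 1)) *\<^sub>R \<delta>"
    unfolding z by (simp add: algebra_simps)
  finally have "action u ((2 / r) *\<^sub>R \<rho>) = action u (b + p + 2 *\<^sub>R Y + (2 * of_int (\<kappa> - 1)) *\<^sub>R \<delta>)" by simp
  then have eq: "(2 / r) *\<^sub>R simple_root i = action u b + action u p + 2 *\<^sub>R action u Y + (2 * of_int (\<kappa> - 1)) *\<^sub>R \<delta>"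
    by (simp only: lin \<delta> u(4))
  have zero: "action u b $ j = 0" "action u p $ j = 0" if "j ~= i" for j
  proof -
    have "0 = action u b $ j + action u p $ j + 2 * action u Y $ j + (2 * of_int (\<kappa> - 1)) * \<delta> $ j"
      using arg_cong[OF eq, of "%v. v $ j"] that by (simp add: simple_root_nth)
    moreover have "(2 * of_int (\<kappa> - 1)) * \<delta> $ j >= 0"
      using \<kappa> B_delta_pos[of j] by (intro mult_nonneg_nonneg) auto
    ultimately show "action u b $ j = 0" "action u p $ j = 0"
      using b p Y' unfolding nonneg_def by (smt (verit))+
  qed
  have multiple: "v = v $ i *\<^sub>R simple_root i" if "!!j. j ~= i ==> v $ j = 0" for v
    using that by (auto simp: vec_eq_iff simple_root_nth)
  obtain l q where lm: "action u b = l *\<^sub>R simple_root i" "action u p = q *\<^sub>R simple_root i"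
    using multiple[OF zero(1)] multiple[OF zero(2)] by metis
  have "form b p = 0" "form b b = 2" "form p p = 2"
    using B_n[OF B] by (simp_all add: b_def p_def B_form)
  then have "form (action u b) (action u p) = 0" "form (action u b) (action u b) = 2" "form (action u p) (action u p) = 2"
    using u(1) by simp_all
  then show False unfolding lm by (auto simp: form_linear)
qed

lemma B_signed_cases:
  assumes "1 <= a" "a <= n" "a ~= 1" "\<sigma> = 1 \<or> \<sigma> = -1"
  obtains (1) "\<sigma> *\<^sub>R e a = e 3 \<or> \<sigma> *\<^sub>R e a = - e 2" "form (\<sigma> *\<^sub>R e a) (e 2 - e 3) = -1"
    | (2) "form (\<sigma> *\<^sub>R e a) (e 2 - e 3) = 1"
    | (3) Y l where "\<exists>d. 4 <= d \<and> d <= n \<and> (Y = e d \<or> Y = \<delta> - e d)" "\<sigma> *\<^sub>R e a = Y + of_int l *\<^sub>R \<delta>"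
      "form (\<sigma> *\<^sub>R e a) (e 2 - e 3) = 0"
proof -
  have n: "n >= 3" by (rule B_n[OF B])
  consider "a = 2" | "a = 3" | "a >= 4" using assms by linarith
  then show ?thesis
  proof cases
    case 3
    show ?thesis
    proof (rule that(3)[of "if \<sigma> = 1 then e a else \<delta> - e a" "if \<sigma> = 1 then 0 else -1"])
      show "form (\<sigma> *\<^sub>R e a) (e 2 - e 3) = 0" using 3 n assms by (simp add: B_form)
    qed (use assms 3 in auto)
  next
    case 1
    then show ?thesis using assms(4) n that(1,2) by (auto simp: B_form)
  next
    case 2
    then show ?thesis using assms(4) n that(1,2) by (auto simp: B_form)
  qed
qed

text \<open>A root of \<open>R(L)\<close> not orthogonal to \<open>B_gamma\<close> has negative
  product with it, so it contains a summand \<open>e 3\<close> or \<open>- e 2\<close>. If the rest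
  is orthogonal to \<open>e 2 - e 3\<close>, then \<open>B_core\<close> applies; if it contains both
  summands, it is a multiple of \<open>\<delta>\<close> minus \<open>e 2 - e 3\<close>, and
  \<open>nohit\<close> applies.\<close>

lemma B_hits:
  assumes \<rho>: "\<rho> \<in> roots" and R: "!!x. x \<in> B_traps ==> nonneg (action x \<rho>)"
    and u: "u \<in> carrier W" "!!b. b \<in> B_mirrors ==> nonneg (action u b)"
      "nonneg (\<delta> - action u (e 2 - e 3))" "action u \<rho> = simple_root i"
    and nohit: "!!k :: int. sqrt 2 *\<^sub>R simple_root i + action u (e 2 - e 3) ~= of_int k *\<^sub>R \<delta>"
  shows "form \<rho> (e 1) = 0" "form \<rho> B_gamma = 0"
proof -
  have n: "n >= 3" by (rule B_n[OF B])
  have form1: "form \<rho> (e 1) = 0" by (rule B_traps_form(1)[OF R])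
  then show "form \<rho> (e 1) = 0" .
  have core: False if "\<rho> = r *\<^sub>R (z + Y + of_int \<kappa> *\<^sub>R \<delta>)" "r > 0" "z = e 3 \<or> z = - e 2"
      "Y = 0 \<or> (\<exists>d. 4 <= d \<and> d <= n \<and> (Y = e d \<or> Y = \<delta> - e d))" for r z Y \<kappa>
    by (rule B_core[OF R that u])
  show "form \<rho> B_gamma = 0"
  proof (rule ccontr)
    assume "form \<rho> B_gamma ~= 0"
    then have "form \<rho> B_gamma < 0" using B_traps_form(2)[OF R] by simp
    then have neg: "form \<rho> (e 2 - e 3) < 0" by (simp add: B_gamma_def form_scaleR_right mult_less_0_iff divide_less_0_iff)
    from B_roots[OF B \<rho>] show False
    proof
      assume "\<rho> \<in> B_signed n e \<delta>"
      then obtain \<sigma> a k where x: "\<sigma> = 1 \<or> \<sigma> = -1" "1 <= a" "a <= n" "\<rho> = \<sigma> *\<^sub>R e a + of_int k *\<^sub>R \<delta>"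
        unfolding B_signed_def[OF B] by blast
      have "a ~= 1" using form1 x n by (auto simp: x(4) B_form)
      from x(2,3) this x(1) show False
      proof (cases rule: B_signed_cases)
        case 1
        then show False using x(4) core[of 1 "\<sigma> *\<^sub>R e a" 0 k] by simp
      qed (use neg x(4) in \<open>simp_all add: form_add_left form_scaleR_left B_null[OF B]\<close>)
    next
      assume "\<exists>x\<in>B_signed n e \<delta>. \<exists>y\<in>B_signed n e \<delta>. form x y = 0 \<and> \<rho> = (1 / sqrt 2) *\<^sub>R (x + y)"
      then obtain \<sigma> a k \<tau> b l where
        x: "\<sigma> = 1 \<or> \<sigma> = -1" "1 <= a" "a <= n" and y: "\<tau> = 1 \<or> \<tau> = -1" "1 <= b" "b <= n" and
        orth: "form (\<sigma> *\<^sub>R e a + of_int k *\<^sub>R \<delta>) (\<tau> *\<^sub>R e b + of_int l *\<^sub>R \<delta>) = 0" and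
        \<rho>_eq: "\<rho> = (1 / sqrt 2) *\<^sub>R ((\<sigma> *\<^sub>R e a + of_int k *\<^sub>R \<delta>) + (\<tau> *\<^sub>R e b + of_int l *\<^sub>R \<delta>))"
        unfolding B_signed_def[OF B] by blast
      have "a ~= b" using orth x y by (auto simp: B_form)
      have "form \<rho> (e 1) = (1 / sqrt 2) * (\<sigma> * (if a = 1 then 1 else 0) + \<tau> * (if b = 1 then 1 else 0))"
        using x y n by (simp add: \<rho>_eq B_form)
      then have ab: "a ~= 1" "b ~= 1" using form1 \<open>a ~= b\<close> x(1) y(1) by (auto split: if_splits)
      have "form \<rho> (e 2 - e 3) = (1 / sqrt 2) * (form (\<sigma> *\<^sub>R e a) (e 2 - e 3) + form (\<tau> *\<^sub>R e b) (e 2 - e 3))"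
        unfolding \<rho>_eq by (simp only: form_add_left form_scaleR_left B_null[OF B]) simp
      then have sum: "form (\<sigma> *\<^sub>R e a) (e 2 - e 3) + form (\<tau> *\<^sub>R e b) (e 2 - e 3) < 0"
        using neg by (simp add: mult_less_0_iff divide_less_0_iff)
      have eq1: "\<rho> = (1 / sqrt 2) *\<^sub>R (z + Y + of_int (k + l + r) *\<^sub>R \<delta>)"
        if "\<sigma> *\<^sub>R e a = z" "\<tau> *\<^sub>R e b = Y + of_int r *\<^sub>R \<delta>" for z Y r
        unfolding \<rho>_eq that by (simp add: algebra_simps)
      have eq2: "\<rho> = (1 / sqrt 2) *\<^sub>R (z + Y + of_int (k + l + r) *\<^sub>R \<delta>)"
        if "\<tau> *\<^sub>R e b = z" "\<sigma> *\<^sub>R e a = Y + of_int r *\<^sub>R \<delta>" for z Y r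
        unfolding \<rho>_eq that by (simp add: algebra_simps)
      from x(2,3) ab(1) x(1) show False
      proof (cases rule: B_signed_cases)
        case 1
        note 1 = this
        from y(2,3) ab(2) y(1) show False
        proof (cases rule: B_signed_cases)
          \<comment> \<open>Both summands have product -1 and are different, so together they are
            \<open>- (e 2 - e 3)\<close>.\<close>
          case y1: 1
          have "\<sigma> *\<^sub>R e a ~= \<tau> *\<^sub>R e b"
          proof
            assume "\<sigma> *\<^sub>R e a = \<tau> *\<^sub>R e b"
            then have "form (\<sigma> *\<^sub>R e a) (e a) = form (\<tau> *\<^sub>R e b) (e a)" by simp
            then show False using x y \<open>a ~= b\<close> by (auto simp: B_form)
          qed
          then have "\<sigma> *\<^sub>R e a + \<tau> *\<^sub>R e b = - (e 2 - e 3)" using 1(1) y1(1) by auto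
          moreover have "\<rho> = (1 / sqrt 2) *\<^sub>R ((\<sigma> *\<^sub>R e a + \<tau> *\<^sub>R e b) + of_int (k + l) *\<^sub>R \<delta>)"
            unfolding \<rho>_eq by (simp add: algebra_simps)
          ultimately have "\<rho> = (1 / sqrt 2) *\<^sub>R (- (e 2 - e 3) + of_int (k + l) *\<^sub>R \<delta>)" by simp
          then have "sqrt 2 *\<^sub>R \<rho> = - (e 2 - e 3) + of_int (k + l) *\<^sub>R \<delta>" by simp
          then have "sqrt 2 *\<^sub>R action u \<rho> = action u (- (e 2 - e 3) + of_int (k + l) *\<^sub>R \<delta>)"
            using linear_scale[OF action_linear[OF u(1)], of "sqrt 2" \<rho>] by simp
          also have "... = - action u (e 2 - e 3) + of_int (k + l) *\<^sub>R action u \<delta>"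
            using action_linear[OF u(1)] by (simp only: linear_add linear_neg linear_scale)
          also have "action u \<delta> = \<delta>"
          proof -
            obtain xs where "u = word_prod W s xs" using u(1) by (rule word_prod_surjE)
            then show ?thesis
              using B_null[OF B] by (simp add: action_word_prod foldr_reflection_fixes_orthogonal)
          qed
          finally show False using nohit[of "k + l"] u(4) by (simp add: algebra_simps)
        next
          case 2
          then show False using 1 sum by simp
        next
          case (3 Y r)
          then show False using core[OF eq1[OF refl 3(2)]] 1(1) by simp
        qed
      next
        case 2
        note 2 = this
        from y(2,3) ab(2) y(1) show False
          by (cases rule: B_signed_cases) (use 2 sum in simp_all)
      next
        case (3 Y r)
        note 3 = this
        from y(2,3) ab(2) y(1) show False
        proof (cases rule: B_signed_cases)
          case 1
          then show False using core[OF eq2[OF refl 3(2)]] 3(1) by simp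
        qed (use 3 sum in simp_all)
      qed
    qed
  qed
qed

end

end

section \<open>Coordinates and the free orbit of type B\<close>

definition B_neighbours :: "nat => nat => nat list" where
  "B_neighbours n b = (if b = 0 \<or> b = 1 then [2] else if b = n then [n - 1]
    else if b = 2 then [0, 1, 3] else [b - 1, b + 1])"

definition B_sum :: "nat => nat => (nat => real) => real" where
  "B_sum n b g = (\<Sum>a\<leftarrow>B_neighbours n b. (if b = n then 2 else 1) * g a)"

definition B_scale :: "nat => nat => real" where
  "B_scale n b = (if b = n then 1 else sqrt 2)"

text \<open>The orbit of \<open>e 2 - e 3\<close> after whole rounds: the rescaled simple roots of
  the inner vertices from 2 to \<open>n - 1\<close>, and, for \<open>j = n\<close>, the complement
  of their sum in \<open>\<delta>\<close>.\<close>

definition B_orbit :: "nat => nat => nat => real" where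
  "B_orbit n j a = (if j = n then (if a = n then 2 else 1) else if a = j then 1 else 0)"

definition B_next :: "nat => nat => nat" where
  "B_next n j = (if j = 2 then n else j - 1)"

lemma B_cases:
  fixes n b :: nat
  assumes "n >= 3" "b <= n"
  obtains (1) k where "n = k + 3" "b = 0" | (2) k where "n = k + 3" "b = 1" | (3) "n = 3" "b = 2"
    | (4) k where "n = k + 4" "b = 2" | (5) k where "n = k + 3" "b = k + 3"
    | (6) k l where "n = k + l + 4" "b = k + 3"
proof -
  obtain k where k: "n = k + 3" using assms(1) by (metis add.commute le_Suc_ex)
  consider "b = 0" | "b = 1" | "b = 2" | "b = k + 3" | "b >= 3" "b <= k + 2"
    using assms(2) k by linarith
  then show ?thesis
  proof cases
    case 3
    then show ?thesis using that(3,4) k by (cases k) auto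
  next
    case 5
    obtain c where c: "b = c + 3" using 5(1) by (metis add.commute le_Suc_ex)
    obtain l where "k = c + 1 + l" using 5(2) c by (intro that[of "k - c - 1"]) simp
    then show ?thesis using that(6) k c by simp
  qed (use that(1,2,5) k in blast)+
qed

lemma B_orbit_step:
  assumes "n >= 3" "2 <= j" "j <= n" "b <= n"
  shows "B_orbit n (B_next n j) b =
    B_sum n b (%a. if a < b then B_orbit n (B_next n j) a else B_orbit n j a) - B_orbit n j b"
proof -
  consider "j = 2" | "j = n" | "2 < j" "j < n" using assms by linarith
  then show ?thesis
  proof cases
    case 1
    then show ?thesis using assms(1)
      by (cases rule: B_cases[OF assms(1,4)]) (simp_all add: B_sum_def B_neighbours_def B_orbit_def B_next_def)
  next
    case 2
    then show ?thesis using assms(1)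
      by (cases rule: B_cases[OF assms(1,4)]) (simp_all add: B_sum_def B_neighbours_def B_orbit_def B_next_def)
  next
    case 3
    obtain q where q: "j = q + 3" using 3(1) by (metis add.commute Suc_leI eval_nat_numeral(3) le_Suc_ex)
    have "n ~= q + 3" "n ~= q + 2" using 3 q by auto
    then show ?thesis using 3 q
      by (cases rule: B_cases[OF assms(1,4)]) (auto simp: B_sum_def B_neighbours_def B_orbit_def B_next_def)
  qed
qed

lemma B_neighbours_less:
  fixes n a b :: nat
  assumes "n >= 3" "a < b" "b <= n"
  shows "a \<in> set (B_neighbours n b) \<longleftrightarrow> a >= 1 \<and> b = a + 1 \<or> a = 0 \<and> b = 2"
    and "b \<in> set (B_neighbours n a) \<longleftrightarrow> a >= 1 \<and> b = a + 1 \<or> a = 0 \<and> b = 2"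
proof -
  show "a \<in> set (B_neighbours n b) \<longleftrightarrow> a >= 1 \<and> b = a + 1 \<or> a = 0 \<and> b = 2"
    using assms(2) by (cases rule: B_cases[OF assms(1,3)]) (auto simp: B_neighbours_def)
  have "a <= n" using assms by simp
  show "b \<in> set (B_neighbours n a) \<longleftrightarrow> a >= 1 \<and> b = a + 1 \<or> a = 0 \<and> b = 2"
    using assms(2,3) by (cases rule: B_cases[OF assms(1) \<open>a <= n\<close>]) (auto simp: B_neighbours_def)
qed

context coxeter_system
begin

lemma finite_range_natural_listing:
  assumes ns: "neighbour_sum idx n d N"
    and step: "!!k b. b <= n ==> g (Suc k) b = N b (%a. if a < b then g (Suc k) a else g k a) - g k b"
    and S: "finite S" "!!k. g k \<in> S"
  shows "finite (range (free_orbit (natural_listing idx n) (fvector idx d (g 0))))"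
proof (rule finite_subset)
  show "range (free_orbit (natural_listing idx n) (fvector idx d (g 0))) \<subseteq>
      (%((g, h), j). fvector idx d (%a. if a < j then h a else g a)) ` ((S \<times> S) \<times> {..n})"
  proof
    fix v assume "v \<in> range (free_orbit (natural_listing idx n) (fvector idx d (g 0)))"
    then obtain t where "v = free_orbit (natural_listing idx n) (fvector idx d (g 0)) t" by blast
    then have "v = fvector idx d (%a. if a < t mod Suc n then g (Suc (t div Suc n)) a else g (t div Suc n) a)"
      by (rule trans) (rule free_orbit_natural_listing[where g = g, OF ns], rule step)
    moreover have "t mod Suc n <= n" using mod_less_divisor[of "Suc n" t] by simp
    ultimately show "v \<in> (%((g, h), j). fvector idx d (%a. if a < j then h a else g a)) ` ((S \<times> S) \<times> {..n})"
      using S(2) by (intro image_eqI[of _ _ "((g (t div Suc n), g (Suc (t div Suc n))), t mod Suc n)"]) auto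
  qed
qed (use S(1) in auto)

context
  fixes n :: nat and f
  assumes n: "n >= 3" and f: "bij_betw f {..n} (UNIV :: 'i set)"
    and M: "!!a b. a < b ==> b <= n ==> m (f a) (f b) =
      (if b = a + 1 \<and> b = n then 4 else if a >= 1 \<and> b = a + 1 \<or> a = 0 \<and> b = 2 then 3 else 2)"
begin

lemma B_entry:
  assumes "a <= n" "b <= n" "a ~= b"
  shows "2 * form_entry (f a) (f b) * B_scale n a =
    - (if a \<in> set (B_neighbours n b) then (if b = n then 2 else 1) else 0) * B_scale n b"
proof -
  have *: "2 * form_entry (f a) (f b) =
      - (if a >= 1 \<and> b = a + 1 \<or> a = 0 \<and> b = 2 then (if b = n then sqrt 2 else 1) else 0)"
    if "a < b" "b <= n" for a b
    using M[OF that] that n form_entry_values(1,2)[of "f a" "f b"] by (cases "b = a + 1") auto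
  consider "a < b" | "b < a" using assms by linarith
  then show ?thesis
  proof cases
    case 1
    show ?thesis
      using *[OF 1 assms(2)] B_neighbours_less(1)[OF n 1 assms(2)] 1 assms(2) by (auto simp: B_scale_def)
  next
    case 2
    show ?thesis
      using *[OF 2 assms(1)] B_neighbours_less(2)[OF n 2 assms(1)] 2 assms(1) form_entry_sym[of "f a" "f b"]
      by (auto simp: B_scale_def)
  qed
qed

abbreviation "B_idx \<equiv> inv_into {..n} f"

lemma B_scale_pos: "B_scale n b > 0"
  by (simp add: B_scale_def)

lemma B_neighbour_sum: "neighbour_sum B_idx n (B_scale n) (B_sum n)"
  and B_inv: "b <= n ==> inv_into UNIV B_idx b = f b"
proof -
  have nb: "distinct (B_neighbours n b) \<and> set (B_neighbours n b) \<subseteq> {..n} - {b}" if "b <= n" for b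
    by (rule B_cases[OF n that]; simp add: B_neighbours_def)
  show "neighbour_sum B_idx n (B_scale n) (B_sum n)"
    unfolding B_sum_def[abs_def]
    by (rule neighbour_sumI(1)[where w = "%b _. if b = n then 2 else 1" and d = "B_scale n" and nb = "B_neighbours n",
      OF f B_scale_pos nb B_entry])
  show "inv_into UNIV B_idx b = f b" if "b <= n"
    by (rule neighbour_sumI(2)[where w = "%b _. if b = n then 2 else 1" and d = "B_scale n" and nb = "B_neighbours n",
      OF f B_scale_pos nb B_entry that])
qed

lemma B_unit: "b <= n ==> B_scale n b *\<^sub>R simple_root (f b) = fvector B_idx (B_scale n) (%a. if a = b then 1 else 0)"
  using fvector_unit[OF B_neighbour_sum, of b] B_inv[of b] by simp

definition B_e :: "nat => real ^ 'i" where
  "B_e k = fvector B_idx (B_scale n) (%a. if k <= a then 1 else 0)"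

definition B_delta :: "real ^ 'i" where
  "B_delta = fvector B_idx (B_scale n) (%a. if a <= 1 then 1 else 2)"

lemma B_form_e:
  assumes "1 <= k" "k <= n"
  shows "form (B_e k) (fvector B_idx (B_scale n) h) = h k - h (k - 1) - (if k = 2 then h 0 else 0)"
proof -
  let ?E = "%a. if k <= a then 1 else (0 :: real)"
  have "(2 * ?E b - B_sum n b ?E) * (B_scale n b)\<^sup>2 =
      (if b = k then 2 else 0) - (if b = k - 1 then 2 else 0) - (if b = 0 then (if k = 2 then 2 else 0) else 0)"
    if "b <= n" for b
  proof -
    obtain q where q: "k = Suc q" using assms(1) by (cases k) auto
    show ?thesis
      using assms(2) unfolding q
      by (cases rule: B_cases[OF n that]) (auto simp: B_sum_def B_neighbours_def B_scale_def)
  qed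
  then have "2 * form (B_e k) (fvector B_idx (B_scale n) h) =
      (\<Sum>b\<le>n. (if b = k then 2 * h k else 0) - (if b = k - 1 then 2 * h (k - 1) else 0) -
        (if b = 0 then (if k = 2 then 2 * h 0 else 0) else 0))"
    unfolding B_e_def form_fvector[OF B_neighbour_sum] mult.assoc by (intro sum.cong refl) auto
  also have "... = 2 * h k - 2 * h (k - 1) - (if k = 2 then 2 * h 0 else 0)"
    unfolding sum_subtractf using assms by (simp add: sum.delta del: sum.delta')
  finally show ?thesis by (simp split: if_splits)
qed

lemma B_coordinates: "B_coordinates n f B_e B_delta"
proof -
  note simps = fvector_simps[OF B_neighbour_sum] fvector_eq_iff[OF B_neighbour_sum]
  have orth: "form (B_e k) (B_e l) = (if k = l then 1 else 0)" if "1 <= k" "k <= n" "1 <= l" "l <= n" for k l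
    using B_form_e[OF that(1,2), of "%a. if l <= a then 1 else 0"] that unfolding B_e_def[of l] by auto
  have null: "form B_delta v = 0" for v
    unfolding B_delta_def
  proof (rule fvector_null[OF B_neighbour_sum])
    show "B_sum n b (%a. if a <= 1 then 1 else 2) = 2 * (if b <= 1 then 1 else 2)" if "b <= n" for b
      by (cases rule: B_cases[OF n that]) (simp_all add: B_sum_def B_neighbours_def)
  qed
  have sq: "sqrt 2 *\<^sub>R simple_root (f b) = fvector B_idx (B_scale n) (%a. if a = b then 1 else 0)" if "b < n" for b
    using B_unit[of b] that by (simp add: B_scale_def)
  have s0: "sqrt 2 *\<^sub>R simple_root (f 0) = fvector B_idx (B_scale n) (%a. if a = 0 then 1 else 0)"
    by (rule sq) (use n in simp)
  have "sqrt 2 *\<^sub>R simple_root (f 0) = B_delta - B_e 1 - B_e 2"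
    unfolding s0 B_delta_def B_e_def simps by auto
  moreover have "sqrt 2 *\<^sub>R simple_root (f k) = B_e k - B_e (Suc k)" if "1 <= k" "k < n" for k
    unfolding sq[OF that(2)] B_e_def simps by auto
  moreover have "simple_root (f n) = B_e n"
    using B_unit[of n] by (auto simp: B_scale_def B_e_def simps)
  ultimately show ?thesis using n f orth null by (auto simp: B_coordinates_def)
qed

lemma B_idx_f: "a <= n ==> B_idx (f a) = a"
  using f by (simp add: bij_betw_def)

lemma B_nth:
  "a <= n ==> B_e k $ f a = (if k <= a then B_scale n a else 0)"
  "a <= n ==> B_delta $ f a = (if a <= 1 then B_scale n a else 2 * B_scale n a)"
  by (simp_all add: B_e_def B_delta_def fvector_def B_idx_f)

lemma B_crystallographic: "crystallographic (%i. B_scale n (B_idx i))"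
proof -
  have "2 * form_entry i j * B_scale n (B_idx j) / B_scale n (B_idx i) \<in> \<int>" for i j
  proof (cases "i = j")
    case True
    then show ?thesis using B_scale_pos[of "B_idx i"] by (simp add: less_imp_neq[THEN not_sym])
  next
    case False
    obtain a b where ab: "a <= n" "i = f a" "b <= n" "j = f b"
      using B_index[OF B_coordinates] by metis
    moreover from this have "a ~= b" using False by blast
    ultimately have "2 * form_entry i j * B_scale n b = - (if b \<in> set (B_neighbours n a) then (if a = n then 2 else 1) else 0) * B_scale n a"
      using B_entry[of b a] False form_entry_sym[of i j] by auto
    then show ?thesis using ab B_scale_pos[of a] by (auto simp: B_idx_f)
  qed
  then show ?thesis by (simp add: crystallographic_def B_scale_pos)
qed

abbreviation "B_walk \<equiv> free_orbit (natural_listing B_idx n) (B_e 2 - B_e 3)"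

lemma B_free_orbit:
  obtains q where "2 <= q" "q <= n" "B_walk t =
    fvector B_idx (B_scale n) (%a. if a < t mod Suc n then B_orbit n (B_next n q) a else B_orbit n q a)"
proof -
  have q: "2 <= (B_next n ^^ k) 2 \<and> (B_next n ^^ k) 2 <= n" for k
    using n by (induction k) (auto simp: B_next_def)
  have "B_e 2 - B_e 3 = fvector B_idx (B_scale n) (B_orbit n ((B_next n ^^ 0) 2))"
    using n by (auto simp: B_e_def fvector_simps[OF B_neighbour_sum] fvector_eq_iff[OF B_neighbour_sum] B_orbit_def)
  moreover have "free_orbit (natural_listing B_idx n) (fvector B_idx (B_scale n) (B_orbit n ((B_next n ^^ 0) 2))) t =
      fvector B_idx (B_scale n) (%a. if a < t mod Suc n then B_orbit n ((B_next n ^^ Suc (t div Suc n)) 2) a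
        else B_orbit n ((B_next n ^^ (t div Suc n)) 2) a)"
    by (rule free_orbit_natural_listing[OF B_neighbour_sum, of "%k. B_orbit n ((B_next n ^^ k) 2)"])
      (unfold funpow.simps o_apply, rule B_orbit_step[OF n], use q in auto)
  ultimately show ?thesis using that[of "(B_next n ^^ (t div Suc n)) 2"] q unfolding funpow.simps(2) o_apply by simp
qed

lemma B_orbit_nonneg: "B_orbit n q a >= 0"
  by (simp add: B_orbit_def)

text \<open>The second part is what \<open>B_core\<close> uses as the positivity of its vector
  \<open>p\<close>.\<close>

lemma B_free_orbit_nonneg: "nonneg (B_walk t)"
  "nonneg (B_delta - B_walk t)"
proof -
  obtain q where q: "2 <= q" "q <= n" "B_walk t =
      fvector B_idx (B_scale n) (%a. if a < t mod Suc n then B_orbit n (B_next n q) a else B_orbit n q a)"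
    by (rule B_free_orbit)
  show "nonneg (B_walk t)"
    unfolding q(3) by (rule fvector_nonneg[OF B_neighbour_sum]) (simp add: B_orbit_nonneg)
  have le: "B_orbit n r a <= (if a <= 1 then 1 else 2)" if "2 <= r" for r a
    using that n by (auto simp: B_orbit_def)
  have "2 <= B_next n q" using q n by (auto simp: B_next_def)
  then have "(if a < t mod Suc n then B_orbit n (B_next n q) a else B_orbit n q a) <= (if a <= 1 then 1 else 2)" for a
    using le[of q a] le[of "B_next n q" a] q(1) by (cases "a < t mod Suc n") simp_all
  then show "nonneg (B_delta - B_walk t)"
    unfolding q(3) B_delta_def fvector_simps[OF B_neighbour_sum]
    by (intro fvector_nonneg[OF B_neighbour_sum]) simp
qed

text \<open>It matters that the generator is the one toggled at time \<open>t\<close>. For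
  \<open>n = 3\<close> and at the beginning of a round, the vector with entries 1, 1, 1, 2 occurs;
  adding the rescaled simple root of vertex 2 would give \<open>\<delta>\<close>, but vertex 0 is
  being toggled.\<close>

lemma B_nohit:
  "sqrt 2 *\<^sub>R simple_root (natural_listing B_idx n ! (t mod Suc n)) +
    B_walk t ~= of_int k *\<^sub>R B_delta"
proof
  assume eq: "sqrt 2 *\<^sub>R simple_root (natural_listing B_idx n ! (t mod Suc n)) +
    B_walk t = of_int k *\<^sub>R B_delta"
  define j where "j = t mod Suc n"
  have j: "j <= n" using mod_less_divisor[of "Suc n" t] by (simp add: j_def)
  obtain q where q: "2 <= q" "q <= n" "B_walk t =
      fvector B_idx (B_scale n) (%a. if a < j then B_orbit n (B_next n q) a else B_orbit n q a)"
    unfolding j_def by (rule B_free_orbit)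
  \<comment> \<open>The vector \<open>sqrt 2\<close> times a simple root has coordinate 1, except at
    the short end \<open>n\<close>, where it is \<open>sqrt 2\<close>.\<close>
  define r where "r = sqrt 2 / B_scale n j"
  have r: "r > 0" "j ~= n ==> r = 1" by (simp_all add: r_def B_scale_def)
  have "natural_listing B_idx n ! j = f j"
    using j B_inv[of j] by (simp add: natural_listing_def[OF B_neighbour_sum] del: upt_Suc)
  then have "sqrt 2 *\<^sub>R simple_root (natural_listing B_idx n ! j) = r *\<^sub>R (B_scale n j *\<^sub>R simple_root (f j))"
    using B_scale_pos[of j] by (simp add: r_def)
  then have root: "sqrt 2 *\<^sub>R simple_root (natural_listing B_idx n ! j) =
      fvector B_idx (B_scale n) (%a. r * (if a = j then 1 else 0))"
    unfolding B_unit[OF j] fvector_simps[OF B_neighbour_sum] .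
  have "fvector B_idx (B_scale n) (%a. r * (if a = j then 1 else 0) +
      (if a < j then B_orbit n (B_next n q) a else B_orbit n q a)) =
      fvector B_idx (B_scale n) (%a. of_int k * (if a <= 1 then 1 else 2))"
    using eq unfolding j_def[symmetric] q(3) root B_delta_def fvector_simps[OF B_neighbour_sum] .
  then have e: "r * (if a = j then 1 else 0) + (if a < j then B_orbit n (B_next n q) a else B_orbit n q a) =
      of_int k * (if a <= 1 then 1 else 2)" if "a <= n" for a
    using that unfolding fvector_eq_iff[OF B_neighbour_sum] by blast
  have e0: "(if j = 0 then r else 0) + (if 0 < j then B_orbit n (B_next n q) 0 else B_orbit n q 0) = of_int k"
    using e[of 0] by (cases "j = 0") simp_all
  have e1: "(if j = 1 then r else 0) + (if 1 < j then B_orbit n (B_next n q) 1 else B_orbit n q 1) = of_int k"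
    using e[of 1] n by (cases "j = 1") simp_all
  have e2: "(if j = 2 then r else 0) + (if 2 < j then B_orbit n (B_next n q) 2 else B_orbit n q 2) = 2 * of_int k"
    using e[of 2] n by (cases "j = 2") simp_all
  have e3: "(if j = 3 then r else 0) + (if 3 < j then B_orbit n (B_next n q) 3 else B_orbit n q 3) = 2 * of_int k"
    using e[of 3] n by (cases "j = 3") simp_all
  have ej: "r + B_orbit n q j = of_int k * (if j <= 1 then 1 else 2)"
    using e[OF j] by simp
  have k: "of_int k > (0 :: real)"
    using ej r(1) B_orbit_nonneg[of q j] by (smt (verit) mult_less_0_iff mult_nonneg_nonneg zero_less_mult_iff)
  consider "q = 2" | "q = n" | "2 < q" "q < n" using q by linarith
  then show False
  proof cases
    case 1
    have o: "B_orbit n q a = (if a = 2 then 1 else 0)" "B_orbit n (B_next n q) a = (if a = n then 2 else 1)" for a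
      using 1 n by (auto simp: B_orbit_def B_next_def)
    consider "j = 0" | "j = 1" | "j = 2" | "j >= 3" by linarith
    then show False
      by cases (use e0 e1 e2 e3 o n k in \<open>simp_all split: if_splits\<close>)
  next
    case 2
    have o: "B_orbit n q a = (if a = n then 2 else 1)" "B_orbit n (B_next n q) a = (if a = n - 1 then 1 else 0)" for a
      using 2 n by (auto simp: B_orbit_def B_next_def)
    show False
      by (cases "j = 0") (use e0 e1 o n k r in \<open>simp_all split: if_splits\<close>)
  next
    case 3
    have o: "B_orbit n q a = (if a = q then 1 else 0)" "B_orbit n (B_next n q) a = (if a = q - 1 then 1 else 0)" for a
      using 3 n by (auto simp: B_orbit_def B_next_def)
    show False
      by (cases "j = 0") (use e0 e1 o n k r 3 in \<open>simp_all split: if_splits\<close>)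
  qed
qed

lemma B_finite_orbits:
  "finite (range (B_walk))"
  "finite (range (free_orbit (natural_listing B_idx n) (B_e 1)))"
proof -
  have q: "2 <= (B_next n ^^ k) 2 \<and> (B_next n ^^ k) 2 <= n" for k
    using n by (induction k) (auto simp: B_next_def)
  define g where "g = (%k. B_orbit n ((B_next n ^^ k) 2))"
  have "finite (range (free_orbit (natural_listing B_idx n) (fvector B_idx (B_scale n) (g 0))))"
  proof (rule finite_range_natural_listing[OF B_neighbour_sum, of g "B_orbit n ` {2..n}"])
    show "g (Suc k) b = B_sum n b (%a. if a < b then g (Suc k) a else g k a) - g k b" if "b <= n" for k b
      unfolding g_def funpow.simps o_apply by (rule B_orbit_step[OF n]) (use q that in auto)
    show "g k \<in> B_orbit n ` {2..n}" for k using q[of k] by (simp add: g_def)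
  qed simp
  moreover have "B_e 2 - B_e 3 = fvector B_idx (B_scale n) (g 0)"
    using n by (auto simp: B_e_def fvector_simps[OF B_neighbour_sum] fvector_eq_iff[OF B_neighbour_sum] B_orbit_def g_def)
  ultimately show "finite (range (B_walk))" by simp
  \<comment> \<open>Whole rounds alternate between \<open>e 1\<close> and
    \<open>\<delta> - e 1\<close>.\<close>
  define h :: "nat => nat => real" where
    "h = (%k a. if even k then (if 1 <= a then 1 else 0) else if a = 1 then 0 else 1)"
  have "finite (range (free_orbit (natural_listing B_idx n) (fvector B_idx (B_scale n) (h 0))))"
  proof (rule finite_range_natural_listing[OF B_neighbour_sum, of h "{h 0, h 1}"])
    show "h (Suc k) b = B_sum n b (%a. if a < b then h (Suc k) a else h k a) - h k b" if "b <= n" for k b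
      by (cases "even k"; cases rule: B_cases[OF n that]) (simp_all add: h_def B_sum_def B_neighbours_def)
    show "h k \<in> {h 0, h 1}" for k by (cases "even k") (simp_all add: h_def)
  qed simp
  moreover have "B_e 1 = fvector B_idx (B_scale n) (h 0)" by (simp add: B_e_def h_def)
  ultimately show "finite (range (free_orbit (natural_listing B_idx n) (B_e 1)))" by simp
qed

lemma B_ancient: ancient
proof -
  let ?xs = "natural_listing B_idx n"
  note B = B_coordinates and ns = B_neighbour_sum
  note BB = B B_scale_pos B_nth
  define \<gamma> where "\<gamma> = B_gamma B_e"
  define X where "X = B_traps n B_e B_delta"
  define M where "M = B_mirrors n B_e B_delta"
  have gamma: "\<gamma> = (1 / sqrt 2) *\<^sub>R (B_e 2 - B_e 3)" by (simp add: \<gamma>_def B_gamma_def[OF BB])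
  have root: "\<gamma> \<in> roots"
    using B_gamma_simple[OF BB] simple_root_in_roots[of "f 2"] by (simp add: \<gamma>_def)
  have orbit\<gamma>: "free_orbit ?xs \<gamma> t = (1 / sqrt 2) *\<^sub>R free_orbit ?xs (B_e 2 - B_e 3) t" for t
    by (simp add: gamma free_orbit_scaleR)
  have J: "finite (UNIV \<times> {3..n} :: (bool \<times> nat) set)" by simp
  obtain k :: "real ^ 'i => real" where k: "!!b. b \<in> B_mirror B_e B_delta ` (UNIV \<times> {3..n}) ==> k b > 0"
    "(\<Sum>b\<in>B_mirror B_e B_delta ` (UNIV \<times> {3..n}). k b *\<^sub>R b) = (\<Sum>j\<in>UNIV \<times> {3..n}. 1 *\<^sub>R B_mirror B_e B_delta j)"
    by (rule family_weights[OF J, of "%_. 1" "B_mirror B_e B_delta"]) (simp, blast)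
  have M_eq: "M = B_mirror B_e B_delta ` (UNIV \<times> {3..n})" by (simp add: M_def B_mirrors_def[OF BB])
  have "\<exists>L. is_convex L \<and> L ~= {} \<and> ~ heavy_listing L ?xs"
  proof (rule trap[OF natural_listing_nonempty[OF ns] B_crystallographic, of X \<gamma> "{\<gamma>, B_e 1}" M k])
    show "X \<subseteq> carrier W" by (auto simp: X_def B_traps_def[OF BB])
    show "X ~= {}" using B_generator_traps[OF BB] by (auto simp: X_def)
    show "nonneg (- action x \<gamma>)" if "x \<in> X" for x
      using that by (simp add: X_def \<gamma>_def B_traps_def[OF BB])
    show "nonneg (free_orbit ?xs \<gamma> t)" for t
      unfolding orbit\<gamma> using B_free_orbit_nonneg(1) by (intro nonneg_scaleR) auto
    show "finite (range (free_orbit ?xs v))" if "v \<in> {\<gamma>, B_e 1}" for v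
    proof -
      have "range (free_orbit ?xs \<gamma>) = (%v. (1 / sqrt 2) *\<^sub>R v) ` range (free_orbit ?xs (B_e 2 - B_e 3))"
        by (simp add: image_image flip: orbit\<gamma>)
      then show ?thesis using that B_finite_orbits by auto
    qed
    show "finite M" by (simp add: M_eq)
    show "M \<subseteq> roots" using B_mirror_roots[OF BB] by (auto simp: M_def)
    show "nonneg b" if "b \<in> M" for b using B_mirror_nonneg[OF BB] that by (simp add: M_def)
    show "nonneg (action x b)" if "b \<in> M" "x \<in> X" for b x
      using that by (simp add: M_def X_def B_traps_def[OF BB])
    show "k b > 0" if "b \<in> M" for b using k(1) that by (simp add: M_eq)
    show "form (\<Sum>b\<in>M. k b *\<^sub>R b) v = 0" for v
    proof -
      \<comment> \<open>The two mirrors of a pair add up to a multiple of \<open>\<delta>\<close>,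
        so equal weights already give a null combination.\<close>
      have "form (B_mirror B_e B_delta (True, d)) v + form (B_mirror B_e B_delta (False, d)) v = 0" for d
        using B_null[OF B] by (simp add: B_mirror_def[OF BB] form_linear flip: add_divide_distrib)
      then have "(\<Sum>d\<in>{3..n}. form (B_mirror B_e B_delta (True, d)) v + form (B_mirror B_e B_delta (False, d)) v) = 0"
        by simp
      then have "(\<Sum>j\<in>UNIV \<times> {3..n}. form (B_mirror B_e B_delta j) v) = 0"
        by (simp add: sum.cartesian_product' UNIV_bool sum.distrib add.commute)
      then show ?thesis unfolding M_eq k(2) by (simp add: form_sum_left)
    qed
    show "simple_root i \<in> span ({\<gamma>, B_e 1} \<union> M)" for i
    proof -
      let ?S = "span ({\<gamma>, B_e 1} \<union> M)"
      have base: "\<gamma> \<in> ?S" "B_e 1 \<in> ?S" "!!b. b \<in> M ==> b \<in> ?S" by (auto intro: span_base)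
      have sq: "sqrt 2 *\<^sub>R ((1 / sqrt 2) *\<^sub>R v) = v" for v :: "real ^ 'i" by simp
      have "(1 / sqrt 2) *\<^sub>R (B_delta + (B_e 2 + B_e 3)) \<in> ?S"
        by (rule base(3)) (simp add: M_def B_mirrors_iff[OF BB])
      moreover have "(1 / sqrt 2) *\<^sub>R (B_delta - (B_e 2 + B_e 3)) \<in> ?S"
        by (rule base(3)) (simp add: M_def B_mirrors_iff[OF BB])
      ultimately have pm: "B_delta + (B_e 2 + B_e 3) \<in> ?S" "B_delta - (B_e 2 + B_e 3) \<in> ?S"
        using span_scale[of _ _ "sqrt 2"] unfolding sq by (metis sq)+
      have g: "B_e 2 - B_e 3 \<in> ?S" using span_scale[OF base(1), of "sqrt 2"] unfolding gamma sq .
      have "2 *\<^sub>R B_delta \<in> ?S" "4 *\<^sub>R B_e 2 \<in> ?S" "4 *\<^sub>R B_e 3 \<in> ?S"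
      proof -
        have "2 *\<^sub>R B_delta = (B_delta + (B_e 2 + B_e 3)) + (B_delta - (B_e 2 + B_e 3))" by (simp add: scaleR_2)
        then show "2 *\<^sub>R B_delta \<in> ?S" using span_add[OF pm] by metis
        have "4 *\<^sub>R B_e 2 = (B_delta + (B_e 2 + B_e 3)) - (B_delta - (B_e 2 + B_e 3)) + 2 *\<^sub>R (B_e 2 - B_e 3)"
          by (simp add: vec_eq_iff)
        then show "4 *\<^sub>R B_e 2 \<in> ?S" using span_add[OF span_diff[OF pm] span_scale[OF g, of 2]] by metis
        have "4 *\<^sub>R B_e 3 = (B_delta + (B_e 2 + B_e 3)) - (B_delta - (B_e 2 + B_e 3)) - 2 *\<^sub>R (B_e 2 - B_e 3)"
          by (simp add: vec_eq_iff)
        then show "4 *\<^sub>R B_e 3 \<in> ?S" using span_diff[OF span_diff[OF pm] span_scale[OF g, of 2]] by metis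
      qed
      from span_scale[OF this(1), of "1 / 2"] span_scale[OF this(2), of "1 / 4"] span_scale[OF this(3), of "1 / 4"]
      have 23: "B_delta \<in> ?S" "B_e 2 \<in> ?S" "B_e 3 \<in> ?S" by simp_all
      have e: "B_e a \<in> ?S" if a: "1 <= a" "a <= n" for a
      proof -
        consider "a = 1" | "a = 2" | "a = 3" | "a >= 4" using a by linarith
        then show ?thesis
        proof cases
          case 4
          then have "B_e a \<in> M" using a by (auto simp: M_def B_mirrors_iff[OF BB])
          then show ?thesis by (rule base)
        qed (use base 23 in auto)
      qed
      obtain b where b: "b <= n" "i = f b" by (rule B_index[OF B])
      then consider "b = 0" | "1 <= b" "b < n" | "b = n" by linarith
      then show ?thesis
      proof cases
        case 1
        show ?thesis unfolding b(2) 1 B_simple'(1)[OF B] using n by (intro span_scale span_diff 23 e) auto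
      next
        case 2
        show ?thesis unfolding b(2) B_simple'(2)[OF B 2] using 2 by (intro span_scale span_diff e) auto
      next
        case 3
        show ?thesis unfolding b(2) 3 B_simple(3)[OF B] using n by (intro e) auto
      qed
    qed
    show "form \<rho> v = 0" if \<rho>: "\<rho> \<in> roots" "!!x. x \<in> X ==> nonneg (action x \<rho>)" and u: "u \<in> carrier W"
        "!!v. v \<in> {\<gamma>, B_e 1} ==> action u v = free_orbit ?xs v t" "!!b. b \<in> M ==> nonneg (action u b)"
        "action u \<rho> = simple_root i" and v: "v \<in> {\<gamma>, B_e 1}" and i: "i = ?xs ! (t mod length ?xs)"
      for \<rho> u t i v
    proof -
      have g: "action u (B_e 2 - B_e 3) = free_orbit ?xs (B_e 2 - B_e 3) t"
      proof -
        have "B_e 2 - B_e 3 = sqrt 2 *\<^sub>R \<gamma>" by (simp add: gamma)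
        then show ?thesis using u(2)[of \<gamma>] action_simps(4)[OF u(1)] by (simp only: free_orbit_scaleR) simp
      qed
      have "form \<rho> (B_e 1) = 0 \<and> form \<rho> (B_gamma B_e) = 0"
      proof -
        have 1: "nonneg (action x \<rho>)" if "x \<in> B_traps n B_e B_delta" for x using \<rho>(2) that by (simp add: X_def)
        have 2: "nonneg (action u b)" if "b \<in> B_mirrors n B_e B_delta" for b using u(3) that by (simp add: M_def)
        have 3: "nonneg (B_delta - action u (B_e 2 - B_e 3))" unfolding g by (rule B_free_orbit_nonneg)
        have 4: "sqrt 2 *\<^sub>R simple_root i + action u (B_e 2 - B_e 3) ~= of_int k *\<^sub>R B_delta" for k :: int
          unfolding g i length_natural_listing[OF ns] by (rule B_nohit)
        show ?thesis
          by (intro conjI B_hits(1)[OF BB \<rho>(1) 1 u(1) 2 3 u(4) 4] B_hits(2)[OF BB \<rho>(1) 1 u(1) 2 3 u(4) 4])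
      qed
      then show ?thesis using v by (auto simp: \<gamma>_def)
    qed
  qed (simp_all add: root)
  then obtain L where L: "is_convex L" "L ~= {}" "~ heavy_listing L ?xs" by blast
  have m01: "m (f 0) (f 1) = 2" using M[of 0 1] n by simp
  have parent: "\<exists>p. \<forall>a<l. a ~= p --> m (f a) (f l) = 2" if l: "3 <= l" "l <= n" for l
    using M[of _ l] l by (intro exI[of _ "l - 1"]) auto
  have n2: "n >= 2" using n by simp
  show ?thesis
    by (rule ancientI[OF elimination_order_fork[OF f n2 m01 parent] natural_listing_props[OF ns] L])
qed

end

lemma ancient_B:
  assumes type_B
  shows ancient
proof -
  obtain n where n: "n >= 3" "has_coxeter_matrix n (%a b.
     if b = a + 1 \<and> b = n then 4 else if a >= 1 \<and> b = a + 1 \<or> a = 0 \<and> b = 2 then 3 else 2)"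
    using assms by (auto simp: type_B_def)
  obtain f where "bij_betw f {..n} UNIV" "!!a b. a < b ==> b <= n ==> m (f a) (f b) =
      (if b = a + 1 \<and> b = n then 4 else if a >= 1 \<and> b = a + 1 \<or> a = 0 \<and> b = 2 then 3 else 2)"
    using has_coxeter_matrixE[OF n(2)] by blast
  from B_ancient[OF n(1) this] show ?thesis .
qed

end

section \<open>Types A and C\<close>

lemma int_step_constant:
  fixes f :: "int => 'a"
  assumes "!!a. f (a + 1) = f a"
  shows "f a = f b"
proof -
  have "f a = f 0" for a
  proof (induction a rule: int_induct[of _ 0])
    case (step2 i)
    then show ?case using assms[of "i - 1"] by simp
  qed (use assms in auto)
  then show ?thesis by metis
qed

text \<open>The map \<open>p\<close> permutes the residue classes modulo \<open>N\<close>, and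
  \<open>h\<close> depends on the class only.\<close>

lemma sum_equivariant:
  fixes h :: "int => int"
  assumes N: "N > 0" and p: "inj p" "!!a. p (a + N) = p a + N" and h: "!!a. h (a + N) = h a"
  shows "(\<Sum>a\<in>{0..<N}. h (p a)) = (\<Sum>a\<in>{0..<N}. h a)"
proof -
  have per: "g (a + k * N) = g a + k * c" if "!!a. g (a + N) = g a + c" for g :: "int => int" and a k c
  proof -
    have "g (a + (k + 1) * N) - (k + 1) * c = g (a + k * N) - k * c" for k
      using that[of "a + k * N"] by (simp add: algebra_simps)
    then have "g (a + k * N) - k * c = g (a + 0 * N) - 0 * c" by (rule int_step_constant)
    then show ?thesis by simp
  qed
  have h_mod: "h (a mod N) = h a" for a
    using per[of h 0 "a mod N" "a div N"] h by (simp add: mult.commute)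
  have "inj_on (%a. p a mod N) {0..<N}"
  proof (rule inj_onI)
    fix a b assume ab: "a \<in> {0..<N}" "b \<in> {0..<N}" "p a mod N = p b mod N"
    obtain k where "p a = p b + N * k" using ab(3) by (metis mod_eqE)
    then have "p a = p (b + k * N)" using per[of p N b k] p(2) by (simp add: mult.commute)
    then have "a = b + k * N" using p(1) by (simp add: inj_eq)
    then have "a mod N = b mod N" by simp
    then show "a = b" using ab by simp
  qed
  then have "bij_betw (%a. p a mod N) {0..<N} {0..<N}"
    using N by (intro bij_betw_imageI endo_inj_surj) auto
  then have "(\<Sum>a\<in>{0..<N}. h (p a mod N)) = (\<Sum>a\<in>{0..<N}. h a)"
    by (rule sum.reindex_bij_betw)
  then show ?thesis by (simp add: h_mod)
qed

context coxeter_system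
begin

text \<open>A slot model: the slots are the integers, the gap between the slots \<open>x\<close> and \<open>x + 1\<close> is labelled
  by a generator, and every generator swaps the two slots adjacent to each gap with its label. The vectors
  \<open>gap x\<close> are the differences of consecutive slot vectors.\<close>

definition slot_model :: "(int => 'i) => ('i => real) => int => bool" where
  "slot_model \<pi> r N \<longleftrightarrow> surj \<pi> \<and> N > 0 \<and> (\<forall>a. \<pi> (a + N) = \<pi> a) \<and> (\<forall>a. \<pi> a ~= \<pi> (a + 1)) \<and> (\<forall>i. r i > 0) \<and>
    (\<forall>a i. \<pi> a ~= i --> - 2 * form_entry (\<pi> a) i * r (\<pi> a) =
      ((if \<pi> (a - 1) = i then 1 else 0) + (if \<pi> (a + 1) = i then 1 else 0)) * r i)"

context
  fixes \<pi> r N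
  assumes slot: "slot_model \<pi> r N"
begin

definition gap :: "int => real ^ 'i" where
  "gap a = r (\<pi> a) *\<^sub>R simple_root (\<pi> a)"

definition slot_vec :: "int => real ^ 'i" where
  "slot_vec a = (\<Sum>c\<in>{a..<0}. gap c) - (\<Sum>c\<in>{0..<a}. gap c)"

definition swap :: "'i => int => int" where
  "swap i a = (if \<pi> a = i then a + 1 else if \<pi> (a - 1) = i then a - 1 else a)"

lemma \<pi>_surj: "\<exists>a. \<pi> a = i" and N_pos: "N > 0" and \<pi>_period: "\<pi> (a + N) = \<pi> a"
  and \<pi>_next: "\<pi> a ~= \<pi> (a + 1)" and r_pos: "r i > 0"
  and entry: "\<pi> a ~= i ==> - 2 * form_entry (\<pi> a) i * r (\<pi> a) =
      ((if \<pi> (a - 1) = i then 1 else 0) + (if \<pi> (a + 1) = i then 1 else 0)) * r i"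
proof -
  show "\<exists>a. \<pi> a = i" using slot unfolding slot_model_def surj_def by metis
qed (use slot in \<open>unfold slot_model_def, blast+\<close>)

lemma \<pi>_prev: "\<pi> (a - 1) ~= \<pi> a"
  using \<pi>_next[of "a - 1"] by simp

lemma slot_vec_gap: "slot_vec a - slot_vec (a + 1) = gap a"
proof (cases "a >= 0")
  case True
  then have "{0..<a + 1} = insert a {0..<a}" by auto
  then show ?thesis using True by (simp add: slot_vec_def)
next
  case False
  then have "{a..<0} = insert a {a + 1..<0}" by auto
  then show ?thesis using False by (simp add: slot_vec_def)
qed

lemma slot_vec_less:
  assumes "a < b"
  shows "nonneg (slot_vec a - slot_vec b) \<and> (slot_vec a - slot_vec b) $ \<pi> a > 0"
  using assms
proof (induction b rule: int_gr_induct)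
  case base
  then show ?case using r_pos[of "\<pi> a"] unfolding slot_vec_gap by (auto simp: gap_def nonneg_scaleR simple_root_nth less_imp_le)
next
  case (step b)
  have eq: "slot_vec a - slot_vec (b + 1) = (slot_vec a - slot_vec b) + gap b"
    using slot_vec_gap[of b] by (simp add: algebra_simps)
  have "nonneg (gap b)" using r_pos[of "\<pi> b"] by (simp add: gap_def nonneg_scaleR less_imp_le)
  moreover from this have "gap b $ \<pi> a >= 0" by (simp add: nonneg_def)
  ultimately show ?case using step unfolding eq by (auto intro: nonneg_add)
qed

lemma nonneg_slot_vec_iff: "nonneg (slot_vec a - slot_vec b) \<longleftrightarrow> a <= b"
proof
  assume nonneg: "nonneg (slot_vec a - slot_vec b)"
  show "a <= b"
  proof (rule ccontr)
    assume "~ a <= b"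
    then have "(slot_vec b - slot_vec a) $ \<pi> b > 0" using slot_vec_less[of b a] by simp
    then show False using nonneg by (auto simp: nonneg_def dest: spec[of _ "\<pi> b"])
  qed
next
  assume "a <= b"
  then show "nonneg (slot_vec a - slot_vec b)"
    using slot_vec_less[of a b] by (cases "a = b") (auto simp: nonneg_def)
qed

text \<open>The gap is stretched by each adjacent gap labelled \<open>i\<close>, on either side or
  on both, and reversed if it is labelled \<open>i\<close> itself. The numerical condition of the
  model says just this.\<close>

lemma reflection_gap: "reflection i (gap a) = slot_vec (swap i a) - slot_vec (swap i (a + 1))"
proof -
  have r1: "reflection i (gap a) = gap a - (2 * r (\<pi> a) * form_entry (\<pi> a) i) *\<^sub>R simple_root i"
    by (simp add: reflection_def gap_def form_scaleR_left mult_ac)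
  show ?thesis
  proof (cases "\<pi> a = i")
    case True
    then have "swap i a = a + 1" "swap i (a + 1) = a"
      using \<pi>_next[of a] by (auto simp: swap_def)
    moreover have "reflection i (gap a) = - gap a"
      unfolding r1 using True by (simp add: gap_def scaleR_2 flip: scaleR_scaleR)
    ultimately show ?thesis using slot_vec_gap[of a] by (simp add: algebra_simps)
  next
    case False
    have "- (2 * r (\<pi> a) * form_entry (\<pi> a) i) = - 2 * form_entry (\<pi> a) i * r (\<pi> a)" by simp
    then have "reflection i (gap a) = gap a + (if \<pi> (a - 1) = i then gap (a - 1) else 0) + (if \<pi> (a + 1) = i then gap (a + 1) else 0)"
      unfolding r1 diff_conv_add_uminus scaleR_minus_left[symmetric] unfolding entry[OF False]
      by (auto simp: gap_def scaleR_add_left distrib_right scaleR_2 simp flip: scaleR_scaleR)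
    moreover have "swap i a = (if \<pi> (a - 1) = i then a - 1 else a)" "swap i (a + 1) = (if \<pi> (a + 1) = i then a + 2 else a + 1)"
      using False by (auto simp: swap_def)
    moreover have "slot_vec (a - 1) = slot_vec a + gap (a - 1)" "slot_vec (a + 1) = slot_vec a - gap a"
      "slot_vec (a + 2) = slot_vec a - gap a - gap (a + 1)"
      using slot_vec_gap[of a] slot_vec_gap[of "a - 1"] slot_vec_gap[of "a + 1"]
      by (simp_all add: algebra_simps)
    ultimately show ?thesis by simp
  qed
qed

lemma reflection_slot_vec:
  "reflection i (slot_vec a - slot_vec b) = slot_vec (swap i a) - slot_vec (swap i b)"
proof -
  have "reflection i (slot_vec a) - slot_vec (swap i a) = reflection i (slot_vec b) - slot_vec (swap i b)"
  proof (rule int_step_constant[of "%a. reflection i (slot_vec a) - slot_vec (swap i a)"])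
    fix a
    show "reflection i (slot_vec (a + 1)) - slot_vec (swap i (a + 1)) = reflection i (slot_vec a) - slot_vec (swap i a)"
      using reflection_gap[of i a] unfolding slot_vec_gap[symmetric] linear_diff[OF reflection_linear]
      by (simp add: algebra_simps)
  qed
  then show ?thesis unfolding linear_diff[OF reflection_linear] by (simp add: algebra_simps)
qed

lemma swap_swap: "swap i (swap i a) = a"
  using \<pi>_next[of a] \<pi>_prev[of a] \<pi>_prev[of "a - 1"] by (auto simp: swap_def)

lemma swap_bij: "bij (swap i)"
  by (rule o_bij[of "swap i"]) (auto simp: swap_swap)

lemma swap_period: "swap i (a + N) = swap i a + N"
  using \<pi>_period[of a] \<pi>_period[of "a - 1"] by (simp add: swap_def algebra_simps)

text \<open>\<open>p a\<close> is the slot taken by the label \<open>a\<close>, as in affine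
  permutations. The action only sees differences of slot vectors and determines \<open>p\<close> up
  to a common shift.\<close>

definition occupation :: "'g => (int => int) => bool" where
  "occupation u p \<longleftrightarrow> bij p \<and> (\<forall>a. p (a + N) = p a + N) \<and>
    (\<forall>a b. action u (slot_vec a - slot_vec b) = slot_vec (p a) - slot_vec (p b))"

lemma occupation_swap: "u \<in> carrier W ==> occupation u p ==> occupation (s i \<otimes> u) (swap i \<circ> p)"
  unfolding occupation_def by (auto simp: reflection_slot_vec swap_period intro: bij_comp swap_bij simp del: action_simps)

lemma occupation_exists:
  assumes "u \<in> carrier W"
  shows "\<exists>p. occupation u p"
proof -
  have "\<exists>p. occupation (word_prod W s xs) p" for xs
  proof (induction xs)
    case Nil
    have "occupation \<one> id" by (simp add: occupation_def)
    then show ?case by auto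
  next
    case (Cons i xs)
    then show ?case using occupation_swap[of "word_prod W s xs" _ i] by auto
  qed
  then show ?thesis using assms by (metis word_prod_surj)
qed

text \<open>Within a period every swap moves as many labels to the right as to the left. The sum
  over a period is thus an invariant that fixes the undetermined shift.\<close>

lemma occupation_sum_swap:
  assumes "occupation u p"
  shows "(\<Sum>a\<in>{0..<N}. swap i (p a)) = (\<Sum>a\<in>{0..<N}. p a)"
proof -
  define g where "g = (%a. if \<pi> a = i then 1 else 0 :: int)"
  have g: "g (a + N) = g a" for a by (simp add: g_def \<pi>_period)
  have swap: "swap i a = a + (g a - g (a - 1))" for a
    using \<pi>_prev[of a] by (auto simp: swap_def g_def)
  have p: "inj p" "!!a. p (a + N) = p a + N" using assms by (auto simp: occupation_def bij_def)
  have "(\<Sum>a\<in>{0..<N}. g (p a)) = (\<Sum>a\<in>{0..<N}. g a)"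
    by (rule sum_equivariant[OF N_pos, of p g]) (use p g in auto)
  moreover have "(\<Sum>a\<in>{0..<N}. g (p a - 1)) = (\<Sum>a\<in>{0..<N}. g a)"
    by (rule sum_equivariant[OF N_pos, of "%a. p a - 1" g]) (use p g in \<open>auto simp: inj_def\<close>)
  ultimately show ?thesis by (simp add: swap sum.distrib sum_subtractf)
qed

lemma occupation_unique:
  assumes u: "u \<in> carrier W" "occupation u p" "occupation u q" and sum: "(\<Sum>a\<in>{0..<N}. p a) = (\<Sum>a\<in>{0..<N}. q a)"
  shows "p = q"
proof -
  have bij: "bij p" "bij q" using u by (auto simp: occupation_def)
  have E: "slot_vec (q a) - slot_vec (q b) = slot_vec (p a) - slot_vec (p b)" for a b
    using u(2,3) by (metis occupation_def)
  have le: "q a <= q b \<longleftrightarrow> p a <= p b" for a b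
    using E[of a b] nonneg_slot_vec_iff[of "q a" "q b"] nonneg_slot_vec_iff[of "p a" "p b"] by simp
  \<comment> \<open>It carries one occupation to the other. The signs of differences make it an
    order automorphism of the integers, hence a translation.\<close>
  define f where "f = (%x. q (inv_into UNIV p x))"
  have pi: "p (inv_into UNIV p x) = x" for x using bij(1) by (simp add: bij_is_surj surj_f_inv_f)
  have qi: "q (inv_into UNIV q x) = x" for x using bij(2) by (simp add: bij_is_surj surj_f_inv_f)
  have fp: "f (p a) = q a" for a using bij(1) by (simp add: f_def bij_is_inj)
  have mono: "f x <= f y \<longleftrightarrow> x <= y" for x y
    unfolding f_def le by (simp add: pi)
  have "f (x + 1) = f x + 1" for x
  proof -
    define y where "y = p (inv_into UNIV q (f x + 1))"
    have y: "f y = f x + 1" unfolding y_def fp by (rule qi)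
    then have "~ y <= x" using mono[of y x] by simp
    then have "f (x + 1) <= f x + 1" using mono[of "x + 1" y] y by simp
    moreover have "~ f (x + 1) <= f x" unfolding mono by simp
    ultimately show ?thesis by simp
  qed
  then have "f (x + 1) - (x + 1) = f x - x" for x by simp
  then have shift: "f x - x = f 0 - 0" for x by (rule int_step_constant)
  have q: "q a = p a + f 0" for a using shift[of "p a"] fp[of a] by simp
  then have "(\<Sum>a\<in>{0..<N}. q a) = (\<Sum>a\<in>{0..<N}. p a) + N * f 0"
    using N_pos by (simp add: sum.distrib)
  then have "f 0 = 0" using sum N_pos by simp
  then show ?thesis using q by auto
qed

lemma root_slot_vec:
  assumes "\<beta> \<in> roots"
  obtains a b c where "c > 0" "\<beta> = c *\<^sub>R (slot_vec a - slot_vec b)"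
proof -
  have "\<exists>c a b. c > 0 \<and> \<beta> = c *\<^sub>R (slot_vec a - slot_vec b)"
  proof -
    obtain w i where w: "w \<in> carrier W" "\<beta> = action w (simple_root i)" using assms by (rule rootsE)
    obtain x where x: "\<pi> x = i" using \<pi>_surj by blast
    have i: "simple_root i = (1 / r i) *\<^sub>R (slot_vec x - slot_vec (x + 1))"
      unfolding slot_vec_gap using r_pos[of i] by (simp add: gap_def x)
    obtain p where "occupation w p" using occupation_exists[OF w(1)] by blast
    then have "\<beta> = (1 / r i) *\<^sub>R (slot_vec (p x) - slot_vec (p (x + 1)))"
      unfolding w(2) i occupation_def using linear_scale[OF action_linear[OF w(1)]] by metis
    then show ?thesis using r_pos[of i] by (intro exI[of _ "1 / r i"] exI) auto
  qed
  then show ?thesis using that by blast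
qed

section \<open>Order relations between labels and their motion\<close>

definition before :: "'g set => int => int => bool" where
  "before L a b \<longleftrightarrow> (\<forall>w\<in>L. nonneg (action w (slot_vec a - slot_vec b)))"

lemma before_trans: "L \<subseteq> carrier W ==> before L a b ==> before L b c ==> before L a c"
proof -
  assume L: "L \<subseteq> carrier W" and ab: "before L a b" "before L b c"
  have "nonneg (action w (slot_vec a - slot_vec c))" if w: "w \<in> L" for w
  proof -
    have "slot_vec a - slot_vec c = (slot_vec a - slot_vec b) + (slot_vec b - slot_vec c)" by simp
    moreover have "w \<in> carrier W" using w L by blast
    ultimately have "action w (slot_vec a - slot_vec c) =
        action w (slot_vec a - slot_vec b) + action w (slot_vec b - slot_vec c)"
      using linear_add[OF action_linear] by metis
    then show ?thesis using ab w unfolding before_def by (metis nonneg_add)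
  qed
  then show ?thesis by (simp add: before_def)
qed

lemma before_antisym:
  assumes "L \<subseteq> carrier W" "L ~= {}" "before L a b" "before L b a"
  shows "a = b"
proof -
  obtain w where w: "w \<in> L" "w \<in> carrier W" using assms by blast
  obtain p where p: "occupation w p" using occupation_exists[OF w(2)] by blast
  have "p a <= p b" "p b <= p a"
    using assms(3,4) w p unfolding before_def occupation_def by (metis nonneg_slot_vec_iff)+
  then show ?thesis using p by (auto simp: occupation_def bij_def inj_def)
qed

lemma blocked_iff:
  assumes u: "u \<in> carrier W" "occupation u p" and L: "L \<subseteq> carrier W"
    and x: "\<pi> x = i" "p a = x" "p b = x + 1"
  shows "action (inv u) (simple_root i) \<in> root_set L \<longleftrightarrow> before L a b"
proof -
  have "action u (slot_vec a - slot_vec b) = r i *\<^sub>R simple_root i"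
    using u(2) x slot_vec_gap[of x] by (simp add: occupation_def gap_def)
  then have "action (inv u) (action u (slot_vec a - slot_vec b)) = r i *\<^sub>R action (inv u) (simple_root i)"
    using u(1) by simp
  then have eq: "slot_vec a - slot_vec b = r i *\<^sub>R action (inv u) (simple_root i)"
    using u(1) by simp
  have "action w (slot_vec a - slot_vec b) = r i *\<^sub>R action w (action (inv u) (simple_root i))" if "w \<in> L" for w
    unfolding eq using that L linear_scale[OF action_linear] by blast
  then have "before L a b \<longleftrightarrow> (\<forall>w\<in>L. nonneg (action w (action (inv u) (simple_root i))))"
    using r_pos[of i] by (auto simp: before_def nonneg_def zero_le_mult_iff)
  then show ?thesis using u(1) L by (auto simp: root_set_iff)
qed

text \<open>In the reading order of the listing, the number of steps until the next toggle of \<open>i\<close>.\<close>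

definition wait :: "'i list => nat => 'i => int" where
  "wait xs t i = (int (inv_into {..<length xs} ((!) xs) i) - int t) mod int (length xs)"

primrec occupations :: "'g set => 'i list => 'g => (int => int) => nat => int => int" where
  "occupations L xs u p 0 = p"
| "occupations L xs u p (Suc t) = (if action (inv (orbit L xs u t)) (simple_root (xs ! (t mod length xs))) \<in> root_set L
    then occupations L xs u p t else swap (xs ! (t mod length xs)) \<circ> occupations L xs u p t)"

declare occupations.simps(2) [simp del]

context
  fixes L :: "'g set" and xs :: "'i list" and u :: 'g and p :: "int => int"
  assumes L: "L \<subseteq> carrier W" "L ~= {}" and xs: "distinct xs" "set xs = UNIV" and u: "u \<in> carrier W" "occupation u p"
begin

abbreviation "occ \<equiv> occupations L xs u p"

abbreviation "label t \<equiv> xs ! (t mod length xs)"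

lemma length_pos: "length xs > 0"
  using xs(2) by auto

lemma wait_eq_iff: "wait xs t i = wait xs t j \<longleftrightarrow> i = j"
proof
  assume eq: "wait xs t i = wait xs t j"
  let ?f = "inv_into {..<length xs} ((!) xs)"
  have bij: "(!) xs ` {..<length xs} = UNIV" using xs(2) by (auto simp: set_conv_nth)
  have f: "?f k < length xs" "xs ! ?f k = k" for k
    using inv_into_into[of k "(!) xs" "{..<length xs}"] f_inv_into_f[of k "(!) xs" "{..<length xs}"] bij by auto
  have "(int (?f i) - int t + int t) mod int (length xs) = (int (?f j) - int t + int t) mod int (length xs)"
    using eq unfolding wait_def by (rule mod_add_cong) simp
  then have "?f i = ?f j" using f(1)[of i] f(1)[of j] by simp
  then show "i = j" using f(2) by metis
qed simp

lemma wait_label: "wait xs t (label t) = 0"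
proof -
  have "inj_on ((!) xs) {..<length xs}" using xs(1) by (auto simp: inj_on_def nth_eq_iff_index_eq)
  then have "inv_into {..<length xs} ((!) xs) (label t) = t mod length xs"
    using length_pos by (intro inv_into_f_f) auto
  then show ?thesis by (simp add: wait_def zmod_int mod_diff_left_eq)
qed

lemma wait_bounds: "0 <= wait xs t i" "wait xs t i < length xs"
  using length_pos by (simp_all add: wait_def)

lemma wait_zero_iff: "wait xs t i = 0 \<longleftrightarrow> i = label t"
  using wait_eq_iff[of t i "label t"] wait_label[of t] by simp

lemma wait_Suc: "wait xs (Suc t) i = (if i = label t then int (length xs) - 1 else wait xs t i - 1)"
proof -
  have "wait xs (Suc t) i = (wait xs t i - 1) mod int (length xs)"
    unfolding wait_def by (simp add: mod_diff_left_eq algebra_simps)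
  also have "... = (if wait xs t i = 0 then int (length xs) - 1 else wait xs t i - 1)"
  proof (cases "wait xs t i = 0")
    case True
    have "(-1) mod int (length xs) = int (length xs) - 1"
      using length_pos zmod_minus1 by simp
    then show ?thesis using True by simp
  next
    case False
    then show ?thesis using wait_bounds[of t i] by (simp add: mod_pos_pos_trivial)
  qed
  finally show ?thesis by (simp add: wait_zero_iff)
qed

lemma occupation_occ: "occupation (orbit L xs u t) (occ t)"
proof (induction t)
  case (Suc t)
  then show ?case
    using occupation_swap[OF orbit_carrier[OF u(1)] Suc, of "label t"] by (simp add: toggle_def occupations.simps(2) comp_def)
qed (use u in simp)

lemma sum_occ: "(\<Sum>a\<in>{0..<N}. occ t a) = (\<Sum>a\<in>{0..<N}. p a)"
proof (induction t)
  case (Suc t)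
  then show ?case using occupation_sum_swap[OF occupation_occ[of t], of "label t"] by (simp add: occupations.simps(2))
qed simp

lemma occ_bij: "bij (occ t)"
  using occupation_occ[of t] by (simp add: occupation_def)

lemma occ_eq_iff: "occ t a = occ t b \<longleftrightarrow> a = b"
  using occ_bij[of t] by (auto simp: bij_def inj_def)

lemma occ_surj: obtains a where "occ t a = x"
  using occ_bij[of t] by (metis bij_pointE)

lemma occ_step:
  assumes "\<pi> x = label t" "occ t a = x" "occ t b = x + 1"
  shows "occ (Suc t) a = (if before L a b then x else x + 1)" "occ (Suc t) b = (if before L a b then x + 1 else x)"
  using blocked_iff[OF orbit_carrier[OF u(1)] occupation_occ L(1) assms] assms \<pi>_next[of x]
  by (simp_all add: swap_def occupations.simps(2))

lemma occ_stay: "\<pi> (occ t a) ~= label t ==> \<pi> (occ t a - 1) ~= label t ==> occ (Suc t) a = occ t a"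
  by (simp add: swap_def occupations.simps(2))

text \<open>Two labels can exchange their order only when they face each other across the toggled
  gap, and there the relation blocks the toggle.\<close>

lemma occ_before_mono:
  assumes "before L a b" "occ t a < occ t b"
  shows "occ (Suc t) a < occ (Suc t) b"
proof (cases "occ t b = occ t a + 1 \<and> \<pi> (occ t a) = label t")
  case True
  then show ?thesis using occ_step[of "occ t a" t a b] assms(1) by simp
next
  case False
  have "swap i x < swap i y" if "x < y" "~ (y = x + 1 \<and> \<pi> x = i)" for i x y
    using that \<pi>_next[of x] \<pi>_prev[of y] \<pi>_prev[of x] by (auto simp: swap_def split: if_splits) (smt (verit))+
  then show ?thesis using False assms(2) by (simp add: occupations.simps(2))
qed

lemma occ_before_mono_le:
  assumes "before L a b" "occ t a < occ t b" "t <= t'"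
  shows "occ t' a < occ t' b"
  using assms(3)
proof (induction t' rule: dec_induct)
  case (step k)
  then show ?case using occ_before_mono[OF assms(1)] by blast
qed (rule assms(2))

context
  fixes T :: nat
  assumes T: "T > 0" and periodic: "!!t k. occ (t + k * T) = occ t"
begin

text \<open>The right order is never lost again. By periodicity each moment comes back later, so an
  order that is wrong once is wrong at all times.\<close>

lemma wrong_stays:
  assumes "before L a b" "occ t a > occ t b"
  shows "occ t' a > occ t' b"
proof (rule ccontr)
  assume "~ occ t' a > occ t' b"
  moreover have "a ~= b" using assms(2) by auto
  ultimately have "occ t' a < occ t' b" using occ_eq_iff[of t' a b] by simp
  then have "occ (t + t' * T) a < occ (t + t' * T) b"
    using occ_before_mono_le[OF assms(1)] T by (simp add: trans_le_add2)
  then show False using assms(2) by (simp add: periodic)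
qed

text \<open>A label that is about to move to the left starts a beam: if it is blocked by another label, then
  this label continues the motion. The beam never meets the label \<open>b\<close>.\<close>

lemma beam:
  assumes "before L a b" "occ t a > occ t b" "wait xs t (\<pi> (occ t a - 1)) < wait xs t (\<pi> (occ t a))"
  defines "M \<equiv> int (length xs) * occ t a + wait xs t (\<pi> (occ t a - 1))"
  shows "\<exists>k. before L k b \<and> occ (t + d) k > occ (t + d) b \<and>
    wait xs (t + d) (\<pi> (occ (t + d) k - 1)) < wait xs (t + d) (\<pi> (occ (t + d) k)) \<and>
    int (length xs) * occ (t + d) k + wait xs (t + d) (\<pi> (occ (t + d) k - 1)) <= M - int d"
proof (induction d)
  case 0
  then show ?case using assms by auto
next
  case (Suc d)
  let ?t = "t + d" and ?n = "int (length xs)"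
  obtain k where k: "before L k b" "occ ?t k > occ ?t b"
    "wait xs ?t (\<pi> (occ ?t k - 1)) < wait xs ?t (\<pi> (occ ?t k))"
    "?n * occ ?t k + wait xs ?t (\<pi> (occ ?t k - 1)) <= M - int d"
    using Suc by blast
  define y where "y = occ ?t k"
  have w0: "\<pi> y ~= label ?t" using k(3) wait_bounds(1)[of ?t "\<pi> (y - 1)"] wait_zero_iff[of ?t "\<pi> y"] by (auto simp: y_def)
  show ?case
  proof (cases "\<pi> (y - 1) = label ?t")
    case False
    then have stay: "occ (Suc ?t) k = y" using w0 occ_stay[of ?t k] by (simp add: y_def)
    have "occ (Suc ?t) k > occ (Suc ?t) b" by (rule wrong_stays[OF k(1,2)])
    then show ?thesis
      using k stay w0 False by (intro exI[of _ k]) (simp add: wait_Suc y_def)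
  next
    case True
    obtain l where l: "occ ?t l = y - 1" by (rule occ_surj)
    have "occ ?t k = y - 1 + 1" by (simp add: y_def)
    note step = occ_step[OF True l this, unfolded diff_add_cancel]
    \<comment> \<open>If the swap is blocked, the label in the slot \<open>y - 1\<close> takes over
      the beam, and transitivity puts it before \<open>b\<close> as well; otherwise \<open>k\<close>
      itself has moved there.\<close>
    define k' where "k' = (if before L l k then l else k)"
    have k': "occ (Suc ?t) k' = y - 1" unfolding k'_def using step by (cases "before L l k") simp_all
    have b: "before L k' b"
    proof (cases "before L l k")
      case True
      have "before L l b" by (rule before_trans[OF L(1) True k(1)])
      then show ?thesis using True by (simp add: k'_def)
    next
      case False
      then show ?thesis using k(1) by (simp add: k'_def)
    qed
    have "occ (Suc ?t) k' > occ (Suc ?t) b"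
    proof (cases "before L l k")
      case True
      have "l ~= b"
      proof
        assume "l = b"
        then have "k = b" using True k(1) before_antisym[OF L] by blast
        then show False using k(2) by simp
      qed
      then have "occ ?t l ~= occ ?t b" by (simp add: occ_eq_iff)
      then have "occ ?t l > occ ?t b" using k(2) l by (simp add: y_def)
      then show ?thesis using wrong_stays[of l b ?t "Suc ?t"] b True by (simp add: k'_def)
    next
      case False
      then show ?thesis using wrong_stays[OF k(1,2), of "Suc ?t"] by (simp add: k'_def)
    qed
    \<comment> \<open>The gap just toggled now has the longest possible waiting time, so the gap
      further left is toggled sooner and the beam keeps moving left.\<close>
    moreover have "\<pi> (y - 1 - 1) ~= label ?t" using \<pi>_prev[of "y - 1"] True by simp
    then have w': "wait xs (Suc ?t) (\<pi> (y - 1 - 1)) = wait xs ?t (\<pi> (y - 1 - 1)) - 1" "wait xs (Suc ?t) (\<pi> (y - 1)) = ?n - 1"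
      using True by (simp_all add: wait_Suc)
    moreover have "?n * (y - 1) + (wait xs ?t (\<pi> (y - 1 - 1)) - 1) <= M - int (Suc d)"
      using k(4) wait_bounds[of ?t "\<pi> (y - 1 - 1)"] wait_bounds(1)[of ?t "\<pi> (y - 1)"]
      by (simp add: y_def algebra_simps)
    ultimately show ?thesis
      using b k' wait_bounds(2)[of ?t "\<pi> (y - 1 - 1)"]
      by (intro exI[of _ k']) simp
  qed
qed

text \<open>The measure of the beam drops by at least one per step, although the beam stays to the
  right of \<open>b\<close>, which returns to its slot after every period.\<close>

lemma no_left_moving:
  assumes "before L a b" "occ t a > occ t b"
  shows "wait xs t (\<pi> (occ t a)) < wait xs t (\<pi> (occ t a - 1))"
proof (rule ccontr)
  assume "~ ?thesis"
  then have left: "wait xs t (\<pi> (occ t a - 1)) < wait xs t (\<pi> (occ t a))"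
    using wait_eq_iff[of t "\<pi> (occ t a - 1)" "\<pi> (occ t a)"] \<pi>_prev[of "occ t a"] by simp
  define M where "M = int (length xs) * occ t a + wait xs t (\<pi> (occ t a - 1))"
  define d where "d = nat (M - int (length xs) * occ t b + 1)"
  obtain k where k: "occ (t + d * T) k > occ (t + d * T) b"
    "int (length xs) * occ (t + d * T) k + wait xs (t + d * T) (\<pi> (occ (t + d * T) k - 1)) <= M - int (d * T)"
    using beam[OF assms left, of "d * T"] unfolding M_def by blast
  have "int (length xs) * occ t b <= int (length xs) * occ (t + d * T) k"
    using k(1) by (intro mult_left_mono) (simp_all add: periodic)
  then have "int (length xs) * occ t b <= M - int (d * T)"
    using k(2) wait_bounds(1)[of "t + d * T" "\<pi> (occ (t + d * T) k - 1)"] by linarith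
  moreover have "d <= d * T" using T by simp
  then have "int d <= int (d * T)" by (rule of_nat_mono)
  moreover have "int d >= M - int (length xs) * occ t b + 1" unfolding d_def by simp
  ultimately show False by linarith
qed

text \<open>A wrongly placed label never moves left, so it always meets the gap on its right first.
  The measure, slots times the length of the listing minus the waiting time, is the mirror image of
  the one for the beam.\<close>

lemma right_moving:
  assumes "before L a b" "occ 0 a > occ 0 b"
  shows "int (length xs) * occ t a - wait xs t (\<pi> (occ t a)) >= int (length xs) * occ 0 a - wait xs 0 (\<pi> (occ 0 a)) + int t"
proof (induction t)
  case (Suc t)
  let ?n = "int (length xs)"
  define x where "x = occ t a"
  have right: "wait xs t (\<pi> x) < wait xs t (\<pi> (x - 1))"
    unfolding x_def by (rule no_left_moving[OF assms(1) wrong_stays[OF assms]])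
  then have w: "\<pi> (x - 1) ~= label t"
    using wait_bounds(1)[of t "\<pi> x"] wait_zero_iff[of t "\<pi> (x - 1)"] by auto
  show ?case
  proof (cases "\<pi> x = label t")
    case False
    then have "occ (Suc t) a = x" using w occ_stay[of t a] by (simp add: x_def)
    then show ?thesis using Suc False by (simp add: wait_Suc x_def)
  next
    case True
    obtain l where l: "occ t l = x + 1" by (rule occ_surj)
    note step = occ_step(1)[OF True x_def[symmetric] l]
    \<comment> \<open>If the swap were blocked, the gap on the right would have the longest waiting
      time and the one on the left a shorter one: the label would have turned to the left.\<close>
    have "~ before L a l"
    proof
      assume "before L a l"
      then have "occ (Suc t) a = x" using step by simp
      moreover have "wait xs (Suc t) (\<pi> (occ (Suc t) a)) < wait xs (Suc t) (\<pi> (occ (Suc t) a - 1))"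
        by (rule no_left_moving[OF assms(1) wrong_stays[OF assms]])
      ultimately show False using True w wait_bounds(2)[of t "\<pi> (x - 1)"] by (simp add: wait_Suc)
    qed
    then have "occ (Suc t) a = x + 1" using step by simp
    moreover have "wait xs (Suc t) (\<pi> (x + 1)) <= ?n - 1" using wait_bounds(2)[of "Suc t" "\<pi> (x + 1)"] by simp
    moreover have "wait xs t (\<pi> x) = 0" using True wait_zero_iff by simp
    ultimately show ?thesis using Suc by (simp add: x_def algebra_simps)
  qed
qed simp

lemma no_wrong:
  assumes "before L a b"
  shows "occ 0 a <= occ 0 b"
proof (rule ccontr)
  assume "~ occ 0 a <= occ 0 b"
  then have wrong: "occ 0 a > occ 0 b" by simp
  define d where "d = nat (wait xs 0 (\<pi> (occ 0 a)) + 1)"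
  have "occ (0 + d * T) = occ 0" by (rule periodic)
  moreover have "int (length xs) * occ (d * T) a - wait xs (d * T) (\<pi> (occ (d * T) a)) \<ge>
      int (length xs) * occ 0 a - wait xs 0 (\<pi> (occ 0 a)) + int (d * T)"
    by (rule right_moving[OF assms wrong])
  ultimately have "int (d * T) <= wait xs 0 (\<pi> (occ 0 a))"
    using wait_bounds(1)[of "d * T" "\<pi> (occ (d * T) a)"] by simp
  moreover have "d <= d * T" using T by simp
  then have "int d <= int (d * T)" by (rule of_nat_mono)
  moreover have "int d >= wait xs 0 (\<pi> (occ 0 a)) + 1" unfolding d_def by simp
  ultimately show False by linarith
qed

end

end

lemma slot_model_heavy:
  assumes convex: "is_convex L" "L ~= {}" and xs: "distinct xs" "set xs = UNIV"
  shows "heavy_listing L xs"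
  unfolding heavy_listing_def
proof (intro ballI impI)
  fix u assume u: "u \<in> carrier W" and "\<exists>K\<ge>1. (fold (toggle L) xs ^^ K) u = u"
  then obtain K where K: "K >= 1" "(fold (toggle L) xs ^^ K) u = u" by blast
  have L: "L \<subseteq> carrier W" using convex(1) by (auto simp: is_convex_def)
  obtain p where p: "occupation u p" using occupation_exists[OF u] by blast
  note ctxt = L convex(2) xs u p
  define T where "T = K * length xs"
  have T: "T > 0" using K(1) length_pos[OF ctxt] by (simp add: T_def)
  have orbit: "orbit L xs u (t + k * T) = orbit L xs u t" for t k
    unfolding T_def by (rule orbit_periodic[OF K(2)])
  \<comment> \<open>The period of the group elements carries over to occupations, since the
    invariant sum excludes a shift.\<close>
  have eq: "occupations L xs u p (t + k * T) = occupations L xs u p t" for t k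
    by (rule occupation_unique[OF orbit_carrier[OF u], of L xs "t + k * T"])
      (use occupation_occ[OF ctxt, of "t + k * T"] occupation_occ[OF ctxt, of t] sum_occ[OF ctxt] orbit in auto)
  have "nonneg (action u \<beta>)" if \<beta>: "\<beta> \<in> root_set L" for \<beta>
  proof -
    have "\<beta> \<in> roots" using \<beta> by (simp add: root_set_iff)
    then obtain a b c where c: "c > 0" "\<beta> = c *\<^sub>R (slot_vec a - slot_vec b)" by (rule root_slot_vec)
    have act: "action w \<beta> = c *\<^sub>R action w (slot_vec a - slot_vec b)" if "w \<in> carrier W" for w
      unfolding c(2) using linear_scale[OF action_linear[OF that]] .
    have nn: "nonneg (c *\<^sub>R v) \<longleftrightarrow> nonneg v" for v using c(1) by (auto simp: nonneg_def zero_le_mult_iff)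
    have "before L a b" using \<beta> L act unfolding before_def root_set_iff by (auto simp: nn)
    from no_wrong[OF ctxt T eq this] show ?thesis
      using p u unfolding act[OF u] nn occupation_def by (simp add: nonneg_slot_vec_iff)
  qed
  then show "u \<in> L" using convex_iff[OF convex(1)] u by blast
qed

lemma slot_model_futuristic: futuristic
  by (rule futuristicI) (rule slot_model_heavy)

end

section \<open>Slot models of types A and C\<close>

lemma slot_modelI:
  assumes f: "bij_betw f {..n} (UNIV :: 'i set)" and "N > 0"
    and \<omega>: "!!a. \<omega> a <= n" "!!a. \<omega> (a + N) = \<omega> a" "!!a. \<omega> a ~= \<omega> (a + 1)" "!!b. b <= n ==> \<exists>a. \<omega> a = b"
    and r: "!!b. r b > 0"
    and entry: "!!a b. b <= n ==> \<omega> a ~= b ==> - 2 * form_entry (f (\<omega> a)) (f b) * r (\<omega> a) =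
      ((if \<omega> (a - 1) = b then 1 else 0) + (if \<omega> (a + 1) = b then 1 else 0)) * r b"
  shows "slot_model (%a. f (\<omega> a)) (%i. r (inv_into {..n} f i)) N"
proof -
  have idx: "inv_into {..n} f (f b) = b" if "b <= n" for b
    using f that by (simp add: bij_betw_def)
  have f_eq: "f b = f c \<longleftrightarrow> b = c" if "b <= n" "c <= n" for b c
    using f that by (auto simp: bij_betw_def inj_on_def)
  have index: "\<exists>b\<le>n. i = f b" for i
    using f by (metis UNIV_I atMost_iff bij_betw_def imageE)
  show ?thesis
    unfolding slot_model_def
  proof (intro conjI allI impI)
    show "surj (%a. f (\<omega> a))" unfolding surj_def using index \<omega>(4) by metis
    show "f (\<omega> a) ~= f (\<omega> (a + 1))" for a using \<omega>(1,3) f_eq by simp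
    fix a i assume ne: "f (\<omega> a) ~= i"
    obtain b where b: "b <= n" "i = f b" using index by blast
    have "\<omega> a ~= b" using ne b by auto
    from entry[OF b(1) this]
    show "- 2 * form_entry (f (\<omega> a)) i * r (inv_into {..n} f (f (\<omega> a))) =
      ((if f (\<omega> (a - 1)) = i then 1 else 0) + (if f (\<omega> (a + 1)) = i then 1 else 0)) * r (inv_into {..n} f i)"
      unfolding b(2) by (simp add: idx \<omega>(1) b(1) f_eq)
  qed (use assms in auto)
qed

lemma cyclic_shift:
  fixes a N :: int
  assumes "N > 0"
  shows "(a + 1) mod N = (if a mod N = N - 1 then 0 else a mod N + 1)"
    "(a - 1) mod N = (if a mod N = 0 then N - 1 else a mod N - 1)"
proof -
  have b: "0 <= a mod N" "a mod N < N" using assms by auto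
  have "(a + 1) mod N = (a mod N + 1) mod N" by (simp add: mod_add_left_eq)
  also have "... = (if a mod N = N - 1 then 0 else a mod N + 1)"
  proof (cases "a mod N = N - 1")
    case False
    then have "0 <= a mod N + 1" "a mod N + 1 < N" using b by linarith+
    then show ?thesis using False by (simp only: mod_pos_pos_trivial if_False)
  qed (use assms in simp)
  finally show "(a + 1) mod N = (if a mod N = N - 1 then 0 else a mod N + 1)" .
  have "(a - 1) mod N = (a mod N - 1) mod N" by (simp add: mod_diff_left_eq)
  also have "... = (if a mod N = 0 then N - 1 else a mod N - 1)"
  proof (cases "a mod N = 0")
    case True
    then show ?thesis using assms zmod_minus1[of N] by simp
  next
    case False
    then have "0 <= a mod N - 1" "a mod N - 1 < N" using b by linarith+
    then show ?thesis using False by (simp only: mod_pos_pos_trivial if_False)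
  qed
  finally show "(a - 1) mod N = (if a mod N = 0 then N - 1 else a mod N - 1)" .
qed

text \<open>The cycle is unrolled to the integers modulo \<open>n + 1\<close>. For
  \<open>n = 1\<close> both neighbours of a gap carry the same label, which fits the entry -1 of the
  infinite bond.\<close>

lemma cyclic_futuristic:
  fixes n :: nat
  assumes n: "n >= 1" and f: "bij_betw f {..n} (UNIV :: 'i set)"
    and M: "!!a b. a < b ==> b <= n ==> m (f a) (f b) =
      (if n = 1 then 0 else if b = a + 1 \<or> a = 0 \<and> b = n then 3 else 2)"
  shows futuristic
proof -
  define N where "N = int n + 1"
  define \<omega> where "\<omega> = (%a. nat (a mod N))"
  have N: "N > 0" by (simp add: N_def)
  have entry: "- 2 * form_entry (f b) (f c) = (if n = 1 then 2 else if c = b + 1 \<or> b = c + 1 \<or> b = 0 \<and> c = n \<or> c = 0 \<and> b = n then 1 else 0)"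
    if "b ~= c" "b <= n" "c <= n" for b c
  proof -
    consider "b < c" | "c < b" using \<open>b ~= c\<close> by linarith
    then show ?thesis
    proof cases
      case 1
      then show ?thesis using M[OF 1 that(3)] that n form_entry_values(1)[of "f b" "f c"]
        by (auto simp: form_entry_def[of "f b" "f c"] split: if_splits)
    next
      case 2
      then show ?thesis using M[OF 2 that(2)] that n form_entry_values(1)[of "f c" "f b"] form_entry_sym[of "f b" "f c"]
        by (auto simp: form_entry_def[of "f c" "f b"] split: if_splits)
    qed
  qed
  have bounds: "0 <= a mod N" "a mod N <= int n" for a
    using N pos_mod_bound[of N a] by (auto simp: N_def)
  have succ: "\<omega> (a + 1) = (if \<omega> a = n then 0 else \<omega> a + 1)" for a
    unfolding \<omega>_def cyclic_shift(1)[OF N] using bounds[of a] by (auto simp: N_def nat_add_distrib)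
  have prev: "\<omega> (a - 1) = (if \<omega> a = 0 then n else \<omega> a - 1)" for a
  proof (cases "a mod N = 0")
    case True
    then show ?thesis unfolding \<omega>_def cyclic_shift(2)[OF N] by (simp add: N_def)
  next
    case False
    then have "a mod N > 0" using bounds(1)[of a] by linarith
    then show ?thesis unfolding \<omega>_def cyclic_shift(2)[OF N] by (simp add: nat_diff_distrib)
  qed
  have le: "\<omega> a <= n" for a using bounds[of a] by (simp add: \<omega>_def)
  have "slot_model (%a. f (\<omega> a)) (%i. 1) N"
  proof (rule slot_modelI[where r = "%_. 1", OF f N le])
    show "\<omega> (a + N) = \<omega> a" for a by (simp add: \<omega>_def)
    show "\<omega> a ~= \<omega> (a + 1)" for a using n unfolding succ by simp
    show "\<exists>a. \<omega> a = b" if "b <= n" for b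
      using that by (intro exI[of _ "int b"]) (simp add: \<omega>_def N_def)
    show "- 2 * form_entry (f (\<omega> a)) (f b) * 1 = ((if \<omega> (a - 1) = b then 1 else 0) + (if \<omega> (a + 1) = b then 1 else 0)) * 1"
      if "b <= n" "\<omega> a ~= b" for a b
    proof -
      have P: "\<omega> (a - 1) = b \<longleftrightarrow> \<omega> a = 0 \<and> b = n \<or> \<omega> a = b + 1" unfolding prev by auto
      have Q: "\<omega> (a + 1) = b \<longleftrightarrow> \<omega> a = n \<and> b = 0 \<or> \<omega> a ~= n \<and> b = \<omega> a + 1" unfolding succ by auto
      show ?thesis
      proof (cases "n = 1")
        case True
        then have "\<omega> (a - 1) = b" "\<omega> (a + 1) = b" unfolding P Q using that le[of a] by linarith+
        then show ?thesis unfolding entry[OF that(2) le that(1)] using True by simp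
      next
        case False
        have "~ (\<omega> (a - 1) = b \<and> \<omega> (a + 1) = b)" unfolding P Q using False n by presburger
        moreover have "\<omega> (a - 1) = b \<or> \<omega> (a + 1) = b \<longleftrightarrow> b = \<omega> a + 1 \<or> \<omega> a = b + 1 \<or> \<omega> a = 0 \<and> b = n \<or> b = 0 \<and> \<omega> a = n"
          unfolding P Q using that(1) by presburger
        ultimately show ?thesis unfolding entry[OF that(2) le that(1)] using False
          by (cases "\<omega> (a - 1) = b"; cases "\<omega> (a + 1) = b") simp_all
      qed
    qed
  qed simp
  then show ?thesis by (rule slot_model_futuristic)
qed

lemma futuristic_A: "type_A ==> futuristic"
  unfolding type_A_def
proof (elim disjE exE conjE)
  assume M: "has_coxeter_matrix 1 (%a b. 0)"
  obtain f where f: "bij_betw f {..1 :: nat} UNIV" "!!a b. a < b ==> b <= 1 ==> m (f a) (f b) = 0"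
    using has_coxeter_matrixE[OF M] by blast
  show futuristic by (rule cyclic_futuristic[OF _ f(1)]) (use f(2) in auto)
next
  fix n :: nat assume n: "2 <= n" and M: "has_coxeter_matrix n (%a b. if b = a + 1 \<or> a = 0 \<and> b = n then 3 else 2)"
  obtain f where f: "bij_betw f {..n} UNIV" "!!a b. a < b ==> b <= n ==> m (f a) (f b) = (if b = a + 1 \<or> a = 0 \<and> b = n then 3 else 2)"
    using has_coxeter_matrixE[OF M] by blast
  show futuristic by (rule cyclic_futuristic[OF _ f(1)]) (use f(2) n in auto)
qed

text \<open>The path is unfolded to the sequence 0, 1, ..., n, n - 1, ..., 1 of period
  \<open>2 n\<close>. A gap at an end label has equal labels on both sides; the factor
  \<open>sqrt 2\<close> in \<open>r\<close> splits the entry of the label 4 into 2 in one direction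
  and 1 in the other.\<close>

lemma futuristic_C:
  assumes type_C
  shows futuristic
proof -
  obtain n where n: "n >= 2" "has_coxeter_matrix n (%a b. if b = a + 1 then (if a = 0 \<or> b = n then 4 else 3) else 2)"
    using assms by (auto simp: type_C_def)
  obtain f where f: "bij_betw f {..n} UNIV" and M: "!!a b. a < b ==> b <= n ==> m (f a) (f b) =
      (if b = a + 1 then (if a = 0 \<or> b = n then 4 else 3) else 2)"
    using has_coxeter_matrixE[OF n(2)] by blast
  define N where "N = 2 * int n"
  define \<omega> where "\<omega> = (%a. if a mod N <= int n then nat (a mod N) else nat (N - a mod N))"
  define r where "r = (%b. if b = 0 \<or> b = n then sqrt 2 else 1)"
  have N: "N > 0" using n by (simp add: N_def)
  have less: "- 2 * form_entry (f b) (f c) = (if c = b + 1 then (if b = 0 \<or> c = n then sqrt 2 else 1) else 0)"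
    if "b < c" "c <= n" for b c
    using M[OF that] that n(1) form_entry_values(1,2)[of "f b" "f c"] by (cases "c = b + 1") auto
  have entry: "- 2 * form_entry (f b) (f c) * r b = (if c = b + 1 \<or> b = c + 1 then (if b = 0 \<or> b = n then 2 else 1) else 0) * r c"
    if "b ~= c" "b <= n" "c <= n" for b c
  proof -
    consider "b < c" | "c < b" using \<open>b ~= c\<close> by linarith
    then show ?thesis
    proof cases
      case 1
      then show ?thesis using less[OF 1 that(3)] that n(1) by (auto simp: r_def)
    next
      case 2
      then show ?thesis using less[OF 2 that(2)] that n(1) form_entry_sym[of "f b" "f c"] by (auto simp: r_def)
    qed
  qed
  have bounds: "0 <= a mod N" "a mod N < 2 * int n" for a
    using N pos_mod_bound[of N a] by (auto simp: N_def)
  have le: "\<omega> a <= n" for a using bounds[of a] by (auto simp: \<omega>_def N_def)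
  have neighbours: "\<omega> a = 0 \<and> \<omega> (a - 1) = 1 \<and> \<omega> (a + 1) = 1 \<or> \<omega> a = n \<and> \<omega> (a - 1) = n - 1 \<and> \<omega> (a + 1) = n - 1 \<or>
    0 < \<omega> a \<and> \<omega> a < n \<and> (\<omega> (a - 1) = \<omega> a - 1 \<and> \<omega> (a + 1) = \<omega> a + 1 \<or> \<omega> (a - 1) = \<omega> a + 1 \<and> \<omega> (a + 1) = \<omega> a - 1)" for a
  proof -
    define x where "x = nat (a mod N)"
    have x: "a mod N = int x" "x < 2 * n" using bounds[of a] by (auto simp: x_def)
    have w: "\<omega> a = (if x <= n then x else 2 * n - x)"
      using x by (auto simp: \<omega>_def N_def)
    have p: "\<omega> (a + 1) = (if x < n then x + 1 else 2 * n - x - 1)"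
      unfolding \<omega>_def cyclic_shift(1)[OF N] x(1) using x(2) n(1) by (auto simp: N_def)
    have q: "\<omega> (a - 1) = (if x = 0 then 1 else if x <= n then x - 1 else 2 * n - x + 1)"
      unfolding \<omega>_def cyclic_shift(2)[OF N] x(1) using x(2) n(1) by (auto simp: N_def)
    consider "x = 0" | "0 < x" "x < n" | "x = n" | "n < x" by linarith
    then show ?thesis
    proof cases
      case 1
      then have "\<omega> a = 0" "\<omega> (a + 1) = 1" "\<omega> (a - 1) = 1" unfolding w p q using n(1) by simp_all
      then show ?thesis by blast
    next
      case 2
      then have "\<omega> a = x" "\<omega> (a + 1) = x + 1" "\<omega> (a - 1) = x - 1" unfolding w p q by simp_all
      then show ?thesis using 2 by metis
    next
      case 3
      have "\<omega> a = n" "\<omega> (a + 1) = n - 1" "\<omega> (a - 1) = n - 1" unfolding w p q using n(1) 3 by simp_all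
      then show ?thesis by blast
    next
      case 4
      then have "\<omega> a = 2 * n - x" "\<omega> (a + 1) = 2 * n - x - 1" "\<omega> (a - 1) = 2 * n - x + 1"
        unfolding w p q by simp_all
      moreover have "0 < 2 * n - x" "2 * n - x < n" using 4 x(2) by linarith+
      ultimately show ?thesis by metis
    qed
  qed
  have "slot_model (%a. f (\<omega> a)) (%i. r (inv_into {..n} f i)) N"
  proof (rule slot_modelI[OF f N le])
    show "\<omega> (a + N) = \<omega> a" for a by (simp add: \<omega>_def)
    show "\<omega> a ~= \<omega> (a + 1)" for a
      using neighbours[of a] by (elim disjE conjE) (use n(1) in linarith)+
    show "\<exists>a. \<omega> a = b" if "b <= n" for b
      using that n(1) by (intro exI[of _ "int b"]) (simp add: \<omega>_def N_def)
    show "r b > 0" for b by (simp add: r_def)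
    show "- 2 * form_entry (f (\<omega> a)) (f b) * r (\<omega> a) =
      ((if \<omega> (a - 1) = b then 1 else 0) + (if \<omega> (a + 1) = b then 1 else 0)) * r b"
      if "b <= n" "\<omega> a ~= b" for a b
    proof -
      have n1: "n - 1 = b \<longleftrightarrow> n = b + 1" "b ~= n + 1" using n(1) that(1) by auto
      have w1: "\<omega> a - 1 = b \<longleftrightarrow> \<omega> a = b + 1" if "0 < \<omega> a" using that by auto
      have "(if b = \<omega> a + 1 \<or> \<omega> a = b + 1 then (if \<omega> a = 0 \<or> \<omega> a = n then 2 else 1) else 0) =
          (if \<omega> (a - 1) = b then 1 else 0) + (if \<omega> (a + 1) = b then 1 else 0 :: real)" (is "?l = ?r")
        using neighbours[of a]
      proof (elim disjE conjE)
        assume h: "\<omega> a = 0" "\<omega> (a - 1) = 1" "\<omega> (a + 1) = 1"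
        show "?l = ?r" unfolding h by auto
      next
        assume h: "\<omega> a = n" "\<omega> (a - 1) = n - 1" "\<omega> (a + 1) = n - 1"
        show "?l = ?r" unfolding h n1(1) using n1(2) by auto
      next
        assume h: "0 < \<omega> a" "\<omega> a < n" "\<omega> (a - 1) = \<omega> a - 1" "\<omega> (a + 1) = \<omega> a + 1"
        show "?l = ?r" unfolding h(3,4) w1[OF h(1)] using h(1,2) by auto
      next
        assume h: "0 < \<omega> a" "\<omega> a < n" "\<omega> (a - 1) = \<omega> a + 1" "\<omega> (a + 1) = \<omega> a - 1"
        show "?l = ?r" unfolding h(3,4) w1[OF h(1)] using h(1,2) by auto
      qed
      then show ?thesis unfolding entry[OF that(2) le that(1)] by (rule arg_cong)
    qed
  qed
  then show ?thesis by (rule slot_model_futuristic)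
qed

end

section \<open>Classification\<close>

lemma sum_half_less_1:
  fixes e :: "'a => real"
  assumes "finite T" "!!x. x \<in> T ==> e x >= 1 / 2" "sum e T < 1"
  shows "T = {} \<or> (\<exists>x. T = {x})"
proof (rule ccontr)
  assume "~ ?thesis"
  then obtain x y where xy: "x \<in> T" "y \<in> T" "x ~= y" by blast
  have "sum e {x, y} <= sum e T"
  proof (rule sum_mono2[OF assms(1)])
    show "0 <= e b" if "b \<in> T - {x, y}" for b using assms(2)[of b] that by simp
  qed (use xy in auto)
  then show False using assms(2)[OF xy(1)] assms(2)[OF xy(2)] assms(3) xy(3) by simp
qed

lemma sum_half_eq_1:
  fixes e :: "'a => real"
  assumes T: "finite T" "!!x. x \<in> T ==> e x >= 1 / 2" "sum e T = 1"
  shows "(\<exists>x. T = {x} \<and> e x = 1) \<or> (\<exists>x y. T = {x, y} \<and> x ~= y \<and> e x = 1 / 2 \<and> e y = 1 / 2)"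
proof -
  obtain x where x: "x \<in> T" using T(3) by fastforce
  have r: "sum e (T - {x}) = 1 - e x" using sum.remove[OF T(1) x, of e] T(3) by simp
  have "T - {x} = {} \<or> (\<exists>y. T - {x} = {y})"
    by (rule sum_half_less_1[of _ e]) (use T(1,2) r T(2)[OF x] in auto)
  then show ?thesis
  proof
    assume "T - {x} = {}"
    then have "T = {x}" using x by blast
    then show ?thesis using T(3) by simp
  next
    assume "\<exists>y. T - {x} = {y}"
    then obtain y where y: "T - {x} = {y}" by blast
    then have "T = {x, y}" "x ~= y" "y \<in> T" using x by blast+
    moreover have "e y = 1 - e x" using r unfolding y by simp
    ultimately show ?thesis using T(2)[OF x] T(2)[of y] by force
  qed
qed

text \<open>Obtained from \<open>sin (2 t) = sin (3 t)\<close> for \<open>t = pi / 5\<close>. The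
  relation controls the weight of an edge labelled 5, which occurs in no affine diagram.\<close>

lemma golden_ratio: "2 * cos (pi / 5) * (2 * cos (pi / 5)) = 2 * cos (pi / 5) + 1"
proof -
  let ?t = "pi / 5 :: real"
  have s: "sin ?t > 0" by (rule sin_gt_zero) simp_all
  have "sin (2 * ?t) = sin (pi - 2 * ?t)" by (rule sin_pi_minus[symmetric])
  also have "pi - 2 * ?t = 2 * ?t + ?t" by simp
  also have "sin (2 * ?t + ?t) = sin ?t * (4 * (cos ?t)\<^sup>2 - 1)"
    unfolding sin_add sin_double cos_double_cos by (simp add: algebra_simps power2_eq_square)
  finally have "sin ?t * (2 * cos ?t) = sin ?t * (4 * (cos ?t)\<^sup>2 - 1)" unfolding sin_double by (simp add: mult_ac)
  then have "2 * cos ?t = 4 * (cos ?t)\<^sup>2 - 1" using s by simp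
  moreover have "2 * cos ?t * (2 * cos ?t) = 4 * (cos ?t)\<^sup>2" by (simp add: power2_eq_square)
  ultimately show ?thesis by linarith
qed

context coxeter_system
begin

definition weight :: "'i => 'i => real" where
  "weight i j = (if i = j then 0 else - 2 * form_entry i j)"

lemma weight_sym: "weight i j = weight j i"
  by (simp add: weight_def form_entry_sym[of i j])

lemma weight_cases:
  assumes "i ~= j"
  obtains (2) "m i j = 2" "weight i j = 0" | (3) "m i j = 3" "weight i j = 1" | (4) "m i j = 4" "weight i j = sqrt 2"
    | (5) "m i j = 5" "3 / 2 < weight i j" "weight i j < 5 / 3" "weight i j * weight i j = weight i j + 1"
    | (6) "m i j = 6" "weight i j = sqrt 3" | (7) "m i j >= 7" "sqrt 3 < weight i j" "weight i j < 2" "weight i j > 0"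
    | (0) "m i j = 0" "weight i j = 2"
proof -
  have w: "weight i j = 2 * cos (pi / m i j)" if "m i j ~= 0" using assms that by (simp add: weight_def form_entry_def)
  consider "m i j = 0" | "m i j = 2" | "m i j = 3" | "m i j = 4" | "m i j = 5" | "m i j = 6" | "m i j >= 7"
    using m_ge_2[OF assms] by linarith
  then show ?thesis
  proof cases
    case 1
    then show ?thesis using 0 assms by (simp add: weight_def form_entry_def)
  next
    case 5
    define x where "x = weight i j"
    have x: "x * x = x + 1" using w 5 golden_ratio by (simp add: x_def)
    have "x > 0" using w 5 cos_gt_zero[of "pi / 5"] by (simp add: x_def)
    have "(x - 3 / 2) * (x + 1 / 2) > 0" "(5 / 3 - x) * (x + 2 / 3) > 0" using x by (simp_all add: algebra_simps)
    then have "x > 3 / 2" "x < 5 / 3" using \<open>x > 0\<close> by (simp_all add: zero_less_mult_iff)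
    then show ?thesis using that(4) 5 x by (simp add: x_def)
  next
    case 7
    have "pi / m i j < pi / 6" using 7 by (intro divide_strict_left_mono) auto
    then have "cos (pi / m i j) > cos (pi / 6)" using 7 by (intro cos_monotone_0_pi) (auto simp: divide_simps)
    moreover have "pi / m i j < pi" using 7 by (simp add: divide_simps)
    then have "cos (pi / m i j) < cos 0" using 7 by (intro cos_monotone_0_pi) auto
    ultimately have "sqrt 3 < weight i j" "weight i j < 2" using 7 w by (simp_all add: cos_30)
    moreover have "sqrt (3 :: real) > 0" by simp
    ultimately show ?thesis using that(6) 7 by (meson less_trans)
  qed (use w that in \<open>simp_all add: cos_60 cos_45 cos_30\<close>)
qed

lemma weight_nonneg: "weight i j >= 0"
  by (cases "i = j") (simp_all add: weight_def form_entry_nonpos)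

lemma weight_pos: "weight i j > 0 ==> weight i j >= 1"
proof -
  assume *: "weight i j > 0"
  then have "i ~= j" by (auto simp: weight_def)
  then show ?thesis
  proof (cases rule: weight_cases)
    case 4
    then show ?thesis by simp
  next
    case 6
    then show ?thesis by simp
  next
    case 7
    have "1 <= sqrt (3 :: real)" by simp
    then show ?thesis using 7 by linarith
  qed (use * in simp_all)
qed

lemma weight_less_sqrt_2:
  assumes "weight i j > 0" "(weight i j)\<^sup>2 < 2"
  shows "m i j = 3 \<and> weight i j = 1"
proof -
  have ij: "i ~= j" using assms(1) by (auto simp: weight_def)
  have w: "weight i j < sqrt 2" using assms(2) by (rule real_less_rsqrt)
  have "sqrt 2 < 3 / (2 :: real)" by (rule real_less_lsqrt) (simp_all add: power2_eq_square)
  then have s: "sqrt 2 < 3 / (2 :: real)" "sqrt 2 < sqrt (3 :: real)" "sqrt 2 < (2 :: real)" by simp_all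
  from ij show ?thesis
    by (cases rule: weight_cases) (use assms(1) w s in simp_all)
qed

definition nbrs :: "'i => 'i set" where
  "nbrs i = {j. weight i j > 0}"

lemma nbrs_sym: "j \<in> nbrs i \<longleftrightarrow> i \<in> nbrs j"
  by (simp add: nbrs_def weight_sym[of i j])

lemma not_self_nbr [simp]: "i ~: nbrs i"
  by (simp add: nbrs_def weight_def)

lemma nbrs_iff: "j \<in> nbrs i \<longleftrightarrow> i ~= j \<and> m i j ~= 2"
proof (cases "i = j")
  case False
  show ?thesis by (cases rule: weight_cases[OF False]) (use False in \<open>simp_all add: nbrs_def\<close>)
qed simp

lemma nbrs_closed_UNIV:
  assumes is_irreducible "S ~= {}" "!!i. i \<in> S ==> nbrs i \<subseteq> S"
  shows "S = UNIV"
proof -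
  obtain i where i: "i \<in> S" using assms(2) by blast
  have "j \<in> S" for j
  proof -
    have "(i, j) \<in> coxeter_graph\<^sup>*" using assms(1) by (simp add: is_irreducible_def)
    then show ?thesis
    proof (induction rule: rtrancl_induct)
      case (step j k)
      then have "k \<in> nbrs j" by (auto simp: nbrs_iff coxeter_graph_def)
      then show ?case using step assms(3) by blast
    qed (rule i)
  qed
  then show ?thesis by blast
qed

text \<open>A nonempty set of vertices that contains all its neighbours is everything, so local
  information about the listed vertices already shows that the list is complete.\<close>

lemma has_coxeter_matrixI:
  assumes irr: is_irreducible and zs: "distinct zs" "length zs = Suc n"
    and nb: "!!a. a <= n ==> nbrs (zs ! a) = (!) zs ` nb a" "!!a. a <= n ==> nb a \<subseteq> {..n}"
    and M: "!!a b. a < b ==> b <= n ==> b \<in> nb a ==> m (zs ! a) (zs ! b) = M a b"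
      "!!a b. a < b ==> b <= n ==> b ~: nb a ==> M a b = 2"
  shows "has_coxeter_matrix n M"
proof -
  have "set zs = UNIV"
  proof (rule nbrs_closed_UNIV[OF irr])
    show "set zs ~= {}" using zs(2) by auto
    fix i assume "i \<in> set zs"
    then obtain a where "a <= n" "i = zs ! a" using zs(2) by (auto simp: in_set_conv_nth less_Suc_eq_le)
    then show "nbrs i \<subseteq> set zs" using nb[of a] zs(2) by (auto simp: less_Suc_eq_le)
  qed
  then have "bij_betw ((!) zs) {0..n} UNIV"
    by (intro bij_betw_nth) (use zs in auto)
  moreover have "m (zs ! a) (zs ! b) = M a b" if "a < b" "b <= n" for a b
  proof (cases "b \<in> nb a")
    case False
    have "inj_on ((!) zs) {..n}" using zs by (auto simp: inj_on_def nth_eq_iff_index_eq)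
    then have "zs ! b ~: (!) zs ` nb a" using False nb(2)[of a] that by (auto simp: inj_on_def)
    then have "zs ! b ~: nbrs (zs ! a)" using nb(1)[of a] that by simp
    moreover have "zs ! a ~= zs ! b" using that zs by (simp add: nth_eq_iff_index_eq)
    ultimately show ?thesis using M(2)[OF that False] by (simp add: nbrs_iff)
  qed (use M(1) that in blast)
  ultimately show ?thesis unfolding has_coxeter_matrix_def by blast
qed

context
  fixes \<delta> :: "real ^ 'i"
  assumes irr: is_irreducible and \<delta>_pos: "!!i. \<delta> $ i > 0" and \<delta>_null: "!!v. form \<delta> v = 0"
begin

lemma harmonic: "2 * \<delta> $ i = (\<Sum>j\<in>nbrs i. weight i j * \<delta> $ j)"
proof -
  have "0 = 2 * form \<delta> (simple_root i)" by (simp add: \<delta>_null)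
  also have "... = (\<Sum>j\<in>UNIV. (if j = i then 2 * \<delta> $ j else 0) - weight i j * \<delta> $ j)"
    unfolding form_simple_right sum_distrib_left
    by (intro sum.cong) (auto simp: weight_def form_entry_sym[of i])
  also have "... = 2 * \<delta> $ i - (\<Sum>j\<in>UNIV. weight i j * \<delta> $ j)" by (simp add: sum_subtractf)
  also have "(\<Sum>j\<in>UNIV. weight i j * \<delta> $ j) = (\<Sum>j\<in>nbrs i. weight i j * \<delta> $ j)"
    using weight_nonneg by (intro sum.mono_neutral_right) (auto simp: nbrs_def not_less intro!: antisym)
  finally show ?thesis by simp
qed

lemma harmonic_remove: "u \<in> nbrs i ==> 2 * \<delta> $ i = weight i u * \<delta> $ u + (\<Sum>j\<in>nbrs i - {u}. weight i j * \<delta> $ j)"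
  unfolding harmonic by (rule sum.remove) auto

lemma weight_\<delta>_nonneg: "weight i j * \<delta> $ j >= 0"
  using weight_nonneg[of i j] \<delta>_pos[of j] by simp

text \<open>Keep a single term of the harmonic equation at \<open>j\<close>.\<close>

lemma nbr_lower_bound: "weight i j * \<delta> $ i <= 2 * \<delta> $ j"
proof (cases "i \<in> nbrs j")
  case True
  have "(\<Sum>k\<in>nbrs j - {i}. weight j k * \<delta> $ k) >= 0" by (intro sum_nonneg weight_\<delta>_nonneg)
  then show ?thesis using harmonic_remove[OF True] by (simp add: weight_sym[of i j])
next
  case False
  then have "weight i j = 0" using weight_nonneg[of i j] by (simp add: nbrs_def weight_sym[of j i])
  then show ?thesis using \<delta>_pos[of j] by simp
qed

lemma nbr_lower_bound_2: "(weight i j)\<^sup>2 * \<delta> $ i <= 2 * (weight i j * \<delta> $ j)"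
  using mult_left_mono[OF nbr_lower_bound[of i j] weight_nonneg[of i j]] by (simp add: power2_eq_square mult_ac)

text \<open>Since \<open>2 \<delta> w >= \<delta> v\<close> for every neighbour \<open>w\<close> of \<open>v\<close>, there is no branching below a higher neighbour.\<close>

lemma below_higher_nbr:
  assumes "u \<in> nbrs v" "\<delta> $ v < \<delta> $ u"
  shows "nbrs v = {u} \<or> (\<exists>w. w ~= u \<and> nbrs v = {u, w} \<and> m v w = 3 \<and> \<delta> $ w < \<delta> $ v)"
proof -
  define e where "e = (%j. weight v j * \<delta> $ j / \<delta> $ v)"
  have v: "\<delta> $ v > 0" by (rule \<delta>_pos)
  have "weight v u >= 1" using assms(1) weight_pos by (simp add: nbrs_def)
  then have "weight v u * \<delta> $ u >= \<delta> $ u" using \<delta>_pos[of u] by simp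
  then have "(\<Sum>j\<in>nbrs v - {u}. weight v j * \<delta> $ j) < \<delta> $ v"
    using harmonic_remove[OF assms(1)] assms(2) by simp
  then have sum: "sum e (nbrs v - {u}) < 1"
    using v by (simp add: e_def flip: sum_divide_distrib)
  have half: "e j >= (weight v j)\<^sup>2 / 2" for j
    using nbr_lower_bound_2[of v j] v by (simp add: e_def field_simps)
  have "nbrs v - {u} = {} \<or> (\<exists>w. nbrs v - {u} = {w})"
  proof (rule sum_half_less_1[OF _ _ sum])
    fix j assume "j \<in> nbrs v - {u}"
    then have "weight v j >= 1" using weight_pos by (simp add: nbrs_def)
    then have "(weight v j)\<^sup>2 >= 1" by (simp add: one_le_power)
    then show "e j >= 1 / 2" using half[of j] by simp
  qed simp
  then show ?thesis
  proof
    assume "\<exists>w. nbrs v - {u} = {w}"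
    then obtain w where w: "nbrs v - {u} = {w}" by blast
    then have wv: "w \<in> nbrs v" "w ~= u" "nbrs v = {u, w}" using assms(1) by blast+
    have e: "e w < 1" using sum unfolding w by simp
    then have "m v w = 3 \<and> weight v w = 1"
      using half[of w] wv(1) by (intro weight_less_sqrt_2) (simp_all add: nbrs_def)
    moreover from this have "\<delta> $ w < \<delta> $ v" using e v by (simp add: e_def)
    ultimately show ?thesis using wv by blast
  qed (use assms(1) in blast)
qed

text \<open>The list starts next to \<open>u\<close> and leads outwards and downwards to a leaf. All
  its edges are labelled 3; the label of the edge to \<open>u\<close> is left open.\<close>

primrec arm :: "'i list => 'i => bool" where
  "arm [] u \<longleftrightarrow> True"
| "arm (v # vs) u \<longleftrightarrow> nbrs v = insert u (set (take 1 vs)) \<and> \<delta> $ v < \<delta> $ u \<and> (vs ~= [] --> m v (hd vs) = 3) \<and> arm vs v"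

lemma arm_exists:
  assumes "u \<in> nbrs v" "\<delta> $ v < \<delta> $ u"
  shows "\<exists>vs. arm (v # vs) u"
  using assms
proof (induction "card {w. \<delta> $ w < \<delta> $ v}" arbitrary: u v rule: less_induct)
  case less
  from below_higher_nbr[OF less.prems] show ?case
  proof
    assume "nbrs v = {u}"
    then have "arm [v] u" using less.prems by simp
    then show ?thesis by blast
  next
    assume "\<exists>w. w ~= u \<and> nbrs v = {u, w} \<and> m v w = 3 \<and> \<delta> $ w < \<delta> $ v"
    then obtain w where w: "nbrs v = {u, w}" "m v w = 3" "\<delta> $ w < \<delta> $ v" by blast
    have "card {x. \<delta> $ x < \<delta> $ w} < card {x. \<delta> $ x < \<delta> $ v}"
      using w(3) by (intro psubset_card_mono psubsetI) auto
    moreover have "v \<in> nbrs w" using w(1) nbrs_sym[of w v] by simp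
    ultimately obtain ws where "arm (w # ws) v" using less.hyps w(3) by blast
    then have "arm (v # w # ws) u" using w less.prems by (simp del: arm.simps(2)) (simp add: w less.prems)
    then show ?thesis by blast
  qed
qed

lemma weight_1: "m i j = 3 ==> weight i j = 1"
  using form_entry_values(1)[of i j] m_self[of i] by (auto simp: weight_def)

text \<open>Harmonicity makes the coordinates linear: they would reach 0 one step beyond the last
  vertex, and they start as if the value at \<open>u\<close> were
  \<open>weight v u * \<delta> $ u\<close>.\<close>

lemma arm_value: "arm (v # vs) u ==> u ~= hd (vs @ [v]) ==>
  (real (length vs) + 2) * \<delta> $ v = weight v u * \<delta> $ u * (real (length vs) + 1)"
proof (induction vs arbitrary: u v)
  case Nil
  then show ?case using harmonic[of v] by simp
next
  case (Cons w ws)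
  have w: "nbrs v = {u, w}" "m v w = 3" "arm (w # ws) v" "u ~= w" using Cons.prems by auto
  have "v ~= hd (ws @ [w])"
  proof (cases ws)
    case Nil
    then show ?thesis using w(1) not_self_nbr[of v] by auto
  next
    case (Cons x xs)
    then have "arm (x # xs) w" "\<delta> $ w < \<delta> $ v" using w(3) by auto
    then show ?thesis using Cons by auto
  qed
  define k where "k = real (length ws)"
  from Cons.IH[OF w(3) \<open>v ~= hd (ws @ [w])\<close>] have 1: "(k + 2) * \<delta> $ w = \<delta> $ v * (k + 1)"
    using weight_1[OF w(2)] weight_sym[of w v] by (simp add: k_def)
  have 2: "2 * \<delta> $ v = weight v u * \<delta> $ u + \<delta> $ w"
    using harmonic[of v] w weight_1[OF w(2)] by simp
  have "(k + 2) * (2 * \<delta> $ v) = (k + 2) * (weight v u * \<delta> $ u) + \<delta> $ v * (k + 1)"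
    unfolding 2 distrib_left 1 ..
  then show ?case by (simp add: k_def algebra_simps)
qed

lemma arm_max_nth:
  assumes "arm xs u" "i < length xs"
  shows "\<delta> $ (xs ! i) < \<delta> $ ((u # xs) ! i) \<and> nbrs (xs ! i) = insert ((u # xs) ! i) (if Suc i < length xs then {xs ! Suc i} else {})"
  using assms
proof (induction xs arbitrary: u i)
  case (Cons v vs)
  show ?case
  proof (cases i)
    case 0
    then show ?thesis using Cons.prems by (cases vs) auto
  next
    case (Suc k)
    then show ?thesis using Cons.IH[of v k] Cons.prems by auto
  qed
qed simp

lemma arm_below: "arm xs u ==> i < length xs ==> \<delta> $ (xs ! i) < \<delta> $ u"
proof (induction i)
  case 0
  then show ?case using arm_max_nth[of xs u 0] by simp
next
  case (Suc k)
  then show ?case using arm_max_nth[of xs u "Suc k"] by simp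
qed

lemma arm_decreasing: "arm xs u ==> i < j ==> j < length xs ==> \<delta> $ (xs ! j) < \<delta> $ (xs ! i)"
proof (induction j)
  case (Suc k)
  then show ?case using arm_max_nth[of xs u "Suc k"] by (cases "i = k") auto
qed simp

lemma arm_distinct: "arm xs u ==> distinct (u # xs)"
proof -
  assume a: "arm xs u"
  have "distinct xs"
    unfolding distinct_conv_nth using arm_decreasing[OF a] by (metis less_irrefl linorder_neqE_nat)
  moreover have "u ~: set xs" using arm_below[OF a] by (auto simp: in_set_conv_nth)
  ultimately show ?thesis by simp
qed

text \<open>A vertex of an arm has a unique higher neighbour, so that two arms cannot meet.\<close>

lemma arms_disjoint:
  assumes "arm (x # xs) u" "arm (y # ys) u" "x ~= y"
  shows "set (x # xs) \<inter> set (y # ys) = {}"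
proof -
  have up: "(u # xs) ! i = (u # ys) ! j" if a: "arm xs u" "arm ys u" "i < length xs" "j < length ys" "xs ! i = ys ! j" for xs ys i j
  proof -
    have "(u # xs) ! i \<in> nbrs (ys ! j)" using arm_max_nth[OF a(1,3)] a(5) by auto
    then have "(u # xs) ! i = (u # ys) ! j \<or> Suc j < length ys \<and> (u # xs) ! i = ys ! Suc j"
      using arm_max_nth[OF a(2,4)] by (auto split: if_splits)
    moreover have "\<delta> $ (ys ! Suc j) < \<delta> $ (ys ! j)" if "Suc j < length ys" using arm_decreasing[OF a(2), of j "Suc j"] that by simp
    moreover have "\<delta> $ (ys ! j) < \<delta> $ ((u # xs) ! i)" using arm_max_nth[OF a(1,3)] a(5) by simp
    ultimately show ?thesis by (metis less_asym)
  qed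
  have "(x # xs) ! i ~= (y # ys) ! j" if "i < length (x # xs)" "j < length (y # ys)" for i j
    using that
  proof (induction i arbitrary: j)
    case 0
    show ?case
    proof
      assume eq: "(x # xs) ! 0 = (y # ys) ! j"
      from up[OF assms(1,2) 0 eq] have "u = (u # y # ys) ! j" by simp
      then have "j = 0" using arm_below[OF assms(2), of "j - 1"] 0(2) by (cases j) auto
      then show False using eq assms(3) by simp
    qed
  next
    case (Suc i)
    show ?case
    proof
      assume eq: "(x # xs) ! Suc i = (y # ys) ! j"
      from up[OF assms(1,2) Suc.prems eq] have e: "(x # xs) ! i = (u # y # ys) ! j" by simp
      show False
      proof (cases j)
        case 0
        then show False using e arm_below[OF assms(1), of i] Suc.prems by simp
      next
        case (Suc k)
        then show False using e Suc.IH[of k] Suc.prems by simp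
      qed
    qed
  qed
  then show ?thesis by (metis disjoint_iff in_set_conv_nth)
qed

section \<open>The neighbours of a maximal coordinate\<close>

definition leaf :: "nat => 'i => 'i => bool" where
  "leaf q c x \<longleftrightarrow> nbrs x = {c} \<and> m c x = q"

text \<open>The configurations of leaves that contribute 1 to the total share 2 at
  \<open>c\<close>.\<close>

definition half :: "'i => 'i set => bool" where
  "half c A \<longleftrightarrow> (\<exists>x. A = {x} \<and> leaf 4 c x) \<or> (\<exists>x y. x ~= y \<and> A = {x, y} \<and> leaf 3 c x \<and> leaf 3 c y)"

context
  fixes c
  assumes c: "!!j. \<delta> $ j <= \<delta> $ c"
begin

definition share :: "'i => real" where
  "share j = weight c j * \<delta> $ j / \<delta> $ c"

lemma sum_share: "sum share (nbrs c) = 2"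
proof -
  have "sum share (nbrs c) = (\<Sum>j\<in>nbrs c. weight c j * \<delta> $ j) / \<delta> $ c"
    unfolding share_def by (rule sum_divide_distrib[symmetric])
  also have "... = 2" unfolding harmonic[symmetric] using \<delta>_pos[of c] by simp
  finally show ?thesis .
qed

lemma share_ge_half: "j \<in> nbrs c ==> share j >= 1 / 2"
proof -
  assume "j \<in> nbrs c"
  then have "weight c j >= 1" using weight_pos by (simp add: nbrs_def)
  then have "(weight c j)\<^sup>2 >= 1" by (simp add: one_le_power)
  moreover have "share j >= (weight c j)\<^sup>2 / 2"
    using nbr_lower_bound_2[of c j] \<delta>_pos[of c] by (simp add: share_def field_simps)
  ultimately show ?thesis by simp
qed

text \<open>An arm of \<open>k + 1\<close> vertices contributes
  \<open>weight^2 * (k + 1) / (k + 2)\<close>, and its descent limits \<open>k\<close> in terms of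
  the weight. The shares of the last case are those that no second neighbour can complete to
  2.\<close>

lemma share_cases:
  assumes "j \<in> nbrs c"
  obtains (plateau) "\<delta> $ j = \<delta> $ c" "m c j = 3" "share j = 1"
    | (arm) vs where "m c j = 3" "arm (j # vs) c" "share j = 1 - 1 / (real (length vs) + 2)"
    | (leaf4) "leaf 4 c j" "share j = 1"
    | (arm4) w where "m c j = 4" "arm [j, w] c" "share j = 4 / 3"
    | (leaf6) "leaf 6 c j" "share j = 3 / 2"
    | (infinite) "m c j = 0" "\<delta> $ j = \<delta> $ c" "share j = 2"
    | (bad) "5 / 4 < share j" "share j ~= 4 / 3" "share j ~= 3 / 2" "share j < 2"
proof -
  have cj: "c ~= j" using assms by auto
  have d: "\<delta> $ c > 0" by (rule \<delta>_pos)
  have "4 / 3 < sqrt (2 :: real)" "3 / 2 < sqrt (3 :: real)"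
    by (rule real_less_rsqrt; simp add: power2_eq_square)+
  moreover have "sqrt (2 :: real) < 3 / 2" "sqrt (3 :: real) < 2"
    by (rule real_less_lsqrt; simp add: power2_eq_square)+
  ultimately have s: "sqrt 2 > 4 / (3 :: real)" "sqrt 2 < 3 / (2 :: real)" "sqrt 3 > 3 / (2 :: real)" "sqrt 3 < (2 :: real)"
    by simp_all
  show ?thesis
  proof (cases "\<delta> $ j = \<delta> $ c")
    case True
    then have e: "share j = weight c j" using d by (simp add: share_def)
    from cj show ?thesis
    proof (cases rule: weight_cases)
      case 2
      then show ?thesis using assms by (simp add: nbrs_def)
    next
      case 3
      then show ?thesis using plateau True e by simp
    next
      case 4
      then show ?thesis using bad s e by simp
    next
      case 5
      then show ?thesis using bad e by simp
    next
      case 6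
      then show ?thesis using bad s e by simp
    next
      case 7
      then show ?thesis using bad s e by simp
    next
      case 0
      then show ?thesis using infinite True e by simp
    qed
  next
    case False
    then have less: "\<delta> $ j < \<delta> $ c" using c[of j] by simp
    have "c \<in> nbrs j" using assms nbrs_sym by blast
    from arm_exists[OF this less] obtain vs where vs: "arm (j # vs) c" by blast
    define k where "k = real (length vs)"
    have k0: "k >= 0" by (simp add: k_def)
    have "c ~= hd (vs @ [j])" using arm_distinct[OF vs] cj by (cases vs) auto
    from arm_value[OF vs this] have v: "(k + 2) * \<delta> $ j = weight c j * \<delta> $ c * (k + 1)"
      by (simp add: k_def weight_sym[of j c])
    then have dj: "\<delta> $ j = weight c j * \<delta> $ c * (k + 1) / (k + 2)" using k0 by (simp add: field_simps)
    have e: "share j = weight c j * weight c j * ((k + 1) / (k + 2))"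
      using d by (simp add: share_def dj)
    have "weight c j * (k + 1) * \<delta> $ c < (k + 2) * \<delta> $ c" using v less k0 by (metis mult.commute mult.left_commute mult_strict_left_mono add_nonneg_pos zero_less_numeral)
    \<comment> \<open>The descent of the first edge. A weight of at least \<open>3 / 2\<close>
      leaves a single vertex, and \<open>sqrt 2\<close> leaves at most two.\<close>
    then have bound: "weight c j * (k + 1) < k + 2" using d by simp
    have small: "length vs = 0" if "weight c j >= 3 / 2"
    proof -
      have "3 / 2 * (k + 1) <= weight c j * (k + 1)" using that k0 by (intro mult_right_mono) auto
      then have "k < 1" using bound by simp
      then show ?thesis by (simp add: k_def)
    qed
    have leaf: "leaf (m c j) c j" if "length vs = 0" using vs that by (simp add: leaf_def)
    from cj show ?thesis
    proof (cases rule: weight_cases)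
      case 2
      then show ?thesis using assms by (simp add: nbrs_def)
    next
      case 3
      have "share j = 1 - 1 / (k + 2)" unfolding e 3 using k0 by (simp add: field_simps)
      then show ?thesis using arm[OF 3(1) vs] by (simp add: k_def)
    next
      case 4
      have "4 / 3 * (k + 1) < sqrt 2 * (k + 1)" using s(1) k0 by (intro mult_strict_right_mono) auto
      then have "k < 2" using bound 4 by simp
      then consider "length vs = 0" | "length vs = 1" unfolding k_def by linarith
      then show ?thesis
      proof cases
        case 1
        then have "share j = 1" unfolding e 4 by (simp add: k_def)
        then show ?thesis using leaf4 leaf 1 4 by simp
      next
        case 2
        then obtain w where w: "vs = [w]" by (auto simp: length_Suc_conv)
        then have "share j = 4 / 3" unfolding e 4 by (simp add: k_def)
        then show ?thesis using arm4 4 vs w by blast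
      qed
    next
      case 5
      then have "share j = (weight c j + 1) / 2" using small unfolding e by (simp add: k_def)
      then show ?thesis using bad 5 by simp
    next
      case 6
      then have "length vs = 0" using small s by simp
      moreover from this have "share j = 3 / 2" unfolding e 6 by (simp add: k_def)
      ultimately show ?thesis using leaf6 leaf 6 by simp
    next
      case 7
      then have "length vs = 0" using small s by simp
      then have q: "share j = weight c j * weight c j / 2" unfolding e by (simp add: k_def)
      have "sqrt 3 * sqrt 3 < weight c j * weight c j" "weight c j * weight c j < 2 * 2"
        using 7 by (intro mult_strict_mono; simp)+
      then show ?thesis using bad q by simp
    next
      case 0
      then show ?thesis using bound k0 by simp
    qed
  qed
qed

lemma share_small:
  assumes "j \<in> nbrs c" "share j < 1"
  obtains vs where "m c j = 3" "arm (j # vs) c" "share j = 1 - 1 / (real (length vs) + 2)"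
  using assms(1) by (cases rule: share_cases) (use assms(2) that in auto)

lemma share_half_leaf:
  assumes "j \<in> nbrs c" "share j = 1 / 2"
  shows "leaf 3 c j"
proof -
  have "share j < 1" using assms(2) by simp
  with assms(1) obtain vs where vs: "m c j = 3" "arm (j # vs) c" "share j = 1 - 1 / (real (length vs) + 2)"
    by (rule share_small)
  then have "length vs = 0" using assms(2) by (simp add: field_simps)
  then show ?thesis using vs by (simp add: leaf_def)
qed

lemma share_1:
  assumes "j \<in> nbrs c" "share j = 1"
  shows "\<delta> $ j = \<delta> $ c \<and> m c j = 3 \<or> leaf 4 c j"
  using assms(1) by (cases rule: share_cases) (use assms(2) in auto)

text \<open>The shares add up to 2 and are at least \<open>1 / 2\<close>, so there are at most four
  neighbours. The cases are a share above 1, a share equal to 1, and all shares below 1, where there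
  are three or four arms.\<close>

lemma local_structure:
  obtains (infinite) j where "nbrs c = {j}" "m c j = 0" "nbrs j = {c}"
    | (F4) i i' j j' where "nbrs c = {i, j}" "i ~= j" "m c i = 3" "arm [i, i'] c" "m c j = 4" "arm [j, j'] c"
    | (G2) i j where "nbrs c = {i, j}" "i ~= j" "leaf 3 c i" "leaf 6 c j"
    | (E) x xs y ys z zs where "nbrs c = {x, y, z}" "distinct [x, y, z]" "arm (x # xs) c" "arm (y # ys) c" "arm (z # zs) c"
      "m c x = 3" "m c y = 3" "m c z = 3"
      "1 / (real (length xs) + 2) + 1 / (real (length ys) + 2) + 1 / (real (length zs) + 2) = 1"
    | (halves) A B where "nbrs c = A \<union> B" "A \<inter> B = {}" "half c A" "half c B"
    | (endpoint) d A where "nbrs c = insert d A" "d ~: A" "\<delta> $ d = \<delta> $ c" "m c d = 3" "half c A"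
    | (inner) d d' where "nbrs c = {d, d'}" "d ~= d'" "\<delta> $ d = \<delta> $ c" "m c d = 3" "\<delta> $ d' = \<delta> $ c" "m c d' = 3"
proof -
  have rem: "sum share (nbrs c - {j}) = 2 - share j" if "j \<in> nbrs c" for j
    using sum.remove[of "nbrs c" j share] sum_share that by simp
  consider (a) j where "j \<in> nbrs c" "share j > 1" | (b) j where "j \<in> nbrs c" "share j = 1"
    | (c) "!!j. j \<in> nbrs c ==> share j < 1" by (meson linorder_cases)
  then show ?thesis
  proof cases
    case (a j)
    have "nbrs c - {j} = {} \<or> (\<exists>i. nbrs c - {j} = {i})"
      by (rule sum_half_less_1[of _ share]) (use a rem[OF a(1)] share_ge_half in auto)
    then show ?thesis
    proof
      assume "nbrs c - {j} = {}"
      then have N: "nbrs c = {j}" using a(1) by blast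
      then have "share j = 2" using sum_share by simp
      from a(1) have "m c j = 0 \<and> \<delta> $ j = \<delta> $ c"
      proof (cases rule: share_cases)
        case (arm us)
        then have "share j < 1" by simp
        then show ?thesis using a(2) by simp
      qed (use \<open>share j = 2\<close> in \<open>auto simp del: arm.simps\<close>)
      then have inf: "m c j = 0" "\<delta> $ j = \<delta> $ c" by simp_all
      have cj: "c \<in> nbrs j" using a(1) nbrs_sym by blast
      \<comment> \<open>With weight 2 and equal coordinates this edge exhausts the harmonic equation
        at \<open>j\<close>, leaving no room for further neighbours.\<close>
      have "weight j c = 2" using inf(1) a(1) m_sym[of j c] by (auto simp: weight_def form_entry_def)
      then have z: "(\<Sum>k\<in>nbrs j - {c}. weight j k * \<delta> $ k) = 0"
        using harmonic_remove[OF cj] inf(2) by simp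
      have "nbrs j - {c} = {}"
      proof (rule ccontr)
        assume "nbrs j - {c} ~= {}"
        moreover have "0 < weight j k * \<delta> $ k" if "k \<in> nbrs j - {c}" for k
          using that \<delta>_pos[of k] by (simp add: nbrs_def)
        ultimately have "0 < (\<Sum>k\<in>nbrs j - {c}. weight j k * \<delta> $ k)" by (intro sum_pos) auto
        then show False using z by simp
      qed
      then have "nbrs j = {c}" using cj by blast
      then show ?thesis using infinite N inf(1) by blast
    next
      assume "\<exists>i. nbrs c - {j} = {i}"
      then obtain i where i: "nbrs c - {j} = {i}" by blast
      then have N: "nbrs c = {i, j}" "i ~= j" "i \<in> nbrs c" using a(1) by blast+
      have si: "share i = 2 - share j" using rem[OF a(1)] unfolding i by simp
      then have "share i < 1" using a(2) by simp
      with N(3) obtain vs where vs: "m c i = 3" "arm (i # vs) c" "share i = 1 - 1 / (real (length vs) + 2)"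
        by (rule share_small)
      \<comment> \<open>The possible values \<open>3 / 2\<close>, \<open>4 / 3\<close> and at most
        \<open>5 / 4\<close> lead to G2, to F4 and to a contradiction.\<close>
      have sj: "share j = 1 + 1 / (real (length vs) + 2)" using vs(3) si by simp
      consider "length vs = 0" | "length vs = 1" | "length vs >= 2" by linarith
      then show ?thesis
      proof cases
        case 1
        then have "share j = 3 / 2" using sj by simp
        with a(1) have "leaf 6 c j" by (cases rule: share_cases) (use sj in \<open>auto simp: field_simps\<close>)
        moreover have "leaf 3 c i" using vs 1 by (simp add: leaf_def)
        ultimately show ?thesis using G2 N by blast
      next
        case 2
        then have "share j = 4 / 3" using sj by simp
        from a(1) have "\<exists>w. m c j = 4 \<and> arm [j, w] c"
        proof (cases rule: share_cases)
          case (arm us)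
          then have "share j < 1" by simp
          then show ?thesis using a(2) by simp
        qed (use \<open>share j = 4 / 3\<close> in \<open>auto simp del: arm.simps\<close>)
        then obtain w where "m c j = 4" "arm [j, w] c" by blast
        moreover obtain v where "vs = [v]" using 2 by (auto simp: length_Suc_conv)
        ultimately show ?thesis using F4 N vs by blast
      next
        case 3
        then have "1 / (real (length vs) + 2) <= 1 / 4" by (intro divide_left_mono) auto
        then have "share j <= 5 / 4" using sj by simp
        with a(1) show ?thesis by (cases rule: share_cases) (use a(2) in auto)
      qed
    qed
  next
    case (b j)
    have "(\<exists>x. nbrs c - {j} = {x} \<and> share x = 1) \<or>
        (\<exists>x y. nbrs c - {j} = {x, y} \<and> x ~= y \<and> share x = 1 / 2 \<and> share y = 1 / 2)"
      by (rule sum_half_eq_1) (use b rem[OF b(1)] share_ge_half in auto)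
    then show ?thesis
    proof
      assume "\<exists>x. nbrs c - {j} = {x} \<and> share x = 1"
      then obtain x where x: "nbrs c - {j} = {x}" "share x = 1" by blast
      then have N: "nbrs c = {j, x}" "j ~= x" "x \<in> nbrs c" using b(1) by blast+
      show ?thesis
      proof (cases "leaf 4 c j")
        case True
        then have hj: "half c {j}" by (auto simp: half_def)
        show ?thesis
        proof (cases "leaf 4 c x")
          case True
          then have "half c {x}" by (auto simp: half_def)
          then show ?thesis using halves[of "{j}" "{x}"] hj N by auto
        next
          case False
          then have "\<delta> $ x = \<delta> $ c \<and> m c x = 3" using share_1[OF N(3) x(2)] by blast
          then show ?thesis using endpoint[of x "{j}"] hj N by auto
        qed
      next
        case False
        then have j: "\<delta> $ j = \<delta> $ c \<and> m c j = 3" using share_1[OF b] by blast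
        show ?thesis
        proof (cases "leaf 4 c x")
          case True
          then have "half c {x}" by (auto simp: half_def)
          then show ?thesis using endpoint[of j "{x}"] j N by auto
        next
          case False
          then have "\<delta> $ x = \<delta> $ c \<and> m c x = 3" using share_1[OF N(3) x(2)] by blast
          then show ?thesis using inner[of j x] j N by auto
        qed
      qed
    next
      assume "\<exists>x y. nbrs c - {j} = {x, y} \<and> x ~= y \<and> share x = 1 / 2 \<and> share y = 1 / 2"
      then obtain x y where xy: "nbrs c - {j} = {x, y}" "x ~= y" "share x = 1 / 2" "share y = 1 / 2" by blast
      then have N: "nbrs c = insert j {x, y}" "j ~: {x, y}" "x \<in> nbrs c" "y \<in> nbrs c" using b(1) by blast+
      have h: "half c {x, y}"
        using share_half_leaf[OF N(3) xy(3)] share_half_leaf[OF N(4) xy(4)] xy(2) by (auto simp: half_def)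
      from share_1[OF b] show ?thesis
      proof
        assume "leaf 4 c j"
        then have "half c {j}" by (auto simp: half_def)
        then show ?thesis using halves[of "{j}" "{x, y}"] h N by auto
      qed (use endpoint[of j "{x, y}"] h N in auto)
    qed
  next
    case c
    have "nbrs c ~= {}" using sum_share by auto
    then obtain x where x: "x \<in> nbrs c" by blast
    have s1: "sum share (nbrs c - {x}) = 2 - share x" by (rule rem[OF x])
    have "nbrs c - {x} ~= {}"
    proof
      assume e: "nbrs c - {x} = {}"
      show False using s1 c[OF x] unfolding e by simp
    qed
    then obtain y where y: "y \<in> nbrs c - {x}" by blast
    have s2: "sum share (nbrs c - {x} - {y}) = 2 - share x - share y"
      using sum.remove[OF _ y, of share] s1 by simp
    have "nbrs c - {x} - {y} ~= {}"
    proof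
      assume e: "nbrs c - {x} - {y} = {}"
      show False using s2 c[OF x] c[of y] y unfolding e by simp
    qed
    then obtain z where z: "z \<in> nbrs c - {x} - {y}" by blast
    have s3: "sum share (nbrs c - {x} - {y} - {z}) = 2 - share x - share y - share z"
      using sum.remove[OF _ z, of share] s2 by simp
    have ge: "share x >= 1 / 2" "share y >= 1 / 2" "share z >= 1 / 2" using share_ge_half x y z by auto
    have "nbrs c - {x} - {y} - {z} = {} \<or> (\<exists>w. nbrs c - {x} - {y} - {z} = {w})"
      by (rule sum_half_less_1[of _ share]) (use s3 ge share_ge_half in auto)
    then show ?thesis
    proof
      assume "nbrs c - {x} - {y} - {z} = {}"
      then have N: "nbrs c = {x, y, z}" "distinct [x, y, z]" using x y z by auto
      have yz: "y \<in> nbrs c" "z \<in> nbrs c" using y z by auto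
      obtain xs where xs: "m c x = 3" "arm (x # xs) c" "share x = 1 - 1 / (real (length xs) + 2)" by (rule share_small[OF x c[OF x]])
      obtain ys where ys: "m c y = 3" "arm (y # ys) c" "share y = 1 - 1 / (real (length ys) + 2)" by (rule share_small[OF yz(1) c[OF yz(1)]])
      obtain zs where zs: "m c z = 3" "arm (z # zs) c" "share z = 1 - 1 / (real (length zs) + 2)" by (rule share_small[OF yz(2) c[OF yz(2)]])
      have "share x + share y + share z = 2" using sum_share N by simp
      then show ?thesis using E[OF N xs(2) ys(2) zs(2) xs(1) ys(1) zs(1)] xs(3) ys(3) zs(3) by simp
    next
      assume "\<exists>w. nbrs c - {x} - {y} - {z} = {w}"
      then obtain w where w: "nbrs c - {x} - {y} - {z} = {w}" by blast
      then have N: "nbrs c = {x, y} \<union> {z, w}" "distinct [x, y, z, w]" using x y z by auto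
      have "share w = 2 - share x - share y - share z" using s3 unfolding w by simp
      moreover have "share w >= 1 / 2" using N by (intro share_ge_half) auto
      ultimately have "share x = 1 / 2" "share y = 1 / 2" "share z = 1 / 2" "share w = 1 / 2" using ge by auto
      then have "leaf 3 c x" "leaf 3 c y" "leaf 3 c z" "leaf 3 c w" using N by (auto intro!: share_half_leaf)
      then show ?thesis using N by (intro halves[of "{x, y}" "{z, w}"]) (auto simp: half_def)
    qed
  qed
qed

end

end

end

lemma unit_fractions:
  fixes p q r :: nat
  assumes "2 <= p" "p <= q" "q <= r" "1 / real p + 1 / real q + 1 / real r = 1"
  shows "p = 3 \<and> q = 3 \<and> r = 3 \<or> p = 2 \<and> q = 4 \<and> r = 4 \<or> p = 2 \<and> q = 3 \<and> r = 6"
proof -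
  have le: "1 / real b <= 1 / real a" if "0 < a" "a <= b" for a b :: nat
    using that by (intro divide_left_mono) auto
  have pq: "1 / real q <= 1 / real p" "1 / real r <= 1 / real q" "0 < 1 / real r" using assms by (auto intro!: le)
  have "p <= 3"
  proof (rule ccontr)
    assume "~ p <= 3"
    then have "1 / real p <= 1 / real (4 :: nat)" by (intro le) auto
    then show False using assms(4) pq by simp
  qed
  then consider "p = 2" | "p = 3" using assms(1) by linarith
  then show ?thesis
  proof cases
    case 1
    have sum: "1 / real q + 1 / real r = 1 / 2" using assms(4) 1 by simp
    have "q ~= 2" using sum pq(3) by auto
    moreover have "q <= 4"
    proof (rule ccontr)
      assume "~ q <= 4"
      then have "1 / real q <= 1 / real (5 :: nat)" by (intro le) auto
      then show False using sum pq by simp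
    qed
    ultimately consider "q = 3" | "q = 4" using assms(2) 1 by linarith
    then show ?thesis
    proof cases
      case 1
      then have "1 / real q = 1 / 3" by simp
      then have "1 / real r = 1 / 6" using sum by linarith
      then have "r = 6" using pq(3) by (simp add: field_simps)
      then show ?thesis using 1 \<open>p = 2\<close> by simp
    next
      case 2
      then have "1 / real q = 1 / 4" by simp
      then have "1 / real r = 1 / 4" using sum by linarith
      then have "r = 4" using pq(3) by (simp add: field_simps)
      then show ?thesis using 2 \<open>p = 2\<close> by simp
    qed
  next
    case 2
    then have "1 / real p = 1 / 3" by simp
    then have "1 / real q = 1 / 3" "1 / real r = 1 / 3" using assms(4) pq by linarith+
    then have "q = 3" "r = 3" using pq(3) by (simp_all add: field_simps)
    then show ?thesis using 2 by simp
  qed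
qed

context coxeter_system
begin

section \<open>From neighbourhoods to Coxeter matrices\<close>

lemma has_coxeter_matrix_cong:
  assumes "has_coxeter_matrix n M" "!!a b. a < b ==> b <= n ==> M a b = M' a b"
  shows "has_coxeter_matrix n M'"
proof -
  obtain f where "bij_betw f {0..n} UNIV" "\<forall>a b. a < b \<and> b <= n --> m (f a) (f b) = M a b"
    using assms(1) unfolding has_coxeter_matrix_def by blast
  then show ?thesis unfolding has_coxeter_matrix_def using assms(2) by (intro exI[of _ f]) auto
qed

lemma weight_4: "m i j = 4 ==> weight i j = sqrt 2"
  using form_entry_values(2)[of i j] m_self[of i] by (auto simp: weight_def)

context
  fixes \<delta> :: "real ^ 'i"
  assumes irr: is_irreducible and \<delta>_pos: "!!i. \<delta> $ i > 0" and \<delta>_null: "!!v. form \<delta> v = 0"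
begin

lemmas arms_disjoint' = arms_disjoint[OF irr \<delta>_pos \<delta>_null]
  and arm_distinct' = arm_distinct[OF irr \<delta>_pos \<delta>_null]
  and arm_simps = arm.simps[OF irr \<delta>_pos \<delta>_null]
  and leaf_iff = leaf_def[OF irr \<delta>_pos \<delta>_null]
  and half_iff = half_def[OF irr \<delta>_pos \<delta>_null]

lemma infinite_type_A:
  assumes "nbrs c = {j}" "m c j = 0" "nbrs j = {c}"
  shows type_A
proof -
  have "c ~= j" using assms(1) not_self_nbr[of c] by auto
  then have "has_coxeter_matrix 1 (%a b. 0)"
    by (intro has_coxeter_matrixI[OF irr, of "[c, j]" _ "%a. {1 - a}"])
      (use assms in \<open>auto simp: nth_Cons less_Suc_eq le_Suc_eq split: nat.splits\<close>)
  then show ?thesis by (simp add: type_A_def)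
qed

lemma finite_matrixI:
  assumes zs: "distinct zs" "length zs = Suc n"
    and edges: "\<forall>(a, b)\<in>E. a < b \<and> b <= n \<and> m (zs ! a) (zs ! b) = l a b"
    and nb: "\<forall>a\<in>{..n}. nbrs (zs ! a) = (!) zs ` {b. (a, b) \<in> E \<or> (b, a) \<in> E}"
  shows "has_coxeter_matrix n (%a b. if (a, b) \<in> E then l a b else 2)"
  by (rule has_coxeter_matrixI[OF irr zs, of "%a. {b. (a, b) \<in> E \<or> (b, a) \<in> E}"]) (use edges nb in auto)

lemma atMost_simps: "{..Suc n} = insert (Suc n) {..n}" "{..(0 :: nat)} = {0}"
  by auto

lemma F4_type:
  assumes "nbrs c = {i, j}" "i ~= j" "m c i = 3" "arm \<delta> [i, i'] c" "m c j = 4" "arm \<delta> [j, j'] c"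
  shows type_F4
proof -
  let ?zs = "[i', i, c, j, j']"
  have d: "distinct ?zs"
    using arms_disjoint'[OF assms(4,6,2)] arm_distinct'[OF assms(4)] arm_distinct'[OF assms(6)] by auto
  have N: "nbrs i = {c, i'}" "nbrs i' = {i}" "nbrs j = {c, j'}" "nbrs j' = {j}" "m i i' = 3" "m j j' = 3"
    using assms by (auto simp: arm_simps)
  have "has_coxeter_matrix 4 (%a b. if (a, b) \<in> {(0, 1), (1, 2), (2, 3), (3, 4)} then (if (a, b) = (2, 3) then 4 else 3) else 2)"
    by (rule finite_matrixI[OF d])
      (use N assms m_sym in \<open>auto simp: eval_nat_numeral atMost_simps image_def conj_disj_distribR ex_disj_distrib\<close>)
  moreover have "(%(a :: nat) (b :: nat). if (a, b) \<in> {(0, 1), (1, 2), (2, 3), (3, 4)} then (if (a, b) = (2, 3) then 4 else 3) else 2) =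
     (%(a :: nat) (b :: nat). if (a, b) \<in> {(0, 1), (1, 2), (3, 4)} then 3 else if (a, b) = (2, 3) then 4 else 2 :: nat)"
    by (intro ext) auto
  ultimately show ?thesis by (simp only: type_F4_def)
qed

lemma G2_type:
  assumes "nbrs c = {i, j}" "i ~= j" "leaf 3 c i" "leaf 6 c j"
  shows type_G2
proof -
  let ?zs = "[i, c, j]"
  have d: "distinct ?zs" using assms not_self_nbr[of c] by auto
  have N: "nbrs i = {c}" "nbrs j = {c}" "m i c = 3" "m c j = 6"
    using assms m_sym by (auto simp: leaf_iff)
  have "has_coxeter_matrix 2 (%a b. if (a, b) \<in> {(0, 1), (1, 2)} then (if (a, b) = (0, 1) then 3 else 6) else 2)"
    by (rule finite_matrixI[OF d])
      (use N assms in \<open>auto simp: eval_nat_numeral atMost_simps image_def conj_disj_distribR ex_disj_distrib\<close>)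
  moreover have "(%(a :: nat) (b :: nat). if (a, b) \<in> {(0, 1), (1, 2)} then (if (a, b) = (0, 1) then 3 else 6) else 2) =
     (%(a :: nat) (b :: nat). if (a, b) = (0, 1) then 3 else if (a, b) = (1, 2) then 6 else 2 :: nat)"
    by (intro ext) auto
  ultimately show ?thesis by (simp only: type_G2_def)
qed

text \<open>Each denominator is one more than the number of vertices of the arm. The sorted
  solutions (3, 3, 3), (2, 4, 4) and (2, 3, 6) of the equation for unit fractions are E6, E7 and
  E8.\<close>

lemma E_type_sorted:
  assumes c: "nbrs c = {x, y, z}" "distinct [x, y, z]" and arms: "arm \<delta> (x # xs) c" "arm \<delta> (y # ys) c" "arm \<delta> (z # zs) c"
    and m: "m c x = 3" "m c y = 3" "m c z = 3"
    and sum: "1 / (real (length xs) + 2) + 1 / (real (length ys) + 2) + 1 / (real (length zs) + 2) = 1"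
    and sorted: "length xs <= length ys" "length ys <= length zs"
  shows "type_E6 \<or> type_E7 \<or> type_E8"
proof -
  have disj: "set (x # xs) \<inter> set (y # ys) = {}" "set (x # xs) \<inter> set (z # zs) = {}" "set (y # ys) \<inter> set (z # zs) = {}"
    using arms_disjoint'[OF arms(1,2)] arms_disjoint'[OF arms(1,3)] arms_disjoint'[OF arms(2,3)] c(2) by auto
  note dist = arm_distinct'[OF arms(1)] arm_distinct'[OF arms(2)] arm_distinct'[OF arms(3)]
  have "length xs + 2 = 3 \<and> length ys + 2 = 3 \<and> length zs + 2 = 3 \<or> length xs + 2 = 2 \<and> length ys + 2 = 4 \<and> length zs + 2 = 4 \<or>
      length xs + 2 = 2 \<and> length ys + 2 = 3 \<and> length zs + 2 = 6"
    by (rule unit_fractions) (use sorted sum in \<open>simp_all add: add.commute\<close>)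
  then consider (6) "length xs = 1" "length ys = 1" "length zs = 1" | (7) "length xs = 0" "length ys = 2" "length zs = 2"
    | (8) "length xs = 0" "length ys = 1" "length zs = 4" by auto
  then show ?thesis
  proof cases
    case 6
    then obtain x1 y1 z1 where l: "xs = [x1]" "ys = [y1]" "zs = [z1]" by (auto simp: length_Suc_conv)
    have N: "nbrs x = {c, x1}" "nbrs x1 = {x}" "nbrs y = {c, y1}" "nbrs y1 = {y}" "nbrs z = {c, z1}" "nbrs z1 = {z}"
      "m x x1 = 3" "m y y1 = 3" "m z z1 = 3"
      using arms unfolding l by (auto simp: arm_simps)
    have d: "distinct [c, x, x1, y, y1, z, z1]" using disj dist unfolding l by auto
    have type_E6 unfolding type_E6_def
      by (rule finite_matrixI[OF d])
        (use N c(1) m in \<open>auto simp: eval_nat_numeral atMost_simps image_def conj_disj_distribR ex_disj_distrib\<close>)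
    then show ?thesis by blast
  next
    case 7
    then obtain y1 y2 z1 z2 where l: "xs = []" "ys = [y1, y2]" "zs = [z1, z2]" by (auto simp: length_Suc_conv eval_nat_numeral)
    have N: "nbrs x = {c}" "nbrs y = {c, y1}" "nbrs y1 = {y, y2}" "nbrs y2 = {y1}" "nbrs z = {c, z1}" "nbrs z1 = {z, z2}" "nbrs z2 = {z1}"
      "m y y1 = 3" "m y1 y2 = 3" "m z z1 = 3" "m z1 z2 = 3"
      using arms unfolding l by (auto simp: arm_simps)
    have N': "m y1 y = 3" "m y2 y1 = 3" "m y c = 3" using N m m_sym by metis+
    have d: "distinct [y2, y1, y, c, z, z1, z2, x]" using disj dist unfolding l by auto
    have type_E7 unfolding type_E7_def
      by (rule finite_matrixI[OF d])
        (use N N' c(1) m in \<open>auto simp: eval_nat_numeral atMost_simps image_def conj_disj_distribR ex_disj_distrib\<close>)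
    then show ?thesis by blast
  next
    case 8
    then obtain y1 z1 z2 z3 z4 where l: "xs = []" "ys = [y1]" "zs = [z1, z2, z3, z4]" by (auto simp: length_Suc_conv eval_nat_numeral)
    have N: "nbrs x = {c}" "nbrs y = {c, y1}" "nbrs y1 = {y}" "nbrs z = {c, z1}" "nbrs z1 = {z, z2}" "nbrs z2 = {z1, z3}"
      "nbrs z3 = {z2, z4}" "nbrs z4 = {z3}" "m y y1 = 3" "m z z1 = 3" "m z1 z2 = 3" "m z2 z3 = 3" "m z3 z4 = 3"
      using arms unfolding l by (auto simp: arm_simps)
    have N': "m y1 y = 3" "m y c = 3" using N m m_sym by metis+
    have d: "distinct [y1, y, c, z, z1, z2, z3, z4, x]" using disj dist unfolding l by auto
    have type_E8 unfolding type_E8_def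
      by (rule finite_matrixI[OF d])
        (use N N' c(1) m in \<open>auto simp: eval_nat_numeral atMost_simps image_def conj_disj_distribR ex_disj_distrib\<close>)
    then show ?thesis by blast
  qed
qed

lemma E_type:
  assumes c: "nbrs c = {x, y, z}" "distinct [x, y, z]" and arms: "arm \<delta> (x # xs) c" "arm \<delta> (y # ys) c" "arm \<delta> (z # zs) c"
    and m: "m c x = 3" "m c y = 3" "m c z = 3"
    and sum: "1 / (real (length xs) + 2) + 1 / (real (length ys) + 2) + 1 / (real (length zs) + 2) = 1"
  shows "type_E6 \<or> type_E7 \<or> type_E8"
proof -
  have sets: "{x, y, z} = {x, z, y}" "{x, y, z} = {y, x, z}" "{x, y, z} = {y, z, x}" "{x, y, z} = {z, x, y}" "{x, y, z} = {z, y, x}"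
    by auto
  consider "length xs <= length ys" "length ys <= length zs" | "length xs <= length zs" "length zs <= length ys"
    | "length ys <= length xs" "length xs <= length zs" | "length ys <= length zs" "length zs <= length xs"
    | "length zs <= length xs" "length xs <= length ys" | "length zs <= length ys" "length ys <= length xs" by linarith
  then show ?thesis
  proof cases
    case 1
    then show ?thesis by (intro E_type_sorted[OF c arms m sum])
  next
    case 2
    then show ?thesis using c sum by (intro E_type_sorted[OF _ _ arms(1,3,2) m(1,3,2)]) (auto simp: sets)
  next
    case 3
    then show ?thesis using c sum by (intro E_type_sorted[OF _ _ arms(2,1,3) m(2,1,3)]) (auto simp: sets)
  next
    case 4
    then show ?thesis using c sum by (intro E_type_sorted[OF _ _ arms(2,3,1) m(2,3,1)]) (auto simp: sets)
  next
    case 5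
    then show ?thesis using c sum by (intro E_type_sorted[OF _ _ arms(3,1,2) m(3,1,2)]) (auto simp: sets)
  next
    case 6
    then show ?thesis using c sum by (intro E_type_sorted[OF _ _ arms(3,2,1) m(3,2,1)]) (auto simp: sets)
  qed
qed

text \<open>A path of labels 3, with leaves \<open>A\<close> at its beginning and leaves \<open>B\<close> at its end.\<close>

definition caterpillar :: "'i list => 'i set => 'i set => bool" where
  "caterpillar ws A B \<longleftrightarrow> distinct ws \<and> ws ~= [] \<and> half (hd ws) A \<and> half (last ws) B \<and> A \<inter> B = {} \<and> (A \<union> B) \<inter> set ws = {} \<and>
    (\<forall>i<length ws. nbrs (ws ! i) = (if i = 0 then A else {ws ! (i - 1)}) \<union> (if Suc i = length ws then B else {ws ! Suc i})) \<and>
    (\<forall>i. Suc i < length ws --> m (ws ! i) (ws ! Suc i) = 3)"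

lemma caterpillar_rev:
  assumes "caterpillar ws A B"
  shows "caterpillar (rev ws) B A"
proof -
  note c = assms[unfolded caterpillar_def]
  have "nbrs (rev ws ! i) = (if i = 0 then B else {rev ws ! (i - 1)}) \<union> (if Suc i = length ws then A else {rev ws ! Suc i})"
    if i: "i < length ws" for i
  proof -
    define j where "j = length ws - Suc i"
    have j: "j < length ws" "rev ws ! i = ws ! j" using i by (auto simp: j_def rev_nth)
    have 1: "rev ws ! (i - 1) = ws ! Suc j" "Suc j ~= length ws" if "i ~= 0"
      using i that by (auto simp: j_def rev_nth Suc_diff_Suc)
    have 2: "rev ws ! Suc i = ws ! (j - 1)" "j ~= 0" if "Suc i ~= length ws"
      using i that by (auto simp: j_def rev_nth)
    have 3: "Suc j = length ws" if "i = 0" using i that by (simp add: j_def)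
    have 4: "j = 0" if "Suc i = length ws" using that by (simp add: j_def)
    have "nbrs (ws ! j) = (if j = 0 then A else {ws ! (j - 1)}) \<union> (if Suc j = length ws then B else {ws ! Suc j})"
      using c j(1) by blast
    then show ?thesis unfolding j(2) using 1 2 3 4 by (cases "i = 0"; cases "Suc i = length ws") auto
  qed
  moreover have "m (rev ws ! i) (rev ws ! Suc i) = 3" if "Suc i < length ws" for i
  proof -
    define j where "j = length ws - Suc (Suc i)"
    have "rev ws ! i = ws ! Suc j" "rev ws ! Suc i = ws ! j" "Suc j < length ws"
      using that by (auto simp: j_def rev_nth Suc_diff_Suc)
    then show ?thesis using c m_sym by metis
  qed
  ultimately show ?thesis using c by (auto simp: caterpillar_def hd_rev last_rev)
qed

lemma caterpillar_C:
  assumes "caterpillar ws {x} {y}" "leaf 4 (hd ws) x" "leaf 4 (last ws) y"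
  shows type_C
proof -
  define k where "k = length ws"
  note c = assms(1)[unfolded caterpillar_def]
  have k: "k >= 1" using c by (cases ws) (auto simp: k_def)
  let ?zs = "x # ws @ [y]"
  let ?nb = "%a. if a = 0 then {1} else if a = Suc k then {k} else {a - 1, a + 1}"
  have z: "?zs ! 0 = x" "!!i. i < k ==> ?zs ! Suc i = ws ! i" "?zs ! Suc k = y"
    by (simp_all add: nth_append k_def)
  have ends: "hd ws = ws ! 0" "last ws = ws ! (k - 1)" using c by (simp_all add: hd_conv_nth last_conv_nth k_def)
  have N: "nbrs (ws ! i) = {?zs ! i, ?zs ! Suc (Suc i)}" if "i < k" for i
  proof -
    have "nbrs (ws ! i) = (if i = 0 then {x} else {ws ! (i - 1)}) \<union> (if Suc i = k then {y} else {ws ! Suc i})"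
      using c that by (simp add: k_def)
    moreover have "?zs ! i = (if i = 0 then x else ws ! (i - 1))" using z(2)[of "i - 1"] that by (cases i) auto
    moreover have "?zs ! Suc (Suc i) = (if Suc i = k then y else ws ! Suc i)" using z(2)[of "Suc i"] z(3) that by (cases "Suc i = k") auto
    ultimately show ?thesis by auto
  qed
  have "has_coxeter_matrix (Suc k) (%a b. if b = a + 1 then (if a = 0 \<or> b = Suc k then 4 else 3) else 2)"
  proof (rule has_coxeter_matrixI[OF irr, of ?zs _ ?nb])
    show "distinct ?zs" using c by auto
    show "length ?zs = Suc (Suc k)" by (simp add: k_def)
    show "nbrs (?zs ! a) = (!) ?zs ` ?nb a" if le: "a <= Suc k" for a
    proof -
      consider "a = 0" | i where "a = Suc i" "i < k" | "a = Suc k" using le by (cases a) (auto simp: le_less)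
      then show ?thesis
      proof cases
        case 1
        then show ?thesis using assms(2) k z(2)[of 0] ends by (simp add: leaf_iff)
      next
        case (2 i)
        then show ?thesis using N[of i] z(2)[of i] by (simp del: nth_Cons_Suc)
      next
        case 3
        then show ?thesis using assms(3) k z(2)[of "k - 1"] z(3) ends by (simp add: leaf_iff del: nth_Cons_Suc)
      qed
    qed
    show "?nb a \<subseteq> {..Suc k}" if "a <= Suc k" for a using that by auto
    fix a b assume ab: "a < b" "b <= Suc k"
    show "(if b = a + 1 then (if a = 0 \<or> b = Suc k then 4 else 3) else 2) = 2" if "b ~: ?nb a"
      using that ab by (auto split: if_splits)
    show "m (?zs ! a) (?zs ! b) = (if b = a + 1 then (if a = 0 \<or> b = Suc k then 4 else 3) else 2)" if "b \<in> ?nb a"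
    proof -
      have b: "b = Suc a" using that ab by (auto split: if_splits)
      consider "a = 0" | "a = k" "a ~= 0" | i where "a = Suc i" "Suc i < k" using ab b by (cases a) (auto simp: le_less)
      then show ?thesis
      proof cases
        case 1
        then show ?thesis using assms(2) m_sym[of x "hd ws"] k z(2)[of 0] ends b by (simp add: leaf_iff)
      next
        case 2
        then show ?thesis using assms(3) k z(2)[of "k - 1"] z(3) ends b by (simp add: leaf_iff del: nth_Cons_Suc)
      next
        case (3 i)
        then show ?thesis using c z(2)[of i] z(2)[of "Suc i"] b by (simp add: k_def del: nth_Cons_Suc)
      qed
    qed
  qed
  then show ?thesis unfolding type_C_def using k by (intro exI[of _ "Suc k"]) simp
qed

text \<open>The numbering is: the two leaves, the path, then \<open>bs\<close>. A single leaf with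
  \<open>q = 4\<close> gives type B, two leaves with \<open>q = 3\<close> give type D.\<close>

lemma caterpillar_fork:
  assumes "caterpillar ws {x, y} B" "x ~= y" "leaf 3 (hd ws) x" "leaf 3 (hd ws) y" and bs: "set bs = B" "distinct bs"
    and q: "!!z. z \<in> B ==> leaf q (last ws) z"
  defines "k \<equiv> length ws"
  shows "has_coxeter_matrix (k + length bs + 1) (%a b. if b > k + 1 then (if a = k + 1 then q else 2)
    else if a >= 1 \<and> b = a + 1 \<or> a = 0 \<and> b = 2 then 3 else 2)"
proof -
  note c = assms(1)[unfolded caterpillar_def]
  have k: "k >= 1" using c by (cases ws) (auto simp: k_def)
  let ?zs = "x # y # ws @ bs"
  let ?n = "k + length bs + 1"
  let ?nb = "%a. if a <= 1 then {2} else if a > k + 1 then {k + 1}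
    else (if a = 2 then {0, 1} else {a - 1}) \<union> (if a = k + 1 then {k + 2..?n} else {a + 1})"
  have z: "?zs ! 0 = x" "?zs ! 1 = y" "!!i. i < k ==> ?zs ! Suc (Suc i) = ws ! i"
    "!!i. i < length bs ==> ?zs ! Suc (Suc (k + i)) = bs ! i"
    by (simp_all add: nth_append k_def)
  have ends: "hd ws = ws ! 0" "last ws = ws ! (k - 1)" using c by (simp_all add: hd_conv_nth last_conv_nth k_def)
  have img: "(!) ?zs ` {k + 2..?n} = B"
  proof -
    have "{k + 2..?n} = (%i. Suc (Suc (k + i))) ` {..<length bs}"
    proof (intro equalityI subsetI)
      fix b assume "b \<in> {k + 2..?n}"
      then show "b \<in> (%i. Suc (Suc (k + i))) ` {..<length bs}"
        by (intro image_eqI[of _ _ "b - (k + 2)"]) auto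
    qed auto
    then have "(!) ?zs ` {k + 2..?n} = (!) bs ` {..<length bs}" using z(4) by (simp add: image_image)
    then show ?thesis using bs(1) by (auto simp: set_conv_nth)
  qed
  show ?thesis
  proof (rule has_coxeter_matrixI[OF irr, of ?zs _ ?nb])
    show "distinct ?zs" using c assms(2) bs by auto
    show "length ?zs = Suc ?n" by (simp add: k_def)
    show "?nb a \<subseteq> {..?n}" if "a <= ?n" for a using that k by auto
    show "nbrs (?zs ! a) = (!) ?zs ` ?nb a" if a: "a <= ?n" for a
    proof -
      consider "a = 0" | "a = 1" | i where "a = Suc (Suc i)" "i < k" | i where "a = Suc (Suc (k + i))" "i < length bs"
      proof -
        assume *: "a = 0 ==> thesis" "a = 1 ==> thesis" "!!i. a = Suc (Suc i) ==> i < k ==> thesis"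
          "!!i. a = Suc (Suc (k + i)) ==> i < length bs ==> thesis"
        show thesis
        proof (cases "a <= 1")
          case True
          then show thesis using *(1,2) by linarith
        next
          case False
          show thesis
          proof (cases "a - 2 < k")
            case True
            then show thesis using *(3)[of "a - 2"] False by simp
          next
            case ge: False
            have "a = Suc (Suc (k + (a - 2 - k)))" "a - 2 - k < length bs" using ge False a by linarith+
            then show thesis by (rule *(4))
          qed
        qed
      qed
      then show ?thesis
      proof cases
        case 1
        have "nbrs x = {ws ! 0}" using assms(3) ends by (simp add: leaf_iff)
        moreover have "?zs ! 2 = ws ! 0" using z(3)[of 0] k by (simp add: eval_nat_numeral)
        ultimately show ?thesis using 1 by simp
      next
        case 2
        have "nbrs y = {ws ! 0}" using assms(4) ends by (simp add: leaf_iff)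
        moreover have "?zs ! 2 = ws ! 0" using z(3)[of 0] k by (simp add: eval_nat_numeral)
        ultimately show ?thesis using 2 by simp
      next
        case (3 i)
        have "nbrs (ws ! i) = (if i = 0 then {x, y} else {ws ! (i - 1)}) \<union> (if Suc i = k then B else {ws ! Suc i})"
          using c 3 by (simp add: k_def)
        moreover have "(!) ?zs ` (if a = 2 then {0, 1} else {a - 1}) = (if i = 0 then {x, y} else {ws ! (i - 1)})"
          using z(3)[of "i - 1"] 3 by (cases i) auto
        moreover have "(!) ?zs ` (if a = k + 1 then {k + 2..?n} else {a + 1}) = (if Suc i = k then B else {ws ! Suc i})"
        proof (cases "Suc i = k")
          case True
          then show ?thesis using img 3 by simp
        next
          case False
          then have "?zs ! (a + 1) = ws ! Suc i" using z(3)[of "Suc i"] 3 by simp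
          then show ?thesis using False 3 by auto
        qed
        moreover have "?nb a = (if a = 2 then {0, 1} else {a - 1}) \<union> (if a = k + 1 then {k + 2..?n} else {a + 1})" using 3 by auto
        moreover have "?zs ! a = ws ! i" using z(3)[of i] 3 by simp
        ultimately show ?thesis by (simp only: image_Un)
      next
        case (4 i)
        have "nbrs (bs ! i) = {ws ! (k - 1)}" using q[of "bs ! i"] bs(1) 4 ends by (auto simp: leaf_iff)
        moreover have "?zs ! (k + 1) = ws ! (k - 1)" using z(3)[of "k - 1"] k by simp
        moreover have "?zs ! a = bs ! i" using z(4)[OF 4(2)] 4(1) by simp
        moreover have "?nb a = {k + 1}" using 4 by auto
        ultimately show ?thesis by simp
      qed
    qed
    fix a b assume ab: "a < b" "b <= ?n"
    show "(if b > k + 1 then (if a = k + 1 then q else 2) else if a >= 1 \<and> b = a + 1 \<or> a = 0 \<and> b = 2 then 3 else 2) = 2" if "b ~: ?nb a"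
      using that ab k by (auto split: if_splits)
    show "m (?zs ! a) (?zs ! b) = (if b > k + 1 then (if a = k + 1 then q else 2)
        else if a >= 1 \<and> b = a + 1 \<or> a = 0 \<and> b = 2 then 3 else 2)" if nb: "b \<in> ?nb a"
    proof (cases "b > k + 1")
      case True
      then have a: "a = k + 1" using nb ab k by (auto split: if_splits)
      define i where "i = b - (k + 2)"
      have i: "b = Suc (Suc (k + i))" "i < length bs" using True ab by (auto simp: i_def)
      have "?zs ! b = bs ! i" using z(4)[OF i(2)] i(1) by simp
      moreover have "?zs ! a = ws ! (k - 1)" using z(3)[of "k - 1"] k a by simp
      moreover have "m (last ws) (bs ! i) = q" using q[of "bs ! i"] bs(1) i by (auto simp: leaf_iff)
      ultimately show ?thesis using True a ends by simp
    next
      case False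
      then have e: "a >= 1 \<and> b = a + 1 \<or> a = 0 \<and> b = 2" using nb ab by (auto split: if_splits)
      consider "a <= 1" "b = 2" | i where "a = Suc (Suc i)" "b = Suc (Suc (Suc i))" "Suc i < k"
        using e False by (cases "a <= 1") (auto, metis One_nat_def Suc_leI Suc_less_eq add_2_eq_Suc le_add_diff_inverse linorder_not_le not_less_eq_eq numeral_2_eq_2 plus_1_eq_Suc)
      then show ?thesis
      proof cases
        case 1
        have "?zs ! 2 = ws ! 0" using z(3)[of 0] k by (simp add: eval_nat_numeral)
        moreover have "a = 0 \<or> a = 1" using 1 by linarith
        then have "m (?zs ! a) (hd ws) = 3" using assms(3,4) m_sym by (auto simp: leaf_iff)
        ultimately show ?thesis using 1 e False ends by auto
      next
        case (2 i)
        have "m (ws ! i) (ws ! Suc i) = 3" using c 2(3) by (simp add: k_def)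
        then show ?thesis using z(3)[of i] z(3)[of "Suc i"] 2 False by simp
      qed
    qed
  qed
qed

lemma caterpillar_type:
  assumes "caterpillar ws A B"
  shows "type_B \<or> type_C \<or> type_D"
proof -
  have fork_leaf: "type_B" if c: "caterpillar ws {x, y} {z}" "x ~= y" "leaf 3 (hd ws) x" "leaf 3 (hd ws) y" "leaf 4 (last ws) z" for ws x y z
  proof -
    define k where "k = length ws"
    have k: "k >= 1" using c(1) by (cases ws) (auto simp: k_def caterpillar_def)
    have "has_coxeter_matrix (k + length [z] + 1) (%a b. if b > k + 1 then (if a = k + 1 then 4 else 2)
        else if a >= 1 \<and> b = a + 1 \<or> a = 0 \<and> b = 2 then 3 else 2)"
      unfolding k_def by (rule caterpillar_fork[OF c(1-4)]) (use c(5) in auto)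
    then have "has_coxeter_matrix (k + 2) (%a b. if b > k + 1 then (if a = k + 1 then 4 else 2)
        else if a >= 1 \<and> b = a + 1 \<or> a = 0 \<and> b = 2 then 3 else 2)" by simp
    then have "has_coxeter_matrix (k + 2) (%a b. if b = a + 1 \<and> b = k + 2 then 4
        else if a >= 1 \<and> b = a + 1 \<or> a = 0 \<and> b = 2 then 3 else 2)"
      by (rule has_coxeter_matrix_cong) (use k in \<open>auto simp: eval_nat_numeral\<close>)
    then show ?thesis unfolding type_B_def using k by (intro exI[of _ "k + 2"]) simp
  qed
  have c: "half (hd ws) A" "half (last ws) B" using assms by (auto simp: caterpillar_def)
  from c(1)[unfolded half_iff] c(2)[unfolded half_iff] show ?thesis
  proof (elim disjE exE conjE)
    fix x y assume "A = {x}" "leaf 4 (hd ws) x" "B = {y}" "leaf 4 (last ws) y"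
    then show ?thesis using caterpillar_C assms by blast
  next
    fix x y z assume h: "A = {z}" "leaf 4 (hd ws) z" "x ~= y" "B = {x, y}" "leaf 3 (last ws) x" "leaf 3 (last ws) y"
    have "ws ~= []" using assms by (simp add: caterpillar_def)
    then have "type_B" using caterpillar_rev[OF assms] h by (intro fork_leaf[of "rev ws" x y z]) (simp_all add: hd_rev last_rev)
    then show ?thesis by blast
  next
    fix x y z assume "B = {z}" "leaf 4 (last ws) z" "x ~= y" "A = {x, y}" "leaf 3 (hd ws) x" "leaf 3 (hd ws) y"
    then show ?thesis using fork_leaf assms by blast
  next
    fix x y z w assume h: "x ~= y" "A = {x, y}" "leaf 3 (hd ws) x" "leaf 3 (hd ws) y" "z ~= w" "B = {z, w}" "leaf 3 (last ws) z" "leaf 3 (last ws) w"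
    define k where "k = length ws"
    have k: "k >= 1" using assms by (cases ws) (auto simp: k_def caterpillar_def)
    have "has_coxeter_matrix (k + length [z, w] + 1) (%a b. if b > k + 1 then (if a = k + 1 then 3 else 2)
        else if a >= 1 \<and> b = a + 1 \<or> a = 0 \<and> b = 2 then 3 else 2)"
      unfolding k_def by (rule caterpillar_fork[OF _ h(1,3,4)]) (use assms h in auto)
    then have "has_coxeter_matrix (k + 3) (%a b. if b > k + 1 then (if a = k + 1 then 3 else 2)
        else if a >= 1 \<and> b = a + 1 \<or> a = 0 \<and> b = 2 then 3 else 2)" by (simp add: eval_nat_numeral)
    then have "has_coxeter_matrix (k + 3) (%a b. if a >= 1 \<and> b = a + 1 \<and> b < k + 3 \<or> a = 0 \<and> b = 2 \<or> a = k + 3 - 2 \<and> b = k + 3 then 3 else 2)"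
      by (rule has_coxeter_matrix_cong) (use k in \<open>auto simp: eval_nat_numeral\<close>)
    then have type_D unfolding type_D_def using k by (intro exI[of _ "k + 3"]) simp
    then show ?thesis by blast
  qed
qed

lemma cycle_type:
  assumes ws: "distinct ws" "length ws = Suc n" "n >= 2"
    and N: "!!i. i <= n ==> nbrs (ws ! i) = {ws ! (if i = 0 then n else i - 1), ws ! (if i = n then 0 else Suc i)}"
    and m: "!!i. i <= n ==> m (ws ! i) (ws ! (if i = n then 0 else Suc i)) = 3"
  shows type_A
proof -
  let ?nb = "%i. {if i = 0 then n else i - 1, if i = n then 0 else Suc i}"
  have "has_coxeter_matrix n (%a b. if b = a + 1 \<or> a = 0 \<and> b = n then 3 else 2)"
  proof (rule has_coxeter_matrixI[OF irr ws(1,2), of ?nb])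
    show "nbrs (ws ! a) = (!) ws ` ?nb a" if "a <= n" for a using N[OF that] by simp
    show "?nb a \<subseteq> {..n}" if "a <= n" for a using that by auto
    fix a b assume ab: "a < b" "b <= n"
    show "(if b = a + 1 \<or> a = 0 \<and> b = n then 3 else 2) = 2" if "b ~: ?nb a" using that ab by (auto split: if_splits)
    show "m (ws ! a) (ws ! b) = (if b = a + 1 \<or> a = 0 \<and> b = n then 3 else 2)" if "b \<in> ?nb a"
    proof -
      from that ab have e: "b = a + 1 \<or> a = 0 \<and> b = n" by (auto split: if_splits)
      then show ?thesis
      proof
        assume "b = a + 1"
        then show ?thesis using m[of a] ab by simp
      next
        assume "a = 0 \<and> b = n"
        then show ?thesis using m[of n] m_sym by simp
      qed
    qed
  qed
  then show ?thesis using ws(3) by (auto simp: type_A_def)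
qed

end

context
  fixes \<delta> :: "real ^ 'i"
  assumes irr: is_irreducible and \<delta>_pos: "!!i. \<delta> $ i > 0" and \<delta>_null: "!!v. form \<delta> v = 0"
begin

section \<open>Plateaus of maximal coordinates\<close>

lemma leaf_below:
  assumes "leaf q c x" "q = 3 \<or> q = 4"
  shows "\<delta> $ x < \<delta> $ c"
proof -
  have x: "nbrs x = {c}" "m x c = q" using assms(1) m_sym leaf_def[OF irr \<delta>_pos \<delta>_null] by auto
  have "sqrt 2 < (2 :: real)" by (rule real_less_lsqrt) simp_all
  then have "weight x c < 2" using assms(2) x(2) weight_1[OF irr \<delta>_pos \<delta>_null, of x c] weight_4[of x c] by auto
  then have "weight x c * \<delta> $ c < 2 * \<delta> $ c" by (intro mult_strict_right_mono \<delta>_pos)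
  then show ?thesis using harmonic[OF irr \<delta>_pos \<delta>_null, of x] x(1) by simp
qed

lemma half_below: "half c A ==> x \<in> A ==> \<delta> $ x < \<delta> $ c"
  unfolding half_def[OF irr \<delta>_pos \<delta>_null] using leaf_below by auto

lemma half_nbrs: "half c A ==> x \<in> A ==> nbrs x = {c}"
  unfolding half_def[OF irr \<delta>_pos \<delta>_null] leaf_def[OF irr \<delta>_pos \<delta>_null] by auto

text \<open>An end of the plateau: one neighbour continues it, and leaves contribute the other half
  of the harmonic equation.\<close>

definition end_kind :: "'i => bool" where
  "end_kind v \<longleftrightarrow> (\<exists>d A. nbrs v = insert d A \<and> d ~: A \<and> \<delta> $ d = \<delta> $ v \<and> m v d = 3 \<and> half v A)"

definition inner_kind :: "'i => bool" where
  "inner_kind v \<longleftrightarrow> (\<exists>d d'. nbrs v = {d, d'} \<and> d ~= d' \<and> \<delta> $ d = \<delta> $ v \<and> m v d = 3 \<and> \<delta> $ d' = \<delta> $ v \<and> m v d' = 3)"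

lemma end_kind_unique:
  assumes "end_kind v" "d \<in> nbrs v" "\<delta> $ d = \<delta> $ v"
  obtains A where "nbrs v = insert d A" "m v d = 3" "half v A"
proof -
  obtain e A where e: "nbrs v = insert e A" "m v e = 3" "half v A" using assms(1) by (auto simp: end_kind_def)
  have "d ~: A" using half_below[OF e(3), of d] assms(3) by auto
  then have "d = e" using assms(2) e(1) by auto
  then show ?thesis using that e by blast
qed

lemma inner_kind_unique:
  assumes "inner_kind v" "d \<in> nbrs v" "d' \<in> nbrs v" "d ~= d'"
  shows "nbrs v = {d, d'}" "m v d = 3"
  using assms by (auto simp: inner_kind_def)

lemma kinds:
  assumes max: "!!j. \<delta> $ j <= \<delta> $ c"
  shows "type_A \<or> type_B \<or> type_C \<or> type_D \<or> type_E6 \<or> type_E7 \<or> type_E8 \<or> type_F4 \<or> type_G2 \<or> end_kind c \<or> inner_kind c"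
proof (cases rule: local_structure[OF irr \<delta>_pos \<delta>_null, of c])
  case (2 j)
  then show ?thesis using infinite_type_A[OF irr \<delta>_pos \<delta>_null] by blast
next
  case (3 i i' j j')
  then show ?thesis using F4_type[OF irr \<delta>_pos \<delta>_null] by blast
next
  case (4 i j)
  then show ?thesis using G2_type[OF irr \<delta>_pos \<delta>_null] by blast
next
  case (5 x xs y ys z zs)
  then show ?thesis using E_type[OF irr \<delta>_pos \<delta>_null 5(1-9)] by blast
next
  case (6 A B)
  have "c ~: A" "c ~: B" using 6(1) not_self_nbr[of c] by auto
  then have "caterpillar [c] A B" using 6 by (simp add: caterpillar_def[OF irr \<delta>_pos \<delta>_null])
  then show ?thesis using caterpillar_type[OF irr \<delta>_pos \<delta>_null] by blast
next
  case (7 d A)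
  then have "end_kind c" unfolding end_kind_def by blast
  then show ?thesis by blast
next
  case (8 d d')
  then have "inner_kind c" unfolding inner_kind_def by blast
  then show ?thesis by blast
qed (rule max)

context
  fixes M
  assumes M: "!!j. \<delta> $ j <= M" and kind: "!!v. \<delta> $ v = M ==> end_kind v \<or> inner_kind v"
begin

definition plateau_path :: "'i list => bool" where
  "plateau_path ws \<longleftrightarrow> distinct ws \<and> ws ~= [] \<and> (\<forall>v\<in>set ws. \<delta> $ v = M) \<and> (\<forall>i. Suc i < length ws --> ws ! Suc i \<in> nbrs (ws ! i))"

lemma plateau_path_inner:
  assumes "plateau_path ws" "0 < i" "Suc i < length ws"
  shows "nbrs (ws ! i) = {ws ! (i - 1), ws ! Suc i}" "m (ws ! i) (ws ! (i - 1)) = 3" "m (ws ! i) (ws ! Suc i) = 3"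
proof -
  have p: "distinct ws" "\<forall>v\<in>set ws. \<delta> $ v = M" "!!i. Suc i < length ws ==> ws ! Suc i \<in> nbrs (ws ! i)"
    using assms(1) by (auto simp: plateau_path_def)
  have nb: "ws ! Suc i \<in> nbrs (ws ! i)" "ws ! (i - 1) \<in> nbrs (ws ! i)"
    using p(3)[of i] p(3)[of "i - 1"] assms(2,3) nbrs_sym[of "ws ! i"] by simp_all
  have ne: "ws ! (i - 1) ~= ws ! Suc i" using p(1) assms(2,3) by (simp add: nth_eq_iff_index_eq)
  have val: "\<delta> $ (ws ! i) = M" "\<delta> $ (ws ! Suc i) = M" "\<delta> $ (ws ! (i - 1)) = M" using p(2) assms(2,3) by auto
  have "inner_kind (ws ! i)"
  proof (rule ccontr)
    assume "~ ?thesis"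
    then have e: "end_kind (ws ! i)" using kind[OF val(1)] by blast
    have "\<delta> $ (ws ! Suc i) = \<delta> $ (ws ! i)" using val by simp
    with e nb(1) obtain A where A: "nbrs (ws ! i) = insert (ws ! Suc i) A" "half (ws ! i) A"
      by (rule end_kind_unique)
    have "ws ! (i - 1) \<in> A" using nb(2) ne A(1) by blast
    from half_below[OF A(2) this] show False using val by simp
  qed
  note inner = inner_kind_unique[OF this]
  show "nbrs (ws ! i) = {ws ! (i - 1), ws ! Suc i}" "m (ws ! i) (ws ! (i - 1)) = 3"
    by (rule inner[OF nb(2,1) ne])+
  show "m (ws ! i) (ws ! Suc i) = 3" by (rule inner(2)[OF nb(1,2) ne[symmetric]])
qed

text \<open>A path of greatest length exists because the vertices are finite in number; it cannot be
  prolonged at its last vertex.\<close>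

lemma maximal_plateau_path:
  assumes "\<delta> $ v = M"
  obtains ws k where "plateau_path ws" "hd ws = v" "ws ! 0 = v" "length ws = Suc k" "k >= 1"
    "!!d. d \<in> nbrs (ws ! k) ==> \<delta> $ d = M ==> d \<in> set ws"
proof -
  let ?P = "%ws. plateau_path ws \<and> hd ws = v"
  have P1: "?P [v]" using assms by (simp add: plateau_path_def)
  have bound: "\<forall>ws. ?P ws --> length ws < Suc CARD('i)"
  proof (intro allI impI)
    fix ws assume "?P ws"
    then have "length ws = card (set ws)" by (simp add: plateau_path_def distinct_card)
    then show "length ws < Suc CARD('i)" using card_mono[of UNIV "set ws"] by simp
  qed
  obtain ws where ws: "?P ws" "!!ws'. ?P ws' ==> length ws' <= length ws"
    using ex_has_greatest_nat[of ?P "[v]" length, OF P1 bound] by blast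
  have ne: "ws ~= []" and dist: "distinct ws" using ws(1) by (auto simp: plateau_path_def)
  define k where "k = length ws - 1"
  have k: "length ws = Suc k" using ne by (cases ws) (auto simp: k_def)
  have "\<exists>d. d \<in> nbrs v \<and> \<delta> $ d = M"
    using kind[OF assms] assms by (auto simp: end_kind_def inner_kind_def)
  then obtain d where d: "d \<in> nbrs v" "\<delta> $ d = M" by blast
  have "d ~= v" using d(1) not_self_nbr[of v] by auto
  then have "?P [v, d]" using assms d by (auto simp: plateau_path_def less_Suc_eq)
  from ws(2)[OF this] have k1: "k >= 1" using k by simp
  have closed: "d \<in> set ws" if "d \<in> nbrs (ws ! k)" "\<delta> $ d = M" for d
  proof (rule ccontr)
    assume nd: "d ~: set ws"
    have "?P (ws @ [d])"
      using ws(1) nd that ne k by (auto simp: plateau_path_def nth_append less_Suc_eq)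
    from ws(2)[OF this] show False by simp
  qed
  have "ws ! 0 = v" using ws(1) ne by (simp add: hd_conv_nth)
  then show ?thesis using that[of ws k] ws(1) k k1 closed by blast
qed

text \<open>A maximal path that starts at an end stops at another end and is a caterpillar. If there
  are no ends at all, its last vertex has a second plateau neighbour, which can only be the start,
  and the graph is a cycle.\<close>

lemma plateau_type: "type_A \<or> type_B \<or> type_C \<or> type_D" if v: "\<delta> $ v = M" "end_kind v \<or> (\<forall>v. \<delta> $ v = M --> inner_kind v)"
proof -
  obtain ws k where ws: "plateau_path ws" "hd ws = v" "ws ! 0 = v" "length ws = Suc k" "k >= 1"
    "!!d. d \<in> nbrs (ws ! k) ==> \<delta> $ d = M ==> d \<in> set ws"
    using maximal_plateau_path[OF v(1)] by blast
  have p: "distinct ws" "ws ~= []" "\<forall>v\<in>set ws. \<delta> $ v = M" "!!i. Suc i < length ws ==> ws ! Suc i \<in> nbrs (ws ! i)"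
    using ws(1) by (auto simp: plateau_path_def)
  have val: "\<delta> $ (ws ! i) = M" if "i <= k" for i using p(3) that ws(4) by auto
  have eq: "ws ! i = ws ! j \<longleftrightarrow> i = j" if "i <= k" "j <= k" for i j using p(1) that ws(4) by (simp add: nth_eq_iff_index_eq)
  have first: "ws ! 1 \<in> nbrs (ws ! 0)" using p(4)[of 0] ws(4,5) by simp
  have last: "ws ! (k - 1) \<in> nbrs (ws ! k)" using p(4)[of "k - 1"] ws(4,5) nbrs_sym[of "ws ! k"] by simp
  have inner: "nbrs (ws ! i) = {ws ! (i - 1), ws ! Suc i}" "m (ws ! i) (ws ! Suc i) = 3" if "0 < i" "i < k" for i
    using plateau_path_inner[OF ws(1), of i] that ws(4) by simp_all
  text \<open>A further plateau neighbour of the last vertex can only be the first vertex.\<close>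
  have returns: "d = ws ! 0" if d: "d \<in> nbrs (ws ! k)" "d ~= ws ! (k - 1)" "\<delta> $ d = M" for d
  proof -
    obtain i where i: "i <= k" "d = ws ! i" using ws(6)[OF d(1,3)] ws(4) by (auto simp: in_set_conv_nth less_Suc_eq_le)
    have "i ~= k" using d(1) i(2) not_self_nbr by auto
    have "i = 0"
    proof (rule ccontr)
      assume "i ~= 0"
      then have "nbrs (ws ! i) = {ws ! (i - 1), ws ! Suc i}" using inner(1)[of i] i(1) \<open>i ~= k\<close> by simp
      moreover have "ws ! k \<in> nbrs (ws ! i)" using d(1) i(2) nbrs_sym by blast
      ultimately have "k = i - 1 \<or> k = Suc i" using eq[of k "i - 1"] eq[of k "Suc i"] i(1) \<open>i ~= k\<close> by auto
      then have "i = k - 1" using i(1) \<open>i ~= k\<close> by linarith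
      then show False using d(2) i(2) by simp
    qed
    then show ?thesis using i(2) by simp
  qed
  show ?thesis
  proof (cases "end_kind v")
    case True
    then obtain A where A: "nbrs (ws ! 0) = insert (ws ! 1) A" "m (ws ! 0) (ws ! 1) = 3" "half (ws ! 0) A"
      using end_kind_unique[of v "ws ! 1"] first ws(3) val[of 0] val[of 1] ws(5) by auto
    \<comment> \<open>Otherwise the path would return to its start, whose only plateau neighbour is
      the second vertex; this forces \<open>k = 1\<close>, where both neighbours coincide.\<close>
    have "end_kind (ws ! k)"
    proof (rule ccontr)
      assume "~ ?thesis"
      then have "inner_kind (ws ! k)" using kind[OF val[of k]] by blast
      then obtain d where d: "d \<in> nbrs (ws ! k)" "d ~= ws ! (k - 1)" "\<delta> $ d = M"
        using val[of k] unfolding inner_kind_def by (metis insertI1 insertI2 order_refl)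
      have "d = ws ! 0" by (rule returns[OF d])
      then have "ws ! k \<in> insert (ws ! 1) A" using d(1) nbrs_sym A(1) by blast
      moreover have "ws ! k ~: A" using half_below[OF A(3), of "ws ! k"] val[of k] val[of 0] by auto
      ultimately have "k = 1" using eq[of k 1] ws(5) by simp
      then show False using d(2) \<open>d = ws ! 0\<close> by simp
    qed
    then obtain B where B: "nbrs (ws ! k) = insert (ws ! (k - 1)) B" "m (ws ! k) (ws ! (k - 1)) = 3" "half (ws ! k) B"
      using end_kind_unique[OF _ last] val[of k] val[of "k - 1"] by auto
    have disj: "(A \<union> B) \<inter> set ws = {}"
      using half_below[OF A(3)] half_below[OF B(3)] val[of 0] val[of k] p(3) by fastforce
    have AB: "A \<inter> B = {}"
    proof (rule ccontr)
      assume "A \<inter> B ~= {}"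
      then obtain x where "x \<in> A" "x \<in> B" by blast
      then have "ws ! 0 = ws ! k" using half_nbrs[OF A(3)] half_nbrs[OF B(3)] by auto
      then show False using eq[of 0 k] ws(5) by simp
    qed
    have ends: "hd ws = ws ! 0" "List.last ws = ws ! k" using p(2) ws(4) by (simp_all add: hd_conv_nth last_conv_nth)
    have "caterpillar ws A B"
      unfolding caterpillar_def[OF irr \<delta>_pos \<delta>_null]
    proof (intro conjI allI impI)
      fix i assume "i < length ws"
      then consider "i = 0" | "i = k" "i ~= 0" | "0 < i" "i < k" using ws(4) by linarith
      then show "nbrs (ws ! i) = (if i = 0 then A else {ws ! (i - 1)}) \<union> (if Suc i = length ws then B else {ws ! Suc i})"
        using A(1) B(1) inner(1)[of i] ws(4,5) by cases auto
    next
      fix i assume i: "Suc i < length ws"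
      then show "m (ws ! i) (ws ! Suc i) = 3"
        using A(2) inner(2)[of i] ws(4) by (cases "i = 0") auto
    qed (use p A B disj AB ends in auto)
    then show ?thesis using caterpillar_type[OF irr \<delta>_pos \<delta>_null] by blast
  next
    case False
    then have all: "inner_kind (ws ! i)" if "i <= k" for i using v(2) val[OF that] by blast
    obtain d where d: "d \<in> nbrs (ws ! k)" "d ~= ws ! (k - 1)" "\<delta> $ d = M"
      using all[of k] val[of k] unfolding inner_kind_def by (metis insertI1 insertI2 order_refl)
    have d0: "d = ws ! 0" by (rule returns[OF d])
    have "k ~= 1" using d(2) d0 by auto
    then have k2: "k >= 2" using ws(5) by simp
    have wk: "nbrs (ws ! k) = {ws ! (k - 1), ws ! 0}" "m (ws ! k) (ws ! 0) = 3"
      using inner_kind_unique[OF all[of k] last] inner_kind_unique[OF all[of k], of "ws ! 0" "ws ! (k - 1)"] d d0 last by auto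
    have k0: "ws ! k \<in> nbrs (ws ! 0)" using d(1) d0 nbrs_sym by blast
    have w0: "nbrs (ws ! 0) = {ws ! k, ws ! 1}" "m (ws ! 0) (ws ! 1) = 3"
      using inner_kind_unique[OF all[of 0] k0 first] inner_kind_unique[OF all[of 0] first k0] eq[of k 1] k2 by auto
    have type_A
    proof (rule cycle_type[OF irr \<delta>_pos \<delta>_null p(1) ws(4) k2])
      fix i assume "i <= k"
      then consider "i = 0" | "i = k" "i ~= 0" | "0 < i" "i < k" by linarith
      note c = this
      from c show "nbrs (ws ! i) = {ws ! (if i = 0 then k else i - 1), ws ! (if i = k then 0 else Suc i)}"
        using wk(1) w0(1) inner(1)[of i] k2 by cases auto
      from c show "m (ws ! i) (ws ! (if i = k then 0 else Suc i)) = 3"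
        using wk(2) w0(2) inner(2)[of i] k2 by cases auto
    qed
    then show ?thesis by blast
  qed
qed

end

end

lemma classification:
  assumes irr: is_irreducible and aff: is_affine
  shows "type_A \<or> type_B \<or> type_C \<or> type_D \<or> type_E6 \<or> type_E7 \<or> type_E8 \<or> type_F4 \<or> type_G2"
proof (rule ccontr)
  assume none: "~ ?thesis"
  obtain \<delta> where \<delta>: "!!i. \<delta> $ i > 0" "!!v. form \<delta> v = 0"
    using null_vectorE[OF irr aff] by metis
  define M where "M = Max (range (%i. \<delta> $ i))"
  have M: "\<delta> $ j <= M" for j unfolding M_def by (intro Max_ge) auto
  have kind: "end_kind \<delta> v \<or> inner_kind \<delta> v" if "\<delta> $ v = M" for v
    using kinds[OF irr \<delta>, of v] M none that by auto
  have "M \<in> range (%i. \<delta> $ i)" unfolding M_def by (rule Max_in) auto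
  then obtain c where c: "\<delta> $ c = M" by auto
  have "\<exists>v. \<delta> $ v = M \<and> (end_kind \<delta> v \<or> (\<forall>v. \<delta> $ v = M --> inner_kind \<delta> v))"
    using c kind by metis
  then obtain v where v: "\<delta> $ v = M" "end_kind \<delta> v \<or> (\<forall>v. \<delta> $ v = M --> inner_kind \<delta> v)" by blast
  then show False using plateau_type[OF irr \<delta> M kind v] none by blast
qed

end

section \<open>Type G2\<close>

lemma mod_3_cases:
  fixes t :: nat
  obtains "t mod 3 = 0" "Suc t mod 3 = 1" | "t mod 3 = 1" "Suc t mod 3 = 2" | "t mod 3 = 2" "Suc t mod 3 = 0"
proof -
  have "t mod 3 = 0 \<or> t mod 3 = 1 \<or> t mod 3 = 2" by linarith
  then show ?thesis using that by (auto simp: mod_Suc)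
qed

context coxeter_system
begin

context
  fixes i0 i1 i2 :: 'i and L u K
  assumes G2_UNIV: "UNIV = {i0, i1, i2}" and G2_distinct: "i0 ~= i1" "i0 ~= i2" "i1 ~= i2"
    and M: "m i0 i1 = 3" "m i1 i2 = 6" "m i0 i2 = 2"
    and convex: "is_convex L" "L ~= {}" and u: "u \<in> carrier W"
    and periodic: "K >= 1" "(fold (toggle L) [i0, i1, i2] ^^ K) u = u"
begin

abbreviation "G2_orbit \<equiv> orbit L [i0, i1, i2] u"

text \<open>In these coordinates the null vector is \<open>(1, 2, 3)\<close>.\<close>

definition X0 :: "real ^ 'i => real" where "X0 v = v $ i0 / sqrt 3"

definition X1 :: "real ^ 'i => real" where "X1 v = v $ i1 / sqrt 3"

definition X2 :: "real ^ 'i => real" where "X2 v = v $ i2"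

lemmas X_def = X0_def X1_def X2_def

lemma X_linear:
  "X0 (v + w) = X0 v + X0 w" "X0 (v - w) = X0 v - X0 w" "X0 (c *\<^sub>R v) = c * X0 v"
  "X1 (v + w) = X1 v + X1 w" "X1 (v - w) = X1 v - X1 w" "X1 (c *\<^sub>R v) = c * X1 v"
  "X2 (v + w) = X2 v + X2 w" "X2 (v - w) = X2 v - X2 w" "X2 (c *\<^sub>R v) = c * X2 v"
  by (simp_all add: X_def add_divide_distrib diff_divide_distrib)

lemma X_eqI:
  assumes "X0 v = X0 w" "X1 v = X1 w" "X2 v = X2 w"
  shows "v = w"
proof -
  have "v $ i = w $ i" for i
  proof -
    have "i = i0 \<or> i = i1 \<or> i = i2" using G2_UNIV by auto
    then show ?thesis using assms by (auto simp: X_def)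
  qed
  then show ?thesis by (simp add: vec_eq_iff)
qed

lemma X_nonneg:
  assumes "nonneg v"
  shows "X0 v >= 0" "X1 v >= 0" "X2 v >= 0"
  using assms by (simp_all add: nonneg_def X_def)

lemma X_simple:
  "X0 (simple_root i0) = 1 / sqrt 3" "X1 (simple_root i0) = 0" "X2 (simple_root i0) = 0"
  "X0 (simple_root i1) = 0" "X1 (simple_root i1) = 1 / sqrt 3" "X2 (simple_root i1) = 0"
  "X0 (simple_root i2) = 0" "X1 (simple_root i2) = 0" "X2 (simple_root i2) = 1"
  using G2_distinct by (auto simp: X_def simple_root_nth)

lemma G2_form:
  "2 * form v (simple_root i0) = sqrt 3 * (2 * X0 v - X1 v)"
  "2 * form v (simple_root i1) = sqrt 3 * (2 * X1 v - X0 v - X2 v)"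
  "2 * form v (simple_root i2) = 2 * X2 v - 3 * X1 v"
proof -
  have e: "2 * form_entry i0 i1 = -1" "2 * form_entry i1 i0 = -1" "2 * form_entry i1 i2 = - sqrt 3"
    "2 * form_entry i2 i1 = - sqrt 3" "form_entry i0 i2 = 0" "form_entry i2 i0 = 0"
    using form_entry_values(1)[OF M(1)] form_entry_values(3)[OF M(2)] form_entry_m_2[OF M(3)]
      form_entry_sym[of i1 i0] form_entry_sym[of i2 i1] form_entry_sym[of i2 i0] by simp_all
  have s: "2 * form v (simple_root j) = v $ i0 * (2 * form_entry i0 j) + v $ i1 * (2 * form_entry i1 j) + v $ i2 * (2 * form_entry i2 j)" for j
    unfolding form_simple_right G2_UNIV using G2_distinct by (simp add: algebra_simps)
  have q: "v $ i0 = sqrt 3 * X0 v" "v $ i1 = sqrt 3 * X1 v" "v $ i2 = X2 v" by (simp_all add: X_def)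
  show "2 * form v (simple_root i0) = sqrt 3 * (2 * X0 v - X1 v)"
    unfolding s e q by (simp add: algebra_simps)
  show "2 * form v (simple_root i1) = sqrt 3 * (2 * X1 v - X0 v - X2 v)"
    unfolding s e q by (simp add: algebra_simps)
  have "sqrt 3 * X1 v * - sqrt 3 = - 3 * X1 v"
    using real_sqrt_mult_self[of 3] by (simp add: mult.commute mult.left_commute)
  then show "2 * form v (simple_root i2) = 2 * X2 v - 3 * X1 v"
    unfolding s e q using e(6) by simp
qed

lemma X_reflection:
  "X0 (reflection i0 v) = X1 v - X0 v" "X1 (reflection i0 v) = X1 v" "X2 (reflection i0 v) = X2 v"
  "X0 (reflection i1 v) = X0 v" "X1 (reflection i1 v) = X0 v + X2 v - X1 v" "X2 (reflection i1 v) = X2 v"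
  "X0 (reflection i2 v) = X0 v" "X1 (reflection i2 v) = X1 v" "X2 (reflection i2 v) = 3 * X1 v - X2 v"
  by (simp_all add: reflection_def G2_form X_linear X_simple)

definition G2_delta :: "real ^ 'i" where
  "G2_delta = sqrt 3 *\<^sub>R simple_root i0 + (2 * sqrt 3) *\<^sub>R simple_root i1 + 3 *\<^sub>R simple_root i2"

lemma X_delta: "X0 G2_delta = 1" "X1 G2_delta = 2" "X2 G2_delta = 3"
  by (simp_all add: G2_delta_def X_linear X_simple)

lemma G2_null: "form G2_delta v = 0"
proof -
  have "form G2_delta (simple_root i) = 0" for i
  proof -
    have "i = i0 \<or> i = i1 \<or> i = i2" using G2_UNIV by auto
    then have "2 * form G2_delta (simple_root i) = 0" using G2_form[of G2_delta] X_delta by auto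
    then show ?thesis by simp
  qed
  then have "form G2_delta (\<Sum>i\<in>UNIV. v $ i *\<^sub>R simple_root i) = 0"
    unfolding form_sum_right by (simp add: form_linear)
  moreover have "(\<Sum>i\<in>UNIV. v $ i *\<^sub>R simple_root i) = v"
    by (simp add: vec_eq_iff simple_root_nth if_distrib cong: if_cong)
  ultimately show ?thesis by simp
qed

lemma G2_delta_action: "w \<in> carrier W ==> action w G2_delta = G2_delta"
  using G2_null by (elim word_prod_surjE) (simp add: action_word_prod foldr_reflection_fixes_orthogonal)

lemma G2_delta_nonneg: "nonneg G2_delta"
  unfolding G2_delta_def by (intro nonneg_add nonneg_scaleR) auto

text \<open>The defect \<open>\<Phi>\<close> is invariant under the Coxeter element, and the functional \<open>F\<close> decreases by a multiple
  of the defect.\<close>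

definition \<Phi> :: "nat => real ^ 'i => real" where
  "\<Phi> t v = (if t mod 3 = 0 then X0 v + X1 v - X2 v
    else if t mod 3 = 1 then - X0 v + 2 * X1 v - X2 v else X0 v - 2 * X1 v + X2 v)"

definition F :: "nat => real ^ 'i => real" where
  "F t v = (if t mod 3 = 2 then X0 v + X2 v else 2 * X1 v)"

definition \<kappa> :: "nat => real" where
  "\<kappa> t = (if t mod 3 = 0 then 0 else 1)"

abbreviation "G2_label t \<equiv> [i0, i1, i2] ! (t mod 3)"

lemma \<Phi>_linear: "\<Phi> t (v - w) = \<Phi> t v - \<Phi> t w" "\<Phi> t (c *\<^sub>R v) = c * \<Phi> t v"
  by (simp_all add: \<Phi>_def X_linear algebra_simps)

lemma F_nonneg: "nonneg v ==> F t v >= 0"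
  using X_nonneg[of v] by (simp add: F_def)

lemma \<Phi>_simple: "\<Phi> t (simple_root (G2_label t)) > 0"
  by (cases rule: mod_3_cases[of t]) (simp_all add: \<Phi>_def X_simple)

lemma \<Phi>_step: "\<Phi> (Suc t) (reflection (G2_label t) v) = \<Phi> t v"
  by (cases rule: mod_3_cases[of t]) (simp_all add: \<Phi>_def X_reflection)

text \<open>The functional for time \<open>Suc t\<close> does not involve the coordinate that is
  changed at time \<open>t\<close>. Hence its value drops by the same amount whether or not the
  toggle is blocked.\<close>

lemma F_step: "F (Suc t) (reflection (G2_label t) v) = F t v - \<kappa> t * \<Phi> t v"
  "F (Suc t) (reflection (G2_label t) v) = F (Suc t) v"
  by (cases rule: mod_3_cases[of t]; simp add: F_def \<kappa>_def \<Phi>_def X_reflection)+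

lemma \<Phi>_reflection: "\<Phi> t (reflection i v) = \<Phi> t v - 2 * form v (simple_root i) * \<Phi> t (simple_root i)"
  by (simp add: reflection_def \<Phi>_linear)

lemma \<Phi>_stay: "\<Phi> (Suc t) v = \<Phi> t v - 2 * form v (simple_root (G2_label t)) * \<Phi> t (simple_root (G2_label t))"
  using \<Phi>_step[of t "reflection (G2_label t) v"] by (simp add: \<Phi>_reflection)

lemma F_stay: "F (Suc t) v = F t v - \<kappa> t * \<Phi> t v"
  using F_step[of t v] by simp

definition blocked :: "nat => bool" where
  "blocked t \<longleftrightarrow> action (inv (G2_orbit t)) (simple_root (G2_label t)) \<in> root_set L"

lemma G2_carrier [simp]: "G2_orbit t \<in> carrier W"
  by (simp add: u)

lemma G2_orbit_Suc: "G2_orbit (Suc t) = (if blocked t then G2_orbit t else s (G2_label t) \<otimes> G2_orbit t)"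
proof -
  have l: "length [i0, i1, i2] = 3" by simp
  show ?thesis unfolding orbit.simps toggle_def blocked_def l ..
qed

lemma G2_action_Suc: "action (G2_orbit (Suc t)) v =
    (if blocked t then action (G2_orbit t) v else reflection (G2_label t) (action (G2_orbit t) v))"
  unfolding G2_orbit_Suc using G2_carrier[of t] by simp

lemma G2_periodic: "G2_orbit (t + n * (K * 3)) = G2_orbit t"
  using orbit_periodic[OF periodic(2), of t n] by (simp add: eval_nat_numeral)

text \<open>The negative of the current image of a root of \<open>R(L)\<close> that the orbit
  violates at time \<open>t\<close>.\<close>

definition wrong :: "nat => real ^ 'i => bool" where
  "wrong t v \<longleftrightarrow> v \<in> roots \<and> nonneg v \<and> action (inv (G2_orbit t)) (- v) \<in> root_set L"

lemma right_stays:
  assumes "\<beta> \<in> root_set L" "nonneg (action (G2_orbit t) \<beta>)"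
  shows "nonneg (action (G2_orbit (t + d)) \<beta>)"
proof (induction d)
  case (Suc d)
  then show ?case using toggle_stays_right[OF G2_carrier assms(1)] by simp
qed (use assms in simp)

text \<open>A constraint once satisfied remains so. On a periodic orbit a violated constraint is
  therefore violated at all times, including earlier ones.\<close>

lemma wrong_moves:
  assumes "wrong t v"
  shows "wrong t' (action (G2_orbit t') (action (inv (G2_orbit t)) v))"
proof -
  define \<beta> where "\<beta> = action (inv (G2_orbit t)) (- v)"
  have \<beta>: "\<beta> \<in> root_set L" "\<beta> \<in> roots" using assms unfolding wrong_def \<beta>_def[symmetric] root_set_iff by blast+
  have v: "v = - action (G2_orbit t) \<beta>" by (simp add: \<beta>_def)
  have "~ nonneg (action (G2_orbit t') \<beta>)"
  proof
    assume "nonneg (action (G2_orbit t') \<beta>)"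
    then have "nonneg (action (G2_orbit (t' + (t + (K * 3 - 1) * t'))) \<beta>)"
      by (rule right_stays[OF \<beta>(1)])
    \<comment> \<open>A time after \<open>t'\<close> that differs from \<open>t\<close> by whole
      periods.\<close>
    moreover have e: "t' + (t + (K * 3 - 1) * t') = t + t' * (K * 3)"
      using periodic(1) by (cases K) (simp_all add: algebra_simps)
    ultimately have "nonneg (- v)" unfolding e G2_periodic v by simp
    then show False using assms root_not_both by (auto simp: wrong_def)
  qed
  then have "nonneg (- action (G2_orbit t') \<beta>)"
    using not_nonneg_root \<beta>(2) by simp
  moreover have "action (inv (G2_orbit t)) v = - \<beta>" by (simp add: \<beta>_def)
  ultimately show ?thesis using \<beta> by (simp add: wrong_def)
qed

text \<open>Pulled back, \<open>- v\<close> and the blocking simple root both lie in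
  \<open>R(L)\<close>, and \<open>\<delta>\<close> is positive and invariant. A root that is a
  nonnegative combination of these three is positive on \<open>L\<close> too.\<close>

lemma wrong_combination:
  assumes "wrong t v" "blocked t" "\<zeta> \<in> roots" "nonneg \<zeta>" "a >= 0" "b >= 0" "c >= 0" "r > 0"
    and \<zeta>: "r *\<^sub>R \<zeta> = a *\<^sub>R v - b *\<^sub>R simple_root (G2_label t) - c *\<^sub>R G2_delta"
  shows "wrong t \<zeta>"
proof -
  let ?U = "G2_orbit t"
  define \<beta> where "\<beta> = action (inv ?U) (- v)"
  define \<alpha> where "\<alpha> = action (inv ?U) (simple_root (G2_label t))"
  have "\<zeta> = (1 / r) *\<^sub>R (r *\<^sub>R \<zeta>)" using assms(8) by simp
  also have "... = (1 / r) *\<^sub>R (a *\<^sub>R v - b *\<^sub>R simple_root (G2_label t) - c *\<^sub>R G2_delta)" unfolding \<zeta> ..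
  finally have "action (inv ?U) (- \<zeta>) = action (inv ?U) (- ((1 / r) *\<^sub>R (a *\<^sub>R v - b *\<^sub>R simple_root (G2_label t) - c *\<^sub>R G2_delta)))"
    by simp
  also have "... = (1 / r) *\<^sub>R (a *\<^sub>R \<beta> + b *\<^sub>R \<alpha> + c *\<^sub>R G2_delta)"
    by (simp add: \<beta>_def \<alpha>_def G2_delta_action algebra_simps)
  finally have eq: "action (inv ?U) (- \<zeta>) = (1 / r) *\<^sub>R (a *\<^sub>R \<beta> + b *\<^sub>R \<alpha> + c *\<^sub>R G2_delta)" .
  have "\<forall>w\<in>L. w \<in> carrier W \<and> nonneg (action w \<beta>)" "\<forall>w\<in>L. w \<in> carrier W \<and> nonneg (action w \<alpha>)"
    using assms(1,2) unfolding wrong_def blocked_def \<beta>_def \<alpha>_def root_set_iff by blast+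
  then have "\<forall>w\<in>L. w \<in> carrier W \<and> nonneg (action w (action (inv ?U) (- \<zeta>)))"
    unfolding eq using assms(5-8) G2_delta_nonneg
    by (auto simp: G2_delta_action simp del: scaleR_right_distrib intro!: nonneg_add nonneg_scaleR)
  moreover have "action (inv ?U) (- \<zeta>) \<in> roots" using assms(3) by simp
  ultimately show ?thesis using assms(3,4) unfolding wrong_def root_set_iff by blast
qed

lemma wrong_reflection:
  assumes "wrong t v" "blocked t" "form v (simple_root (G2_label t)) > 0"
  shows "wrong t (reflection (G2_label t) v)"
proof -
  \<comment> \<open>Otherwise a root and its negative would both be positive on the nonempty set
    \<open>L\<close>.\<close>
  have "v ~= simple_root (G2_label t)"
  proof
    assume "v = simple_root (G2_label t)"
    then have "action (inv (G2_orbit t)) (- simple_root (G2_label t)) \<in> root_set L"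
      using assms(1) by (simp add: wrong_def)
    moreover obtain w where w: "w \<in> L" "w \<in> carrier W" using convex by (auto simp: is_convex_def)
    ultimately have "nonneg (- action w (action (inv (G2_orbit t)) (simple_root (G2_label t))))"
      "nonneg (action w (action (inv (G2_orbit t)) (simple_root (G2_label t))))"
      using assms(2) by (auto simp: blocked_def root_set_iff)
    then show False using root_not_both w(2) by (metis G2_carrier action_roots inv_closed simple_root_in_roots)
  qed
  then have "nonneg (reflection (G2_label t) v)"
    using assms(1) reflection_nonneg by (simp add: wrong_def)
  then show ?thesis
  proof (intro wrong_combination[OF assms(1,2), of _ 1 "2 * form v (simple_root (G2_label t))" 0 1])
    show "reflection (G2_label t) v \<in> roots" using assms(1) by (simp add: wrong_def)
    show "1 *\<^sub>R reflection (G2_label t) v =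
        1 *\<^sub>R v - (2 * form v (simple_root (G2_label t))) *\<^sub>R simple_root (G2_label t) - 0 *\<^sub>R G2_delta"
      by (simp add: reflection_def)
  qed (use assms(3) in simp_all)
qed

text \<open>In a blocked step there is a choice between \<open>v\<close> and its reflection. If the
  product with the simple root is positive, the reflected root is wrong as well and has the
  unchanged defect; otherwise keeping \<open>v\<close> does not lower the defect.\<close>

lemma wrong_next:
  assumes "wrong t v"
  obtains w where "wrong (Suc t) w" "\<Phi> (Suc t) w >= \<Phi> t v" "F (Suc t) w = F t v - \<kappa> t * \<Phi> t v"
proof -
  let ?i = "G2_label t"
  have after: "wrong (Suc t) (action (G2_orbit (Suc t)) (action (inv (G2_orbit t)) v))"
    by (rule wrong_moves[OF assms])
  show ?thesis
  proof (cases "blocked t")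
    case False
    then have "wrong (Suc t) (reflection ?i v)" using after by (simp add: G2_action_Suc del: orbit.simps)
    then show ?thesis by (rule that) (simp_all add: \<Phi>_step F_step)
  next
    case True
    then have same: "wrong (Suc t) w" if "wrong t w" for w using that by (simp add: wrong_def G2_orbit_Suc del: orbit.simps)
    show ?thesis
    proof (cases "form v (simple_root ?i) > 0")
      case True
      then have "wrong (Suc t) (reflection ?i v)" using same wrong_reflection[OF assms \<open>blocked t\<close>] by blast
      then show ?thesis by (rule that) (simp_all add: \<Phi>_step F_step)
    next
      case False
      then have "form v (simple_root ?i) * \<Phi> t (simple_root ?i) <= 0"
        using \<Phi>_simple[of t] by (simp add: mult_le_0_iff)
      then have "\<Phi> (Suc t) v >= \<Phi> t v" by (simp add: \<Phi>_stay)
      then show ?thesis by (rule that[OF same[OF assms] _ F_stay])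
    qed
  qed
qed

text \<open>A positive defect could be preserved forever by the choices above, and \<open>F\<close>
  would fall below 0 on positive roots.\<close>

lemma defect_nonpos:
  assumes "wrong t v"
  shows "\<Phi> t v <= 0"
proof (rule ccontr)
  assume "~ \<Phi> t v <= 0"
  define p where "p = \<Phi> t v"
  have p: "p > 0" using \<open>~ \<Phi> t v <= 0\<close> by (simp add: p_def)
  have step: "\<exists>w. wrong (t + d) w \<and> \<Phi> (t + d) w >= p \<and> F (t + d) w <= F t v - (\<Sum>j<d. \<kappa> (t + j)) * p" for d
  proof (induction d)
    case 0
    then show ?case using assms by (auto simp: p_def)
  next
    case (Suc d)
    then obtain w where w: "wrong (t + d) w" "\<Phi> (t + d) w >= p" "F (t + d) w <= F t v - (\<Sum>j<d. \<kappa> (t + j)) * p" by blast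
    obtain w' where w': "wrong (Suc (t + d)) w'" "\<Phi> (Suc (t + d)) w' >= \<Phi> (t + d) w"
      "F (Suc (t + d)) w' = F (t + d) w - \<kappa> (t + d) * \<Phi> (t + d) w"
      using wrong_next[OF w(1)] by blast
    have "\<kappa> (t + d) * \<Phi> (t + d) w >= \<kappa> (t + d) * p"
      using w(2) by (intro mult_left_mono) (auto simp: \<kappa>_def)
    then show ?case using w w' by (intro exI[of _ w']) (simp add: algebra_simps)
  qed
  \<comment> \<open>In each round two of the three steps lower \<open>F\<close>.\<close>
  have sum: "(\<Sum>j<3 * k. \<kappa> (t + j)) = 2 * real k" for k
  proof (induction k)
    case (Suc k)
    have "3 * Suc k = Suc (Suc (Suc (3 * k)))" by simp
    moreover have "\<kappa> (t + 3 * k) + \<kappa> (t + Suc (3 * k)) + \<kappa> (t + Suc (Suc (3 * k))) = 2"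
    proof -
      have "(t + 3 * k) mod 3 = t mod 3" "(t + Suc (3 * k)) mod 3 = Suc t mod 3" "(t + Suc (Suc (3 * k))) mod 3 = Suc (Suc t) mod 3"
        by presburger+
      then show ?thesis unfolding \<kappa>_def by (cases rule: mod_3_cases[of t]) (simp_all add: mod_Suc)
    qed
    ultimately show ?case using Suc unfolding \<open>3 * Suc k = _\<close> by simp
  qed simp
  obtain k :: nat where k: "real k > F t v / (2 * p)" using reals_Archimedean2 by blast
  obtain w where "wrong (t + 3 * k) w" "F (t + 3 * k) w <= F t v - (2 * real k) * p"
    using step[of "3 * k"] unfolding sum by blast
  moreover from this have "F (t + 3 * k) w >= 0" by (simp add: wrong_def F_nonneg)
  moreover have "F t v < 2 * real k * p" using k p by (simp add: field_simps)
  ultimately show False by simp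
qed

text \<open>With all defects nonpositive, \<open>F\<close> cannot decrease along the image of a
  fixed violated root. By periodicity it is constant, so that the defect vanishes in those phases
  where it enters the change of \<open>F\<close>.\<close>

lemma defect_zero:
  assumes "wrong t v" "t mod 3 ~= 0"
  shows "\<Phi> t v = 0"
proof -
  define V where "V = (%t'. action (G2_orbit t') (action (inv (G2_orbit t)) v))"
  have V: "wrong t' (V t')" for t' unfolding V_def by (rule wrong_moves[OF assms(1)])
  have step: "F (Suc t') (V (Suc t')) = F t' (V t') - \<kappa> t' * \<Phi> t' (V t')" for t'
    unfolding V_def G2_action_Suc using F_stay F_step(1) by simp
  have mono: "F (t' + d) (V (t' + d)) >= F t' (V t')" for t' d
  proof (induction d)
    case (Suc d)
    have "\<kappa> (t' + d) * \<Phi> (t' + d) (V (t' + d)) <= 0"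
      using defect_nonpos[OF V[of "t' + d"]] by (intro mult_nonneg_nonpos) (auto simp: \<kappa>_def)
    then show ?case using Suc step[of "t' + d"] by simp
  qed simp
  have "V (t + 1 * (K * 3)) = V t" unfolding V_def G2_periodic ..
  moreover have "(t + 1 * (K * 3)) mod 3 = t mod 3" by simp
  then have "F (t + 1 * (K * 3)) = F t" unfolding F_def by simp
  moreover obtain q where "K * 3 = Suc q" using periodic(1) by (metis Suc_pred' mult_pos_pos less_le_trans zero_less_numeral zero_less_one)
  ultimately have "F (Suc t + q) (V (Suc t + q)) = F t (V t)" by simp
  then have "F (Suc t) (V (Suc t)) <= F t (V t)" using mono[of "Suc t" q] by simp
  then have "\<kappa> t * \<Phi> t (V t) >= 0" unfolding step by simp
  then have "\<Phi> t (V t) >= 0" using assms(2) by (simp add: \<kappa>_def)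
  moreover have "V t = v" by (simp add: V_def)
  ultimately show ?thesis using defect_nonpos[OF assms(1)] by simp
qed

text \<open>The vectors without defect form a plane spanned by \<open>\<delta>\<close> and a unit
  vector \<open>\<eta>\<close>; a root in it is \<open>\<eta>\<close> or \<open>- \<eta>\<close>
  plus a multiple of \<open>\<delta>\<close>.\<close>

lemma G2_tube:
  assumes "v \<in> roots" "X2 v = 2 * X1 v - X0 v"
  shows "2 * X0 v - X1 v = 1 \<or> 2 * X0 v - X1 v = -1"
proof -
  define x z where "x = 2 * X0 v - X1 v" and "z = X1 v - X0 v"
  define \<eta> where "\<eta> = sqrt 3 *\<^sub>R simple_root i0 + sqrt 3 *\<^sub>R simple_root i1 + simple_root i2"
  have \<eta>: "X0 \<eta> = 1" "X1 \<eta> = 1" "X2 \<eta> = 1" by (simp_all add: \<eta>_def X_linear X_simple)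
  have v: "v = x *\<^sub>R \<eta> + z *\<^sub>R G2_delta"
    by (rule X_eqI) (simp_all add: X_linear \<eta> X_delta x_def z_def assms(2))
  have "2 * form \<eta> \<eta> = sqrt 3 * (2 * form \<eta> (simple_root i0)) + sqrt 3 * (2 * form \<eta> (simple_root i1)) + 2 * form \<eta> (simple_root i2)"
    by (subst (2) \<eta>_def) (simp add: form_add_right form_scaleR_right)
  then have "form \<eta> \<eta> = 1" unfolding G2_form \<eta> by simp
  moreover have "form \<eta> G2_delta = 0" using G2_null[of \<eta>] form_sym by metis
  ultimately have "form v v = x\<^sup>2"
    unfolding v by (simp add: form_linear G2_null power2_eq_square)
  then have "x\<^sup>2 = 1" using assms(1) by simp
  then show ?thesis unfolding x_def[symmetric] by (simp add: power2_eq_1_iff)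
qed

text \<open>A blocked step would create another wrong root, by a nonnegative combination or by a
  reflection, whose defect is not zero.\<close>

lemma not_blocked:
  assumes "wrong t v" "t mod 3 ~= 0"
  shows "~ blocked t"
proof
  assume "blocked t"
  have root: "v \<in> roots" "nonneg v" using assms(1) by (auto simp: wrong_def)
  have defect: "\<Phi> t v = 0" by (rule defect_zero[OF assms])
  then have x2: "X2 v = 2 * X1 v - X0 v" using assms(2) by (auto simp: \<Phi>_def split: if_splits)
  have pos: "X0 v >= 0" "X1 v >= 0" "X2 v >= 0" using X_nonneg[OF root(2)] by auto
  have tube: "2 * X0 v - X1 v = 1 \<or> 2 * X0 v - X1 v = -1" by (rule G2_tube[OF root(1) x2])
  have neg: "\<Phi> t \<zeta> = 0" if "wrong t \<zeta>" for \<zeta> by (rule defect_zero[OF that assms(2)])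
  consider "t mod 3 = 1" | "t mod 3 = 2" using assms(2) by linarith
  then show False
  proof cases
    case 1
    from tube show False
    proof
      assume x: "2 * X0 v - X1 v = 1"
      define z where "z = X1 v - X0 v"
      \<comment> \<open>The coefficients are chosen to cancel the coordinates \<open>X1\<close> and
        \<open>X2\<close>; that of \<open>\<delta>\<close> is half of \<open>X2 v\<close>.\<close>
      have "wrong t (simple_root i0)"
      proof (rule wrong_combination[OF assms(1) \<open>blocked t\<close>, of _ "3 / 2" "sqrt 3 / 2" "(1 + 3 * z) / 2" "sqrt 3"])
        show "(1 + 3 * z) / 2 >= 0" using pos(3) x x2 by (simp add: z_def)
        show "sqrt 3 *\<^sub>R simple_root i0 = (3 / 2) *\<^sub>R v - (sqrt 3 / 2) *\<^sub>R simple_root (G2_label t) - ((1 + 3 * z) / 2) *\<^sub>R G2_delta"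
          unfolding 1 by (rule X_eqI) (use x x2 in \<open>simp_all add: X_linear X_simple X_delta z_def field_simps\<close>)
      qed auto
      from neg[OF this] show False using 1 by (simp add: \<Phi>_def X_simple)
    next
      assume x: "2 * X0 v - X1 v = -1"
      \<comment> \<open>Here cancelling \<open>X0 v\<close> by \<open>\<delta>\<close> leaves
        \<open>X1\<close> and \<open>X2\<close> in the ratio 1 to 3, which is this root.\<close>
      define \<zeta> where "\<zeta> = reflection i2 (simple_root i1)"
      have X\<zeta>: "X0 \<zeta> = 0" "X1 \<zeta> = 1 / sqrt 3" "X2 \<zeta> = 3 / sqrt 3" by (simp_all add: \<zeta>_def X_reflection X_simple)
      have \<zeta>: "\<zeta> \<in> roots" "nonneg \<zeta>"
      proof -
        show "\<zeta> \<in> roots" by (simp add: \<zeta>_def)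
        have "simple_root i1 ~= simple_root i2" using X_simple(5,8) by auto
        then show "nonneg \<zeta>" unfolding \<zeta>_def by (intro reflection_nonneg) auto
      qed
      have "wrong t \<zeta>"
      proof (rule wrong_combination[OF assms(1) \<open>blocked t\<close> \<zeta>, of "3 / 2" "sqrt 3 / 2" "(3 / 2) * X0 v" "sqrt 3"])
        show "sqrt 3 *\<^sub>R \<zeta> = (3 / 2) *\<^sub>R v - (sqrt 3 / 2) *\<^sub>R simple_root (G2_label t) - ((3 / 2) * X0 v) *\<^sub>R G2_delta"
          unfolding 1 by (rule X_eqI) (use x x2 in \<open>simp_all add: X_linear X_simple X_delta X\<zeta> field_simps\<close>)
      qed (use pos in auto)
      from neg[OF this] show False using 1 by (simp add: \<Phi>_def X\<zeta>)
    qed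
  next
    case 2
    define B where "B = 2 * form v (simple_root i2)"
    have B: "B = 2 * X2 v - 3 * X1 v" unfolding B_def by (rule G2_form)
    \<comment> \<open>The blocked \<open>v\<close> is still wrong one step later, in the phase where
      only the inequality for the defect is available. It determines the sign of the product with
      the simple root \<open>i2\<close>.\<close>
    have "\<Phi> (Suc t) v <= 0"
      using assms(1) \<open>blocked t\<close> by (intro defect_nonpos) (simp add: wrong_def G2_orbit_Suc del: orbit.simps)
    then have "B * \<Phi> t (simple_root i2) >= 0" using \<Phi>_stay[of t v] defect 2 by (simp add: B_def)
    moreover have "\<Phi> t (simple_root i2) = 1" using 2 by (simp add: \<Phi>_def X_simple)
    ultimately have "B >= 0" by simp
    moreover have "B ~= 0" unfolding B using tube x2 by auto
    ultimately have "B > 0" by simp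
    then have "wrong t (reflection i2 v)"
      using wrong_reflection[OF assms(1) \<open>blocked t\<close>] 2 by (simp add: B_def)
    from neg[OF this] show False
      using defect \<open>\<Phi> t (simple_root i2) = 1\<close> \<open>B > 0\<close> by (simp add: \<Phi>_reflection B_def)
  qed
qed

text \<open>A violated constraint would unblock every toggle after the first. The group would then
  move as if \<open>L\<close> were absent, and a simple root with positive defect would make
  \<open>F\<close> decrease forever.\<close>

lemma G2_no_wrong: "~ wrong 0 v"
proof
  assume "wrong 0 v"
  define V where "V = (%t'. action (G2_orbit t') (action (inv (G2_orbit 0)) v))"
  have V: "wrong t' (V t')" for t' unfolding V_def by (rule wrong_moves[OF \<open>wrong 0 v\<close>])
  \<comment> \<open>The remaining phase 0 follows by looking at both sides: the root has zero defect
    after phase 2 and, if blocked, also in phase 1. Together these make \<open>2 X0 - X1\<close>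
    vanish, which no root of the tube allows. The preceding step is used, hence
    \<open>Suc t\<close>.\<close>
  have free: "~ blocked (Suc t)" for t
  proof (cases "Suc t mod 3 = 0")
    case False
    then show ?thesis using not_blocked[OF V[of "Suc t"]] by simp
  next
    case True
    then have t: "t mod 3 = 2" "Suc (Suc t) mod 3 = 1"
      by (cases rule: mod_3_cases[of t]; simp add: mod_Suc)+
    show ?thesis
    proof
      assume b: "blocked (Suc t)"
      have "~ blocked t" using not_blocked[OF V[of t]] t by simp
      then have "V (Suc t) = reflection (G2_label t) (V t)" unfolding V_def G2_action_Suc by simp
      then have "\<Phi> (Suc t) (V (Suc t)) = 0" using \<Phi>_step[of t "V t"] defect_zero[OF V[of t]] t by simp
      then have 1: "X0 (V (Suc t)) + X1 (V (Suc t)) - X2 (V (Suc t)) = 0" using True by (simp add: \<Phi>_def)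
      have same: "V (Suc (Suc t)) = V (Suc t)" using b unfolding V_def G2_action_Suc[of "Suc t"] by simp
      have "\<Phi> (Suc (Suc t)) (V (Suc t)) = 0" using defect_zero[OF V[of "Suc (Suc t)"]] t same by simp
      then have 2: "X2 (V (Suc t)) = 2 * X1 (V (Suc t)) - X0 (V (Suc t))" using t by (simp add: \<Phi>_def)
      have "V (Suc t) \<in> roots" using V[of "Suc t"] by (simp add: wrong_def)
      from G2_tube[OF this 2] show False using 1 2 by auto
    qed
  qed
  \<comment> \<open>The simple root is placed at time 1, from which on the motion is known to be
    free; phase 1 lowers \<open>F\<close> at once.\<close>
  define y where "y = action (inv (G2_orbit 1)) (simple_root i1)"
  define Y where "Y = (%t. action (G2_orbit t) y)"
  have Y: "Y (Suc (Suc t)) = reflection (G2_label (Suc t)) (Y (Suc t))" for t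
    unfolding Y_def G2_action_Suc[of "Suc t"] using free by simp
  have Y1: "Y 1 = simple_root i1" unfolding Y_def y_def by (rule action_inv(2)[OF G2_carrier])
  define p where "p = \<Phi> 1 (simple_root i1)"
  have p: "p > 0" using \<Phi>_simple[of 1] by (simp add: p_def)
  have defect: "\<Phi> (Suc t) (Y (Suc t)) = p" for t
  proof (induction t)
    case (Suc t)
    then show ?case unfolding Y by (simp add: \<Phi>_step)
  qed (use Y1 in \<open>simp add: p_def\<close>)
  have F: "F (Suc (Suc t)) (Y (Suc (Suc t))) = F (Suc t) (Y (Suc t)) - \<kappa> (Suc t) * p" for t
    unfolding Y F_step(1) defect ..
  have mono: "F (Suc t) (Y (Suc t)) <= F 1 (Y 1) - (if t = 0 then 0 else p)" for t
  proof (induction t)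
    case (Suc t)
    have "\<kappa> (Suc t) * p >= 0" using p by (simp add: \<kappa>_def)
    moreover have "\<kappa> (Suc 0) = 1" by (simp add: \<kappa>_def)
    ultimately show ?case using Suc F[of t] p by (cases "t = 0") auto
  qed simp
  have "Y (1 + 1 * (K * 3)) = Y 1" unfolding Y_def G2_periodic ..
  moreover have "F (1 + 1 * (K * 3)) = F 1"
  proof -
    have "(1 + 1 * (K * 3)) mod 3 = (1 :: nat) mod 3" by presburger
    then show ?thesis unfolding F_def by presburger
  qed
  ultimately have "F (Suc (K * 3)) (Y (Suc (K * 3))) = F 1 (Y 1)" by simp
  then show False using mono[of "K * 3"] p periodic(1) by simp
qed

lemma G2_in_L: "u \<in> L"
proof -
  have "nonneg (action u \<beta>)" if \<beta>: "\<beta> \<in> root_set L" for \<beta>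
  proof (rule ccontr)
    assume "~ nonneg (action u \<beta>)"
    moreover have "\<beta> \<in> roots" using \<beta> by (simp add: root_set_iff)
    ultimately have "nonneg (- action u \<beta>)" using not_nonneg_root u by simp
    then have "wrong 0 (- action u \<beta>)"
      using \<beta> \<open>\<beta> \<in> roots\<close> u by (simp add: wrong_def)
    then show False using G2_no_wrong by blast
  qed
  then show ?thesis using convex_iff[OF convex(1)] u by blast
qed

end

lemma futuristic_G2:
  assumes type_G2
  shows futuristic
proof -
  have G: "has_coxeter_matrix 2 (%a b. if (a, b) = (0, 1) then 3 else if (a, b) = (1, 2) then 6 else 2)"
    using assms by (simp add: type_G2_def)
  obtain f where f: "bij_betw f {..2 :: nat} UNIV" and M: "!!a b. a < b ==> b <= 2 ==> m (f a) (f b) =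
      (if (a, b) = (0, 1) then 3 else if (a, b) = (1, 2) then 6 else 2)"
    using has_coxeter_matrixE[OF G] by blast
  have m: "m (f 0) (f 1) = 3" "m (f 1) (f 2) = 6" "m (f 0) (f 2) = 2"
    using M[of 0 1] M[of 1 2] M[of 0 2] by simp_all
  have *: "{..2 :: nat} = {0, 1, 2}" by auto
  have U: "distinct [f 0, f 1, f 2]" "set [f 0, f 1, f 2] = UNIV"
    using f unfolding bij_betw_def * by auto
  have "elimination_order [f 2, f 1, f 0]"
    using m m_sym[of "f 0" "f 2"] by auto
  then have E: "elimination_order [f 2, f 1, f 0]" "distinct [f 2, f 1, f 0]" "set [f 2, f 1, f 0] = UNIV"
    using U by auto
  have G2: "UNIV = {f 0, f 1, f 2}" "f 0 ~= f 1" "f 0 ~= f 2" "f 1 ~= f 2" using U by auto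
  \<comment> \<open>The graph is a path, so that the coordinates and phases above, made for one
    listing, cover all of them.\<close>
  note independence = listing_independence[OF E _ _ U]
  show ?thesis
  proof (rule futuristicI)
    fix L xs assume L: "is_convex L" "L ~= {}" and xs: "distinct xs" "set xs = (UNIV :: 'i set)"
    have "heavy_listing L [f 0, f 1, f 2]"
      unfolding heavy_listing_def using G2_in_L[OF G2 m L] by blast
    then show "heavy_listing L xs" using independence[OF xs L(1)] by simp
  qed
qed

end

theorem corollary1p20:
  fixes W :: "('g, 'b) monoid_scheme" and s :: "'i :: finite \<Rightarrow> 'g"
  assumes "coxeter_system W s"
    and "coxeter_system.is_irreducible W s"
    and "coxeter_system.is_affine W s"
  shows "(coxeter_system.type_A W s \<or> coxeter_system.type_C W s \<or> coxeter_system.type_G2 W s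
      \<longrightarrow> coxeter_system.futuristic W s) \<and>
    (\<not> (coxeter_system.type_A W s \<or> coxeter_system.type_C W s \<or> coxeter_system.type_G2 W s)
      \<longrightarrow> coxeter_system.ancient W s) \<and>
    (coxeter_system.type_B W s \<or> coxeter_system.type_D W s \<or> coxeter_system.type_E6 W s \<or>
      coxeter_system.type_E7 W s \<or> coxeter_system.type_E8 W s \<or> coxeter_system.type_F4 W s
      \<longrightarrow> coxeter_system.ancient W s)"
proof -
  interpret coxeter_system W s by (rule assms(1))
  note irr = assms(2) and aff = assms(3)
  have futuristic: "type_A \<or> type_C \<or> type_G2 \<Longrightarrow> futuristic"
    using futuristic_A futuristic_C futuristic_G2 by blast
  have ancient: "type_B \<or> type_D \<or> type_E6 \<or> type_E7 \<or> type_E8 \<or> type_F4 \<Longrightarrow> ancient"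
    using ancient_B ancient_D[OF irr aff] ancient_E6[OF irr aff] ancient_E7[OF irr aff] ancient_E8[OF irr aff]
      ancient_F4[OF irr aff] by blast
  show ?thesis using futuristic ancient classification[OF irr aff] by blast
qed

end
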